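(* Let $\Omega\subseteq\mathbb{R}^N$ be an open subset with $|\Omega|<\infty$, let $a\in\mathbb{C}$ and $b\in\mathbb{B}$. Let $V\in L^\infty(\Omega;\mathbb{R})$ with $V\ge 0$ a.e. in $\Omega$. Then for any $F\in H^{-1}(\Omega)$, the problem $$-\Delta u+a\,U+b\,u+V\,u=F\ \text{ in }\Omega,\qquad U=\frac{u}{|u|}\ \text{ a.e. in }\{x\in\Omega;u(x)\ne0\},\qquad u_{|\partial\Omega}=0,$$ admits at least one global weak solution. In addition, the following symmetry property holds: if there exists $\mathcal{R}\in SO_N(\mathbb{R})$ such that for almost every $x\in\Omega$, $\mathcal{R}x\in\Omega$, $F(\mathcal{R}x)=F(x)$ and $V(\mathcal{R}x)=V(x)$, then we may construct a solution $u$ which also satisfies $u(\mathcal{R}x)=u(x)$ for almost every $x\in\Omega$. When $N=1$, if $\Omega$ is symmetric with respect to the origin and if $F$ and $V$ are odd functions, then (the constructed solution) $u$ is also an odd function. Finally, any global weak solution $u$ to the problem satisfies $$\|u\|_{H^1_0(\Omega)}\le C,$$ where $C=C(\|F\|_{H^{-1}(\Omega)},\|V\|_{L^\infty(\Omega;\mathbb{R})},|\Omega|,|a|,|b|,N)$.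
   Context: Functions are complex-valued unless specified, and vector spaces are over $\mathbb{R}$; $\langle\cdot,\cdot\rangle_{X^\star,X}$ is the (real) duality product, with $\langle f,v\rangle=\mathrm{Re}\int_\Omega f\overline{v}\,dx$ for $f\in L^{q'}(\Omega)$, $v\in L^q(\Omega)$. $|\Omega|$ is the Lebesgue measure of $\Omega$. $C_P=C_P(|\Omega|,N)$ is the constant in Poincaré's inequality: $\|w\|_{L^2(\Omega)}\le C_P\|\nabla w\|_{L^2(\Omega)}$ for all $w\in H^1_0(\Omega)$. Set $\mathbb{B}=\mathbb{C}\setminus\{z\in\mathbb{C};\ \mathrm{Re}(z)\le-\frac1{C_P^2}\text{ and }\mathrm{Im}(z)=0\}$. Saturated section: for $u\in L^1_{\mathrm{loc}}(\Omega)$, $U\in L^\infty(\Omega)$ is a saturated section associated to $u$ if $\|U\|_{L^\infty(\Omega)}\le1$ and $U=\frac{u}{|u|}$ a.e. in $\{u\ne0\}$. Global weak solution (Dirichlet): $u\in H^1_0(\Omega)\cap L^1(\Omega)$ such that there is a saturated section $U$ associated to $u$ with $$\langle\nabla u,\nabla v\rangle_{L^2,L^2}+\langle aU,v\rangle_{L^\infty,L^1}+\langle bu,v\rangle_{L^2,L^2}+\langle Vu,v\rangle_{L^2,L^2}=\langle F,v\rangle_{X^\star,X}$$ for any $v\in X:=H^1_0(\Omega)\cap L^1(\Omega)$. $SO_N(\mathbb{R})$ is the special orthogonal group of $\mathbb{R}^N$. For $F$ not a function, the identities $F(\mathcal{R}x)=F(x)$ and "$F$ odd" are understood in the usual sense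 by duality. $C=C(c_1,\dots,c_k)$ denotes a positive constant depending only and continuously on $c_1,\dots,c_k$.
   Formalization: The constant C depends continuously on b itself, not only on |b| (false with |b|: eigenfunction data, b near the slit); for the rotation symmetry, v∘R⁻¹ must lie in H¹₀(Ω) for all v in H¹₀(Ω), automatic if Rx∈Ω for every x∈Ω (false if only a.e.: slit disc). *)

theory Defs
  imports "HOL-Analysis.Analysis" "HOL-Probability.Essential_Supremum"
begin

text \<open>
  Elements of a function space on \<open>\<Omega>\<close> are represented by functions defined on the whole of
  \<open>real ^ 'n\<close>; every notion below only sees their values almost everywhere on \<open>\<Omega>\<close>.
\<close>

subsection \<open>Lebesgue spaces\<close>

definition L1 :: "(real ^ 'n) set \<Rightarrow> (real ^ 'n \<Rightarrow> 'b :: euclidean_space) set" where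
  "L1 \<Omega> = {f. integrable (lebesgue_on \<Omega>) f}"

definition L1loc :: "(real ^ 'n) set \<Rightarrow> (real ^ 'n \<Rightarrow> 'b :: euclidean_space) set" where
  "L1loc \<Omega> = {f. \<forall>K. compact K \<and> K \<subseteq> \<Omega> \<longrightarrow> integrable (lebesgue_on K) f}"

definition L2 :: "(real ^ 'n) set \<Rightarrow> (real ^ 'n \<Rightarrow> 'b :: euclidean_space) set" where
  "L2 \<Omega> = {f \<in> borel_measurable (lebesgue_on \<Omega>). integrable (lebesgue_on \<Omega>) (\<lambda>x. (norm (f x))\<^sup>2)}"

definition L2_norm :: "(real ^ 'n) set \<Rightarrow> (real ^ 'n \<Rightarrow> 'b :: euclidean_space) \<Rightarrow> real" where
  "L2_norm \<Omega> f = sqrt (LINT x|lebesgue_on \<Omega>. (norm (f x))\<^sup>2)"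

definition Linf :: "(real ^ 'n) set \<Rightarrow> (real ^ 'n \<Rightarrow> 'b :: euclidean_space) set" where
  "Linf \<Omega> = {f \<in> borel_measurable (lebesgue_on \<Omega>). \<exists>c. AE x in lebesgue_on \<Omega>. norm (f x) \<le> c}"

text \<open>Only meaningful on \<open>Linf \<Omega>\<close>: \<open>enn2real\<close> sends an infinite essential supremum to \<open>0\<close>.\<close>

definition Linf_norm :: "(real ^ 'n) set \<Rightarrow> (real ^ 'n \<Rightarrow> 'b :: euclidean_space) \<Rightarrow> real" where
  "Linf_norm \<Omega> f = enn2real (esssup (lebesgue_on \<Omega>) (\<lambda>x. ennreal (norm (f x))))"

definition duality :: "(real ^ 'n) set \<Rightarrow> (real ^ 'n \<Rightarrow> complex) \<Rightarrow> (real ^ 'n \<Rightarrow> complex) \<Rightarrow> real" where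
  "duality \<Omega> f v = Re (LINT x|lebesgue_on \<Omega>. f x * cnj (v x))"

subsection \<open>Test functions, weak gradients and Sobolev spaces\<close>

definition partial_derivative :: "'n \<Rightarrow> (real ^ 'n \<Rightarrow> complex) \<Rightarrow> real ^ 'n \<Rightarrow> complex" where
  "partial_derivative i f x = frechet_derivative f (at x) (axis i 1)"

primrec C_k :: "nat \<Rightarrow> (real ^ 'n \<Rightarrow> complex) \<Rightarrow> bool" where
  "C_k 0 f \<longleftrightarrow> continuous_on UNIV f"
| "C_k (Suc k) f \<longleftrightarrow> (\<forall>x. f differentiable (at x)) \<and> (\<forall>i. C_k k (partial_derivative i f))"

definition test_functions :: "(real ^ 'n) set \<Rightarrow> (real ^ 'n \<Rightarrow> complex) set" where
  "test_functions \<Omega> =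
    {\<phi>. (\<forall>k. C_k k \<phi>) \<and> (\<exists>K. compact K \<and> K \<subseteq> \<Omega> \<and> (\<forall>x. x \<notin> K \<longrightarrow> \<phi> x = 0))}"

definition has_weak_gradient ::
    "(real ^ 'n) set \<Rightarrow> (real ^ 'n \<Rightarrow> complex) \<Rightarrow> (real ^ 'n \<Rightarrow> complex ^ 'n) \<Rightarrow> bool" where
  "has_weak_gradient \<Omega> u g \<longleftrightarrow> u \<in> L1loc \<Omega> \<and> g \<in> L1loc \<Omega> \<and>
    (\<forall>\<phi> \<in> test_functions \<Omega>. \<forall>i.
      (LINT x|lebesgue_on \<Omega>. u x * partial_derivative i \<phi> x) =
      - (LINT x|lebesgue_on \<Omega>. g x $ i * \<phi> x))"

text \<open>For open \<open>\<Omega>\<close> the weak gradient is unique up to a null set, so the choice does not matter.\<close>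

definition weak_gradient :: "(real ^ 'n) set \<Rightarrow> (real ^ 'n \<Rightarrow> complex) \<Rightarrow> real ^ 'n \<Rightarrow> complex ^ 'n" where
  "weak_gradient \<Omega> u = (SOME g. has_weak_gradient \<Omega> u g)"

definition H1 :: "(real ^ 'n) set \<Rightarrow> (real ^ 'n \<Rightarrow> complex) set" where
  "H1 \<Omega> = {u \<in> L2 \<Omega>. \<exists>g \<in> L2 \<Omega>. has_weak_gradient \<Omega> u g}"

definition H1_norm :: "(real ^ 'n) set \<Rightarrow> (real ^ 'n \<Rightarrow> complex) \<Rightarrow> real" where
  "H1_norm \<Omega> u = sqrt ((L2_norm \<Omega> u)\<^sup>2 + (L2_norm \<Omega> (weak_gradient \<Omega> u))\<^sup>2)"

definition H10 :: "(real ^ 'n) set \<Rightarrow> (real ^ 'n \<Rightarrow> complex) set" where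
  "H10 \<Omega> = {u \<in> H1 \<Omega>. \<forall>\<epsilon>>0. \<exists>\<phi> \<in> test_functions \<Omega>. H1_norm \<Omega> (\<lambda>x. u x - \<phi> x) < \<epsilon>}"

text \<open>
  The dual of the real Banach space \<open>H10 \<Omega>\<close>. The bound makes each functional insensitive to
  changes on null sets.
\<close>

definition Hm1 :: "(real ^ 'n) set \<Rightarrow> ((real ^ 'n \<Rightarrow> complex) \<Rightarrow> real) set" where
  "Hm1 \<Omega> = {F.
    (\<forall>v \<in> H10 \<Omega>. \<forall>w \<in> H10 \<Omega>. F (\<lambda>x. v x + w x) = F v + F w) \<and>
    (\<forall>c. \<forall>v \<in> H10 \<Omega>. F (\<lambda>x. c *\<^sub>R v x) = c * F v) \<and>
    (\<exists>K. \<forall>v \<in> H10 \<Omega>. \<bar>F v\<bar> \<le> K * H1_norm \<Omega> v)}"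

definition Hm1_norm :: "(real ^ 'n) set \<Rightarrow> ((real ^ 'n \<Rightarrow> complex) \<Rightarrow> real) \<Rightarrow> real" where
  "Hm1_norm \<Omega> F = (SUP v \<in> {v \<in> H10 \<Omega>. H1_norm \<Omega> v \<le> 1}. \<bar>F v\<bar>)"

subsection \<open>The Dirichlet problem\<close>

text \<open>The argument \<open>c\<close> is the constant in Poincar\'e's inequality.\<close>

definition slit_plane :: "real \<Rightarrow> complex set" where
  "slit_plane c = UNIV - {z. Re z \<le> - (1 / c\<^sup>2) \<and> Im z = 0}"

definition saturated_section ::
    "(real ^ 'n) set \<Rightarrow> (real ^ 'n \<Rightarrow> complex) \<Rightarrow> (real ^ 'n \<Rightarrow> complex) \<Rightarrow> bool" where
  "saturated_section \<Omega> u U \<longleftrightarrow> u \<in> L1loc \<Omega> \<and> U \<in> Linf \<Omega> \<and> Linf_norm \<Omega> U \<le> 1 \<and>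
    (AE x in lebesgue_on \<Omega>. u x \<noteq> 0 \<longrightarrow> U x = u x / of_real (cmod (u x)))"

definition global_weak_solution ::
    "(real ^ 'n) set \<Rightarrow> complex \<Rightarrow> complex \<Rightarrow> (real ^ 'n \<Rightarrow> real) \<Rightarrow>
     ((real ^ 'n \<Rightarrow> complex) \<Rightarrow> real) \<Rightarrow> (real ^ 'n \<Rightarrow> complex) \<Rightarrow> bool" where
  "global_weak_solution \<Omega> a b V F u \<longleftrightarrow> u \<in> H10 \<Omega> \<inter> L1 \<Omega> \<and>
    (\<exists>U. saturated_section \<Omega> u U \<and>
      (\<forall>v \<in> H10 \<Omega> \<inter> L1 \<Omega>.
        (\<Sum>i\<in>UNIV. duality \<Omega> (\<lambda>x. weak_gradient \<Omega> u x $ i) (\<lambda>x. weak_gradient \<Omega> v x $ i))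
        + duality \<Omega> (\<lambda>x. a * U x) v
        + duality \<Omega> (\<lambda>x. b * u x) v
        + duality \<Omega> (\<lambda>x. of_real (V x) * u x) v
        = F v))"

text \<open>
  \<open>F (R x) = F x\<close> by duality: since \<open>R\<close> preserves Lebesgue measure, \<open>\<langle>F \<circ> R, v\<rangle> = \<langle>F, v \<circ> R\<^sup>-\<^sup>1\<rangle>\<close>, and
  \<open>R\<^sup>-\<^sup>1 = transpose R\<close>. For this to make sense, composition with \<open>R\<^sup>-\<^sup>1\<close> has to act on \<open>H10 \<Omega>\<close>. That is
  automatic if \<open>R x \<in> \<Omega>\<close> for every \<open>x \<in> \<Omega>\<close> (then the image of \<open>\<Omega>\<close> under \<open>R\<close> is \<open>\<Omega>\<close>), but not if
  this holds only for almost every \<open>x\<close>: removing a segment from a disc changes \<open>H10\<close>.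
\<close>

definition dual_invariant ::
    "(real ^ 'n) set \<Rightarrow> real ^ 'n ^ 'n \<Rightarrow> ((real ^ 'n \<Rightarrow> complex) \<Rightarrow> real) \<Rightarrow> bool" where
  "dual_invariant \<Omega> R F \<longleftrightarrow>
    (\<forall>v \<in> H10 \<Omega>. (\<lambda>x. v (transpose R *v x)) \<in> H10 \<Omega> \<and> F (\<lambda>x. v (transpose R *v x)) = F v)"

definition dual_odd ::
    "(real ^ 'n) set \<Rightarrow> ((real ^ 'n \<Rightarrow> complex) \<Rightarrow> real) \<Rightarrow> bool" where
  "dual_odd \<Omega> F \<longleftrightarrow> (\<forall>v \<in> H10 \<Omega>. F (\<lambda>x. v (- x)) = - F v)"

end

theory Submission
  imports Defs "HOL-Library.Diagonal_Subsequence"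
begin

text \<open>
  Let \<open>T X\<close> be the weak solution of the linear problem in which \<open>U\<close> is replaced by a given field \<open>X\<close>.
  It exists by Lax and Milgram, since for \<open>b\<close> in the slit plane the form becomes coercive after
  multiplication by a complex constant. Compactness of \<open>H10 \<Omega>\<close> in \<open>L2 \<Omega>\<close> makes
  \<open>X \<mapsto> T X / (\<bar>T X\<bar> + \<epsilon>)\<close> continuous from the weak to the strong topology on the weakly compact
  convex set \<open>\<bar>X\<bar> \<le> 1\<close>, so it has approximate fixed points \<open>X\<^sub>\<epsilon>\<close>. If \<open>X\<^sub>\<epsilon>\<close> tends weakly to \<open>U\<close>
  as \<open>\<epsilon> \<rightarrow> 0\<close>, then \<open>T X\<^sub>\<epsilon>\<close> tends strongly to \<open>u = T U\<close>, hence almost everywhere along a subsequence,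
  and \<open>U = u / \<bar>u\<bar>\<close> wherever \<open>u \<noteq> 0\<close>.

  For the symmetries everything is done in the closed subspaces of symmetric functions; the residual
  of the equation is an invariant functional that vanishes there, and is therefore zero.
  Testing with \<open>u\<close> and \<open>\<i> u\<close> gives the bound.
\<close>

subsection \<open>Hilbert spaces\<close>

text \<open>The sign \<open>z / \<bar>z\<bar>\<close> is discontinuous at 0, and with a general
  complex coefficient \<open>a\<close> it is neither monotone nor a gradient, so minimisation is out
  of reach. This is why the section, not \<open>u\<close>, is the unknown. A weak limit of fields of
  modulus at most one has modulus at most one, and nothing else is asked where the limit solution
  vanishes; elsewhere pointwise convergence identifies the value.

  \<open>F\<close> is only real-linear. All Hilbert spaces are therefore real, and multiplication by
  a complex number is a separate operator, \<open>cmul\<close>.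

  Elements of \<open>H10 \<Omega>\<close> are functions, not classes. Each is represented by the
  pair of the classes of \<open>u\<close> and of its weak gradient, both extended by zero. The H1
  norm becomes the norm of the pair, and \<open>H10 \<Omega>\<close> becomes the closed subspace
  \<open>sobolev \<Omega>\<close> of a product of two complete spaces.

  If \<open>\<Omega>\<close> is invariant only up to a null set, a rotation need not carry test
  functions to test functions. That composition acts on \<open>H10 \<Omega>\<close> is then an
  assumption, and its effect on gradients is found on the whole space.\<close>

lemma closed_convex_projection:
  fixes K :: "'a::{real_inner,complete_space} set"
  assumes "closed K" "convex K" "K \<noteq> {}"
  obtains p where "p \<in> K" "\<And>y. y \<in> K \<Longrightarrow> inner (x - p) (y - p) \<le> 0"
proof -
  define d where "d = (INF y\<in>K. (norm (x - y))\<^sup>2)"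
  have bdd: "bdd_below ((\<lambda>y. (norm (x - y))\<^sup>2) ` K)"
    by (rule bdd_belowI2[where m = 0]) simp
  have d_le: "d \<le> (norm (x - y))\<^sup>2" if "y \<in> K" for y
    unfolding d_def by (rule cINF_lower[OF bdd that])
  have "\<exists>y\<in>K. (norm (x - y))\<^sup>2 < d + 1 / real (Suc n)" for n
    using cINF_less_iff[OF assms(3) bdd, of "d + 1 / real (Suc n)"] by (auto simp: d_def)
  then obtain Y where Y: "\<And>n. Y n \<in> K" "\<And>n. (norm (x - Y n))\<^sup>2 < d + 1 / real (Suc n)"
    by metis
  \<comment> \<open>Parallelogram identity about \<open>x\<close>: the midpoint of two almost
    minimisers lies in the convex set \<open>K\<close>, which bounds their distance and makes
    \<open>Y\<close> Cauchy.\<close>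
  have par: "(norm (Y n - Y m))\<^sup>2 \<le> 2 / real (Suc n) + 2 / real (Suc m)" for n m
  proof -
    have mid: "(1/2) *\<^sub>R Y n + (1/2) *\<^sub>R Y m \<in> K"
      using Y(1) by (intro convexD[OF assms(2)]) auto
    have "(norm (Y n - Y m))\<^sup>2 + 4 * (norm (x - ((1/2) *\<^sub>R Y n + (1/2) *\<^sub>R Y m)))\<^sup>2
        = 2 * (norm (x - Y n))\<^sup>2 + 2 * (norm (x - Y m))\<^sup>2"
      by (simp add: power2_norm_eq_inner inner_diff_left inner_diff_right inner_add_left
          inner_add_right inner_commute algebra_simps)
    then show ?thesis using d_le[OF mid] Y(2)[of n] Y(2)[of m] by simp
  qed
  have "Cauchy Y"
  proof (rule metric_CauchyI)
    fix e :: real assume "0 < e"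
    then obtain M where M: "4 / e\<^sup>2 < real (Suc M)"
      using reals_Archimedean2 by (metis less_Suc_eq less_trans of_nat_less_iff)
    have "dist (Y m) (Y n) < e" if "m \<ge> M" "n \<ge> M" for m n
    proof -
      have "2 / real (Suc m) \<le> 2 / real (Suc M)" "2 / real (Suc n) \<le> 2 / real (Suc M)"
        using that by (auto intro!: divide_left_mono)
      then have "(norm (Y m - Y n))\<^sup>2 \<le> 4 / real (Suc M)" using par[of m n] by linarith
      also have "\<dots> < e\<^sup>2" using M \<open>0 < e\<close> by (simp add: field_simps)
      finally show ?thesis using \<open>0 < e\<close> by (simp add: dist_norm power2_less_imp_less)
    qed
    then show "\<exists>M. \<forall>m\<ge>M. \<forall>n\<ge>M. dist (Y m) (Y n) < e" by blast
  qed
  then obtain p where p: "Y \<longlonglongrightarrow> p" using Cauchy_convergent convergent_def by blast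
  have pK: "p \<in> K" using closed_sequentially[OF assms(1)] Y(1) p by blast
  have "(\<lambda>n. d + 1 / real (Suc n)) \<longlonglongrightarrow> d + 0"
    by (intro tendsto_add tendsto_const LIMSEQ_Suc[OF lim_1_over_n])
  moreover have "(\<lambda>n. (norm (x - Y n))\<^sup>2) \<longlonglongrightarrow> (norm (x - p))\<^sup>2"
    by (intro tendsto_intros p)
  ultimately have nd: "(norm (x - p))\<^sup>2 \<le> d"
    using Y(2) by (intro LIMSEQ_le[where Y = "\<lambda>n. d + 1 / real (Suc n)"]) (auto intro: less_imp_le)
  have "inner (x - p) (y - p) \<le> 0" if y: "y \<in> K" for y
  proof (rule ccontr)
    assume neg: "\<not> ?thesis"
    define c where "c = inner (x - p) (y - p)"
    define N where "N = (norm (y - p))\<^sup>2"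
    have c: "c > 0" using neg by (simp add: c_def)
    have N: "N \<ge> 0" by (simp add: N_def)
    \<comment> \<open>The step \<open>t\<close> from \<open>p\<close> towards \<open>y\<close> is so
      short that the quadratic term \<open>t * N\<close> cannot outweigh the gain
      \<open>2 * c\<close>; the new point would be nearer to \<open>x\<close> than \<open>d\<close>
      allows.\<close>
    define t where "t = min 1 (c / (N + 1))"
    have t: "0 < t" "t \<le> 1" "t * (N + 1) \<le> c"
    proof -
      have "t \<le> c / (N + 1)" by (simp add: t_def)
      then show "t * (N + 1) \<le> c" using N by (simp add: pos_le_divide_eq)
    qed (use c N in \<open>auto simp: t_def\<close>)
    have "(1 - t) *\<^sub>R p + t *\<^sub>R y \<in> K"
      using t y pK by (intro convexD[OF assms(2)]) auto
    then have "d \<le> (norm (x - ((1 - t) *\<^sub>R p + t *\<^sub>R y)))\<^sup>2" by (rule d_le)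
    also have "x - ((1 - t) *\<^sub>R p + t *\<^sub>R y) = (x - p) - t *\<^sub>R (y - p)"
      by (simp add: algebra_simps)
    also have "(norm \<dots>)\<^sup>2 = (norm (x - p))\<^sup>2 - 2 * t * c + t\<^sup>2 * N"
      unfolding c_def N_def power2_norm_eq_inner
      by (simp add: inner_diff_left inner_diff_right inner_commute power2_eq_square algebra_simps)
    finally have "2 * t * c \<le> t * (t * N)" using nd by (simp add: power2_eq_square)
    then have "2 * c \<le> t * N" using t(1) by simp
    also have "\<dots> \<le> t * (N + 1)" using t(1) by simp
    finally show False using t(3) c by linarith
  qed
  then show ?thesis using pK that by blast
qed

lemma closed_subspace_projection:
  fixes S :: "'a::{real_inner,complete_space} set"
  assumes "closed S" "subspace S"
  obtains p where "p \<in> S" "\<And>y. y \<in> S \<Longrightarrow> inner (x - p) y = 0"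
proof -
  obtain p where p: "p \<in> S" "\<And>y. y \<in> S \<Longrightarrow> inner (x - p) (y - p) \<le> 0"
    using closed_convex_projection[OF assms(1) subspace_imp_convex[OF assms(2)]]
      subspace_0[OF assms(2)] by blast
  have "inner (x - p) y = 0" if "y \<in> S" for y
  proof -
    have "p + y \<in> S" "p - y \<in> S"
      using p that assms(2) by (auto intro: subspace_add subspace_diff)
    from p(2)[OF this(1)] p(2)[OF this(2)] show ?thesis by simp
  qed
  then show ?thesis using p that by blast
qed

lemma subspace_closure:
  fixes S :: "'a::real_normed_vector set"
  assumes "subspace S"
  shows "subspace (closure S)"
  unfolding subspace_def
proof (intro conjI ballI allI)
  show "0 \<in> closure S" using subspace_0[OF assms] closure_subset by blast
next
  fix x y assume "x \<in> closure S" "y \<in> closure S"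
  then obtain a b where "\<forall>n. a n \<in> S" "a \<longlonglongrightarrow> x" "\<forall>n. b n \<in> S" "b \<longlonglongrightarrow> y"
    unfolding closure_sequential by blast
  then show "x + y \<in> closure S" unfolding closure_sequential
    by (intro exI[of _ "\<lambda>n. a n + b n"]) (auto intro: subspace_add[OF assms] tendsto_add)
next
  fix c x assume "x \<in> closure S"
  then obtain a where "\<forall>n. a n \<in> S" "a \<longlonglongrightarrow> x"
    unfolding closure_sequential by blast
  then show "c *\<^sub>R x \<in> closure S" unfolding closure_sequential
    by (intro exI[of _ "\<lambda>n. c *\<^sub>R a n"]) (auto intro: subspace_scale[OF assms] tendsto_scaleR)
qed

text \<open>Linearity is asked on \<open>S\<close> only: functionals such as \<open>Fs\<close> in
  \<open>Hm1_graph\<close> are determined on the Sobolev subspace and arbitrary elsewhere.\<close>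

definition linear_functional_on :: "'a::real_vector set \<Rightarrow> ('a \<Rightarrow> real) \<Rightarrow> bool" where
  "linear_functional_on S f \<longleftrightarrow>
    (\<forall>x\<in>S. \<forall>y\<in>S. f (x + y) = f x + f y) \<and> (\<forall>c. \<forall>x\<in>S. f (c *\<^sub>R x) = c * f x)"

lemma linear_functional_on_diff:
  assumes "linear_functional_on S f" "subspace S" "x \<in> S" "y \<in> S"
  shows "f (x - y) = f x - f y"
proof -
  have "(-1) *\<^sub>R y \<in> S" using assms subspace_scale by blast
  then have "f (x + (-1) *\<^sub>R y) = f x + (-1) * f y"
    using assms unfolding linear_functional_on_def by metis
  then show ?thesis by simp
qed

text \<open>The kernel \<open>N\<close> is a closed subspace. The part of \<open>x\<close>
  orthogonal to it spans the complement of \<open>N\<close> in \<open>S\<close>, and a multiple of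
  this vector is the representative.\<close>

lemma riesz_subspace:
  fixes S :: "'a::{real_inner,complete_space} set"
  assumes S: "closed S" "subspace S"
    and lin: "linear_functional_on S f" and bd: "\<And>v. v \<in> S \<Longrightarrow> \<bar>f v\<bar> \<le> K * norm v"
  obtains w where "w \<in> S" "\<And>v. v \<in> S \<Longrightarrow> f v = inner w v"
proof (cases "\<forall>v\<in>S. f v = 0")
  case True
  then show ?thesis using that[of 0] S subspace_0 by auto
next
  case False
  then obtain x where x: "x \<in> S" "f x \<noteq> 0" by blast
  define N where "N = {v \<in> S. f v = 0}"
  have f0: "f 0 = 0" using linear_functional_on_diff[OF lin S(2) x(1) x(1)] by simp
  have sN: "subspace N"
    using S(2) lin f0 unfolding N_def subspace_def linear_functional_on_def by auto
  have cN: "closed N"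
  proof (rule closed_sequential_limits[THEN iffD2], intro allI impI, elim conjE)
    fix X l assume X: "\<forall>n. X n \<in> N" "X \<longlonglongrightarrow> l"
    then have l: "l \<in> S" using S(1) closed_sequentially N_def by blast
    have "\<bar>f l\<bar> \<le> K * norm (l - X n)" for n
    proof -
      have "X n \<in> S" "f (X n) = 0" using X by (auto simp: N_def)
      then show ?thesis
        using bd[of "l - X n"] linear_functional_on_diff[OF lin S(2) l, of "X n"]
          subspace_diff[OF S(2) l] by simp
    qed
    moreover have "(\<lambda>n. K * norm (l - X n)) \<longlonglongrightarrow> K * norm (l - l)"
      by (intro tendsto_intros X(2))
    ultimately have "\<bar>f l\<bar> \<le> 0" by (intro LIMSEQ_le_const) auto
    then show "l \<in> N" using l by (simp add: N_def)
  qed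
  obtain p where p: "p \<in> N" "\<And>y. y \<in> N \<Longrightarrow> inner (x - p) y = 0"
    using closed_subspace_projection[OF cN sN] by blast
  define n where "n = x - p"
  have nS: "n \<in> S" using x p subspace_diff[OF S(2)] by (auto simp: n_def N_def)
  have fn: "f n \<noteq> 0"
    using x p linear_functional_on_diff[OF lin S(2) x(1), of p] by (auto simp: n_def N_def)
  have n0: "inner n n \<noteq> 0" using fn f0 by auto
  define w where "w = (f n / inner n n) *\<^sub>R n"
  have "f v = inner w v" if v: "v \<in> S" for v
  proof -
    have m: "(f v / f n) *\<^sub>R n \<in> S" using nS S(2) subspace_scale by blast
    have "f (v - (f v / f n) *\<^sub>R n) = f v - f v / f n * f n"
      using linear_functional_on_diff[OF lin S(2) v m] lin nS
      unfolding linear_functional_on_def by simp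
    then have "v - (f v / f n) *\<^sub>R n \<in> N"
      using fn subspace_diff[OF S(2) v m] by (simp add: N_def)
    from p(2)[OF this] have "inner n v = f v / f n * inner n n"
      by (simp add: n_def[symmetric] inner_diff_right)
    then show ?thesis using fn n0 by (simp add: w_def)
  qed
  moreover have "w \<in> S" using nS S(2) subspace_scale w_def by blast
  ultimately show ?thesis using that by blast
qed

text \<open>Without symmetry of the form there is nothing to minimise. With
  \<open>B u v = inner (A u) v\<close>, the map \<open>u - \<rho> *\<^sub>R (A u - w)\<close> is a
  contraction of \<open>S\<close>, and its fixed point solves \<open>A u = w\<close>.\<close>

lemma lax_milgram:
  fixes S :: "'a::{real_inner,complete_space} set"
  assumes S: "closed S" "subspace S" and B: "bounded_bilinear B"
    and \<kappa>: "\<kappa> > 0" "\<And>v. v \<in> S \<Longrightarrow> \<kappa> * (norm v)\<^sup>2 \<le> B v v"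
    and lin: "linear_functional_on S f" and bd: "\<And>v. v \<in> S \<Longrightarrow> \<bar>f v\<bar> \<le> K * norm v"
  shows "\<exists>u\<in>S. \<forall>v\<in>S. B u v = f v"
proof -
  interpret B: bounded_bilinear B by (rule B)
  obtain L0 where L0: "\<And>x y. norm (B x y) \<le> norm x * norm y * L0" "L0 \<ge> 0"
    using B.nonneg_bounded by blast
  \<comment> \<open>Enlarging the bound by \<open>\<kappa>\<close> gives \<open>L > 0\<close> and
    \<open>\<kappa> \<le> L\<close>, so that \<open>\<rho>\<close> and \<open>q\<close> below make
    sense.\<close>
  define L where "L = L0 + \<kappa>"
  have L: "\<bar>B x y\<bar> \<le> norm x * norm y * L" for x y
  proof -
    have "norm x * norm y * L0 \<le> norm x * norm y * L" using \<kappa> by (intro mult_left_mono) (auto simp: L_def)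
    then show ?thesis using L0(1)[of x y] by simp
  qed
  have L_pos: "L > 0" "\<kappa> \<le> L" using L0 \<kappa> by (auto simp: L_def)
  have "\<exists>w\<in>S. \<forall>v\<in>S. B u v = inner w v" for u
  proof (rule riesz_subspace[OF S])
    show "linear_functional_on S (B u)"
      by (simp add: linear_functional_on_def B.add_right B.scaleR_right)
    show "\<bar>B u v\<bar> \<le> (norm u * L) * norm v" for v using L[of u v] by (simp add: mult_ac)
  qed blast
  then obtain A where A: "\<And>u. A u \<in> S" "\<And>u v. v \<in> S \<Longrightarrow> B u v = inner (A u) v" by metis
  obtain w where w: "w \<in> S" "\<And>v. v \<in> S \<Longrightarrow> f v = inner w v"
    using riesz_subspace[OF S lin bd] by blast
  \<comment> \<open>This value minimises
    \<open>1 - 2 * \<rho> * \<kappa> + \<rho>\<^sup>2 * L\<^sup>2\<close>, the bound for the squared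
    contraction factor; the minimum is \<open>1 - (\<kappa> / L)\<^sup>2\<close>.\<close>
  define \<rho> where "\<rho> = \<kappa> / L\<^sup>2"
  have \<rho>: "\<rho> > 0" using \<kappa> L_pos by (simp add: \<rho>_def)
  define T where "T u = u - \<rho> *\<^sub>R (A u - w)" for u
  define q where "q = sqrt (1 - (\<kappa> / L)\<^sup>2)"
  have kl: "0 < \<kappa> / L" "\<kappa> / L \<le> 1" using \<kappa> L_pos by auto
  then have kl2: "(\<kappa> / L)\<^sup>2 > 0" "(\<kappa> / L)\<^sup>2 \<le> 1" by (auto simp: power_le_one)
  have q: "0 \<le> q" "q < 1" using kl2 by (auto simp: q_def)
  have TS: "T ` S \<subseteq> S" unfolding T_def
    using A(1) w(1) S(2) by (auto intro!: subspace_diff subspace_scale)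
  have T_dist: "dist (T x) (T y) \<le> q * dist x y" if xy: "x \<in> S" "y \<in> S" for x y
  proof -
    define d where "d = x - y"
    define e where "e = A x - A y"
    have d: "d \<in> S" and e: "e \<in> S" using xy A(1) S(2) by (auto simp: d_def e_def intro: subspace_diff)
    have Be: "B d v = inner e v" if "v \<in> S" for v
      unfolding d_def e_def B.diff_left inner_diff_left by (simp only: A(2)[OF that])
    have "(norm e)\<^sup>2 \<le> norm d * norm e * L"
      using Be[OF e] L[of d e] by (simp add: power2_norm_eq_inner)
    then have ne: "norm e \<le> norm d * L"
      by (cases "norm e = 0") (use L_pos in \<open>auto simp: power2_eq_square mult.assoc mult.left_commute\<close>)
    have "(norm (d - \<rho> *\<^sub>R e))\<^sup>2 = (norm d)\<^sup>2 - 2 * \<rho> * inner e d + \<rho>\<^sup>2 * (norm e)\<^sup>2"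
      unfolding power2_norm_eq_inner
      by (simp add: inner_diff_left inner_diff_right inner_commute power2_eq_square algebra_simps)
    also have "\<dots> \<le> (norm d)\<^sup>2 - 2 * \<rho> * (\<kappa> * (norm d)\<^sup>2) + \<rho>\<^sup>2 * (norm d * L)\<^sup>2"
    proof -
      have "\<kappa> * (norm d)\<^sup>2 \<le> inner e d" using \<kappa>(2)[OF d] Be[OF d] by simp
      then have 1: "\<rho> * (\<kappa> * (norm d)\<^sup>2) \<le> \<rho> * inner e d" using \<rho> by simp
      have "(norm e)\<^sup>2 \<le> (norm d * L)\<^sup>2" using ne by (intro power_mono) auto
      then have 2: "\<rho>\<^sup>2 * (norm e)\<^sup>2 \<le> \<rho>\<^sup>2 * (norm d * L)\<^sup>2" by (intro mult_left_mono) auto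
      show ?thesis using 1 2 by linarith
    qed
    also have "\<dots> = (1 - (\<kappa> / L)\<^sup>2) * (norm d)\<^sup>2"
      using L_pos by (simp add: \<rho>_def field_simps power2_eq_square)
    also have "\<dots> = (q * norm d)\<^sup>2" using kl2 by (simp add: q_def power_mult_distrib)
    finally have "norm (d - \<rho> *\<^sub>R e) \<le> q * norm d"
      by (rule power2_le_imp_le) (use q in auto)
    moreover have "T x - T y = d - \<rho> *\<^sub>R e" by (simp add: T_def d_def e_def algebra_simps)
    ultimately show ?thesis by (simp add: dist_norm d_def)
  qed
  have "\<exists>!x\<in>S. T x = x"
    using S subspace_0[OF S(2)] q TS T_dist
    by (intro Banach_fix) (auto simp: complete_eq_closed)
  then obtain u where u: "u \<in> S" "T u = u" by blast
  then have "A u = w" using \<rho> by (simp add: T_def)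
  then show ?thesis using u A w by (intro bexI[of _ u]) auto
qed

section \<open>Weak sequential compactness\<close>

lemma bounded_coordinates_subseq:
  fixes X :: "nat \<Rightarrow> nat \<Rightarrow> real"
  assumes "\<And>k i. \<bar>X k i\<bar> \<le> M i"
  obtains r where "strict_mono r" "\<And>i. convergent (\<lambda>k. X (r k) i)"
proof -
  interpret subseqs "\<lambda>i s. convergent (\<lambda>k. X (s k) i)"
  proof
    fix i and s :: "nat \<Rightarrow> nat" assume "strict_mono s"
    have "bounded (range (\<lambda>k. X (s k) i))"
      using assms by (intro boundedI[where B = "M i"]) auto
    then obtain l r where "strict_mono r" "((\<lambda>k. X (s k) i) \<circ> r) \<longlonglongrightarrow> l"
      using bounded_imp_convergent_subsequence by blast
    then show "\<exists>r'. strict_mono r' \<and> convergent (\<lambda>k. X ((s \<circ> r') k) i)"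
      by (auto simp: o_def convergent_def)
  qed
  have "convergent (\<lambda>k. X (diagseq k) i)" for i
  proof -
    \<comment> \<open>Only from index \<open>Suc i\<close> on is the diagonal sequence a subsequence
      of the one chosen for coordinate \<open>i\<close>; the finite beginning is then
      restored.\<close>
    have "convergent (\<lambda>k. X ((diagseq \<circ> ((+) (Suc i))) k) i)"
    proof (rule diagseq_holds)
      fix r s :: "nat \<Rightarrow> nat" and n
      assume r: "strict_mono r" and c: "convergent (\<lambda>k. X (s k) n)"
      show "convergent (\<lambda>k. X ((s \<circ> r) k) n)"
        using convergent_subseq_convergent[OF c r] by (simp add: o_def)
    qed
    then have "convergent (\<lambda>k. X (diagseq (k + Suc i)) i)" by (simp add: add.commute)
    then show ?thesis by (subst (asm) convergent_ignore_initial_segment)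
  qed
  then show ?thesis using that subseq_diagseq by blast
qed

definition weak_lim :: "(nat \<Rightarrow> 'a::real_inner) \<Rightarrow> 'a \<Rightarrow> bool" where
  "weak_lim X x \<longleftrightarrow> (\<forall>y. (\<lambda>k. inner (X k) y) \<longlonglongrightarrow> inner x y)"

lemma weak_limD: "weak_lim X x \<Longrightarrow> (\<lambda>k. inner (X k) y) \<longlonglongrightarrow> inner x y"
  by (simp add: weak_lim_def)

lemma weak_lim_subseq: "weak_lim X x \<Longrightarrow> strict_mono r \<Longrightarrow> weak_lim (X \<circ> r) x"
  unfolding weak_lim_def using LIMSEQ_subseq_LIMSEQ by (fastforce simp: o_def)

text \<open>The diagonal argument gives convergence against the countably many vectors
  \<open>X i\<close>. Boundedness extends it to their closed span \<open>S\<close>, where Riesz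
  yields the limit, and any other vector acts on the sequence through its projection to
  \<open>S\<close>.\<close>

lemma bounded_imp_weak_lim_subseq:
  fixes X :: "nat \<Rightarrow> 'a::{real_inner,complete_space}"
  assumes bd: "\<And>k. norm (X k) \<le> M"
  obtains r x where "strict_mono r" "weak_lim (X \<circ> r) x"
proof -
  have M: "M \<ge> 0" using bd[of 0] norm_ge_zero order_trans by blast
  obtain r where r: "strict_mono r" "\<And>i. convergent (\<lambda>k. inner (X (r k)) (X i))"
  proof (rule bounded_coordinates_subseq[where X = "\<lambda>k i. inner (X k) (X i)" and M = "\<lambda>i. M * M"])
    fix k i
    have "\<bar>inner (X k) (X i)\<bar> \<le> norm (X k) * norm (X i)" by (rule Cauchy_Schwarz_ineq2)
    also have "\<dots> \<le> M * M" using bd M by (intro mult_mono) auto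
    finally show "\<bar>inner (X k) (X i)\<bar> \<le> M * M" .
  qed blast
  define S where "S = closure (span (range X))"
  have "closed S" by (simp add: S_def)
  have "subspace S" by (simp add: S_def subspace_closure)
  note S = \<open>closed S\<close> \<open>subspace S\<close>
  define C where "C = {y. convergent (\<lambda>k. inner (X (r k)) y)}"
  have "subspace C"
    unfolding subspace_def C_def
    by (auto simp: inner_add_right intro!: convergent_add convergent_mult convergent_const)
  then have "span (range X) \<subseteq> C" using r(2) by (intro span_minimal) (auto simp: C_def)
  moreover have "closed C"
  proof (rule closed_sequential_limits[THEN iffD2], intro allI impI, elim conjE)
    fix Y l assume Y: "\<forall>n. Y n \<in> C" "Y \<longlonglongrightarrow> l"
    have "Cauchy (\<lambda>k. inner (X (r k)) l)"
    proof (rule metric_CauchyI)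
      fix e :: real assume e: "e > 0"
      then obtain n where n: "norm (Y n - l) < e / (3 * (M + 1))"
        using Y(2) M unfolding LIMSEQ_iff
        by (metis le_refl zero_less_divide_iff zero_less_mult_iff zero_less_numeral add_nonneg_pos zero_less_one)
      have n': "\<bar>inner (X k) (Y n) - inner (X k) l\<bar> < e / 3" for k
      proof -
        have "\<bar>inner (X k) (Y n - l)\<bar> \<le> norm (X k) * norm (Y n - l)" by (rule Cauchy_Schwarz_ineq2)
        also have "\<dots> \<le> (M + 1) * norm (Y n - l)" using bd[of k] by (intro mult_right_mono) auto
        also have "\<dots> < e / 3" using n M by (simp add: field_simps)
        finally show ?thesis by (simp add: inner_diff_right)
      qed
      have "Cauchy (\<lambda>k. inner (X (r k)) (Y n))"
        using Y(1) by (auto simp: C_def intro: convergent_Cauchy)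
      then obtain N where N: "\<And>i j. i \<ge> N \<Longrightarrow> j \<ge> N \<Longrightarrow>
          dist (inner (X (r i)) (Y n)) (inner (X (r j)) (Y n)) < e / 3"
        using e unfolding Cauchy_def by (metis zero_less_divide_iff zero_less_numeral)
      have "dist (inner (X (r i)) l) (inner (X (r j)) l) < e" if "i \<ge> N" "j \<ge> N" for i j
        using N[OF that] n'[of "r i"] n'[of "r j"] unfolding dist_real_def by linarith
      then show "\<exists>N. \<forall>i\<ge>N. \<forall>j\<ge>N. dist (inner (X (r i)) l) (inner (X (r j)) l) < e" by blast
    qed
    then show "l \<in> C" by (simp add: C_def Cauchy_convergent_iff)
  qed
  ultimately have SC: "S \<subseteq> C" unfolding S_def by (rule closure_minimal)
  define f where "f y = lim (\<lambda>k. inner (X (r k)) y)" for y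
  have f: "(\<lambda>k. inner (X (r k)) y) \<longlonglongrightarrow> f y" if "y \<in> S" for y
    using that SC unfolding f_def C_def by (auto simp: convergent_LIMSEQ_iff)
  have "linear_functional_on S f"
    unfolding linear_functional_on_def
  proof (intro conjI ballI allI)
    fix x y assume "x \<in> S" "y \<in> S"
    then have "(\<lambda>k. inner (X (r k)) (x + y)) \<longlonglongrightarrow> f x + f y"
      using f by (auto simp: inner_add_right intro!: tendsto_add)
    then show "f (x + y) = f x + f y"
      using f[of "x + y"] \<open>x \<in> S\<close> \<open>y \<in> S\<close> S(2) by (metis subspace_add LIMSEQ_unique)
  next
    fix c x assume "x \<in> S"
    then have "(\<lambda>k. inner (X (r k)) (c *\<^sub>R x)) \<longlonglongrightarrow> c * f x"
      using f by (auto intro!: tendsto_intros)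
    then show "f (c *\<^sub>R x) = c * f x"
      using f[of "c *\<^sub>R x"] \<open>x \<in> S\<close> S(2) by (metis subspace_scale LIMSEQ_unique)
  qed
  moreover have "\<bar>f y\<bar> \<le> M * norm y" if "y \<in> S" for y
  proof -
    have "(\<lambda>k. \<bar>inner (X (r k)) y\<bar>) \<longlonglongrightarrow> \<bar>f y\<bar>" using f[OF that] by (intro tendsto_intros)
    moreover have "\<bar>inner (X (r k)) y\<bar> \<le> M * norm y" for k
      using Cauchy_Schwarz_ineq2[of "X (r k)" y] mult_right_mono[OF bd[of "r k"], of "norm y"] by simp
    ultimately show ?thesis by (intro LIMSEQ_le_const2) auto
  qed
  ultimately obtain x where x: "x \<in> S" "\<And>v. v \<in> S \<Longrightarrow> f v = inner x v"
    using riesz_subspace[OF S] by metis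
  have "weak_lim (X \<circ> r) x"
    unfolding weak_lim_def
  proof
    fix y
    obtain p where p: "p \<in> S" "\<And>z. z \<in> S \<Longrightarrow> inner (y - p) z = 0"
      using closed_subspace_projection[OF S] by blast
    have eq: "inner z y = inner z p" if "z \<in> S" for z
      using p(2)[OF that] by (simp add: inner_diff_left inner_commute[of z])
    have XS: "X k \<in> S" for k
      unfolding S_def by (intro subsetD[OF closure_subset] span_base) auto
    show "(\<lambda>k. inner ((X \<circ> r) k) y) \<longlonglongrightarrow> inner x y"
      using f[OF p(1)] unfolding o_def eq[OF x(1)] eq[OF XS] x(2)[OF p(1)] .
  qed
  then show ?thesis using that r by blast
qed

text \<open>If \<open>p\<close> is the projection of \<open>x\<close> onto \<open>K\<close>, the
  inequality \<open>inner (x - p) (X k - p) \<le> 0\<close> passes to the weak limit and says that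
  \<open>norm (x - p)\<close> is 0.\<close>

lemma closed_convex_weak_lim:
  fixes K :: "'a::{real_inner,complete_space} set"
  assumes "closed K" "convex K" "\<And>k. X k \<in> K" "weak_lim X x"
  shows "x \<in> K"
proof -
  obtain p where p: "p \<in> K" "\<And>y. y \<in> K \<Longrightarrow> inner (x - p) (y - p) \<le> 0"
    using closed_convex_projection[OF assms(1,2)] assms(3) by blast
  have "(\<lambda>k. inner (X k) (x - p)) \<longlonglongrightarrow> inner x (x - p)" using assms(4) by (rule weak_limD)
  then have "(\<lambda>k. inner (X k) (x - p) - inner p (x - p)) \<longlonglongrightarrow> inner x (x - p) - inner p (x - p)"
    by (rule tendsto_diff[OF _ tendsto_const])
  moreover have "inner (X k) (x - p) - inner p (x - p) \<le> 0" for k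
    using p(2)[OF assms(3)[of k]] by (simp add: inner_commute inner_diff_left inner_diff_right)
  ultimately have "inner x (x - p) - inner p (x - p) \<le> 0" by (intro LIMSEQ_le_const2) auto
  then have "inner (x - p) (x - p) \<le> 0" by (simp add: inner_diff_left)
  then show ?thesis using p(1) by (metis inner_gt_zero_iff linorder_not_le right_minus_eq)
qed

text \<open>For a contraction \<open>T\<close>, \<open>T\<^sup>* w = w\<close> forces \<open>T w = w\<close>.\<close>

lemma contraction_adjoint_fixed:
  fixes w :: "'a::real_inner"
  assumes "norm (T w) \<le> norm w" "inner w (T w) = inner w w"
  shows "T w = w"
proof -
  have "(norm (T w - w))\<^sup>2 = (norm (T w))\<^sup>2 - 2 * inner w (T w) + (norm w)\<^sup>2"
    by (simp add: power2_norm_eq_inner inner_diff_left inner_diff_right inner_commute)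
  also have "\<dots> \<le> 0"
    using power_mono[OF assms(1) norm_ge_zero, of 2] assms(2) by (simp add: power2_norm_eq_inner)
  finally show ?thesis by simp
qed

subsection \<open>Approximate fixed points\<close>

text \<open>The dimension varies, so Brouwer's theorem is taken from Kuhn's lemma on \<open>nat \<Rightarrow> real\<close>
  rather than from the library version on a Euclidean type.\<close>

lemma brouwer_cube_nat:
  fixes f :: "(nat \<Rightarrow> real) \<Rightarrow> nat \<Rightarrow> real" and n :: nat
  defines "Q \<equiv> {x. \<forall>i<n. 0 \<le> x i \<and> x i \<le> 1}"
  assumes maps: "\<And>x. x \<in> Q \<Longrightarrow> f x \<in> Q"
    and cont: "\<And>X x i. (\<And>k. X k \<in> Q) \<Longrightarrow> x \<in> Q \<Longrightarrow> (\<And>i. i < n \<Longrightarrow> (\<lambda>k. X k i) \<longlonglongrightarrow> x i) \<Longrightarrow> i < n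
      \<Longrightarrow> (\<lambda>k. f (X k) i) \<longlonglongrightarrow> f x i"
  obtains x where "x \<in> Q" "\<And>i. i < n \<Longrightarrow> f x i = x i"
proof -
  define sc where "sc p x = (\<lambda>i. real (x i) / real (Suc p))" for p and x :: "nat \<Rightarrow> nat"
  \<comment> \<open>Label 1 records that \<open>f\<close> lowers coordinate \<open>i\<close>. On the
    face \<open>x i = Suc p\<close> it is imposed, as Kuhn's lemma demands label 1 there even where
    \<open>f\<close> leaves the coordinate unchanged.\<close>
  define label where "label p x i = (if f (sc p x) i < sc p x i \<or> x i = Suc p then 1 else 0 :: nat)"
    for p x i
  have sc_Q: "sc p x \<in> Q" if "\<forall>i<n. x i \<le> Suc p" for p x
  proof -
    have "real (x i) \<le> real (Suc p)" if "i < n" for i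
      using \<open>\<forall>i<n. x i \<le> Suc p\<close> that by (simp only: of_nat_le_iff)
    then show ?thesis by (simp add: sc_def Q_def)
  qed
  have step: "\<exists>q. (\<forall>i<n. q i < Suc p) \<and>
     (\<forall>i<n. \<exists>r s. (\<forall>j<n. q j \<le> r j \<and> r j \<le> q j + 1) \<and> (\<forall>j<n. q j \<le> s j \<and> s j \<le> q j + 1) \<and>
        label p r i \<noteq> label p s i)" for p
  proof -
    have 2: "\<forall>x. (\<forall>i<n. x i \<le> Suc p) \<longrightarrow> (\<forall>i<n. x i = 0 \<longrightarrow> label p x i = 0)"
    proof (intro allI impI)
      fix x i assume "\<forall>i<n. x i \<le> Suc p" "i < n" "x i = 0"
      then show "label p x i = 0"
        using maps[OF sc_Q[of x p]] by (simp add: label_def sc_def Q_def not_less)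
    qed
    have 1: "\<forall>x. (\<forall>i<n. x i \<le> Suc p) \<longrightarrow> (\<forall>i<n. label p x i = 0 \<or> label p x i = 1)"
      and 3: "\<forall>x. (\<forall>i<n. x i \<le> Suc p) \<longrightarrow> (\<forall>i<n. x i = Suc p \<longrightarrow> label p x i = 1)"
      by (simp_all add: label_def)
    show ?thesis by (rule kuhn_lemma[OF zero_less_Suc 1 2 3]) blast
  qed
  have step': "\<exists>q. (\<forall>i<n. q i < Suc p) \<and>
     (\<forall>i<n. \<exists>r s. (\<forall>j<n. q j \<le> r j \<and> r j \<le> q j + 1) \<and> (\<forall>j<n. q j \<le> s j \<and> s j \<le> q j + 1) \<and>
        label p r i = 0 \<and> label p s i = 1)" for p
  proof -
    obtain q where q: "\<forall>i<n. q i < Suc p" "\<forall>i<n. \<exists>r s. (\<forall>j<n. q j \<le> r j \<and> r j \<le> q j + 1) \<and>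
        (\<forall>j<n. q j \<le> s j \<and> s j \<le> q j + 1) \<and> label p r i \<noteq> label p s i" using step[of p] by blast
    have lab: "label p r i = 0 \<and> label p s i = 1 \<or> label p s i = 0 \<and> label p r i = 1"
      if "label p r i \<noteq> label p s i" for r s i using that by (auto simp: label_def split: if_splits)
    have "\<exists>r s. (\<forall>j<n. q j \<le> r j \<and> r j \<le> q j + 1) \<and> (\<forall>j<n. q j \<le> s j \<and> s j \<le> q j + 1) \<and>
        label p r i = 0 \<and> label p s i = 1" if "i < n" for i
    proof -
      obtain r s where "\<forall>j<n. q j \<le> r j \<and> r j \<le> q j + 1" "\<forall>j<n. q j \<le> s j \<and> s j \<le> q j + 1"
        "label p r i \<noteq> label p s i" using q(2) \<open>i < n\<close> by blast
      with lab show ?thesis by blast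
    qed
    with q(1) show ?thesis by blast
  qed
  have "\<exists>q. \<forall>p. (\<forall>i<n. q p i < Suc p) \<and>
     (\<forall>i<n. \<exists>r s. (\<forall>j<n. q p j \<le> r j \<and> r j \<le> q p j + 1) \<and> (\<forall>j<n. q p j \<le> s j \<and> s j \<le> q p j + 1) \<and>
        label p r i = 0 \<and> label p s i = 1)"
    by (rule choice, rule allI, rule step')
  then obtain q where q: "\<And>p i. i < n \<Longrightarrow> q p i < Suc p"
    and q': "\<And>p i. i < n \<Longrightarrow> \<exists>r s. (\<forall>j<n. q p j \<le> r j \<and> r j \<le> q p j + 1) \<and>
        (\<forall>j<n. q p j \<le> s j \<and> s j \<le> q p j + 1) \<and> label p r i = 0 \<and> label p s i = 1" by blast
  define P where "P p i r s \<longleftrightarrow> (\<forall>j<n. q p j \<le> r j \<and> r j \<le> q p j + 1) \<and>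
        (\<forall>j<n. q p j \<le> s j \<and> s j \<le> q p j + 1) \<and> label p r i = 0 \<and> label p s i = 1" for p i r s
  define r where "r p i = (SOME a. \<exists>b. P p i a b)" for p i
  define s where "s p i = (SOME b. P p i (r p i) b)" for p i
  have rs0: "P p i (r p i) (s p i)" if "i < n" for p i
  proof -
    have "\<exists>a b. P p i a b" using q'[OF that] unfolding P_def .
    then have "\<exists>b. P p i (r p i) b" unfolding r_def by (rule someI_ex)
    then show ?thesis unfolding s_def by (rule someI_ex)
  qed
  have rs: "\<And>p i j. i < n \<Longrightarrow> j < n \<Longrightarrow> q p j \<le> r p i j \<and> r p i j \<le> q p j + 1"
      "\<And>p i j. i < n \<Longrightarrow> j < n \<Longrightarrow> q p j \<le> s p i j \<and> s p i j \<le> q p j + 1"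
      "\<And>p i. i < n \<Longrightarrow> label p (r p i) i = 0" "\<And>p i. i < n \<Longrightarrow> label p (s p i) i = 1"
    using rs0 unfolding P_def by blast+
  define X where "X p i = (if i < n then sc p (q p) i else 0)" for p i
  have "\<bar>X p i\<bar> \<le> 1" for p i using q[of i p] by (auto simp: X_def sc_def)
  then obtain \<phi> where \<phi>: "strict_mono \<phi>" "\<And>i. convergent (\<lambda>k. X (\<phi> k) i)"
    using bounded_coordinates_subseq[of X "\<lambda>_. 1"] by metis
  define x where "x i = lim (\<lambda>k. X (\<phi> k) i)" for i
  have x: "(\<lambda>k. X (\<phi> k) i) \<longlonglongrightarrow> x i" for i
    using \<phi>(2) by (simp add: x_def convergent_LIMSEQ_iff)
  have inv0: "(\<lambda>k. 1 / real (Suc (\<phi> k))) \<longlonglongrightarrow> 0"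
    using LIMSEQ_subseq_LIMSEQ[OF LIMSEQ_Suc[OF lim_1_over_n] \<phi>(1)] by (simp add: o_def)
  \<comment> \<open>Each vertex of the small cube with corner \<open>q p\<close> is within one mesh
    width of it in every coordinate, so all choices of vertices share the limit
    \<open>x\<close>.\<close>
  have near: "(\<lambda>k. sc (\<phi> k) (t k) j) \<longlonglongrightarrow> x j"
    if "j < n" "\<And>k. q (\<phi> k) j \<le> t k j \<and> t k j \<le> q (\<phi> k) j + 1" for t j
  proof (rule tendsto_sandwich[of "\<lambda>k. X (\<phi> k) j" _ _ "\<lambda>k. X (\<phi> k) j + 1 / real (Suc (\<phi> k))"])
    show "(\<lambda>k. X (\<phi> k) j + 1 / real (Suc (\<phi> k))) \<longlonglongrightarrow> x j"
      using tendsto_add[OF x inv0] by simp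
    show "\<forall>\<^sub>F k in sequentially. X (\<phi> k) j \<le> sc (\<phi> k) (t k) j"
      using that by (intro always_eventually allI) (auto simp: X_def sc_def intro!: divide_right_mono)
    show "\<forall>\<^sub>F k in sequentially. sc (\<phi> k) (t k) j \<le> X (\<phi> k) j + 1 / real (Suc (\<phi> k))"
    proof (rule always_eventually, rule allI)
      fix k
      have "real (t k j) \<le> real (q (\<phi> k) j) + 1" using that(2)[of k] by linarith
      then show "sc (\<phi> k) (t k) j \<le> X (\<phi> k) j + 1 / real (Suc (\<phi> k))"
        using that(1) by (simp add: X_def sc_def add_divide_distrib[symmetric] divide_right_mono)
    qed
  qed (use x in auto)
  have xQ: "x \<in> Q"
  proof -
    have "0 \<le> x i \<and> x i \<le> 1" if "i < n" for i
    proof -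
      have "0 \<le> X k i \<and> X k i \<le> 1" for k using q[OF that, of k] by (auto simp: X_def sc_def)
      then show ?thesis using LIMSEQ_le_const[OF x[of i], of 0] LIMSEQ_le_const2[OF x[of i], of 1] by auto
    qed
    then show ?thesis by (auto simp: Q_def)
  qed
  have "f x i = x i" if i: "i < n" for i
  proof -
    have rQ: "sc p (r p i) \<in> Q" and sQ: "sc p (s p i) \<in> Q" for p
    proof -
      show "sc p (r p i) \<in> Q"
        by (rule sc_Q, intro allI impI) (use rs(1)[OF i, of _ p] q[of _ p] in \<open>metis Suc_eq_plus1 Suc_leI add_le_mono1 order_trans\<close>)
      show "sc p (s p i) \<in> Q"
        by (rule sc_Q, intro allI impI) (use rs(2)[OF i, of _ p] q[of _ p] in \<open>metis Suc_eq_plus1 Suc_leI add_le_mono1 order_trans\<close>)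
    qed
    have rx: "(\<lambda>k. sc (\<phi> k) (r (\<phi> k) i) j) \<longlonglongrightarrow> x j" if "j < n" for j
      using rs(1)[OF i that] by (intro near that) auto
    have sx: "(\<lambda>k. sc (\<phi> k) (s (\<phi> k) i) j) \<longlonglongrightarrow> x j" if "j < n" for j
      using rs(2)[OF i that] by (intro near that) auto
    have r1: "sc p (r p i) i \<le> f (sc p (r p i)) i" for p
      using rs(3)[OF i, of p] by (auto simp: label_def split: if_splits)
    \<comment> \<open>If label 1 was imposed on the upper face, the scaled coordinate is 1 and the
      inequality holds because \<open>f\<close> maps into the cube.\<close>
    have s1: "f (sc p (s p i)) i \<le> sc p (s p i) i" for p
    proof (cases "s p i i = Suc p")
      case True
      then have "sc p (s p i) i = 1" by (simp add: sc_def)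
      then show ?thesis using maps[OF sQ[of p]] i by (auto simp: Q_def)
    next
      case False
      then show ?thesis using rs(4)[OF i, of p] by (auto simp: label_def split: if_splits)
    qed
    have "x i \<le> f x i"
      by (rule LIMSEQ_le[OF rx[OF i] cont[of "\<lambda>k. sc (\<phi> k) (r (\<phi> k) i)"]]) (use rQ xQ rx i r1 in auto)
    moreover have "f x i \<le> x i"
      by (rule LIMSEQ_le[OF cont[of "\<lambda>k. sc (\<phi> k) (s (\<phi> k) i)"] sx[OF i]]) (use sQ xQ sx i s1 in auto)
    ultimately show ?thesis by simp
  qed
  then show ?thesis using that xQ by blast
qed

text \<open>Let \<open>y\<close> be a finite \<open>\<delta>\<close>-net of the range. A cube point
  \<open>l\<close> gives a convex combination \<open>X l\<close> of the net, and \<open>g l\<close>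
  consists of the weights of the Schauder projection of \<open>f (X l)\<close>. If
  \<open>g l = l\<close>, then \<open>X l\<close> is that projection and lies within
  \<open>\<delta>\<close> of \<open>f (X l)\<close>.\<close>

lemma schauder_approximate_fixpoint:
  fixes f :: "'a::real_normed_vector \<Rightarrow> 'a"
  assumes K: "convex K" "K \<noteq> {}" and f: "f ` K \<subseteq> K" "continuous_on K f" "compact (f ` K)"
    and \<delta>: "\<delta> > 0"
  obtains x where "x \<in> K" "dist x (f x) \<le> \<delta>"
proof -
  obtain D where D: "finite D" "D \<subseteq> f ` K" "f ` K \<subseteq> (\<Union>y\<in>D. ball y \<delta>)"
    using compactE_image[OF f(3), of "f ` K" "\<lambda>y. ball y \<delta>"] \<delta> by force
  define n where "n = card D"
  obtain y where y: "bij_betw y {0..<n} D" using ex_bij_betw_nat_finite[OF D(1)] n_def by blast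
  have yD: "y i \<in> D" if "i < n" for i using y that by (auto simp: bij_betw_def)
  have yK: "y i \<in> K" if "i < n" for i using yD[OF that] D f by blast
  \<comment> \<open>Tent functions: only net points within \<open>\<delta>\<close> of
    \<open>z\<close> receive weight, so their weighted mean stays within \<open>\<delta>\<close> of
    \<open>z\<close>.\<close>
  define w where "w i z = max 0 (\<delta> - dist z (y i))" for i z
  have w0: "w i z \<ge> 0" for i z by (simp add: w_def)
  have W: "(\<Sum>i<n. w i z) > 0" if "z \<in> f ` K" for z
  proof -
    have "z \<in> (\<Union>y\<in>D. ball y \<delta>)" using D(3) that by blast
    then obtain d where "d \<in> D" "dist d z < \<delta>" by auto
    then obtain i where i: "i < n" "dist (y i) z < \<delta>" using y by (auto simp: bij_betw_def)
    then have "w i z > 0" by (simp add: w_def dist_commute)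
    then show ?thesis using i w0 by (intro sum_pos2[of _ i]) auto
  qed
  have n0: "0 < n" using W K by (metis f(1) ex_in_conv image_eqI lessThan_0 neq0_conv order_less_irrefl sum.empty)
  define s where "s l = (\<Sum>i<n. l i)" for l :: "nat \<Rightarrow> real"
  \<comment> \<open>A total weight above 1 is divided out, and weight missing from 1 goes to
    \<open>y 0\<close>. Every cube point, even \<open>l = 0\<close>, thus yields a convex
    combination that depends continuously on it.\<close>
  define X where "X l = (1 / max 1 (s l)) *\<^sub>R ((\<Sum>i<n. l i *\<^sub>R y i) + max 0 (1 - s l) *\<^sub>R y 0)" for l
  let ?Q = "{x. \<forall>i<n. 0 \<le> x i \<and> x i \<le> (1::real)}"
  have XK: "X l \<in> K" if "l \<in> ?Q" for l
  proof -
    define c where "c i = (1 / max 1 (s l)) * (l i + (if i = 0 then max 0 (1 - s l) else 0))" for i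
    have "X l = (\<Sum>i<n. c i *\<^sub>R y i)"
    proof -
      have "(\<Sum>i<n. (l i + (if i = 0 then max 0 (1 - s l) else 0)) *\<^sub>R y i)
          = (\<Sum>i<n. l i *\<^sub>R y i) + (\<Sum>i<n. if i = 0 then max 0 (1 - s l) *\<^sub>R y 0 else 0)"
        unfolding sum.distrib[symmetric] by (rule sum.cong) (auto simp: scaleR_add_left)
      also have "\<dots> = (\<Sum>i<n. l i *\<^sub>R y i) + max 0 (1 - s l) *\<^sub>R y 0" using n0 by simp
      finally show ?thesis
        unfolding X_def c_def by (simp only: scaleR_sum_right[symmetric] scaleR_scaleR[symmetric])
    qed
    moreover have "(\<Sum>i<n. c i *\<^sub>R y i) \<in> K"
    proof (rule convex_sum[OF _ K(1)])
      show "sum c {..<n} = 1"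
        unfolding c_def sum_distrib_left[symmetric] using n0
        by (simp add: sum.distrib flip: s_def) (simp add: s_def max_def)
      show "0 \<le> c i" if "i \<in> {..<n}" for i
        using that \<open>l \<in> ?Q\<close> by (auto simp: c_def intro!: divide_nonneg_pos add_nonneg_nonneg)
    qed (use yK in auto)
    ultimately show ?thesis by simp
  qed
  define g where "g l i = w i (f (X l)) / (\<Sum>j<n. w j (f (X l)))" for l i
  obtain l where l: "l \<in> ?Q" "\<And>i. i < n \<Longrightarrow> g l i = l i"
  proof (rule brouwer_cube_nat[of n g])
    fix l assume "l \<in> ?Q"
    then have p: "(\<Sum>j<n. w j (f (X l))) > 0" using XK W by blast
    have "w i (f (X l)) \<le> (\<Sum>j<n. w j (f (X l)))" if "i < n" for i
      using that w0 by (intro member_le_sum) auto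
    then show "g l \<in> ?Q" using p w0 by (auto simp: g_def)
  next
    fix L l i assume L: "\<And>k. L k \<in> ?Q" and l: "l \<in> ?Q"
      and lim: "\<And>i. i < n \<Longrightarrow> (\<lambda>k. L k i) \<longlonglongrightarrow> l i" and i: "i < n"
    have sl: "(\<lambda>k. s (L k)) \<longlonglongrightarrow> s l" unfolding s_def by (intro tendsto_sum lim) auto
    have "(\<lambda>k. X (L k)) \<longlonglongrightarrow> X l" unfolding X_def
      by (intro tendsto_intros sl lim tendsto_max) (auto simp: max_def)
    then have "(\<lambda>k. f (X (L k))) \<longlonglongrightarrow> f (X l)"
      using f(2) XK L l unfolding continuous_on_sequentially by (auto simp: o_def)
    then have wl: "(\<lambda>k. w j (f (X (L k)))) \<longlonglongrightarrow> w j (f (X l))" for j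
      unfolding w_def by (intro tendsto_intros tendsto_max)
    show "(\<lambda>k. g (L k) i) \<longlonglongrightarrow> g l i" unfolding g_def
      using W XK[OF l] by (intro tendsto_intros wl) (metis imageI less_irrefl)
  qed blast
  define x where "x = X l"
  define z where "z = f x"
  have xK: "x \<in> K" using XK l x_def by blast
  have p: "(\<Sum>j<n. w j z) > 0" using W xK z_def by blast
  have li: "l i = w i z / (\<Sum>j<n. w j z)" if "i < n" for i
    using l(2)[OF that] by (simp add: g_def x_def z_def)
  have s1: "s l = 1"
  proof -
    have "s l = (\<Sum>i<n. w i z / (\<Sum>j<n. w j z))" unfolding s_def by (intro sum.cong) (auto simp: li)
    also have "\<dots> = 1" using p by (simp add: sum_divide_distrib[symmetric])
    finally show ?thesis .
  qed
  have "x - z = (\<Sum>i<n. l i *\<^sub>R (y i - z))"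
    using s1 by (simp add: x_def X_def scaleR_diff_right sum_subtractf scaleR_left.sum[symmetric] s_def)
  then have "norm (x - z) \<le> (\<Sum>i<n. norm (l i *\<^sub>R (y i - z)))" by (simp only: norm_sum)
  also have "\<dots> \<le> (\<Sum>i<n. l i * \<delta>)"
  proof (rule sum_mono)
    fix i assume i: "i \<in> {..<n}"
    show "norm (l i *\<^sub>R (y i - z)) \<le> l i * \<delta>"
    proof (cases "w i z = 0")
      case True
      then show ?thesis using li i by simp
    next
      case False
      then have "dist z (y i) \<le> \<delta>" by (auto simp: w_def max_def split: if_splits)
      then show ?thesis using l(1) i by (auto simp: dist_norm norm_minus_commute intro!: mult_left_mono)
    qed
  qed
  also have "\<dots> = \<delta>" using s1 by (simp add: sum_distrib_right[symmetric] s_def)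
  finally show ?thesis using that[OF xK] by (simp add: dist_norm z_def)
qed

subsection \<open>Square-integrable functions as a Hilbert space\<close>

definition sq_int :: "('a::euclidean_space \<Rightarrow> 'b::euclidean_space) \<Rightarrow> bool" where
  "sq_int f \<longleftrightarrow> f \<in> borel_measurable lebesgue \<and> integrable lebesgue (\<lambda>x. (norm (f x))\<^sup>2)"

lemma sq_int_measurable [measurable_dest]: "sq_int f \<Longrightarrow> f \<in> borel_measurable lebesgue"
  and sq_int_integrable: "sq_int f \<Longrightarrow> integrable lebesgue (\<lambda>x. (norm (f x))\<^sup>2)"
  by (auto simp: sq_int_def)

lemma sq_int_bound:
  assumes "sq_int f" "g \<in> borel_measurable lebesgue" "AE x in lebesgue. norm (g x) \<le> c * norm (f x)"
  shows "sq_int g"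
  unfolding sq_int_def
proof (rule conjI, rule assms(2), rule Bochner_Integration.integrable_bound)
  show "integrable lebesgue (\<lambda>x. c\<^sup>2 * (norm (f x))\<^sup>2)"
    using assms(1) by (simp add: sq_int_def)
  show "(\<lambda>x. (norm (g x))\<^sup>2) \<in> borel_measurable lebesgue" using assms(2) by measurable
  show "AE x in lebesgue. norm ((norm (g x))\<^sup>2) \<le> norm (c\<^sup>2 * (norm (f x))\<^sup>2)"
    using assms(3) by eventually_elim (auto simp flip: power_mult_distrib intro!: power_mono)
qed

lemma sq_int_add: assumes "sq_int f" "sq_int g" shows "sq_int (\<lambda>x. f x + g x)"
  unfolding sq_int_def
proof (rule conjI, goal_cases)
  case 1
  have [measurable]: "f \<in> borel_measurable lebesgue" "g \<in> borel_measurable lebesgue"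
    using assms by (auto simp: sq_int_def)
  show ?case by measurable
next
  case 2
  show ?case
  proof (rule Bochner_Integration.integrable_bound)
  have [measurable]: "f \<in> borel_measurable lebesgue" "g \<in> borel_measurable lebesgue"
    using assms by (auto simp: sq_int_def)
  show "(\<lambda>x. (norm (f x + g x))\<^sup>2) \<in> borel_measurable lebesgue" by measurable
  show "integrable lebesgue (\<lambda>x. 2 * (norm (f x))\<^sup>2 + 2 * (norm (g x))\<^sup>2)"
    using assms by (simp add: sq_int_def)
  have "(norm (f x + g x))\<^sup>2 \<le> 2 * (norm (f x))\<^sup>2 + 2 * (norm (g x))\<^sup>2" for x
  proof -
    have "(norm (f x + g x))\<^sup>2 \<le> (norm (f x) + norm (g x))\<^sup>2"
      by (intro power_mono norm_triangle_ineq) simp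
    also have "\<dots> \<le> 2 * (norm (f x))\<^sup>2 + 2 * (norm (g x))\<^sup>2"
      using sum_squares_bound[of "norm (f x)" "norm (g x)"] by (simp add: power2_sum)
    finally show ?thesis .
  qed
  then show "AE x in lebesgue. norm ((norm (f x + g x))\<^sup>2) \<le> norm (2 * (norm (f x))\<^sup>2 + 2 * (norm (g x))\<^sup>2)"
    by (intro AE_I2) (simp add: add_nonneg_nonneg)
  qed
qed

lemma sq_int_scaleR: assumes "sq_int f" shows "sq_int (\<lambda>x. c *\<^sub>R f x)"
  using assms by (intro sq_int_bound[OF assms, where c = "\<bar>c\<bar>"]) (auto simp: sq_int_def)

lemma sq_int_uminus: "sq_int f \<Longrightarrow> sq_int (\<lambda>x. - f x)"
  using sq_int_scaleR[of f "-1"] by simp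

lemma sq_int_diff: "sq_int f \<Longrightarrow> sq_int g \<Longrightarrow> sq_int (\<lambda>x. f x - g x)"
  using sq_int_add[of f "\<lambda>x. - g x"] sq_int_uminus by auto

lemma sq_int_zero: "sq_int (\<lambda>x. 0)"
  by (simp add: sq_int_def)

lemma sq_int_inner:
  assumes "sq_int f" "sq_int g" shows "integrable lebesgue (\<lambda>x. inner (f x) (g x))"
proof (rule Bochner_Integration.integrable_bound)
  have [measurable]: "f \<in> borel_measurable lebesgue" "g \<in> borel_measurable lebesgue"
    using assms by (auto simp: sq_int_def)
  show "(\<lambda>x. inner (f x) (g x)) \<in> borel_measurable lebesgue" by measurable
  show "integrable lebesgue (\<lambda>x. (norm (f x))\<^sup>2 + (norm (g x))\<^sup>2)"
    using assms by (simp add: sq_int_def)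
  have "\<bar>inner (f x) (g x)\<bar> \<le> (norm (f x))\<^sup>2 + (norm (g x))\<^sup>2" for x
    using Cauchy_Schwarz_ineq2[of "f x" "g x"] sum_squares_bound[of "norm (f x)" "norm (g x)"]
      mult_nonneg_nonneg[OF norm_ge_zero[of "f x"] norm_ge_zero[of "g x"]]
    by linarith
  then show "AE x in lebesgue. norm (inner (f x) (g x)) \<le> norm ((norm (f x))\<^sup>2 + (norm (g x))\<^sup>2)"
    by (intro AE_I2) (simp add: add_nonneg_nonneg)
qed

\<comment> \<open>L2 is made a type so that the results above, stated for type classes, apply to it.
  The quotient is partial: only square-integrable functions have a class. All functions live on the
  whole space; a domain enters through \<open>emb\<close>.\<close>
quotient_type (overloaded) ('a, 'b) lsq = "'a::euclidean_space \<Rightarrow> 'b::euclidean_space" /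
  partial: "\<lambda>f g. sq_int f \<and> sq_int g \<and> (AE x in lebesgue. f x = g x)"
proof (rule part_equivpI)
  show "\<exists>f::'a \<Rightarrow> 'b. sq_int f \<and> sq_int f \<and> (AE x in lebesgue. f x = f x)"
    by (rule exI[of _ "\<lambda>_. 0"]) (simp add: sq_int_zero)
  show "symp (\<lambda>f g :: 'a \<Rightarrow> 'b. sq_int f \<and> sq_int g \<and> (AE x in lebesgue. f x = g x))"
    by (auto intro!: sympI elim: eventually_mono)
  show "transp (\<lambda>f g :: 'a \<Rightarrow> 'b. sq_int f \<and> sq_int g \<and> (AE x in lebesgue. f x = g x))"
    by (rule transpI) (auto elim: eventually_elim2)
qed

instantiation lsq :: (euclidean_space, euclidean_space) real_vector
begin

lift_definition zero_lsq :: "('a, 'b) lsq" is "\<lambda>_. 0" by (simp add: sq_int_zero)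

lift_definition plus_lsq :: "('a, 'b) lsq \<Rightarrow> ('a, 'b) lsq \<Rightarrow> ('a, 'b) lsq" is "\<lambda>f g x. f x + g x"
  by (auto intro: sq_int_add elim: eventually_elim2)

lift_definition minus_lsq :: "('a, 'b) lsq \<Rightarrow> ('a, 'b) lsq \<Rightarrow> ('a, 'b) lsq" is "\<lambda>f g x. f x - g x"
  by (auto intro: sq_int_diff elim: eventually_elim2)

lift_definition uminus_lsq :: "('a, 'b) lsq \<Rightarrow> ('a, 'b) lsq" is "\<lambda>f x. - f x"
  by (auto intro: sq_int_uminus elim: eventually_mono)

lift_definition scaleR_lsq :: "real \<Rightarrow> ('a, 'b) lsq \<Rightarrow> ('a, 'b) lsq" is "\<lambda>c f x. c *\<^sub>R f x"
  by (auto intro: sq_int_scaleR elim: eventually_mono)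

instance
proof
  fix x y z :: "('a, 'b) lsq" and a b :: real
  show "x + y + z = x + (y + z)" by transfer (auto intro: sq_int_add simp: add.assoc)
  show "x + y = y + x" by transfer (auto intro: sq_int_add simp: add.commute)
  show "0 + x = x" by transfer (auto intro: sq_int_add)
  show "- x + x = 0" by transfer (auto intro: sq_int_add sq_int_zero)
  show "x - y = x + - y" by transfer (auto intro: sq_int_add sq_int_diff sq_int_uminus)
  show "a *\<^sub>R (x + y) = a *\<^sub>R x + a *\<^sub>R y"
    by transfer (auto intro: sq_int_add sq_int_scaleR simp: scaleR_add_right)
  show "(a + b) *\<^sub>R x = a *\<^sub>R x + b *\<^sub>R x"
    by transfer (auto intro: sq_int_add sq_int_scaleR simp: scaleR_add_left)
  show "a *\<^sub>R b *\<^sub>R x = (a * b) *\<^sub>R x" by transfer (auto intro: sq_int_scaleR)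
  show "1 *\<^sub>R x = x" by transfer (auto intro: sq_int_scaleR)
qed

end

instantiation lsq :: (euclidean_space, euclidean_space) real_inner
begin

lift_definition inner_lsq :: "('a, 'b) lsq \<Rightarrow> ('a, 'b) lsq \<Rightarrow> real"
  is "\<lambda>f g. LINT x|lebesgue. inner (f x) (g x)"
proof (elim conjE)
  fix f f' g g' :: "'a \<Rightarrow> 'b"
  assume "sq_int f" "sq_int f'" "sq_int g" "sq_int g'"
  then have [measurable]: "f \<in> borel_measurable lebesgue" "f' \<in> borel_measurable lebesgue"
    "g \<in> borel_measurable lebesgue" "g' \<in> borel_measurable lebesgue"
    by (auto simp: sq_int_def)
  assume "AE x in lebesgue. f x = f' x" "AE x in lebesgue. g x = g' x"
  then have "AE x in lebesgue. inner (f x) (g x) = inner (f' x) (g' x)" by eventually_elim simp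
  then show "(LINT x|lebesgue. inner (f x) (g x)) = (LINT x|lebesgue. inner (f' x) (g' x))"
    by (intro integral_cong_AE) measurable
qed

definition norm_lsq :: "('a, 'b) lsq \<Rightarrow> real" where "norm_lsq x = sqrt (inner x x)"
definition dist_lsq :: "('a, 'b) lsq \<Rightarrow> ('a, 'b) lsq \<Rightarrow> real" where "dist_lsq x y = norm (x - y)"
definition sgn_lsq :: "('a, 'b) lsq \<Rightarrow> ('a, 'b) lsq" where "sgn_lsq x = inverse (norm x) *\<^sub>R x"
definition uniformity_lsq :: "(('a, 'b) lsq \<times> ('a, 'b) lsq) filter" where
  "uniformity_lsq = (INF e\<in>{0<..}. principal {(x, y). dist x y < e})"
definition open_lsq :: "('a, 'b) lsq set \<Rightarrow> bool" where
  "open_lsq U \<longleftrightarrow> (\<forall>x\<in>U. eventually (\<lambda>(x', y). x' = x \<longrightarrow> y \<in> U) uniformity)"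

instance
proof
  fix x y z :: "('a, 'b) lsq" and r :: real
  show "dist x y = norm (x - y)" by (rule dist_lsq_def)
  show "sgn x = x /\<^sub>R norm x" by (simp add: sgn_lsq_def)
  show "uniformity = (INF e\<in>{0<..}. principal {(x :: ('a, 'b) lsq, y). dist x y < e})"
    by (rule uniformity_lsq_def)
  show "open U \<longleftrightarrow> (\<forall>x\<in>U. \<forall>\<^sub>F (x', y) in uniformity. x' = x \<longrightarrow> y \<in> U)" for U :: "('a, 'b) lsq set"
    by (rule open_lsq_def)
  show "inner x y = inner y x" by transfer (simp add: inner_commute)
  show "inner (x + y) z = inner x z + inner y z"
    by transfer (simp add: inner_add_left sq_int_inner)
  show "inner (r *\<^sub>R x) y = r * inner x y" by transfer simp
  show "0 \<le> inner x x" by transfer simp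
  show "(inner x x = 0) = (x = 0)"
  proof transfer
    fix f :: "'a \<Rightarrow> 'b" assume "sq_int f \<and> sq_int f \<and> (AE x in lebesgue. f x = f x)"
    then show "((LINT x|lebesgue. inner (f x) (f x)) = 0) =
        (sq_int f \<and> sq_int (\<lambda>_. 0) \<and> (AE x in lebesgue. f x = 0))"
      using integral_nonneg_eq_0_iff_AE[OF sq_int_inner[of f f]] by (simp add: sq_int_zero)
  qed
  show "norm x = sqrt (inner x x)" by (rule norm_lsq_def)
qed

end

lemma sq_int_rep [simp, intro]: "sq_int (rep_lsq x)"
  using Quotient3_rep_reflp[OF Quotient3_lsq, of x] by simp

lemma abs_rep_lsq [simp]: "abs_lsq (rep_lsq x) = x"
  using Quotient3_abs_rep[OF Quotient3_lsq] .

lemma abs_lsq_eq_iff: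
  "sq_int f \<Longrightarrow> sq_int g \<Longrightarrow> abs_lsq f = abs_lsq g \<longleftrightarrow> (AE x in lebesgue. f x = g x)"
  using Quotient3_rel[OF Quotient3_lsq, of f g] by simp

lemma rep_abs_lsq: "sq_int f \<Longrightarrow> AE x in lebesgue. rep_lsq (abs_lsq f) x = f x"
  using abs_lsq_eq_iff[of "rep_lsq (abs_lsq f)" f] by simp

lemma abs_lsq_arith:
  assumes "sq_int f"
  shows "sq_int g \<Longrightarrow> abs_lsq f + abs_lsq g = abs_lsq (\<lambda>x. f x + g x)"
    "sq_int g \<Longrightarrow> abs_lsq f - abs_lsq g = abs_lsq (\<lambda>x. f x - g x)"
    "- abs_lsq f = abs_lsq (\<lambda>x. - f x)"
    "c *\<^sub>R abs_lsq f = abs_lsq (\<lambda>x. c *\<^sub>R f x)"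
    "sq_int g \<Longrightarrow> inner (abs_lsq f) (abs_lsq g) = (LINT x|lebesgue. inner (f x) (g x))"
  using assms by (simp_all add: plus_lsq.abs_eq minus_lsq.abs_eq uminus_lsq.abs_eq
      scaleR_lsq.abs_eq inner_lsq.abs_eq)

lemma norm_abs_lsq: "sq_int f \<Longrightarrow> (norm (abs_lsq f))\<^sup>2 = (LINT x|lebesgue. (norm (f x))\<^sup>2)"
  by (simp add: power2_norm_eq_inner abs_lsq_arith)

lemma lsq_cases: obtains f where "sq_int f" "x = abs_lsq f"
  using that[of "rep_lsq x"] by simp

lemma norm_abs_lsq_mono:
  assumes "sq_int f" "sq_int g" "AE x in lebesgue. norm (f x) \<le> c * norm (g x)" "0 \<le> c"
  shows "norm (abs_lsq f) \<le> c * norm (abs_lsq g)"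
proof (rule power2_le_imp_le)
  have "(LINT x|lebesgue. (norm (f x))\<^sup>2) \<le> (LINT x|lebesgue. c\<^sup>2 * (norm (g x))\<^sup>2)"
  proof (rule integral_mono_AE)
    show "AE x in lebesgue. (norm (f x))\<^sup>2 \<le> c\<^sup>2 * (norm (g x))\<^sup>2"
      using assms(3) by eventually_elim (auto simp flip: power_mult_distrib intro!: power_mono)
  qed (use assms sq_int_integrable in auto)
  then show "(norm (abs_lsq f))\<^sup>2 \<le> (c * norm (abs_lsq g))\<^sup>2"
    using assms by (simp add: norm_abs_lsq power_mult_distrib)
qed (use assms in auto)

text \<open>Exchanging sum and integral shows that the sum of the squared norms has a finite
  integral. It is finite almost everywhere, so its terms tend to 0.\<close>

lemma AE_tendsto_0_if_summable:
  fixes f :: "nat \<Rightarrow> 'a::euclidean_space \<Rightarrow> 'b::euclidean_space"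
  assumes f: "\<And>n. sq_int (f n)" and s: "summable (\<lambda>n. LINT x|lebesgue. (norm (f n x))\<^sup>2)"
  shows "AE x in lebesgue. (\<lambda>n. f n x) \<longlonglongrightarrow> 0"
proof -
  have [measurable]: "f n \<in> borel_measurable lebesgue" for n using f by (simp add: sq_int_def)
  have "(\<integral>\<^sup>+ x. (\<Sum>n. ennreal ((norm (f n x))\<^sup>2)) \<partial>lebesgue)
      = (\<Sum>n. \<integral>\<^sup>+ x. ennreal ((norm (f n x))\<^sup>2) \<partial>lebesgue)"
    by (rule nn_integral_suminf) measurable
  also have "\<dots> = (\<Sum>n. ennreal (LINT x|lebesgue. (norm (f n x))\<^sup>2))"
    using sq_int_integrable[OF f] by (simp add: nn_integral_eq_integral)
  also have "\<dots> < \<infinity>" using s by (simp add: suminf_ennreal2)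
  finally have "AE x in lebesgue. (\<Sum>n. ennreal ((norm (f n x))\<^sup>2)) \<noteq> \<infinity>"
    by (intro nn_integral_noteq_infinite) auto
  then show ?thesis
  proof eventually_elim
    case (elim x)
    then have "summable (\<lambda>n. (norm (f n x))\<^sup>2)" by (intro summable_suminf_not_top) auto
    then have "(\<lambda>n. sqrt ((norm (f n x))\<^sup>2)) \<longlonglongrightarrow> sqrt 0"
      by (intro tendsto_real_sqrt summable_LIMSEQ_zero)
    then show ?case by (simp add: tendsto_norm_zero_iff)
  qed
qed

lemma Cauchy_geometric_subseq:
  fixes X :: "nat \<Rightarrow> 'a::real_normed_vector" and e :: "nat \<Rightarrow> real"
  assumes "Cauchy X" and e: "\<And>k. e k > 0"
  obtains r where "strict_mono r" "\<And>k m n. m \<ge> r k \<Longrightarrow> n \<ge> r k \<Longrightarrow> norm (X m - X n) < e k"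
proof -
  have "\<exists>N. \<forall>m\<ge>N. \<forall>n\<ge>N. norm (X m - X n) < e k" for k
    using CauchyD[OF assms(1) e] .
  then obtain N where N: "\<And>k m n. m \<ge> N k \<Longrightarrow> n \<ge> N k \<Longrightarrow> norm (X m - X n) < e k" by metis
  define r where "r k = k + (\<Sum>j\<le>k. N j)" for k
  have "strict_mono r" by (auto simp: r_def strict_mono_Suc_iff)
  moreover have "N k \<le> r k" for k
    using member_le_sum[of k "{..k}" N] by (simp add: r_def)
  ultimately show ?thesis using that N by (meson le_trans)
qed

text \<open>Riesz and Fischer. A subsequence has increments of norm below \<open>(1/4) ^ k\<close>.
  Multiplied by \<open>2 ^ k\<close> these still have summable squared norms, so pointwise they are
  bounded by a multiple of \<open>(1/2) ^ k\<close> almost everywhere and the subsequence converges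
  there. Fatou's lemma turns this into convergence in norm.\<close>

instance lsq :: (euclidean_space, euclidean_space) complete_space
proof
  fix X :: "nat \<Rightarrow> ('a, 'b) lsq" assume X: "Cauchy X"
  obtain r where r: "strict_mono r"
    "\<And>k m n. m \<ge> r k \<Longrightarrow> n \<ge> r k \<Longrightarrow> norm (X m - X n) < (1/4) ^ k"
    using Cauchy_geometric_subseq[OF X, of "\<lambda>k. (1/4)^k"] by (metis zero_less_power zero_less_divide_1_iff zero_less_numeral)
  define f where "f k = rep_lsq (X (r k))" for k
  have f: "sq_int (f k)" for k by (simp add: f_def)
  have [measurable]: "f n \<in> borel_measurable lebesgue" for n using f by (simp add: sq_int_def)
  have fn: "(LINT x|lebesgue. (norm (f m x - f k x))\<^sup>2) = (norm (X (r m) - X (r k)))\<^sup>2" for m k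
    using norm_abs_lsq[OF sq_int_diff[OF f f]] abs_lsq_arith(2)[OF f f] by (simp add: f_def)
  define g where "g k x = 2 ^ k *\<^sub>R (f (Suc k) x - f k x)" for k x
  have g: "sq_int (g k)" for k unfolding g_def by (intro sq_int_scaleR sq_int_diff f)
  have gn: "(LINT x|lebesgue. (norm (g k x))\<^sup>2) \<le> (1/4)^k" for k
  proof -
    have "(norm (X (r (Suc k)) - X (r k)))\<^sup>2 \<le> ((1/4)^k)\<^sup>2"
      using r(2)[of k "r (Suc k)" "r k"] strict_mono_leD[OF r(1), of k "Suc k"]
      by (intro power_mono) auto
    then have "(2^k)\<^sup>2 * (norm (X (r (Suc k)) - X (r k)))\<^sup>2 \<le> (2^k)\<^sup>2 * ((1/4)^k)\<^sup>2"
      by (intro mult_left_mono) auto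
    also have "\<dots> = ((2 * (1/4)) ^ k)\<^sup>2" by (simp only: power_mult_distrib)
    also have "\<dots> = (1/4::real) ^ k" by (simp add: power2_eq_square flip: power_mult_distrib)
    finally show ?thesis by (simp add: g_def power_mult_distrib fn)
  qed
  have "AE x in lebesgue. (\<lambda>k. g k x) \<longlonglongrightarrow> 0"
    by (rule AE_tendsto_0_if_summable[OF g], rule summable_comparison_test'[of "\<lambda>k. (1/4)^k"]) (use gn in auto)
  then have conv: "AE x in lebesgue. convergent (\<lambda>k. f k x)"
  proof eventually_elim
    case (elim x)
    obtain C where C: "\<And>k. norm (g k x) \<le> C"
      using convergent_imp_Bseq[OF convergentI[OF elim]] by (auto simp: Bseq_def)
    have "summable (\<lambda>k. f (Suc k) x - f k x)"
    proof (rule summable_comparison_test')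
      show "summable (\<lambda>k. C * (1/2)^k)" by (intro summable_mult summable_geometric) simp
      have "2 ^ k * norm (f (Suc k) x - f k x) \<le> C" for k
        using C[of k] by (simp add: g_def)
      then show "norm (f (Suc k) x - f k x) \<le> C * (1/2)^k" for k
        by (simp add: field_simps power_divide)
    qed
    then have "convergent (\<lambda>n. \<Sum>k<n. f (Suc k) x - f k x)" by (simp add: summable_iff_convergent)
    then have "convergent (\<lambda>n. f n x - f 0 x)"
      unfolding sum_lessThan_telescope[of "\<lambda>k. f k x"] .
    from convergent_add[OF this convergent_const[of "f 0 x"]] show ?case by simp
  qed
  define h where "h x = lim (\<lambda>k. f k x)" for x
  have [measurable]: "h \<in> borel_measurable lebesgue" unfolding h_def by measurable
  have hf: "sq_int (\<lambda>x. h x - f k x) \<and> (LINT x|lebesgue. (norm (h x - f k x))\<^sup>2) \<le> ((1/4)^k)\<^sup>2" for k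
  proof -
    have "(\<integral>\<^sup>+ x. ennreal ((norm (h x - f k x))\<^sup>2) \<partial>lebesgue)
      = (\<integral>\<^sup>+ x. liminf (\<lambda>m. ennreal ((norm (f m x - f k x))\<^sup>2)) \<partial>lebesgue)"
    proof (rule nn_integral_cong_AE, use conv in eventually_elim)
      case (elim x)
      then have "(\<lambda>m. f m x) \<longlonglongrightarrow> h x" by (simp add: h_def convergent_LIMSEQ_iff)
      then have "(\<lambda>m. ennreal ((norm (f m x - f k x))\<^sup>2)) \<longlonglongrightarrow> ennreal ((norm (h x - f k x))\<^sup>2)"
        by (intro tendsto_ennrealI tendsto_power tendsto_norm tendsto_diff tendsto_const)
      then show ?case by (simp only: lim_imp_Liminf[OF trivial_limit_sequentially])
    qed
    also have "\<dots> \<le> liminf (\<lambda>m. \<integral>\<^sup>+ x. ennreal ((norm (f m x - f k x))\<^sup>2) \<partial>lebesgue)"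
      by (rule nn_integral_liminf) measurable
    also have "\<dots> = liminf (\<lambda>m. ennreal ((norm (X (r m) - X (r k)))\<^sup>2))"
      using sq_int_integrable[OF sq_int_diff[OF f f]] by (simp add: nn_integral_eq_integral fn)
    also have "\<dots> \<le> liminf (\<lambda>m. ennreal (((1/4)^k)\<^sup>2))"
    proof (rule Liminf_mono, rule eventually_sequentiallyI[of k])
      fix m assume "k \<le> m"
      then have "norm (X (r m) - X (r k)) < (1/4)^k"
        using strict_mono_leD[OF r(1)] by (intro r(2)) auto
      then show "ennreal ((norm (X (r m) - X (r k)))\<^sup>2) \<le> ennreal (((1/4)^k)\<^sup>2)"
        by (intro ennreal_leI power_mono) auto
    qed
    also have "\<dots> = ennreal (((1/4)^k)\<^sup>2)" by (simp add: Liminf_const)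
    finally have le: "(\<integral>\<^sup>+ x. ennreal ((norm (h x - f k x))\<^sup>2) \<partial>lebesgue) \<le> ennreal (((1/4)^k)\<^sup>2)" .
    have int: "integrable lebesgue (\<lambda>x. (norm (h x - f k x))\<^sup>2)"
      by (rule integrableI_bounded) (use le in \<open>auto simp: order_le_less_trans\<close>)
    then show ?thesis using le by (auto simp: sq_int_def nn_integral_eq_integral)
  qed
  have h: "sq_int h" using sq_int_add[OF conjunct1[OF hf[of 0]] f[of 0]] by simp
  have "norm (abs_lsq h - X (r k)) \<le> (1/4)^k" for k
  proof -
    have "abs_lsq h - X (r k) = abs_lsq (\<lambda>x. h x - f k x)"
      using abs_lsq_arith(2)[OF h f] by (simp add: f_def)
    then have "(norm (abs_lsq h - X (r k)))\<^sup>2 \<le> ((1/4)^k)\<^sup>2"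
      using norm_abs_lsq[OF conjunct1[OF hf]] hf by simp
    then show ?thesis by (rule power2_le_imp_le) simp
  qed
  then have "(\<lambda>k. norm (X (r k) - abs_lsq h)) \<longlonglongrightarrow> 0"
    by (intro tendsto_sandwich[OF _ _ tendsto_const LIMSEQ_power_zero[of "1/4::real"]])
      (auto simp: norm_minus_commute)
  then have "(X \<circ> r) \<longlonglongrightarrow> abs_lsq h"
    by (simp add: o_def LIM_zero_iff tendsto_norm_zero_iff)
  then show "convergent X" using Cauchy_converges_subseq[OF X r(1)] by (auto simp: convergent_def)
qed

lemma lsq_tendsto_AE_subseq:
  fixes X :: "nat \<Rightarrow> ('a::euclidean_space, 'b::euclidean_space) lsq"
  assumes "X \<longlonglongrightarrow> x"
  obtains r where "strict_mono r" "AE t in lebesgue. (\<lambda>k. rep_lsq (X (r k)) t) \<longlonglongrightarrow> rep_lsq x t"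
proof -
  define u where "u n t = (norm (rep_lsq (X n) t - rep_lsq x t))\<^sup>2" for n t
  have u: "integrable lebesgue (u n)" for n
    unfolding u_def by (intro sq_int_integrable sq_int_diff) auto
  have "(LINT t|lebesgue. norm (u n t)) = (norm (X n - x))\<^sup>2" for n
    using norm_abs_lsq[OF sq_int_diff[of "rep_lsq (X n)" "rep_lsq x"]]
      abs_lsq_arith(2)[of "rep_lsq (X n)" "rep_lsq x"] by (simp add: u_def)
  moreover have "(\<lambda>n. (norm (X n - x))\<^sup>2) \<longlonglongrightarrow> (norm (x - x))\<^sup>2" by (intro tendsto_intros assms)
  ultimately have "(\<lambda>n. LINT t|lebesgue. norm (u n t)) \<longlonglongrightarrow> 0" by simp
  then obtain r where r: "strict_mono r" "AE t in lebesgue. (\<lambda>n. u (r n) t) \<longlonglongrightarrow> 0"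
    using tendsto_L1_AE_subseq[of lebesgue u, OF u] by blast
  from r(2) have "AE t in lebesgue. (\<lambda>k. rep_lsq (X (r k)) t) \<longlonglongrightarrow> rep_lsq x t"
  proof eventually_elim
    case (elim t)
    then have "(\<lambda>n. sqrt (u (r n) t)) \<longlonglongrightarrow> sqrt 0" by (intro tendsto_real_sqrt)
    then show ?case by (simp add: u_def tendsto_norm_zero_iff LIM_zero_iff)
  qed
  then show ?thesis using that r by blast
qed

subsection \<open>Smooth functions\<close>

lemma partial_derivative_eq:
  assumes "(f has_derivative f') (at x)"
  shows "partial_derivative i f x = f' (axis i 1)"
  unfolding partial_derivative_def using frechet_derivative_at[OF assms] by simp

lemma C_k_continuous: "C_k k f \<Longrightarrow> continuous_on UNIV f"
  by (cases k) (auto intro: continuous_at_imp_continuous_on differentiable_imp_continuous_within)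

text \<open>Smoothness is obtained by exhibiting a class of differentiable functions closed under
  partial derivatives, without formulas for higher derivatives.\<close>

lemma C_k_coinduct:
  assumes "f \<in> A"
    and "\<And>g. g \<in> A \<Longrightarrow> (\<forall>x. g differentiable (at x)) \<and> (\<forall>i. partial_derivative i g \<in> A)"
  shows "C_k k f"
  using assms(1)
proof (induction k arbitrary: f)
  case 0
  then show ?case using assms(2)[OF 0]
    by (auto intro: continuous_at_imp_continuous_on differentiable_imp_continuous_within)
next
  case (Suc k)
  then show ?case using assms(2) by auto
qed

lemma C_k_add: "C_k k f \<Longrightarrow> C_k k g \<Longrightarrow> C_k k (\<lambda>x. f x + g x)"
proof (induction k arbitrary: f g)
  case (Suc k)
  have "partial_derivative i (\<lambda>x. f x + g x) = (\<lambda>x. partial_derivative i f x + partial_derivative i g x)" for i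
  proof
    fix x
    have "(f has_derivative frechet_derivative f (at x)) (at x)"
      "(g has_derivative frechet_derivative g (at x)) (at x)"
      using Suc.prems by (simp_all add: frechet_derivative_works[symmetric])
    from partial_derivative_eq[OF has_derivative_add[OF this]]
    show "partial_derivative i (\<lambda>x. f x + g x) x = partial_derivative i f x + partial_derivative i g x"
      by (simp add: partial_derivative_def)
  qed
  then show ?case using Suc by (auto intro!: Suc.IH)
qed (auto intro: continuous_on_add)

lemma partial_derivative_cmult:
  assumes "f differentiable (at x)"
  shows "partial_derivative i (\<lambda>x. c * f x) x = c * partial_derivative i f x"
proof -
  have "(f has_derivative frechet_derivative f (at x)) (at x)"
    using assms frechet_derivative_works by blast
  from partial_derivative_eq[OF has_derivative_mult_right[OF this]]
  show ?thesis by (simp add: partial_derivative_def)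
qed

lemma C_k_cmult: "C_k k f \<Longrightarrow> C_k k (\<lambda>x. c * f x)"
proof (induction k arbitrary: f)
  case (Suc k)
  have "partial_derivative i (\<lambda>x. c * f x) = (\<lambda>x. c * partial_derivative i f x)" for i
    using Suc.prems by (auto simp: fun_eq_iff partial_derivative_cmult)
  then show ?case using Suc by (auto intro!: Suc.IH differentiable_mult)
qed (auto intro: continuous_on_mult)

lemma C_k_zero: "C_k k (\<lambda>x :: real ^ 'n. 0)"
proof (rule C_k_coinduct[of _ "{\<lambda>x. 0}"])
  have "partial_derivative i (\<lambda>x. 0) = (\<lambda>x. 0)" for i :: 'n
    by (simp add: fun_eq_iff partial_derivative_eq[OF has_derivative_const])
  then show "(\<forall>x. g differentiable at x) \<and> (\<forall>i. partial_derivative i g \<in> {\<lambda>x. 0})"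
    if "g \<in> {\<lambda>x. 0}" for g :: "real ^ 'n \<Rightarrow> complex" using that by auto
qed simp

lemma C_k_sum: "finite I \<Longrightarrow> (\<And>i. i \<in> I \<Longrightarrow> C_k k (f i)) \<Longrightarrow> C_k k (\<lambda>x. \<Sum>i\<in>I. f i x)"
  by (induction I rule: finite_induct) (auto simp: C_k_zero intro: C_k_add)

lemma frechet_derivative_eq_sum:
  assumes "f differentiable (at x)"
  shows "frechet_derivative f (at x) h = (\<Sum>j\<in>UNIV. h $ j *\<^sub>R partial_derivative j f x)"
proof -
  interpret D: linear "frechet_derivative f (at x)" by (rule linear_frechet_derivative[OF assms])
  have "h = (\<Sum>j\<in>UNIV. h $ j *\<^sub>R axis j 1)" using basis_expansion[of h] by (simp add: scalar_mult_eq_scaleR)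
  then have "frechet_derivative f (at x) h = frechet_derivative f (at x) (\<Sum>j\<in>UNIV. h $ j *\<^sub>R axis j 1)" by simp
  also have "\<dots> = (\<Sum>j\<in>UNIV. h $ j *\<^sub>R partial_derivative j f x)"
    by (simp add: D.sum D.scaleR partial_derivative_def)
  finally show ?thesis .
qed

lemma partial_derivative_compose_matrix:
  assumes "f differentiable (at (M *v x))"
  shows "partial_derivative i (\<lambda>x. f (M *v x)) x
      = (\<Sum>j\<in>UNIV. M $ j $ i *\<^sub>R partial_derivative j f (M *v x))"
    and "(\<lambda>x. f (M *v x)) differentiable (at x)"
proof -
  have *: "((\<lambda>x. f (M *v x)) has_derivative (\<lambda>h. frechet_derivative f (at (M *v x)) (M *v h))) (at x)"
    using has_derivative_compose[OF bounded_linear_imp_has_derivative[OF matrix_vector_mul_bounded_linear]]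
      assms frechet_derivative_works by blast
  then show "(\<lambda>x. f (M *v x)) differentiable (at x)" unfolding differentiable_def by blast
  have "(M *v axis i 1) $ j = M $ j $ i" for j
    by (simp add: matrix_vector_mul_component inner_axis)
  then show "partial_derivative i (\<lambda>x. f (M *v x)) x
      = (\<Sum>j\<in>UNIV. M $ j $ i *\<^sub>R partial_derivative j f (M *v x))"
    by (simp add: partial_derivative_eq[OF *] frechet_derivative_eq_sum[OF assms])
qed

lemma C_k_compose_matrix: "C_k k f \<Longrightarrow> C_k k (\<lambda>x. f (M *v x))"
proof (induction k arbitrary: f)
  case 0
  then show ?case
    using continuous_on_compose2[of UNIV f UNIV "(*v) M"] linear_continuous_on[OF matrix_vector_mul_bounded_linear]
    by auto
next
  case (Suc k)
  have "partial_derivative i (\<lambda>x. f (M *v x))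
      = (\<lambda>x. \<Sum>j\<in>UNIV. of_real (M $ j $ i) * partial_derivative j f (M *v x))" for i
    using Suc.prems by (auto simp: fun_eq_iff partial_derivative_compose_matrix scaleR_conv_of_real)
  then show ?case using Suc
    by (auto intro!: C_k_sum C_k_cmult Suc.IH partial_derivative_compose_matrix(2))
qed

section \<open>Smooth bump functions supported in boxes\<close>

definition exp_cutoff :: "nat \<Rightarrow> real \<Rightarrow> real" where
  "exp_cutoff k t = (if t > 0 then (1 / t) ^ k * exp (- 1 / t) else 0)"

text \<open>The quadratic bound compares the exponential series at \<open>1 / t\<close> with its
  single term of degree \<open>k + 2\<close>. It makes the derivative at 0 exist and vanish. The
  factor \<open>(1 / t) ^ k\<close> is there because differentiating \<open>exp (- 1 / t)\<close>
  produces such powers.\<close>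

lemma exp_cutoff_bounds:
  "0 \<le> exp_cutoff k t" "exp_cutoff k t \<le> fact (k + 2) * t\<^sup>2" "exp_cutoff 0 t \<le> 1"
proof -
  show "0 \<le> exp_cutoff k t" by (simp add: exp_cutoff_def)
  show "exp_cutoff 0 t \<le> 1" by (simp add: exp_cutoff_def)
  show "exp_cutoff k t \<le> fact (k + 2) * t\<^sup>2"
  proof (cases "t > 0")
    case True
    define F where "F = (fact (k + 2) :: real)"
    have F: "F > 0" by (simp add: F_def)
    have "(\<Sum>n\<in>{k + 2}. (1 / t) ^ n /\<^sub>R fact n) \<le> (\<Sum>n. (1 / t) ^ n /\<^sub>R fact n)"
      using True by (intro sum_le_suminf sums_summable[OF exp_converges]) auto
    then have "inverse F * (1 / t) ^ (k + 2) \<le> exp (1 / t)"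
      using sums_unique[OF exp_converges[of "1 / t"]]
      by (simp only: sum.insert finite.emptyI empty_iff not_False_eq_True sum.empty add_0_right
          real_scaleR_def F_def)
    then have "F * (inverse F * (1 / t) ^ (k + 2)) \<le> F * exp (1 / t)" using F by (intro mult_left_mono) auto
    then have "(1 / t) ^ (k + 2) \<le> F * exp (1 / t)" using F by (simp flip: mult.assoc)
    then have "t\<^sup>2 * (1 / t) ^ (k + 2) \<le> t\<^sup>2 * (F * exp (1 / t))" by (rule mult_left_mono) simp
    moreover have "t\<^sup>2 * (1 / t) ^ (k + 2) = (1 / t) ^ k"
      using True by (simp add: power_add power_divide power2_eq_square)
    ultimately have "(1 / t) ^ k \<le> t\<^sup>2 * (fact (k + 2) * exp (1 / t))" by (simp only: F_def)
    then have "(1 / t) ^ k * exp (- 1 / t) \<le> t\<^sup>2 * (fact (k + 2) * exp (1 / t)) * exp (- 1 / t)"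
      by (rule mult_right_mono) simp
    also have "\<dots> = fact (k + 2) * t\<^sup>2 * (exp (1 / t) * exp (- 1 / t))" by (simp only: mult_ac)
    also have "exp (1 / t) * exp (- 1 / t) = 1" by (simp flip: exp_add)
    finally show ?thesis using True by (simp add: exp_cutoff_def)
  qed (simp add: exp_cutoff_def)
qed

lemma exp_cutoff_deriv:
  "(exp_cutoff k has_real_derivative (- real k * exp_cutoff (k + 1) t + exp_cutoff (k + 2) t)) (at t)"
proof -
  consider "t > 0" | "t < 0" | "t = 0" by linarith
  then show ?thesis
  proof cases
    case 1
    have "((\<lambda>t. (1 / t) ^ k * exp (- 1 / t)) has_real_derivative
        (- real k * exp_cutoff (k + 1) t + exp_cutoff (k + 2) t)) (at t)"
    proof (cases k)
      case 0
      show ?thesis using 1 unfolding 0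
        by (auto intro!: derivative_eq_intros simp: exp_cutoff_def power2_eq_square field_simps)
    next
      case (Suc j)
      show ?thesis using 1 unfolding Suc
        by (auto intro!: derivative_eq_intros simp: exp_cutoff_def power2_eq_square field_simps power_divide)
          (cases j, auto)
    qed
    then show ?thesis
      by (rule has_field_derivative_transform_within_open[of _ _ _ "{0<..}"]) (use 1 in \<open>auto simp: exp_cutoff_def\<close>)
  next
    case 2
    have "((\<lambda>_. 0) has_real_derivative (- real k * exp_cutoff (k + 1) t + exp_cutoff (k + 2) t)) (at t)"
      using 2 by (simp add: exp_cutoff_def)
    then show ?thesis
      by (rule has_field_derivative_transform_within_open[of _ _ _ "{..<0}"]) (use 2 in \<open>auto simp: exp_cutoff_def\<close>)
  next
    case 3
    have "((\<lambda>h. exp_cutoff k h / h) \<longlongrightarrow> 0) (at 0)"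
    proof (rule Lim_null_comparison)
      show "\<forall>\<^sub>F h in at 0. norm (exp_cutoff k h / h) \<le> fact (k + 2) * \<bar>h\<bar>"
      proof (rule always_eventually, rule allI)
        fix h :: real
        have "\<bar>exp_cutoff k h\<bar> \<le> (fact (k + 2) * \<bar>h\<bar>) * \<bar>h\<bar>"
          using exp_cutoff_bounds(1,2)[of k h] by (simp add: power2_eq_square mult.assoc)
        then show "norm (exp_cutoff k h / h) \<le> fact (k + 2) * \<bar>h\<bar>"
          by (cases "h = 0") (simp_all add: abs_divide pos_divide_le_eq)
      qed
      have "((\<lambda>h::real. fact (k + 2) * \<bar>h\<bar>) \<longlongrightarrow> fact (k + 2) * \<bar>0\<bar>) (at 0)"
        by (intro tendsto_intros)
      then show "((\<lambda>h::real. fact (k + 2) * \<bar>h\<bar>) \<longlongrightarrow> 0) (at 0)" by simp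
    qed
    then show ?thesis unfolding 3 has_field_derivative_iff by (simp add: exp_cutoff_def)
  qed
qed

text \<open>A class of functions closed under partial derivatives that contains the bumps below.\<close>

inductive_set cutoff_algebra :: "(real ^ 'n \<Rightarrow> complex) set" where
  base: "(\<lambda>x. of_real (exp_cutoff k (c * x $ j + d))) \<in> cutoff_algebra"
| const: "(\<lambda>x. z) \<in> cutoff_algebra"
| add: "f \<in> cutoff_algebra \<Longrightarrow> g \<in> cutoff_algebra \<Longrightarrow> (\<lambda>x. f x + g x) \<in> cutoff_algebra"
| mult: "f \<in> cutoff_algebra \<Longrightarrow> g \<in> cutoff_algebra \<Longrightarrow> (\<lambda>x. f x * g x) \<in> cutoff_algebra"

lemma cutoff_algebra_deriv:
  fixes f :: "real ^ 'n \<Rightarrow> complex"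
  assumes "f \<in> cutoff_algebra"
  shows "\<exists>f'. (\<forall>x. (f has_derivative f' x) (at x)) \<and> (\<forall>i. (\<lambda>x. f' x (axis i 1)) \<in> cutoff_algebra)"
  using assms
proof induction
  case (base k c j d)
  define e where "e x = - real k * exp_cutoff (k + 1) (c * x $ j + d) + exp_cutoff (k + 2) (c * x $ j + d)"
    for x :: "real ^ 'n"
  have e: "(\<lambda>x. complex_of_real (e x)) \<in> cutoff_algebra"
    unfolding e_def of_real_add of_real_mult
    by (intro cutoff_algebra.intros)
  have d: "((\<lambda>x. complex_of_real (exp_cutoff k (c * x $ j + d))) has_derivative
      (\<lambda>h. of_real (e x * (c * h $ j)))) (at x)" for x
  proof -
    have "((\<lambda>x. c * x $ j + d) has_derivative (\<lambda>h. c * h $ j)) (at x)"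
      by (auto intro!: derivative_eq_intros bounded_linear_imp_has_derivative[OF bounded_linear_vec_nth])
    moreover have "(exp_cutoff k has_derivative (\<lambda>h. e x * h)) (at (c * x $ j + d))"
      using exp_cutoff_deriv[of k "c * x $ j + d"] unfolding e_def has_field_derivative_def .
    ultimately have "((\<lambda>x. exp_cutoff k (c * x $ j + d)) has_derivative (\<lambda>h. e x * (c * h $ j))) (at x)"
      by (rule has_derivative_compose)
    then show ?thesis by (rule has_derivative_of_real)
  qed
  have "(\<lambda>x. complex_of_real (e x * (c * axis i 1 $ j))) \<in> cutoff_algebra" for i
    unfolding of_real_mult[of "e _"] by (rule cutoff_algebra.mult[OF e cutoff_algebra.const])
  with d show ?case by (intro exI[of _ "\<lambda>x h. of_real (e x * (c * h $ j))"]) blast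
next
  case (const z)
  then show ?case by (intro exI[of _ "\<lambda>_ _. 0"]) (auto intro: cutoff_algebra.const)
next
  case (add f g)
  then obtain f' g' where "\<forall>x. (f has_derivative f' x) (at x)" "\<forall>i. (\<lambda>x. f' x (axis i 1)) \<in> cutoff_algebra"
    "\<forall>x. (g has_derivative g' x) (at x)" "\<forall>i. (\<lambda>x. g' x (axis i 1)) \<in> cutoff_algebra" by blast
  then show ?case
    by (intro exI[of _ "\<lambda>x h. f' x h + g' x h"]) (auto intro: has_derivative_add cutoff_algebra.add)
next
  case (mult f g)
  then obtain f' g' where "\<forall>x. (f has_derivative f' x) (at x)" "\<forall>i. (\<lambda>x. f' x (axis i 1)) \<in> cutoff_algebra"
    "\<forall>x. (g has_derivative g' x) (at x)" "\<forall>i. (\<lambda>x. g' x (axis i 1)) \<in> cutoff_algebra" by blast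
  then show ?case using mult.hyps
    by (intro exI[of _ "\<lambda>x h. f x * g' x h + f' x h * g x"] conjI allI has_derivative_mult
        cutoff_algebra.add cutoff_algebra.mult) blast+
qed

lemma cutoff_algebra_smooth: "f \<in> cutoff_algebra \<Longrightarrow> C_k k f"
proof (rule C_k_coinduct[of f cutoff_algebra])
  fix g :: "real ^ 'n \<Rightarrow> complex" assume "g \<in> cutoff_algebra"
  then obtain g' where g': "\<forall>x. (g has_derivative g' x) (at x)" "\<forall>i. (\<lambda>x. g' x (axis i 1)) \<in> cutoff_algebra"
    using cutoff_algebra_deriv by blast
  moreover have "partial_derivative i g = (\<lambda>x. g' x (axis i 1))" for i
    by (rule ext, rule partial_derivative_eq) (use g' in blast)
  ultimately show "(\<forall>x. g differentiable (at x)) \<and> (\<forall>i. partial_derivative i g \<in> cutoff_algebra)"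
    unfolding differentiable_def by auto
qed

lemma cutoff_algebra_prod:
  "finite I \<Longrightarrow> (\<And>i. i \<in> I \<Longrightarrow> f i \<in> cutoff_algebra) \<Longrightarrow> (\<lambda>x. \<Prod>i\<in>I. f i x) \<in> cutoff_algebra"
proof (induction I rule: finite_induct)
  case empty
  then show ?case using cutoff_algebra.const[of 1] by simp
next
  case (insert i I)
  then show ?case using cutoff_algebra.mult[of "f i" "\<lambda>x. \<Prod>i\<in>I. f i x"] by simp
qed

text \<open>The arguments are written as affine functions of one coordinate to fit the rule
  \<open>base\<close> of \<open>cutoff_algebra\<close>. As \<open>m\<close> grows the product tends
  to the indicator of the open box, because \<open>exp (- 1 / (m * c))\<close> tends to 1 for
  \<open>c > 0\<close>.\<close>

definition box_bump :: "real ^ 'n \<Rightarrow> real ^ 'n \<Rightarrow> nat \<Rightarrow> real ^ 'n \<Rightarrow> complex" where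
  "box_bump a b m x = (\<Prod>i\<in>UNIV. of_real (exp_cutoff 0 (real m * x $ i + (- real m * a $ i))) *
      of_real (exp_cutoff 0 (- real m * x $ i + real m * b $ i)))"

lemma box_bump_smooth: "C_k k (box_bump a b m)"
  unfolding box_bump_def[abs_def]
  by (rule cutoff_algebra_smooth, rule cutoff_algebra_prod[OF finite],
      rule cutoff_algebra.mult[OF cutoff_algebra.base cutoff_algebra.base])

lemma box_bump_bound: "norm (box_bump a b m x) \<le> 1"
proof -
  have "norm (complex_of_real (exp_cutoff 0 s) * of_real (exp_cutoff 0 t)) \<le> 1" for s t
    using mult_le_one[of "exp_cutoff 0 s" "exp_cutoff 0 t"] exp_cutoff_bounds(1,3)
    by (simp add: norm_mult)
  then show ?thesis
    unfolding box_bump_def prod_norm[symmetric] by (intro prod_le_1) simp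
qed

lemma mem_box_vec: "x \<in> box a b \<longleftrightarrow> (\<forall>i. a $ i < x $ i \<and> x $ i < b $ i)"
  for a b x :: "real ^ 'n" by (simp add: mem_box_cart)

lemma box_bump_outside:
  assumes "x \<notin> box a b" shows "box_bump a b m x = 0"
proof -
  obtain i where "x $ i \<le> a $ i \<or> b $ i \<le> x $ i"
    using assms by (auto simp: mem_box_vec not_less)
  then have "exp_cutoff 0 (real m * x $ i + (- real m * a $ i)) = 0 \<or>
      exp_cutoff 0 (- real m * x $ i + real m * b $ i) = 0"
  proof
    assume "x $ i \<le> a $ i"
    then have "real m * x $ i \<le> real m * a $ i" by (simp add: mult_left_mono)
    then show ?thesis by (simp add: exp_cutoff_def)
  next
    assume "b $ i \<le> x $ i"
    then have "real m * b $ i \<le> real m * x $ i" by (simp add: mult_left_mono)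
    then show ?thesis by (simp add: exp_cutoff_def)
  qed
  then show ?thesis unfolding box_bump_def by (intro prod_zero) auto
qed

lemma box_bump_tendsto:
  fixes a b x :: "real ^ 'n"
  shows "(\<lambda>m. box_bump a b m x) \<longlonglongrightarrow> indicator (box a b) x"
proof (cases "x \<in> box a b")
  case True
  have one: "(\<lambda>m. complex_of_real (exp_cutoff 0 (real m * c))) \<longlonglongrightarrow> of_real 1" if c: "c > 0" for c
  proof (rule tendsto_of_real)
    have "(\<lambda>m. - (1 / c) * (1 / real m)) \<longlonglongrightarrow> - (1 / c) * 0" by (intro tendsto_intros lim_1_over_n)
    then have "(\<lambda>m. exp (- (1 / c) * (1 / real m))) \<longlonglongrightarrow> exp (- (1 / c) * 0)" by (rule tendsto_exp)
    then have "(\<lambda>m. exp (- (1 / c) * (1 / real m))) \<longlonglongrightarrow> 1" by simp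
    moreover have "\<forall>\<^sub>F m in sequentially. exp (- (1 / c) * (1 / real m)) = exp_cutoff 0 (real m * c)"
      using eventually_gt_at_top[of 0] by eventually_elim (use c in \<open>auto simp: exp_cutoff_def field_simps\<close>)
    ultimately show "(\<lambda>m. exp_cutoff 0 (real m * c)) \<longlonglongrightarrow> 1" by (rule Lim_transform_eventually)
  qed
  have "(\<lambda>m. box_bump a b m x) \<longlonglongrightarrow> (\<Prod>i\<in>(UNIV::'n set). of_real 1 * of_real 1)"
    unfolding box_bump_def
  proof (intro tendsto_prod tendsto_mult)
    fix i
    have "0 < x $ i - a $ i" "0 < b $ i - x $ i" using True by (auto simp: mem_box_vec)
    from one[OF this(1)] one[OF this(2)]
    show "(\<lambda>m. complex_of_real (exp_cutoff 0 (real m * x $ i + - real m * a $ i))) \<longlonglongrightarrow> of_real 1"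
      "(\<lambda>m. complex_of_real (exp_cutoff 0 (- real m * x $ i + real m * b $ i))) \<longlonglongrightarrow> of_real 1"
      by (simp_all add: algebra_simps)
  qed
  then show ?thesis using True by simp
next
  case False
  then show ?thesis by (simp add: box_bump_outside)
qed

lemma box_bump_test_function: "cbox a b \<subseteq> \<Omega> \<Longrightarrow> box_bump a b m \<in> test_functions \<Omega>"
  unfolding test_functions_def
proof (intro CollectI conjI allI exI[of _ "cbox a b"] impI)
  show "box_bump a b m x = 0" if "x \<notin> cbox a b" for x
    using that box_subset_cbox[of a b] by (intro box_bump_outside) auto
qed (auto simp: box_bump_smooth)

subsection \<open>The fundamental lemma of the calculus of variations\<close>

lemma L1loc_cbox:
  assumes "g \<in> L1loc \<Omega>" "cbox a b \<subseteq> \<Omega>"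
  shows "integrable lebesgue (\<lambda>x. indicator (cbox a b) x *\<^sub>R g x)"
  using assms integrable_restrict_space[of "cbox a b" lebesgue g] by (auto simp: L1loc_def)

text \<open>The indicator of the open box is a bounded pointwise limit of test functions
  \<open>box_bump a b m\<close>. The restriction \<open>h\<close> of \<open>g\<close> to the closed
  box is integrable and dominates.\<close>

lemma integral_box_eq_0:
  fixes g :: "real ^ 'n \<Rightarrow> complex"
  assumes \<Omega>: "open \<Omega>" and g: "g \<in> L1loc \<Omega>"
    and zero: "\<And>\<phi>. \<phi> \<in> test_functions \<Omega> \<Longrightarrow> (LINT x|lebesgue_on \<Omega>. g x * \<phi> x) = 0"
    and ab: "cbox a b \<subseteq> \<Omega>"
  shows "(LINT x|lebesgue. indicator (box a b) x *\<^sub>R g x) = 0"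
proof -
  define h where "h x = indicator (cbox a b) x *\<^sub>R g x" for x
  have h: "integrable lebesgue h" unfolding h_def by (rule L1loc_cbox[OF g ab])
  have [measurable]: "h \<in> borel_measurable lebesgue" using h by simp
  have bb[measurable]: "box_bump a b m \<in> borel_measurable lebesgue" for m
    by (rule measurable_completion)
      (use borel_measurable_continuous_onI[OF C_k_continuous[OF box_bump_smooth]] in simp)
  have "(\<lambda>m. LINT x|lebesgue. h x * box_bump a b m x) \<longlonglongrightarrow> (LINT x|lebesgue. h x * indicator (box a b) x)"
  proof (rule integral_dominated_convergence[where w = "\<lambda>x. norm (h x)"])
    show "AE x in lebesgue. (\<lambda>m. h x * box_bump a b m x) \<longlonglongrightarrow> h x * indicator (box a b) x"
      by (intro AE_I2 tendsto_intros box_bump_tendsto)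
    show "AE x in lebesgue. norm (h x * box_bump a b m x) \<le> norm (h x)" for m
      by (intro AE_I2) (simp add: norm_mult mult_left_le box_bump_bound)
    show "(\<lambda>x. h x * indicator (box a b) x) \<in> borel_measurable lebesgue"
      by (intro borel_measurable_times borel_measurable_indicator) auto
  qed (use h in \<open>auto intro!: integrable_norm\<close>)
  moreover have "(LINT x|lebesgue. h x * box_bump a b m x) = 0" for m
  proof -
    have "(LINT x|lebesgue. h x * box_bump a b m x) = (LINT x|lebesgue_on \<Omega>. g x * box_bump a b m x)"
      using \<Omega> ab box_subset_cbox[of a b]
      by (subst integral_restrict_space)
        (auto simp: h_def indicator_def intro!: Bochner_Integration.integral_cong box_bump_outside)
    then show ?thesis using zero[OF box_bump_test_function[OF ab]] by simp
  qed
  ultimately have "(LINT x|lebesgue. h x * indicator (box a b) x) = 0"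
    by (simp add: LIMSEQ_const_iff)
  moreover have "h x * indicator (box a b) x = indicator (box a b) x *\<^sub>R g x" for x
    using box_subset_cbox[of a b] by (auto simp: h_def indicator_def)
  ultimately show ?thesis by simp
qed

text \<open>Boxes are stable under intersection and generate the Borel sets, so the signed measure
  with density \<open>f\<close> vanishes on every Borel set. The total integral handles the
  complements in this induction.\<close>

lemma AE_eq_0_if_integral_box_eq_0:
  fixes f :: "real ^ 'n \<Rightarrow> real"
  assumes f: "integrable lebesgue f"
    and zero: "\<And>c d. (LINT x|lebesgue. indicator (box c d) x *\<^sub>R f x) = 0"
    and total: "(LINT x|lebesgue. f x) = 0"
  shows "AE x in lebesgue. f x = 0"
proof (rule density_unique_real[OF f])
  have borel: "(LINT x:A|lebesgue. f x) = 0" if "A \<in> sets borel" for A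
  proof -
    have "Int_stable (range (\<lambda>(a, b). box a b :: (real ^ 'n) set))"
      by (auto simp: Int_stable_def box_Int_box)
    moreover have "range (\<lambda>(a, b). box a b :: (real ^ 'n) set) \<subseteq> Pow UNIV" by simp
    moreover have "A \<in> sigma_sets UNIV (range (\<lambda>(a, b). box a b :: (real ^ 'n) set))"
      using that unfolding borel_eq_box by simp
    ultimately show ?thesis
    proof (induction rule: sigma_sets_induct_disjoint)
      case (basic A)
      then show ?case using zero by (auto simp: set_lebesgue_integral_def)
    next
      case empty
      then show ?case by (simp add: set_lebesgue_integral_def)
    next
      case (compl A)
      have "A \<in> sets borel" unfolding borel_eq_box using compl(1) by simp
      then have [measurable]: "A \<in> sets lebesgue" by simp
      have "(LINT x:UNIV - A|lebesgue. f x) = (LINT x|lebesgue. f x - indicator A x *\<^sub>R f x)"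
        unfolding set_lebesgue_integral_def
        by (intro Bochner_Integration.integral_cong) (auto simp: indicator_def)
      also have "\<dots> = (LINT x|lebesgue. f x) - (LINT x:A|lebesgue. f x)"
        unfolding set_lebesgue_integral_def
        by (intro Bochner_Integration.integral_diff f integrable_mult_indicator) auto
      finally show ?case using compl total by simp
    next
      case (union F)
      have "F i \<in> sets borel" for i unfolding borel_eq_box using union(2) by auto
      then have F: "F i \<in> sets lebesgue" for i by simp
      have "(LINT x:(\<Union>i. F i)|lebesgue. f x) = (\<Sum>i. (LINT x:F i|lebesgue. f x))"
        using F union(1) f unfolding set_integrable_def
        by (intro lebesgue_integral_countable_add)
          (auto simp: disjoint_family_on_def set_integrable_def
            intro!: integrable_mult_indicator[where f = f, simplified real_scaleR_def])
      then show ?case using union by simp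
    qed
  qed
  \<comment> \<open>A Lebesgue measurable set is a Borel set up to a subset of a null set.\<close>
  fix A :: "(real ^ 'n) set" assume A: "A \<in> sets lebesgue"
  then obtain S N N' where S: "A = S \<union> N" "N \<subseteq> N'" "N' \<in> null_sets lborel" "S \<in> sets borel"
    by (auto elim!: sets_completionE)
  have "AE x in lebesgue. x \<notin> N'" using S by (intro AE_not_in null_sets_completionI)
  then have "AE x in lebesgue. indicator A x *\<^sub>R f x = indicator S x *\<^sub>R f x"
    by eventually_elim (use S in \<open>auto simp: indicator_def\<close>)
  then have "(LINT x:A|lebesgue. f x) = (LINT x:S|lebesgue. f x)"
    unfolding set_lebesgue_integral_def using A S f
    by (intro integral_cong_AE borel_measurable_scaleR borel_measurable_indicator) auto
  then show "(LINT x:A|lebesgue. f x) = (LINT x:A|lebesgue. 0)"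
    using borel[OF S(4)] by (simp add: set_lebesgue_integral_def)
qed simp

text \<open>Cut to the interior of a closed box in \<open>\<Omega>\<close>, \<open>g\<close> is
  integrable on the whole space, and its real and imaginary parts have integral 0 over every box.
  Countably many such closed boxes cover \<open>\<Omega>\<close>, and their frontiers are
  null.\<close>

lemma fundamental_lemma:
  fixes g :: "real ^ 'n \<Rightarrow> complex"
  assumes \<Omega>: "open \<Omega>" and g: "g \<in> L1loc \<Omega>"
    and zero: "\<And>\<phi>. \<phi> \<in> test_functions \<Omega> \<Longrightarrow> (LINT x|lebesgue_on \<Omega>. g x * \<phi> x) = 0"
  shows "AE x in lebesgue. x \<in> \<Omega> \<longrightarrow> g x = 0"
proof -
  have box0: "AE x in lebesgue. x \<in> cbox a b \<longrightarrow> g x = 0" if ab: "cbox a b \<subseteq> \<Omega>" for a b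
  proof -
    define h where "h x = indicator (box a b) x *\<^sub>R g x" for x
    have eq: "indicator (box a b) x *\<^sub>R (indicator (cbox a b) x *\<^sub>R g x) = h x" for x
      using box_subset_cbox[of a b] by (auto simp: h_def indicator_def)
    have h: "integrable lebesgue h"
      using integrable_mult_indicator[OF _ L1loc_cbox[OF g ab], of "box a b"] by (simp only: eq) simp
    have hb: "(LINT x|lebesgue. indicator (box c d) x *\<^sub>R h x) = 0" for c d
    proof -
      define a' b' where "a' = (\<Sum>i\<in>Basis. max (a \<bullet> i) (c \<bullet> i) *\<^sub>R i)"
        and "b' = (\<Sum>i\<in>Basis. min (b \<bullet> i) (d \<bullet> i) *\<^sub>R i)"
      have "box c d \<inter> box a b = box a' b'" "cbox a' b' \<subseteq> \<Omega>"
        using ab by (auto simp: a'_def b'_def box_Int_box Int_commute max.commute min.commute mem_box subset_eq)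
      then have "indicator (box c d) x *\<^sub>R h x = indicator (box a' b') x *\<^sub>R g x" for x
        by (auto simp: h_def indicator_def)
      then show ?thesis using integral_box_eq_0[OF \<Omega> g zero \<open>cbox a' b' \<subseteq> \<Omega>\<close>] by simp
    qed
    have h0: "(LINT x|lebesgue. h x) = 0"
      unfolding h_def by (rule integral_box_eq_0[OF \<Omega> g zero ab])
    have "AE x in lebesgue. Re (h x) = 0"
    proof (rule AE_eq_0_if_integral_box_eq_0)
      show "integrable lebesgue (\<lambda>x. Re (h x))" using h by simp
      show "(LINT x|lebesgue. Re (h x)) = 0" using h h0 by simp
      show "(LINT x|lebesgue. indicator (box c d) x *\<^sub>R Re (h x)) = 0" for c d
        using hb[of c d] integral_Re[OF integrable_mult_indicator[OF _ h], of "box c d"] by simp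
    qed
    moreover have "AE x in lebesgue. Im (h x) = 0"
    proof (rule AE_eq_0_if_integral_box_eq_0)
      show "integrable lebesgue (\<lambda>x. Im (h x))" using h by simp
      show "(LINT x|lebesgue. Im (h x)) = 0" using h h0 by simp
      show "(LINT x|lebesgue. indicator (box c d) x *\<^sub>R Im (h x)) = 0" for c d
        using hb[of c d] integral_Im[OF integrable_mult_indicator[OF _ h], of "box c d"] by simp
    qed
    moreover have "AE x in lebesgue. x \<notin> cbox a b - box a b"
      using negligible_frontier_interval[of a b] by (intro AE_not_in) (simp add: negligible_iff_null_sets)
    ultimately show ?thesis
      by eventually_elim (auto simp: h_def indicator_def complex_eq_iff)
  qed
  show ?thesis
  proof (rule open_countable_Union_open_cbox[OF \<Omega>])
    fix \<D> :: "(real ^ 'n) set set"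
    assume \<D>: "countable \<D>" "\<D> \<subseteq> Pow \<Omega>" "\<And>X. X \<in> \<D> \<Longrightarrow> \<exists>a b. X = cbox a b" "\<Union>\<D> = \<Omega>"
    have "AE x in lebesgue. \<forall>X\<in>\<D>. x \<in> X \<longrightarrow> g x = 0"
    proof (subst AE_ball_countable[OF \<D>(1)], rule ballI)
      fix X assume X: "X \<in> \<D>"
      then obtain a b where ab: "X = cbox a b" using \<D>(3)[OF X] by (elim exE) (rule that)
      moreover have "X \<subseteq> \<Omega>" using \<D>(2) X by auto
      ultimately show "AE x in lebesgue. x \<in> X \<longrightarrow> g x = 0" using box0[of a b] by simp
    qed
    then show ?thesis
    proof eventually_elim
      case (elim x)
      show ?case
      proof
        assume "x \<in> \<Omega>"
        then have "x \<in> \<Union>\<D>" by (simp only: \<D>(4))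
        then show "g x = 0" using elim by (elim UnionE) auto
      qed
    qed
  qed
qed

subsection \<open>Square-integrable functions on an open set\<close>

text \<open>Extension by zero makes L2 of every \<open>\<Omega>\<close> a subspace of one Hilbert
  space, so that domains, among them the whole space, can be compared.\<close>

definition emb :: "(real ^ 'n) set \<Rightarrow> (real ^ 'n \<Rightarrow> 'b::euclidean_space) \<Rightarrow> (real ^ 'n, 'b) lsq" where
  "emb \<Omega> f = abs_lsq (\<lambda>x. indicator \<Omega> x *\<^sub>R f x)"

lemma open_lebesgue: "open \<Omega> \<Longrightarrow> \<Omega> \<in> sets lebesgue"
  by (simp add: borel_open)

lemma L2_iff_sq_int:
  assumes "\<Omega> \<in> sets lebesgue"
  shows "f \<in> L2 \<Omega> \<longleftrightarrow> sq_int (\<lambda>x. indicator \<Omega> x *\<^sub>R f x)"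
proof -
  have "(norm (indicator \<Omega> x *\<^sub>R f x))\<^sup>2 = indicator \<Omega> x *\<^sub>R (norm (f x))\<^sup>2" for x
    by (simp add: indicator_def)
  then show ?thesis using assms
    by (simp add: L2_def sq_int_def borel_measurable_restrict_space_iff integrable_restrict_space)
qed

lemma L2_sq_int: "open \<Omega> \<Longrightarrow> f \<in> L2 \<Omega> \<Longrightarrow> sq_int (\<lambda>x. indicator \<Omega> x *\<^sub>R f x)"
  using L2_iff_sq_int open_lebesgue by blast

lemma L2_lincomb:
  assumes "open \<Omega>" "f \<in> L2 \<Omega>" "g \<in> L2 \<Omega>"
  shows "(\<lambda>x. f x + g x) \<in> L2 \<Omega>" "(\<lambda>x. f x - g x) \<in> L2 \<Omega>" "(\<lambda>x. c *\<^sub>R f x) \<in> L2 \<Omega>"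
  using assms sq_int_add[OF L2_sq_int[OF assms(1,2)] L2_sq_int[OF assms(1,3)]]
    sq_int_diff[OF L2_sq_int[OF assms(1,2)] L2_sq_int[OF assms(1,3)]]
    sq_int_scaleR[OF L2_sq_int[OF assms(1,2)], of c]
  by (simp_all add: L2_iff_sq_int open_lebesgue scaleR_add_right scaleR_diff_right mult.commute)

lemma emb_arith:
  assumes "open \<Omega>" "f \<in> L2 \<Omega>" "g \<in> L2 \<Omega>"
  shows "emb \<Omega> (\<lambda>x. f x + g x) = emb \<Omega> f + emb \<Omega> g"
    "emb \<Omega> (\<lambda>x. f x - g x) = emb \<Omega> f - emb \<Omega> g"
    "emb \<Omega> (\<lambda>x. c *\<^sub>R f x) = c *\<^sub>R emb \<Omega> f"
  unfolding emb_def
  using abs_lsq_arith[OF L2_sq_int[OF assms(1,2)]] L2_sq_int[OF assms(1,3)]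
  by (simp_all add: scaleR_add_right scaleR_diff_right mult.commute)

lemma inner_emb:
  assumes "open \<Omega>" "f \<in> L2 \<Omega>" "g \<in> L2 \<Omega>"
  shows "inner (emb \<Omega> f) (emb \<Omega> g) = (LINT x|lebesgue_on \<Omega>. inner (f x) (g x))"
    "integrable (lebesgue_on \<Omega>) (\<lambda>x. inner (f x) (g x))"
proof -
  have eq: "inner (indicator \<Omega> x *\<^sub>R f x) (indicator \<Omega> x *\<^sub>R g x) = indicator \<Omega> x *\<^sub>R inner (f x) (g x)" for x
    by (simp add: indicator_def)
  show "inner (emb \<Omega> f) (emb \<Omega> g) = (LINT x|lebesgue_on \<Omega>. inner (f x) (g x))"
    using abs_lsq_arith(5)[OF L2_sq_int[OF assms(1,2)] L2_sq_int[OF assms(1,3)]] open_lebesgue[OF assms(1)]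
    by (simp add: emb_def eq integral_restrict_space del: inner_scaleR_left inner_scaleR_right)
  show "integrable (lebesgue_on \<Omega>) (\<lambda>x. inner (f x) (g x))"
    using sq_int_inner[OF L2_sq_int[OF assms(1,2)] L2_sq_int[OF assms(1,3)]] open_lebesgue[OF assms(1)]
    by (simp add: eq integrable_restrict_space del: inner_scaleR_left inner_scaleR_right)
qed

lemma L2_norm_eq: "open \<Omega> \<Longrightarrow> f \<in> L2 \<Omega> \<Longrightarrow> L2_norm \<Omega> f = norm (emb \<Omega> f)"
  by (simp add: L2_norm_def norm_eq_sqrt_inner inner_emb power2_norm_eq_inner)

lemma AE_lebesgue_on: "\<Omega> \<in> sets lebesgue \<Longrightarrow> (AE x in lebesgue_on \<Omega>. P x) \<longleftrightarrow> (AE x in lebesgue. x \<in> \<Omega> \<longrightarrow> P x)"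
  by (simp add: AE_restrict_space_iff)

lemma emb_eq_iff:
  assumes "open \<Omega>" "f \<in> L2 \<Omega>" "g \<in> L2 \<Omega>"
  shows "emb \<Omega> f = emb \<Omega> g \<longleftrightarrow> (AE x in lebesgue. x \<in> \<Omega> \<longrightarrow> f x = g x)"
  unfolding emb_def using abs_lsq_eq_iff[OF L2_sq_int[OF assms(1,2)] L2_sq_int[OF assms(1,3)]]
  by (simp add: indicator_def) (auto elim!: eventually_mono split: if_splits)

lemma L2_cong_AE:
  assumes "open \<Omega>" "f \<in> L2 \<Omega>" and ae: "AE x in lebesgue. x \<in> \<Omega> \<longrightarrow> f x = g x"
  shows "g \<in> L2 \<Omega>" "emb \<Omega> f = emb \<Omega> g"
proof -
  have ae': "AE x in lebesgue. indicator \<Omega> x *\<^sub>R f x = indicator \<Omega> x *\<^sub>R g x"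
    using ae by eventually_elim (auto simp: indicator_def)
  have "sq_int (\<lambda>x. indicator \<Omega> x *\<^sub>R g x)"
  proof (rule sq_int_bound[OF L2_sq_int[OF assms(1,2)], where c = 1])
    show "(\<lambda>x. indicator \<Omega> x *\<^sub>R g x) \<in> borel_measurable lebesgue"
      using borel_measurable_AE[OF sq_int_measurable[OF L2_sq_int[OF assms(1,2)]] ae'] .
    show "AE x in lebesgue. norm (indicator \<Omega> x *\<^sub>R g x) \<le> 1 * norm (indicator \<Omega> x *\<^sub>R f x)"
      using ae' by eventually_elim (simp only: mult_1 order_refl)
  qed
  then show "g \<in> L2 \<Omega>" using L2_iff_sq_int open_lebesgue[OF assms(1)] by blast
  then show "emb \<Omega> f = emb \<Omega> g" using emb_eq_iff assms by blast
qed

lemma sq_int_integrable_on: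
  assumes "sq_int f" "K \<in> lmeasurable"
  shows "integrable lebesgue (\<lambda>x. indicator K x *\<^sub>R f x)"
proof (rule Bochner_Integration.integrable_bound)
  show "integrable lebesgue (\<lambda>x. indicator K x + (norm (f x))\<^sup>2)"
    using assms sq_int_integrable by (intro Bochner_Integration.integrable_add) (auto simp: fmeasurable_def)
  show "(\<lambda>x. indicator K x *\<^sub>R f x) \<in> borel_measurable lebesgue"
    using assms by (intro borel_measurable_scaleR borel_measurable_indicator sq_int_measurable) auto
  have "t \<le> 1 + t\<^sup>2" for t :: real
  proof -
    have "0 \<le> (t - 1/2)\<^sup>2" by simp
    then have "t \<le> t\<^sup>2 + (1/2)\<^sup>2" unfolding power2_diff by simp
    then show ?thesis by (simp add: power2_eq_square)
  qed
  then have "norm (indicator K x *\<^sub>R f x) \<le> norm (indicator K x + (norm (f x))\<^sup>2)" for x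
    by (auto simp: indicator_def)
  then show "AE x in lebesgue. norm (indicator K x *\<^sub>R f x) \<le> norm (indicator K x + (norm (f x))\<^sup>2)"
    by (rule AE_I2)
qed

lemma L2_L1loc: assumes "open \<Omega>" "f \<in> L2 \<Omega>" shows "f \<in> L1loc \<Omega>"
  unfolding L1loc_def
proof (intro CollectI allI impI, elim conjE)
  fix K assume K: "compact K" "K \<subseteq> \<Omega>"
  have "integrable lebesgue (\<lambda>x. indicator K x *\<^sub>R (indicator \<Omega> x *\<^sub>R f x))"
    using K by (intro sq_int_integrable_on L2_sq_int assms lmeasurable_compact)
  moreover have "indicator K x *\<^sub>R (indicator \<Omega> x *\<^sub>R f x) = indicator K x *\<^sub>R f x" for x
    using K by (auto simp: indicator_def)
  moreover have "K \<in> sets lebesgue" using lmeasurable_compact[OF K(1)] by blast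
  ultimately show "integrable (lebesgue_on K) f"
    by (simp only: integrable_restrict_space sets.Int_space_eq2)
qed

lemma L2_L1: assumes "open \<Omega>" "\<Omega> \<in> lmeasurable" "f \<in> L2 \<Omega>" shows "f \<in> L1 \<Omega>"
proof -
  have "indicator \<Omega> x *\<^sub>R (indicator \<Omega> x *\<^sub>R f x) = indicator \<Omega> x *\<^sub>R f x" for x
    by (auto simp: indicator_def)
  then show ?thesis
    using sq_int_integrable_on[OF L2_sq_int[OF assms(1,3)] assms(2)] open_lebesgue[OF assms(1)]
    by (simp only: L1_def mem_Collect_eq integrable_restrict_space sets.Int_space_eq2)
qed

lemma continuous_compact_support:
  fixes f :: "real ^ 'n \<Rightarrow> 'b::euclidean_space"
  assumes f: "continuous_on UNIV f" and K: "compact K" "\<And>x. x \<notin> K \<Longrightarrow> f x = 0"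
  shows "\<exists>C\<ge>0. \<forall>x. norm (f x) \<le> C" "sq_int f" "f \<in> borel_measurable borel" "f \<in> borel_measurable lebesgue"
    "integrable lebesgue f"
proof -
  obtain C where C: "\<And>x. x \<in> K \<Longrightarrow> norm (f x) \<le> C"
    using compact_imp_bounded[OF compact_continuous_image[OF continuous_on_subset[OF f] K(1)]]
    by (auto simp: bounded_iff)
  have bd: "norm (f x) \<le> max 0 C" for x using C[of x] K(2)[of x] by (cases "x \<in> K") auto
  then show "\<exists>C\<ge>0. \<forall>x. norm (f x) \<le> C" by (intro exI[of _ "max 0 C"]) auto
  show mb: "f \<in> borel_measurable borel" using f by (rule borel_measurable_continuous_onI)
  then show m: "f \<in> borel_measurable lebesgue" by (simp add: measurable_completion)
  have Km: "K \<in> lmeasurable" using K(1) by (rule lmeasurable_compact)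
  have ind: "integrable lebesgue (\<lambda>x. (max 0 C)\<^sup>2 * indicator K x)"
    using Km by (auto simp: fmeasurable_def)
  have "integrable lebesgue (\<lambda>x. (norm (f x))\<^sup>2)"
  proof (rule Bochner_Integration.integrable_bound[OF ind])
    show "AE x in lebesgue. norm ((norm (f x))\<^sup>2) \<le> norm ((max 0 C)\<^sup>2 * indicator K x)"
      using K(2) bd by (intro AE_I2) (auto simp: indicator_def intro!: power_mono)
  qed (use m in measurable)
  then show sq: "sq_int f" using m by (simp add: sq_int_def)
  have "indicator K x *\<^sub>R f x = f x" for x using K(2) by (auto simp: indicator_def)
  then show "integrable lebesgue f" using sq_int_integrable_on[OF sq Km] by simp
qed

subsection \<open>Test functions\<close>

lemma test_functionsE:
  assumes "\<phi> \<in> test_functions \<Omega>"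
  obtains K where "compact K" "K \<subseteq> \<Omega>" "\<And>x. x \<notin> K \<Longrightarrow> \<phi> x = 0"
  using assms by (auto simp: test_functions_def)

lemma test_functions_differentiable: "\<phi> \<in> test_functions \<Omega> \<Longrightarrow> \<phi> differentiable (at x)"
  by (auto simp: test_functions_def dest!: spec[of _ "Suc 0"])

lemma test_functions_continuous: "\<phi> \<in> test_functions \<Omega> \<Longrightarrow> continuous_on UNIV \<phi>"
  by (auto simp: test_functions_def intro: C_k_continuous)

lemma partial_derivative_support:
  assumes "compact K" "\<And>x. x \<notin> K \<Longrightarrow> \<phi> x = 0" "x \<notin> K"
  shows "(\<phi> has_derivative (\<lambda>_. 0)) (at x)" "partial_derivative i \<phi> x = 0"
proof -
  have "open (- K)" using assms(1) by (simp add: compact_imp_closed open_Compl)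
  then show "(\<phi> has_derivative (\<lambda>_. 0)) (at x)"
    by (rule has_derivative_transform_within_open[OF has_derivative_const[of 0]]) (use assms in auto)
  then show "partial_derivative i \<phi> x = 0" by (rule partial_derivative_eq)
qed

lemma test_functions_partial:
  assumes "\<phi> \<in> test_functions \<Omega>" shows "partial_derivative i \<phi> \<in> test_functions \<Omega>"
proof -
  obtain K where K: "compact K" "K \<subseteq> \<Omega>" "\<And>x. x \<notin> K \<Longrightarrow> \<phi> x = 0" using test_functionsE[OF assms] by blast
  have "C_k k (partial_derivative i \<phi>)" for k
    using assms by (auto simp: test_functions_def dest!: spec[of _ "Suc k"])
  then show ?thesis using K partial_derivative_support(2)[OF K(1,3)] by (auto simp: test_functions_def)
qed

lemma test_functions_zero: "(\<lambda>x. 0) \<in> test_functions \<Omega>"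
  by (auto simp: test_functions_def C_k_zero intro: exI[of _ "{}"])

lemma test_functions_add:
  assumes "\<phi> \<in> test_functions \<Omega>" "\<psi> \<in> test_functions \<Omega>" shows "(\<lambda>x. \<phi> x + \<psi> x) \<in> test_functions \<Omega>"
proof -
  obtain K L where "compact K" "K \<subseteq> \<Omega>" "\<And>x. x \<notin> K \<Longrightarrow> \<phi> x = 0" "compact L" "L \<subseteq> \<Omega>" "\<And>x. x \<notin> L \<Longrightarrow> \<psi> x = 0"
    using test_functionsE[OF assms(1)] test_functionsE[OF assms(2)] by metis
  then show ?thesis using assms
    by (auto simp: test_functions_def intro!: C_k_add exI[of _ "K \<union> L"])
qed

lemma test_functions_cmult:
  assumes "\<phi> \<in> test_functions \<Omega>" shows "(\<lambda>x. c * \<phi> x) \<in> test_functions \<Omega>"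
  using assms by (auto simp: test_functions_def intro!: C_k_cmult)

definition grad :: "(real ^ 'n \<Rightarrow> complex) \<Rightarrow> real ^ 'n \<Rightarrow> complex ^ 'n" where
  "grad \<phi> x = (\<chi> i. partial_derivative i \<phi> x)"

lemma grad_cmult:
  assumes "\<phi> \<in> test_functions \<Omega>"
  shows "grad (\<lambda>x. c * \<phi> x) x = (\<chi> i. c * grad \<phi> x $ i)"
  by (simp add: grad_def vec_eq_iff partial_derivative_cmult[OF test_functions_differentiable[OF assms]])

lemma test_functions_L2:
  assumes "open \<Omega>" "\<phi> \<in> test_functions \<Omega>"
  shows "\<phi> \<in> L2 \<Omega>" "emb \<Omega> \<phi> = abs_lsq \<phi>" "sq_int \<phi>" "grad \<phi> \<in> L2 \<Omega>" "emb \<Omega> (grad \<phi>) = abs_lsq (grad \<phi>)"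
    "sq_int (grad \<phi>)" "continuous_on UNIV (grad \<phi>)"
proof -
  obtain K where K: "compact K" "K \<subseteq> \<Omega>" "\<And>x. x \<notin> K \<Longrightarrow> \<phi> x = 0" using test_functionsE[OF assms(2)] by blast
  have K': "grad \<phi> x = 0" if "x \<notin> K" for x
    using partial_derivative_support(2)[OF K(1,3) that] by (simp add: grad_def vec_eq_iff)
  show c: "continuous_on UNIV (grad \<phi>)"
    unfolding grad_def using test_functions_continuous[OF test_functions_partial[OF assms(2)]]
    by (intro continuous_on_vec_lambda)
  show sq: "sq_int \<phi>" "sq_int (grad \<phi>)"
    using continuous_compact_support(2)[OF test_functions_continuous[OF assms(2)] K(1,3)]
      continuous_compact_support(2)[OF c K(1) K'] by auto
  have "indicator \<Omega> x *\<^sub>R \<phi> x = \<phi> x" "indicator \<Omega> x *\<^sub>R grad \<phi> x = grad \<phi> x" for x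
    using K(2) K(3)[of x] K'[of x] by (auto simp: indicator_def)
  then show "\<phi> \<in> L2 \<Omega>" "emb \<Omega> \<phi> = abs_lsq \<phi>" "grad \<phi> \<in> L2 \<Omega>" "emb \<Omega> (grad \<phi>) = abs_lsq (grad \<phi>)"
    using sq open_lebesgue[OF assms(1)] by (simp_all add: L2_iff_sq_int emb_def)
qed

subsection \<open>Difference quotients and integration by parts\<close>

text \<open>Pointwise convergence comes with a bound uniform in \<open>m\<close>: the mean value
  inequality bounds the quotients, and their supports lie in one ball. This is the domination needed
  in \<open>integral_derivative_eq_0\<close> and \<open>translation_estimate\<close>.\<close>

lemma difference_quotient:
  fixes h :: "real ^ 'n \<Rightarrow> complex"
  assumes h: "\<And>x. (h has_derivative h' x) (at x)" and cont: "continuous_on UNIV (\<lambda>x. h' x v)"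
    and K: "compact K" "\<And>x. x \<notin> K \<Longrightarrow> h x = 0"
    and q_def: "\<And>m x. q m x = real (Suc m) *\<^sub>R (h (x + (1 / real (Suc m)) *\<^sub>R v) - h x)"
  shows "\<exists>C R. (\<forall>x. (\<lambda>m. q m x) \<longlonglongrightarrow> h' x v) \<and> (\<forall>m x. norm (q m x) \<le> C * indicator (cball 0 R) x) \<and>
    (\<forall>x. norm (h' x v) \<le> C * indicator (cball 0 R) x)"
proof -
  have z: "h' x v = 0" if "x \<notin> K" for x
    using has_derivative_unique[OF h partial_derivative_support(1)[OF K that]] by simp
  obtain C where C: "C \<ge> 0" "\<And>x. norm (h' x v) \<le> C"
    using continuous_compact_support(1)[OF cont K(1) z] by blast
  obtain R where R: "R \<ge> 0" "K \<subseteq> cball 0 R"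
    using compact_imp_bounded[OF K(1)] by (metis bounded_pos bounded_iff mem_cball_0 subsetI less_imp_le)
  have line: "((\<lambda>t. h (x + t *\<^sub>R v)) has_derivative (\<lambda>s. s *\<^sub>R h' (x + t *\<^sub>R v) v)) (at t within T)" for x t T
  proof -
    have "((\<lambda>t. x + t *\<^sub>R v) has_derivative (\<lambda>s. s *\<^sub>R v)) (at t within T)"
      by (auto intro!: derivative_eq_intros)
    from has_derivative_compose[OF this h]
    have "((\<lambda>t. h (x + t *\<^sub>R v)) has_derivative (\<lambda>s. h' (x + t *\<^sub>R v) (s *\<^sub>R v))) (at t within T)" .
    moreover have "h' (x + t *\<^sub>R v) (s *\<^sub>R v) = s *\<^sub>R h' (x + t *\<^sub>R v) v" for s
      using linear_scale[OF has_derivative_linear[OF h]] .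
    ultimately show ?thesis by simp
  qed
  have lim: "(\<lambda>m. q m x) \<longlonglongrightarrow> h' x v" for x
  proof -
    have "((\<lambda>t. norm (h (x + t *\<^sub>R v) - h x - t *\<^sub>R h' x v) / norm t) \<longlongrightarrow> 0) (at 0)"
      using line[of x 0 UNIV] by (simp add: has_derivative_iff_norm)
    moreover have "\<forall>\<^sub>F t in at 0. norm (h (x + t *\<^sub>R v) - h x - t *\<^sub>R h' x v) / norm t
        = norm ((1 / t) *\<^sub>R (h (x + t *\<^sub>R v) - h x) - h' x v)"
    proof (rule eventually_at_filter[THEN iffD2], intro always_eventually allI impI)
      fix t :: real assume "t \<noteq> 0"
      then have "(1 / t) *\<^sub>R (h (x + t *\<^sub>R v) - h x) - h' x v = (1 / t) *\<^sub>R (h (x + t *\<^sub>R v) - h x - t *\<^sub>R h' x v)"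
        by (simp add: scaleR_diff_right)
      then show "norm (h (x + t *\<^sub>R v) - h x - t *\<^sub>R h' x v) / norm t
        = norm ((1 / t) *\<^sub>R (h (x + t *\<^sub>R v) - h x) - h' x v)" by simp
    qed
    ultimately have "((\<lambda>t. norm ((1 / t) *\<^sub>R (h (x + t *\<^sub>R v) - h x) - h' x v)) \<longlongrightarrow> 0) (at 0)"
      by (rule Lim_transform_eventually)
    then have "((\<lambda>t. (1 / t) *\<^sub>R (h (x + t *\<^sub>R v) - h x)) \<longlongrightarrow> h' x v) (at 0)"
      by (simp add: tendsto_norm_zero_iff LIM_zero_iff)
    moreover have "filterlim (\<lambda>m. 1 / real (Suc m)) (at 0) sequentially"
      unfolding filterlim_at using LIMSEQ_Suc[OF lim_1_over_n] by (simp add: eventually_sequentially)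
    ultimately have "(\<lambda>m. (1 / (1 / real (Suc m))) *\<^sub>R (h (x + (1 / real (Suc m)) *\<^sub>R v) - h x)) \<longlonglongrightarrow> h' x v"
      by (rule filterlim_compose)
    then show ?thesis by (simp add: q_def)
  qed
  have bd: "norm (q m x) \<le> C" for m x
  proof -
    have "norm (h (x + (1 / real (Suc m)) *\<^sub>R v) - h (x + 0 *\<^sub>R v)) \<le> C * norm (1 / real (Suc m) - 0)"
    proof (rule differentiable_bound[of UNIV])
      show "onorm (\<lambda>s. s *\<^sub>R h' (x + t *\<^sub>R v) v) \<le> C" for t
        using C(2)[of "x + t *\<^sub>R v"] by (intro onorm_le) (auto simp: mult.commute[of C] mult_left_mono)
    qed (use line in auto)
    then have "real (Suc m) * norm (h (x + (1 / real (Suc m)) *\<^sub>R v) - h (x + 0 *\<^sub>R v))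
        \<le> real (Suc m) * (C * norm (1 / real (Suc m) - 0))" by (rule mult_left_mono) simp
    then show ?thesis by (simp add: q_def del: of_nat_Suc)
  qed
  \<comment> \<open>Shifts have length at most \<open>norm v\<close>, so beyond radius
    \<open>R + norm v\<close> neither \<open>x\<close> nor the shifted point lies in
    \<open>K\<close>.\<close>
  have supp: "q m x = 0 \<and> h' x v = 0" if "x \<notin> cball 0 (R + norm v)" for m x
  proof -
    have x: "norm x > R + norm v" using that by simp
    have "norm ((1 / real (Suc m)) *\<^sub>R v) \<le> norm v"
      unfolding norm_scaleR by (rule mult_left_le_one_le) auto
    then have "norm (x + (1 / real (Suc m)) *\<^sub>R v) > R"
      using x norm_diff_ineq[of x "(1 / real (Suc m)) *\<^sub>R v"] by linarith
    then have 1: "x + (1 / real (Suc m)) *\<^sub>R v \<notin> K" using R(2) by force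
    have "x \<notin> cball 0 R" using x norm_ge_zero[of v] by (auto simp del: norm_ge_zero)
    then have "x \<notin> K" using R(2) by blast
    with 1 show ?thesis using K(2) z by (simp add: q_def)
  qed
  show ?thesis
  proof (rule exI[of _ C], rule exI[of _ "R + norm v"], intro conjI allI lim)
    show "norm (q m x) \<le> C * indicator (cball 0 (R + norm v)) x" for m x
      using supp[of x m] bd[of m x] by (cases "x \<in> cball 0 (R + norm v)") auto
    show "norm (h' x v) \<le> C * indicator (cball 0 (R + norm v)) x" for x
      using supp[of x 0] C(2)[of x] by (cases "x \<in> cball 0 (R + norm v)") auto
  qed
qed

lemma integral_translation:
  fixes f :: "'a::euclidean_space \<Rightarrow> 'b::euclidean_space"
  assumes [measurable]: "f \<in> borel_measurable borel"
  shows "(LINT x|lebesgue. f (x + c)) = (LINT x|lebesgue. f x)"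
    "integrable lebesgue (\<lambda>x. f (x + c)) \<longleftrightarrow> integrable lebesgue f"
proof -
  have "(LINT x|lborel. f x) = (LINT x|distr lborel borel ((+) c). f x)" by (simp add: lborel_distr_plus)
  also have "\<dots> = (LINT x|lborel. f (c + x))" by (rule integral_distr) measurable
  finally show "(LINT x|lebesgue. f (x + c)) = (LINT x|lebesgue. f x)"
    by (simp add: integral_completion add.commute)
  have "integrable lborel f \<longleftrightarrow> integrable (distr lborel borel ((+) c)) f" by (simp add: lborel_distr_plus)
  also have "\<dots> \<longleftrightarrow> integrable lborel (\<lambda>x. f (c + x))" by (rule integrable_distr_eq) measurable
  finally show "integrable lebesgue (\<lambda>x. f (x + c)) \<longleftrightarrow> integrable lebesgue f"
    by (simp add: integrable_completion add.commute)
qed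

text \<open>Every difference quotient has integral 0 by translation invariance, and dominated
  convergence carries this over to the derivative.\<close>

lemma integral_derivative_eq_0:
  fixes h :: "real ^ 'n \<Rightarrow> complex"
  assumes h: "\<And>x. (h has_derivative h' x) (at x)" and cont: "continuous_on UNIV (\<lambda>x. h' x v)"
    and K: "compact K" "\<And>x. x \<notin> K \<Longrightarrow> h x = 0"
  shows "(LINT x|lebesgue. h' x v) = 0"
proof -
  define q where "q m x = real (Suc m) *\<^sub>R (h (x + (1 / real (Suc m)) *\<^sub>R v) - h x)" for m x
  obtain C R where CR: "\<forall>x. (\<lambda>m. q m x) \<longlonglongrightarrow> h' x v" "\<forall>m x. norm (q m x) \<le> C * indicator (cball 0 R) x"
    using difference_quotient[OF h cont K q_def] by blast
  have hc: "continuous_on UNIV h" using h by (auto intro!: continuous_at_imp_continuous_on has_derivative_continuous)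
  note hs = continuous_compact_support[OF hc K]
  have [measurable]: "h \<in> borel_measurable borel" by (rule hs)
  have hsh: "integrable lebesgue (\<lambda>x. h (x + c))" for c using integral_translation(2)[of h c] hs by simp
  have "(\<lambda>m. LINT x|lebesgue. q m x) \<longlonglongrightarrow> (LINT x|lebesgue. h' x v)"
  proof (rule integral_dominated_convergence[where w = "\<lambda>x. C * indicator (cball 0 R) x"])
    show "(\<lambda>x. h' x v) \<in> borel_measurable lebesgue"
      using borel_measurable_continuous_onI[OF cont] by (simp add: measurable_completion)
    show "q m \<in> borel_measurable lebesgue" for m
      unfolding q_def using hsh hs by (intro borel_measurable_scaleR borel_measurable_diff) auto
    show "integrable lebesgue (\<lambda>x. C * indicator (cball 0 R) x)"
      using lmeasurable_cball[of 0 R] by (auto simp: fmeasurable_def)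
  qed (use CR in auto)
  moreover have "(LINT x|lebesgue. q m x) = 0" for m
    unfolding q_def using hsh hs(5) integral_translation(1)[of h] by simp
  ultimately show ?thesis by (simp add: LIMSEQ_const_iff)
qed

lemma integration_by_parts:
  assumes "\<phi> \<in> test_functions \<Omega>" "\<psi> \<in> test_functions \<Omega>"
  shows "(LINT x|lebesgue. \<phi> x * partial_derivative i \<psi> x) = - (LINT x|lebesgue. partial_derivative i \<phi> x * \<psi> x)"
proof -
  obtain K where K: "compact K" "K \<subseteq> \<Omega>" "\<And>x. x \<notin> K \<Longrightarrow> \<phi> x = 0" using test_functionsE[OF assms(1)] by blast
  have d: "(\<phi> has_derivative frechet_derivative \<phi> (at x)) (at x)" "(\<psi> has_derivative frechet_derivative \<psi> (at x)) (at x)" for x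
    using test_functions_differentiable[OF assms(1)] test_functions_differentiable[OF assms(2)]
    by (simp_all add: frechet_derivative_works[symmetric])
  have c: "continuous_on UNIV \<phi>" "continuous_on UNIV \<psi>" "continuous_on UNIV (partial_derivative i \<phi>)"
     "continuous_on UNIV (partial_derivative i \<psi>)"
    using assms by (auto intro!: test_functions_continuous test_functions_partial)
  have i1: "integrable lebesgue (\<lambda>x. \<phi> x * partial_derivative i \<psi> x)"
    using K by (intro continuous_compact_support(5)[OF _ K(1)] continuous_intros c) auto
  have i2: "integrable lebesgue (\<lambda>x. partial_derivative i \<phi> x * \<psi> x)"
    using K partial_derivative_support(2)[OF K(1,3)]
    by (intro continuous_compact_support(5)[OF _ K(1)] continuous_intros c) auto
  have "(LINT x|lebesgue. \<phi> x * frechet_derivative \<psi> (at x) (axis i 1) + frechet_derivative \<phi> (at x) (axis i 1) * \<psi> x) = 0"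
  proof (rule integral_derivative_eq_0[OF has_derivative_mult[OF d(1) d(2)] _ K(1)])
    show "continuous_on UNIV (\<lambda>x. \<phi> x * frechet_derivative \<psi> (at x) (axis i 1) + frechet_derivative \<phi> (at x) (axis i 1) * \<psi> x)"
      using c unfolding partial_derivative_def by (intro continuous_intros)
  qed (use K in auto)
  then show ?thesis using i1 i2
    by (simp flip: partial_derivative_def add: Bochner_Integration.integral_add eq_neg_iff_add_eq_0)
qed

subsection \<open>Weak gradients\<close>

lemma L1loc_mult_integrable:
  fixes f :: "real ^ 'n \<Rightarrow> complex"
  assumes \<Omega>: "open \<Omega>" and f: "f \<in> L1loc \<Omega>" and \<phi>: "\<phi> \<in> test_functions \<Omega>"
  shows "integrable (lebesgue_on \<Omega>) (\<lambda>x. f x * \<phi> x)"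
proof -
  obtain K where K: "compact K" "K \<subseteq> \<Omega>" "\<And>x. x \<notin> K \<Longrightarrow> \<phi> x = 0" using test_functionsE[OF \<phi>] by blast
  note c = continuous_compact_support[OF test_functions_continuous[OF \<phi>] K(1,3)]
  obtain C where C: "C \<ge> 0" "\<And>x. norm (\<phi> x) \<le> C" using c(1) by blast
  have Ks: "K \<in> sets lebesgue" using lmeasurable_compact[OF K(1)] by blast
  have i: "integrable lebesgue (\<lambda>x. indicator K x *\<^sub>R f x)"
    using f K Ks integrable_restrict_space[of K lebesgue f] by (simp add: L1loc_def)
  have "integrable lebesgue (\<lambda>x. (indicator K x *\<^sub>R f x) * \<phi> x)"
  proof (rule Bochner_Integration.integrable_bound[OF integrable_mult_right[OF integrable_norm[OF i], of C]])
    show "(\<lambda>x. (indicator K x *\<^sub>R f x) * \<phi> x) \<in> borel_measurable lebesgue"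
      using i c(4) by (intro borel_measurable_times) auto
    show "AE x in lebesgue. norm ((indicator K x *\<^sub>R f x) * \<phi> x) \<le> norm (C * norm (indicator K x *\<^sub>R f x))"
      using C by (intro AE_I2) (auto simp: indicator_def norm_mult mult.commute[of C] intro!: mult_left_mono)
  qed
  moreover have "(indicator K x *\<^sub>R f x) * \<phi> x = indicator \<Omega> x *\<^sub>R (f x * \<phi> x)" for x
    using K(2) K(3)[of x] by (auto simp: indicator_def)
  ultimately show ?thesis
    by (simp only: integrable_restrict_space sets.Int_space_eq2 open_lebesgue[OF \<Omega>])
qed

lemma L1loc_component: "g \<in> L1loc \<Omega> \<Longrightarrow> (\<lambda>x. g x $ i) \<in> L1loc \<Omega>" for g :: "real ^ 'n \<Rightarrow> complex ^ 'm"
  unfolding L1loc_def by (auto intro: integrable_bounded_linear[OF bounded_linear_vec_nth])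

lemma L1loc_lincomb:
  fixes f g :: "real ^ 'n \<Rightarrow> complex"
  assumes "f \<in> L1loc \<Omega>" "g \<in> L1loc \<Omega>"
  shows "(\<lambda>x. c * f x + d * g x) \<in> L1loc \<Omega>"
  using assms unfolding L1loc_def by auto

lemma L1loc_vec_lincomb:
  fixes f g :: "real ^ 'n \<Rightarrow> complex ^ 'm"
  assumes "f \<in> L1loc \<Omega>" "g \<in> L1loc \<Omega>"
  shows "(\<lambda>x. \<chi> i. c * f x $ i + d * g x $ i) \<in> L1loc \<Omega>"
proof -
  have "bounded_linear (\<lambda>v :: complex ^ 'm. \<chi> i. z * v $ i)" for z
    by (intro linear_conv_bounded_linear[THEN iffD1] linearI) (simp_all add: vec_eq_iff algebra_simps)
  then have "integrable (lebesgue_on K) (\<lambda>x. (\<chi> i. c * f x $ i) + (\<chi> i. d * g x $ i))"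
    if "compact K \<and> K \<subseteq> \<Omega>" for K
    using that assms unfolding L1loc_def
    by (intro Bochner_Integration.integrable_add) (auto intro: integrable_bounded_linear)
  moreover have "(\<chi> i. c * f x $ i) + (\<chi> i. d * g x $ i) = (\<chi> i. c * f x $ i + d * g x $ i)" for x
    by (simp add: vec_eq_iff)
  ultimately show ?thesis by (simp add: L1loc_def)
qed

lemma has_weak_gradient_lincomb:
  assumes \<Omega>: "open \<Omega>" and u: "has_weak_gradient \<Omega> u g" and v: "has_weak_gradient \<Omega> v h"
  shows "has_weak_gradient \<Omega> (\<lambda>x. c * u x + d * v x) (\<lambda>x. \<chi> i. c * g x $ i + d * h x $ i)"
  unfolding has_weak_gradient_def
proof (intro conjI ballI allI)
  have L: "u \<in> L1loc \<Omega>" "v \<in> L1loc \<Omega>" "g \<in> L1loc \<Omega>" "h \<in> L1loc \<Omega>"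
    using u v by (auto simp: has_weak_gradient_def)
  show "(\<lambda>x. c * u x + d * v x) \<in> L1loc \<Omega>" "(\<lambda>x. \<chi> i. c * g x $ i + d * h x $ i) \<in> L1loc \<Omega>"
    using L by (auto intro: L1loc_lincomb L1loc_vec_lincomb)
  fix \<phi> i assume \<phi>: "\<phi> \<in> test_functions \<Omega>"
  have p: "partial_derivative i \<phi> \<in> test_functions \<Omega>" using \<phi> by (rule test_functions_partial)
  note I = L1loc_mult_integrable[OF \<Omega> L(1) p] L1loc_mult_integrable[OF \<Omega> L(2) p]
    L1loc_mult_integrable[OF \<Omega> L1loc_component[OF L(3)] \<phi>, of i] L1loc_mult_integrable[OF \<Omega> L1loc_component[OF L(4)] \<phi>, of i]
  have "(LINT x|lebesgue_on \<Omega>. (c * u x + d * v x) * partial_derivative i \<phi> x)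
      = (LINT x|lebesgue_on \<Omega>. c * (u x * partial_derivative i \<phi> x) + d * (v x * partial_derivative i \<phi> x))"
    by (simp add: algebra_simps)
  also have "\<dots> = c * (LINT x|lebesgue_on \<Omega>. u x * partial_derivative i \<phi> x) + d * (LINT x|lebesgue_on \<Omega>. v x * partial_derivative i \<phi> x)"
    using I by simp
  also have "\<dots> = - (c * (LINT x|lebesgue_on \<Omega>. g x $ i * \<phi> x) + d * (LINT x|lebesgue_on \<Omega>. h x $ i * \<phi> x))"
    using u v \<phi> by (simp add: has_weak_gradient_def)
  also have "\<dots> = - (LINT x|lebesgue_on \<Omega>. c * (g x $ i * \<phi> x) + d * (h x $ i * \<phi> x))"
    using I by simp
  finally show "(LINT x|lebesgue_on \<Omega>. (c * u x + d * v x) * partial_derivative i \<phi> x)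
      = - (LINT x|lebesgue_on \<Omega>. (\<chi> i. c * g x $ i + d * h x $ i) $ i * \<phi> x)"
    by (simp add: algebra_simps)
qed

lemma has_weak_gradient_unique:
  assumes \<Omega>: "open \<Omega>" and g: "has_weak_gradient \<Omega> u g" and h: "has_weak_gradient \<Omega> u h"
  shows "AE x in lebesgue. x \<in> \<Omega> \<longrightarrow> g x = h x"
proof -
  have L: "g \<in> L1loc \<Omega>" "h \<in> L1loc \<Omega>" using g h by (auto simp: has_weak_gradient_def)
  have "AE x in lebesgue. x \<in> \<Omega> \<longrightarrow> g x $ i - h x $ i = 0" for i
  proof (rule fundamental_lemma[OF \<Omega>])
    show "(\<lambda>x. g x $ i - h x $ i) \<in> L1loc \<Omega>"
      using L1loc_lincomb[OF L1loc_component[OF L(1)] L1loc_component[OF L(2)], of 1 i "-1" i] by simp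
    fix \<phi> assume \<phi>: "\<phi> \<in> test_functions \<Omega>"
    have "(LINT x|lebesgue_on \<Omega>. (g x $ i - h x $ i) * \<phi> x)
        = (LINT x|lebesgue_on \<Omega>. g x $ i * \<phi> x) - (LINT x|lebesgue_on \<Omega>. h x $ i * \<phi> x)"
      using L1loc_mult_integrable[OF \<Omega> L1loc_component[OF L(1)] \<phi>, of i]
        L1loc_mult_integrable[OF \<Omega> L1loc_component[OF L(2)] \<phi>, of i]
      by (simp add: left_diff_distrib)
    also have "\<dots> = 0"
    proof -
      have "- (LINT x|lebesgue_on \<Omega>. g x $ i * \<phi> x) = - (LINT x|lebesgue_on \<Omega>. h x $ i * \<phi> x)"
        using g h \<phi> unfolding has_weak_gradient_def by (elim conjE) (drule (1) bspec, drule spec[of _ i], simp)+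
      then show ?thesis by simp
    qed
    finally show "(LINT x|lebesgue_on \<Omega>. (g x $ i - h x $ i) * \<phi> x) = 0" .
  qed
  then have "AE x in lebesgue. \<forall>i. x \<in> \<Omega> \<longrightarrow> g x $ i - h x $ i = 0"
    by (intro AE_all_countable[THEN iffD2] allI)
  then show ?thesis by eventually_elim (simp add: vec_eq_iff)
qed

lemma has_weak_gradient_test:
  assumes \<Omega>: "open \<Omega>" and \<phi>: "\<phi> \<in> test_functions \<Omega>"
  shows "has_weak_gradient \<Omega> \<phi> (grad \<phi>)"
  unfolding has_weak_gradient_def
proof (intro conjI ballI allI)
  show "\<phi> \<in> L1loc \<Omega>" "grad \<phi> \<in> L1loc \<Omega>" using test_functions_L2[OF \<Omega> \<phi>] \<Omega> by (auto intro: L2_L1loc)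
  fix \<psi> i assume \<psi>: "\<psi> \<in> test_functions \<Omega>"
  obtain K where K: "compact K" "K \<subseteq> \<Omega>" "\<And>x. x \<notin> K \<Longrightarrow> \<phi> x = 0" using test_functionsE[OF \<phi>] by blast
  have pz: "partial_derivative i \<phi> x = 0" if "x \<notin> K" for x
    by (rule partial_derivative_support(2)[OF K(1) K(3) that])
  have "indicator \<Omega> x *\<^sub>R (\<phi> x * partial_derivative i \<psi> x) = \<phi> x * partial_derivative i \<psi> x"
    "indicator \<Omega> x *\<^sub>R (grad \<phi> x $ i * \<psi> x) = partial_derivative i \<phi> x * \<psi> x" for x
    using K(2) K(3)[of x] pz[of x] by (auto simp: indicator_def grad_def)
  then show "(LINT x|lebesgue_on \<Omega>. \<phi> x * partial_derivative i \<psi> x) = - (LINT x|lebesgue_on \<Omega>. grad \<phi> x $ i * \<psi> x)"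
    using integration_by_parts[OF \<phi> \<psi>]
    by (simp only: integral_restrict_space sets.Int_space_eq2 open_lebesgue[OF \<Omega>])
qed

lemma weak_gradient_eq:
  assumes \<Omega>: "open \<Omega>" and u: "has_weak_gradient \<Omega> u g" and g: "g \<in> L2 \<Omega>"
  shows "has_weak_gradient \<Omega> u (weak_gradient \<Omega> u)" "weak_gradient \<Omega> u \<in> L2 \<Omega>"
    "emb \<Omega> (weak_gradient \<Omega> u) = emb \<Omega> g" "AE x in lebesgue. x \<in> \<Omega> \<longrightarrow> weak_gradient \<Omega> u x = g x"
proof -
  show w: "has_weak_gradient \<Omega> u (weak_gradient \<Omega> u)"
    unfolding weak_gradient_def by (rule someI[of "has_weak_gradient \<Omega> u", OF u])
  have ae: "AE x in lebesgue. x \<in> \<Omega> \<longrightarrow> g x = weak_gradient \<Omega> u x"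
    by (rule has_weak_gradient_unique[OF \<Omega> u w])
  show "weak_gradient \<Omega> u \<in> L2 \<Omega>" "emb \<Omega> (weak_gradient \<Omega> u) = emb \<Omega> g"
    using L2_cong_AE[OF \<Omega> g ae] by auto
  show "AE x in lebesgue. x \<in> \<Omega> \<longrightarrow> weak_gradient \<Omega> u x = g x" using ae by eventually_elim simp
qed

subsection \<open>The Sobolev space as a closed subspace\<close>

definition graph :: "(real ^ 'n) set \<Rightarrow> (real ^ 'n \<Rightarrow> complex) \<Rightarrow> (real ^ 'n, complex) lsq \<times> (real ^ 'n, complex ^ 'n) lsq" where
  "graph \<Omega> u = (emb \<Omega> u, emb \<Omega> (weak_gradient \<Omega> u))"

definition sobolev :: "(real ^ 'n) set \<Rightarrow> ((real ^ 'n, complex) lsq \<times> (real ^ 'n, complex ^ 'n) lsq) set" where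
  "sobolev \<Omega> = closure (graph \<Omega> ` test_functions \<Omega>)"

lemma H1D:
  assumes "open \<Omega>" "u \<in> H1 \<Omega>"
  shows "u \<in> L2 \<Omega>" "weak_gradient \<Omega> u \<in> L2 \<Omega>" "has_weak_gradient \<Omega> u (weak_gradient \<Omega> u)"
  using assms weak_gradient_eq[OF assms(1)] by (auto simp: H1_def)

lemma H1_graphI:
  assumes "open \<Omega>" "u \<in> L2 \<Omega>" "has_weak_gradient \<Omega> u g" "g \<in> L2 \<Omega>"
  shows "u \<in> H1 \<Omega>" "graph \<Omega> u = (emb \<Omega> u, emb \<Omega> g)"
  using assms weak_gradient_eq(3)[OF assms(1,3,4)] by (auto simp: H1_def graph_def)

lemma H1_norm_eq: "open \<Omega> \<Longrightarrow> u \<in> H1 \<Omega> \<Longrightarrow> H1_norm \<Omega> u = norm (graph \<Omega> u)"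
  by (simp add: H1_norm_def graph_def norm_Pair L2_norm_eq H1D)

lemma test_H1:
  assumes "open \<Omega>" "\<phi> \<in> test_functions \<Omega>"
  shows "\<phi> \<in> H1 \<Omega>" "graph \<Omega> \<phi> = (emb \<Omega> \<phi>, emb \<Omega> (grad \<phi>))"
  using H1_graphI[OF assms(1) test_functions_L2(1)[OF assms] has_weak_gradient_test[OF assms] test_functions_L2(4)[OF assms]]
  by auto

lemma bounded_linear_vec_cmult: "bounded_linear (\<lambda>v :: complex ^ 'm. \<chi> i. c * v $ i)"
  by (intro linear_conv_bounded_linear[THEN iffD1] linearI) (simp_all add: vec_eq_iff algebra_simps)

lemma L2_bounded_linear:
  fixes f :: "real ^ 'n \<Rightarrow> 'b::euclidean_space" and T :: "'b \<Rightarrow> 'c::euclidean_space"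
  assumes "open \<Omega>" "f \<in> L2 \<Omega>" "bounded_linear T" shows "(\<lambda>x. T (f x)) \<in> L2 \<Omega>"
proof -
  interpret T: bounded_linear T by fact
  obtain K where K: "\<And>x. norm (T x) \<le> norm x * K" using T.bounded by blast
  have sq: "sq_int (\<lambda>x. indicator \<Omega> x *\<^sub>R f x)" using assms by (intro L2_sq_int)
  have "sq_int (\<lambda>x. T (indicator \<Omega> x *\<^sub>R f x))"
  proof (rule sq_int_bound[OF sq])
    show "(\<lambda>x. T (indicator \<Omega> x *\<^sub>R f x)) \<in> borel_measurable lebesgue"
      using measurable_compose[OF sq_int_measurable[OF sq] borel_measurable_continuous_onI[OF linear_continuous_on[OF assms(3)]]] .
    show "AE x in lebesgue. norm (T (indicator \<Omega> x *\<^sub>R f x)) \<le> K * norm (indicator \<Omega> x *\<^sub>R f x)"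
      using K by (intro AE_I2) (simp only: mult.commute[of K])
  qed
  then show ?thesis using open_lebesgue[OF assms(1)] by (simp add: L2_iff_sq_int T.scaleR)
qed

lemma H1_lincomb:
  assumes \<Omega>: "open \<Omega>" and u: "u \<in> H1 \<Omega>" and v: "v \<in> H1 \<Omega>"
  shows "(\<lambda>x. c * u x + d * v x) \<in> H1 \<Omega>"
    "graph \<Omega> (\<lambda>x. c * u x + d * v x) = (emb \<Omega> (\<lambda>x. c * u x + d * v x),
      emb \<Omega> (\<lambda>x. \<chi> i. c * weak_gradient \<Omega> u x $ i + d * weak_gradient \<Omega> v x $ i))"
proof -
  note U = H1D[OF \<Omega> u] and V = H1D[OF \<Omega> v]
  have "(\<lambda>x. c * u x + d * v x) \<in> L2 \<Omega>"
    using U(1) V(1) \<Omega> by (intro L2_lincomb L2_bounded_linear[where T = "(*) _"] bounded_linear_mult_right)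
  moreover have "(\<lambda>x. (\<chi> i. c * weak_gradient \<Omega> u x $ i) + (\<chi> i. d * weak_gradient \<Omega> v x $ i)) \<in> L2 \<Omega>"
    using U(2) V(2) \<Omega> by (intro L2_lincomb L2_bounded_linear[OF _ _ bounded_linear_vec_cmult])
  moreover have "(\<chi> i. c * weak_gradient \<Omega> u x $ i) + (\<chi> i. d * weak_gradient \<Omega> v x $ i)
      = (\<chi> i. c * weak_gradient \<Omega> u x $ i + d * weak_gradient \<Omega> v x $ i)" for x by (simp add: vec_eq_iff)
  ultimately show "(\<lambda>x. c * u x + d * v x) \<in> H1 \<Omega>"
    "graph \<Omega> (\<lambda>x. c * u x + d * v x) = (emb \<Omega> (\<lambda>x. c * u x + d * v x),
      emb \<Omega> (\<lambda>x. \<chi> i. c * weak_gradient \<Omega> u x $ i + d * weak_gradient \<Omega> v x $ i))"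
    using H1_graphI[OF \<Omega> _ has_weak_gradient_lincomb[OF \<Omega> U(3) V(3)], of c d] by simp_all
qed

lemma graph_arith:
  assumes \<Omega>: "open \<Omega>" and u: "u \<in> H1 \<Omega>" and v: "v \<in> H1 \<Omega>"
  shows "graph \<Omega> (\<lambda>x. u x + v x) = graph \<Omega> u + graph \<Omega> v" "(\<lambda>x. u x + v x) \<in> H1 \<Omega>"
    "graph \<Omega> (\<lambda>x. u x - v x) = graph \<Omega> u - graph \<Omega> v" "(\<lambda>x. u x - v x) \<in> H1 \<Omega>"
    "graph \<Omega> (\<lambda>x. r *\<^sub>R u x) = r *\<^sub>R graph \<Omega> u" "(\<lambda>x. r *\<^sub>R u x) \<in> H1 \<Omega>"
proof -
  note U = H1D[OF \<Omega> u] and V = H1D[OF \<Omega> v]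
  have *: "(\<chi> i. p $ i + q $ i) = p + q" "(\<chi> i. p $ i - q $ i) = p - q" "(\<chi> i. r *\<^sub>R p $ i) = r *\<^sub>R p"
    for p q :: "complex ^ 'n" and r by (simp_all add: vec_eq_iff)
  show "graph \<Omega> (\<lambda>x. u x + v x) = graph \<Omega> u + graph \<Omega> v" "(\<lambda>x. u x + v x) \<in> H1 \<Omega>"
    using H1_lincomb[OF \<Omega> u v, of 1 1] U V \<Omega> by (simp_all add: * graph_def emb_arith)
  show "graph \<Omega> (\<lambda>x. u x - v x) = graph \<Omega> u - graph \<Omega> v" "(\<lambda>x. u x - v x) \<in> H1 \<Omega>"
    using H1_lincomb[OF \<Omega> u v, of 1 "-1"] U V \<Omega> by (simp_all add: * graph_def emb_arith)
  show "graph \<Omega> (\<lambda>x. r *\<^sub>R u x) = r *\<^sub>R graph \<Omega> u" "(\<lambda>x. r *\<^sub>R u x) \<in> H1 \<Omega>"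
    using H1_lincomb[OF \<Omega> u u, of "of_real r" 0] U \<Omega>
    by (simp_all add: * graph_def emb_arith[OF \<Omega> U(1) U(1)] emb_arith[OF \<Omega> U(2) U(2)] flip: scaleR_conv_of_real)
qed

lemma H10_H1: "u \<in> H10 \<Omega> \<Longrightarrow> u \<in> H1 \<Omega>" by (simp add: H10_def)

lemma H10_iff_sobolev:
  assumes \<Omega>: "open \<Omega>"
  shows "u \<in> H10 \<Omega> \<longleftrightarrow> u \<in> H1 \<Omega> \<and> graph \<Omega> u \<in> sobolev \<Omega>"
proof -
  have "H1_norm \<Omega> (\<lambda>x. u x - \<phi> x) = dist (graph \<Omega> \<phi>) (graph \<Omega> u)"
    if "u \<in> H1 \<Omega>" "\<phi> \<in> test_functions \<Omega>" for \<phi>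
    using that test_H1[OF \<Omega> that(2)] by (simp add: H1_norm_eq graph_arith \<Omega> dist_norm norm_minus_commute)
  then have "(\<exists>\<phi>\<in>test_functions \<Omega>. H1_norm \<Omega> (\<lambda>x. u x - \<phi> x) < \<epsilon>)
      \<longleftrightarrow> (\<exists>y\<in>graph \<Omega> ` test_functions \<Omega>. dist y (graph \<Omega> u) < \<epsilon>)" if "u \<in> H1 \<Omega>" for \<epsilon>
    using that by simp
  then show ?thesis
    by (cases "u \<in> H1 \<Omega>") (simp_all only: H10_def sobolev_def closure_approachable mem_Collect_eq simp_thms)
qed

lemma test_subset_H10:
  assumes "open \<Omega>" "\<phi> \<in> test_functions \<Omega>" shows "\<phi> \<in> H10 \<Omega>"
proof -
  have "graph \<Omega> \<phi> \<in> sobolev \<Omega>"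
    unfolding sobolev_def by (rule subsetD[OF closure_subset imageI[OF assms(2)]])
  then show ?thesis using test_H1(1)[OF assms] H10_iff_sobolev[OF assms(1)] by blast
qed

lemma subspace_sobolev:
  assumes \<Omega>: "open \<Omega>" shows "subspace (sobolev \<Omega>)"
  unfolding sobolev_def
proof (rule subspace_closure, unfold subspace_def, intro conjI ballI allI)
  note T = test_H1(1)[OF \<Omega>]
  have "graph \<Omega> (\<lambda>x. 0) = 0"
    using graph_arith(5)[OF \<Omega> T[OF test_functions_zero] T[OF test_functions_zero], of 0] by simp
  then show "0 \<in> graph \<Omega> ` test_functions \<Omega>" by (metis test_functions_zero imageI)
  fix x y assume "x \<in> graph \<Omega> ` test_functions \<Omega>"
  then obtain \<phi> where \<phi>: "\<phi> \<in> test_functions \<Omega>" "x = graph \<Omega> \<phi>" by blast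
  show "c *\<^sub>R x \<in> graph \<Omega> ` test_functions \<Omega>" for c
  proof -
    have "(\<lambda>x. c *\<^sub>R \<phi> x) \<in> test_functions \<Omega>"
      using test_functions_cmult[OF \<phi>(1), of "of_real c"] by (simp add: scaleR_conv_of_real)
    then show ?thesis using graph_arith(5)[OF \<Omega> T[OF \<phi>(1)] T[OF \<phi>(1)], of c] \<phi>(2) by (metis imageI)
  qed
  assume "y \<in> graph \<Omega> ` test_functions \<Omega>"
  then obtain \<psi> where \<psi>: "\<psi> \<in> test_functions \<Omega>" "y = graph \<Omega> \<psi>" by blast
  show "x + y \<in> graph \<Omega> ` test_functions \<Omega>"
    using graph_arith(1)[OF \<Omega> T[OF \<phi>(1)] T[OF \<psi>(1)]] test_functions_add[OF \<phi>(1) \<psi>(1)] \<phi>(2) \<psi>(2) by (metis imageI)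
qed

lemma closed_sobolev: "closed (sobolev \<Omega>)"
  by (simp add: sobolev_def)

text \<open>Expresses both sides of the identity that defines a weak gradient as inner products in
  \<open>lsq\<close>. In this form the identity survives limits and depends only on classes.\<close>

lemma LINT_Re_inner:
  assumes \<Omega>: "open \<Omega>" and f: "f \<in> L2 \<Omega>" and g: "g \<in> L2 \<Omega>" and \<phi>: "\<phi> \<in> test_functions \<Omega>"
  shows "Re (LINT x|lebesgue_on \<Omega>. f x * \<phi> x) = inner (emb \<Omega> f) (emb \<Omega> (\<lambda>x. cnj (\<phi> x)))"
    "Re (LINT x|lebesgue_on \<Omega>. g x $ i * \<phi> x) = inner (emb \<Omega> g) (emb \<Omega> (\<lambda>x. axis i (cnj (\<phi> x))))"
proof -
  note T = test_functions_L2(1)[OF \<Omega> \<phi>]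
  have c: "(\<lambda>x. cnj (\<phi> x)) \<in> L2 \<Omega>" by (rule L2_bounded_linear[OF \<Omega> T bounded_linear_cnj])
  have "bounded_linear (axis i :: complex \<Rightarrow> complex ^ 'b)" for i :: "'b::finite"
    by (intro linear_conv_bounded_linear[THEN iffD1] linearI) (simp_all add: vec_eq_iff axis_def)
  from L2_bounded_linear[OF \<Omega> c this] have a: "(\<lambda>x. axis i (cnj (\<phi> x)) :: complex ^ 'b) \<in> L2 \<Omega>" for i :: "'b::finite" .
  have "Re (LINT x|lebesgue_on \<Omega>. f x * \<phi> x) = (LINT x|lebesgue_on \<Omega>. Re (f x * \<phi> x))"
    by (rule integral_Re[symmetric, OF L1loc_mult_integrable[OF \<Omega> L2_L1loc[OF \<Omega> f] \<phi>]])
  then show "Re (LINT x|lebesgue_on \<Omega>. f x * \<phi> x) = inner (emb \<Omega> f) (emb \<Omega> (\<lambda>x. cnj (\<phi> x)))"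
    by (simp add: inner_emb[OF \<Omega> f c] inner_complex_def)
  have "Re (LINT x|lebesgue_on \<Omega>. g x $ i * \<phi> x) = (LINT x|lebesgue_on \<Omega>. Re (g x $ i * \<phi> x))"
    by (rule integral_Re[symmetric, OF L1loc_mult_integrable[OF \<Omega> L1loc_component[OF L2_L1loc[OF \<Omega> g]] \<phi>]])
  then show "Re (LINT x|lebesgue_on \<Omega>. g x $ i * \<phi> x) = inner (emb \<Omega> g) (emb \<Omega> (\<lambda>x. axis i (cnj (\<phi> x))))"
    by (simp add: inner_emb[OF \<Omega> g a] inner_axis) (simp add: inner_complex_def)
qed

text \<open>Real parts suffice since test functions may be multiplied by \<open>-\<i>\<close>.\<close>

lemma has_weak_gradient_iff_inner:
  assumes \<Omega>: "open \<Omega>" and u: "u \<in> L2 \<Omega>" and g: "g \<in> L2 \<Omega>"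
  shows "has_weak_gradient \<Omega> u g \<longleftrightarrow> (\<forall>\<phi>\<in>test_functions \<Omega>. \<forall>i.
    inner (emb \<Omega> u) (emb \<Omega> (\<lambda>x. cnj (partial_derivative i \<phi> x)))
      = - inner (emb \<Omega> g) (emb \<Omega> (\<lambda>x. axis i (cnj (\<phi> x)))))" (is "_ \<longleftrightarrow> ?R")
proof
  assume "has_weak_gradient \<Omega> u g"
  then have "(LINT x|lebesgue_on \<Omega>. u x * partial_derivative i \<phi> x) = - (LINT x|lebesgue_on \<Omega>. g x $ i * \<phi> x)"
    if "\<phi> \<in> test_functions \<Omega>" for \<phi> i using that by (simp add: has_weak_gradient_def)
  then have "Re (LINT x|lebesgue_on \<Omega>. u x * partial_derivative i \<phi> x) = - Re (LINT x|lebesgue_on \<Omega>. g x $ i * \<phi> x)"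
    if "\<phi> \<in> test_functions \<Omega>" for \<phi> i using that by simp
  then show ?R by (simp add: LINT_Re_inner[OF \<Omega> u g] test_functions_partial)
next
  assume ?R
  then have re: "Re (LINT x|lebesgue_on \<Omega>. u x * partial_derivative i \<phi> x) = - Re (LINT x|lebesgue_on \<Omega>. g x $ i * \<phi> x)"
    if "\<phi> \<in> test_functions \<Omega>" for \<phi> i using that by (simp add: LINT_Re_inner[OF \<Omega> u g] test_functions_partial)
  have im: "Im (LINT x|lebesgue_on \<Omega>. u x * partial_derivative i \<phi> x) = - Im (LINT x|lebesgue_on \<Omega>. g x $ i * \<phi> x)"
    if \<phi>: "\<phi> \<in> test_functions \<Omega>" for \<phi> i
  proof -
    have p: "partial_derivative i (\<lambda>x. (-\<i>) * \<phi> x) = (\<lambda>x. (-\<i>) * partial_derivative i \<phi> x)"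
      using partial_derivative_cmult[OF test_functions_differentiable[OF \<phi>]] by blast
    have "u x * ((-\<i>) * partial_derivative i \<phi> x) = (-\<i>) * (u x * partial_derivative i \<phi> x)"
      "g x $ i * ((-\<i>) * \<phi> x) = (-\<i>) * (g x $ i * \<phi> x)" for x by simp_all
    then show ?thesis using re[OF test_functions_cmult[OF \<phi>, of "-\<i>"], of i] unfolding p
      by (simp only: integral_mult_right_zero) simp
  qed
  show "has_weak_gradient \<Omega> u g"
    unfolding has_weak_gradient_def using re im u g \<Omega> by (auto intro!: L2_L1loc complex_eqI)
qed

text \<open>Cutting off outside \<open>\<Omega>\<close> is the orthogonal projection onto the
  extended functions: the error is the part of \<open>x\<close> outside \<open>\<Omega>\<close>,
  where \<open>emb \<Omega> f\<close> vanishes. It shows that limits of extended functions are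
  extended functions.\<close>

lemma emb_closest:
  assumes "open \<Omega>" "f \<in> L2 \<Omega>"
  shows "rep_lsq x \<in> L2 \<Omega>" "norm (emb \<Omega> (rep_lsq x) - x) \<le> norm (x - emb \<Omega> f)"
proof -
  note O = open_lebesgue[OF assms(1)]
  have s: "sq_int (\<lambda>t. indicator \<Omega> t *\<^sub>R rep_lsq x t)"
  proof (rule sq_int_bound[OF sq_int_rep, where c = 1])
    show "(\<lambda>t. indicator \<Omega> t *\<^sub>R rep_lsq x t) \<in> borel_measurable lebesgue"
      using O by (intro borel_measurable_scaleR borel_measurable_indicator sq_int_measurable sq_int_rep)
  qed (auto simp: indicator_def)
  then show "rep_lsq x \<in> L2 \<Omega>" using L2_iff_sq_int[OF O] by blast
  have f: "sq_int (\<lambda>t. indicator \<Omega> t *\<^sub>R f t)" using assms by (rule L2_sq_int)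
  have 1: "emb \<Omega> (rep_lsq x) - x = abs_lsq (\<lambda>t. indicator \<Omega> t *\<^sub>R rep_lsq x t - rep_lsq x t)"
    using abs_lsq_arith(2)[OF s sq_int_rep] by (simp add: emb_def)
  have 2: "x - emb \<Omega> f = abs_lsq (\<lambda>t. rep_lsq x t - indicator \<Omega> t *\<^sub>R f t)"
    using abs_lsq_arith(2)[OF sq_int_rep f] by (simp add: emb_def)
  have "norm (emb \<Omega> (rep_lsq x) - x) \<le> 1 * norm (x - emb \<Omega> f)"
    unfolding 1 2
    by (rule norm_abs_lsq_mono[OF sq_int_diff[OF s sq_int_rep] sq_int_diff[OF sq_int_rep f]])
      (auto intro!: AE_I2 simp: indicator_def)
  then show "norm (emb \<Omega> (rep_lsq x) - x) \<le> norm (x - emb \<Omega> f)" by simp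
qed

lemma emb_rep_closed:
  assumes "open \<Omega>" "\<And>n. X n \<in> emb \<Omega> ` L2 \<Omega>" "X \<longlonglongrightarrow> x"
  shows "emb \<Omega> (rep_lsq x) = x"
proof -
  have "norm (emb \<Omega> (rep_lsq x) - x) \<le> norm (x - X n)" for n
    using assms(2)[of n] emb_closest(2)[OF assms(1)] by auto
  moreover have "(\<lambda>n. norm (x - X n)) \<longlonglongrightarrow> norm (x - x)" by (intro tendsto_intros assms(3))
  ultimately have "norm (emb \<Omega> (rep_lsq x) - x) \<le> norm (x - x)" by (intro LIMSEQ_le_const) auto
  then show ?thesis by simp
qed

text \<open>The weak gradient is a closed operator: the identity in
  \<open>has_weak_gradient_iff_inner\<close> is preserved under convergence of both components, so a
  limit of graphs of test functions is again a graph.\<close>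

lemma sobolevE:
  assumes \<Omega>: "open \<Omega>" and s: "s \<in> sobolev \<Omega>"
  obtains u where "u \<in> H10 \<Omega>" "s = graph \<Omega> u"
proof -
  obtain \<sigma> where \<sigma>': "\<forall>n. \<sigma> n \<in> graph \<Omega> ` test_functions \<Omega>" and \<sigma>: "\<sigma> \<longlonglongrightarrow> s"
    using s unfolding sobolev_def closure_sequential by blast
  have "\<forall>n. \<exists>f. f \<in> test_functions \<Omega> \<and> \<sigma> n = graph \<Omega> f" using \<sigma>' by blast
  from choice[OF this] obtain \<phi> where "\<forall>n. \<phi> n \<in> test_functions \<Omega> \<and> \<sigma> n = graph \<Omega> (\<phi> n)" by blast
  then have \<phi>: "\<And>n. \<phi> n \<in> test_functions \<Omega>" "\<And>n. \<sigma> n = graph \<Omega> (\<phi> n)" by auto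
  define u where "u = rep_lsq (fst s)"
  define g where "g = rep_lsq (snd s)"
  have l1: "(\<lambda>n. emb \<Omega> (\<phi> n)) \<longlonglongrightarrow> fst s" and l2: "(\<lambda>n. emb \<Omega> (grad (\<phi> n))) \<longlonglongrightarrow> snd s"
    using tendsto_fst[OF \<sigma>] tendsto_snd[OF \<sigma>] by (simp_all add: \<phi>(2) test_H1(2)[OF \<Omega> \<phi>(1)])
  have u: "u \<in> L2 \<Omega>" "emb \<Omega> u = fst s"
    using emb_closest(1)[OF \<Omega> test_functions_L2(1)[OF \<Omega> \<phi>(1)]] emb_rep_closed[OF \<Omega> _ l1]
      test_functions_L2(1)[OF \<Omega> \<phi>(1)] by (auto simp: u_def)
  have g: "g \<in> L2 \<Omega>" "emb \<Omega> g = snd s"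
    using emb_closest(1)[OF \<Omega> test_functions_L2(4)[OF \<Omega> \<phi>(1)]] emb_rep_closed[OF \<Omega> _ l2]
      test_functions_L2(4)[OF \<Omega> \<phi>(1)] by (auto simp: g_def)
  have w: "has_weak_gradient \<Omega> u g"
    unfolding has_weak_gradient_iff_inner[OF \<Omega> u(1) g(1)]
  proof (intro ballI allI)
    fix \<psi> i assume \<psi>: "\<psi> \<in> test_functions \<Omega>"
    let ?a = "emb \<Omega> (\<lambda>x. cnj (partial_derivative i \<psi> x))" and ?b = "emb \<Omega> (\<lambda>x. axis i (cnj (\<psi> x)))"
    have "inner (emb \<Omega> (\<phi> n)) ?a = - inner (emb \<Omega> (grad (\<phi> n))) ?b" for n
      using has_weak_gradient_iff_inner[OF \<Omega> test_functions_L2(1,4)[OF \<Omega> \<phi>(1)]] has_weak_gradient_test[OF \<Omega> \<phi>(1)] \<psi>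
      by blast
    moreover have "(\<lambda>n. inner (emb \<Omega> (\<phi> n)) ?a) \<longlonglongrightarrow> inner (fst s) ?a"
      "(\<lambda>n. - inner (emb \<Omega> (grad (\<phi> n))) ?b) \<longlonglongrightarrow> - inner (snd s) ?b"
      by (intro tendsto_intros l1 l2)+
    ultimately show "inner (emb \<Omega> u) ?a = - inner (emb \<Omega> g) ?b"
      using u(2) g(2) by (simp add: LIMSEQ_unique)
  qed
  have 1: "u \<in> H1 \<Omega>" by (rule H1_graphI(1)[OF \<Omega> u(1) w g(1)])
  have 2: "graph \<Omega> u = s" unfolding H1_graphI(2)[OF \<Omega> u(1) w g(1)] u(2) g(2) by simp
  show ?thesis
    by (rule that[of u]) (use 1 2 s H10_iff_sobolev[OF \<Omega>, of u] in simp_all)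
qed

lemma H10_arith:
  assumes \<Omega>: "open \<Omega>" and u: "u \<in> H10 \<Omega>" and v: "v \<in> H10 \<Omega>"
  shows "(\<lambda>x. u x + v x) \<in> H10 \<Omega>" "(\<lambda>x. u x - v x) \<in> H10 \<Omega>" "(\<lambda>x. r *\<^sub>R u x) \<in> H10 \<Omega>"
  using graph_arith[OF \<Omega> H10_H1[OF u] H10_H1[OF v]] subspace_sobolev[OF \<Omega>] u v
  by (simp_all add: H10_iff_sobolev[OF \<Omega>] subspace_add subspace_diff subspace_scale)

subsection \<open>Translations\<close>

lemma norm_sum_scaleR_vec_le:
  fixes w :: "'b::real_inner ^ 'n"
  shows "norm (\<Sum>j\<in>UNIV. v $ j *\<^sub>R w $ j) \<le> norm v * norm w"
proof -
  have "norm (\<Sum>j\<in>UNIV. v $ j *\<^sub>R w $ j) \<le> (\<Sum>j\<in>UNIV. \<bar>v $ j\<bar> * \<bar>norm (w $ j)\<bar>)"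
    by (rule norm_sum[THEN order_trans]) simp
  also have "\<dots> \<le> L2_set (\<lambda>j. v $ j) UNIV * L2_set (\<lambda>j. norm (w $ j)) UNIV" by (rule L2_set_mult_ineq)
  also have "\<dots> = norm v * norm w" by (simp add: norm_vec_def L2_set_def)
  finally show ?thesis .
qed

lemma translate_sq_int:
  assumes "f \<in> borel_measurable borel" "sq_int f"
  shows "sq_int (\<lambda>x. f (x + c))" "norm (abs_lsq (\<lambda>x. f (x + c))) = norm (abs_lsq f)"
proof -
  have m: "(\<lambda>x. (norm (f x))\<^sup>2) \<in> borel_measurable borel" using assms(1) by measurable
  have "(\<lambda>x. f (x + c)) \<in> borel_measurable borel" using assms(1) by measurable
  then show s: "sq_int (\<lambda>x. f (x + c))"
    using assms(2) integral_translation(2)[OF m, of c] by (simp add: sq_int_def measurable_completion)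
  show "norm (abs_lsq (\<lambda>x. f (x + c))) = norm (abs_lsq f)"
    using norm_abs_lsq[OF s] norm_abs_lsq[OF assms(2)] integral_translation(1)[OF m, of c]
    by (metis norm_ge_zero power2_eq_imp_eq)
qed

text \<open>The norm \<open>N v\<close> of the increment is subadditive in \<open>v\<close> because
  translations are isometries. Hence \<open>N v\<close> is at most \<open>Suc m\<close> times the
  value at \<open>v\<close> divided by \<open>Suc m\<close>, which is the norm of a difference
  quotient; it tends to the norm of the directional derivative as \<open>m\<close> grows.\<close>

lemma translation_estimate:
  fixes \<phi> :: "real ^ 'n \<Rightarrow> complex"
  assumes \<Omega>: "open \<Omega>" and \<phi>: "\<phi> \<in> test_functions \<Omega>"
  shows "sq_int (\<lambda>x. \<phi> (x + v) - \<phi> x)" "norm (abs_lsq (\<lambda>x. \<phi> (x + v) - \<phi> x)) \<le> norm v * norm (abs_lsq (grad \<phi>))"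
proof -
  obtain K where K: "compact K" "K \<subseteq> \<Omega>" "\<And>x. x \<notin> K \<Longrightarrow> \<phi> x = 0" using test_functionsE[OF \<phi>] by blast
  note c = continuous_compact_support[OF test_functions_continuous[OF \<phi>] K(1,3)]
  have sq: "sq_int (\<lambda>x. \<phi> (x + c) - \<phi> x)" for c
    using translate_sq_int(1)[OF c(3,2)] c(2) by (rule sq_int_diff)
  then show "sq_int (\<lambda>x. \<phi> (x + v) - \<phi> x)" .
  have [measurable]: "\<phi> \<in> borel_measurable borel" by (rule c(3))
  define N where "N c = norm (abs_lsq (\<lambda>x. \<phi> (x + c) - \<phi> x))" for c
  have N_add: "N (c + d) \<le> N c + N d" for c d
  proof -
    have s: "sq_int (\<lambda>x. \<phi> (x + d + c) - \<phi> (x + d))"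
      "norm (abs_lsq (\<lambda>x. \<phi> (x + d + c) - \<phi> (x + d))) = N c"
      using translate_sq_int[of "\<lambda>x. \<phi> (x + c) - \<phi> x" d] sq[of c] by (simp_all add: N_def)
    have "abs_lsq (\<lambda>x. \<phi> (x + (c + d)) - \<phi> x)
        = abs_lsq (\<lambda>x. \<phi> (x + d + c) - \<phi> (x + d)) + abs_lsq (\<lambda>x. \<phi> (x + d) - \<phi> x)"
      using abs_lsq_arith(1)[OF s(1) sq[of d]] by (simp add: ac_simps)
    then have "N (c + d) \<le> norm (abs_lsq (\<lambda>x. \<phi> (x + d + c) - \<phi> (x + d))) + N d"
      unfolding N_def by (simp only: norm_triangle_ineq)
    then show ?thesis by (simp only: s(2))
  qed
  have N_mult: "N (real m *\<^sub>R c) \<le> real m * N c" for m c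
  proof (induction m)
    case 0
    have "abs_lsq (\<lambda>x. \<phi> (x + 0) - \<phi> x) = 0" by (simp add: zero_lsq_def)
    then show ?case by (simp add: N_def)
  next
    case (Suc m)
    then show ?case using N_add[of "real m *\<^sub>R c" c] by (simp add: scaleR_add_left algebra_simps)
  qed
  define D where "D x = frechet_derivative \<phi> (at x) v" for x
  have D: "(\<phi> has_derivative frechet_derivative \<phi> (at x)) (at x)" for x
    using test_functions_differentiable[OF \<phi>] by (simp add: frechet_derivative_works[symmetric])
  have Deq: "D x = (\<Sum>j\<in>UNIV. v $ j *\<^sub>R grad \<phi> x $ j)" for x
    by (simp add: D_def frechet_derivative_eq_sum[OF test_functions_differentiable[OF \<phi>]] grad_def)
  have Dc: "continuous_on UNIV D"
    unfolding Deq[abs_def] using test_functions_L2(7)[OF \<Omega> \<phi>] by (intro continuous_intros)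
  define q where "q m x = real (Suc m) *\<^sub>R (\<phi> (x + (1 / real (Suc m)) *\<^sub>R v) - \<phi> x)" for m x
  obtain C R where CR: "\<forall>x. (\<lambda>m. q m x) \<longlonglongrightarrow> D x" "\<forall>m x. norm (q m x) \<le> C * indicator (cball 0 R) x"
    "\<forall>x. norm (D x) \<le> C * indicator (cball 0 R) x"
    using difference_quotient[OF D Dc[unfolded D_def] K(1,3) q_def] unfolding D_def by blast
  have Dm: "D \<in> borel_measurable borel" using Dc by (rule borel_measurable_continuous_onI)
  have qs: "sq_int (q m)" for m unfolding q_def by (intro sq_int_scaleR sq)
  have "(\<lambda>m. LINT x|lebesgue. (norm (q m x))\<^sup>2) \<longlonglongrightarrow> (LINT x|lebesgue. (norm (D x))\<^sup>2)"
  proof (rule integral_dominated_convergence[where w = "\<lambda>x. C\<^sup>2 * indicator (cball 0 R) x"])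
    show "(\<lambda>x. (norm (D x))\<^sup>2) \<in> borel_measurable lebesgue"
      using Dm by (intro measurable_completion) measurable
    show "(\<lambda>x. (norm (q m x))\<^sup>2) \<in> borel_measurable lebesgue" for m
      using sq_int_measurable[OF qs[of m]] by measurable
    show "integrable lebesgue (\<lambda>x. C\<^sup>2 * indicator (cball 0 R) x)"
      using lmeasurable_cball[of 0 R] by (auto simp: fmeasurable_def)
    show "AE x in lebesgue. (\<lambda>m. (norm (q m x))\<^sup>2) \<longlonglongrightarrow> (norm (D x))\<^sup>2"
      using CR(1) by (intro AE_I2 tendsto_intros) auto
    have "norm ((norm (q m x))\<^sup>2) \<le> C\<^sup>2 * indicator (cball 0 R) x" for m x
    proof -
      have "(norm (q m x))\<^sup>2 \<le> (C * indicator (cball 0 R) x)\<^sup>2" using CR(2) by (intro power_mono) auto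
      then show ?thesis by (cases "x \<in> cball 0 R") (simp_all del: mem_cball_0 mem_cball)
    qed
    then show "AE x in lebesgue. norm ((norm (q m x))\<^sup>2) \<le> C\<^sup>2 * indicator (cball 0 R) x" for m
      by (rule AE_I2)
  qed
  moreover have "(N v)\<^sup>2 \<le> (LINT x|lebesgue. (norm (q m x))\<^sup>2)" for m
  proof -
    have "N v \<le> real (Suc m) * N ((1 / real (Suc m)) *\<^sub>R v)"
      using N_mult[of "Suc m" "(1 / real (Suc m)) *\<^sub>R v"] by (simp del: of_nat_Suc)
    also have "\<dots> = norm (abs_lsq (q m))"
    proof -
      have "abs_lsq (q m) = real (Suc m) *\<^sub>R abs_lsq (\<lambda>x. \<phi> (x + (1 / real (Suc m)) *\<^sub>R v) - \<phi> x)"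
        unfolding q_def[abs_def] by (rule abs_lsq_arith(4)[OF sq, symmetric])
      then show ?thesis by (simp add: N_def del: of_nat_Suc)
    qed
    finally have "(N v)\<^sup>2 \<le> (norm (abs_lsq (q m)))\<^sup>2" by (intro power_mono) (auto simp: N_def)
    then show ?thesis by (simp add: norm_abs_lsq[OF qs])
  qed
  ultimately have "(N v)\<^sup>2 \<le> (LINT x|lebesgue. (norm (D x))\<^sup>2)" by (intro LIMSEQ_le_const) auto
  also have Dsq: "sq_int D"
    by (rule sq_int_bound[OF test_functions_L2(6)[OF \<Omega> \<phi>], where c = "norm v"])
      (use Dm in \<open>auto simp: measurable_completion Deq intro!: norm_sum_scaleR_vec_le\<close>)
  have "(LINT x|lebesgue. (norm (D x))\<^sup>2) = (norm (abs_lsq D))\<^sup>2" by (rule norm_abs_lsq[OF Dsq, symmetric])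
  also have "\<dots> \<le> (norm v * norm (abs_lsq (grad \<phi>)))\<^sup>2"
    by (intro power_mono norm_abs_lsq_mono[OF Dsq test_functions_L2(6)[OF \<Omega> \<phi>]])
      (auto simp: Deq intro!: norm_sum_scaleR_vec_le)
  finally show "norm (abs_lsq (\<lambda>x. \<phi> (x + v) - \<phi> x)) \<le> norm v * norm (abs_lsq (grad \<phi>))"
    unfolding N_def by (rule power2_le_imp_le) simp
qed

subsection \<open>Compactness\<close>

text \<open>The mean of \<open>\<phi>\<close> over the ball of radius \<open>d\<close> about
  \<open>x\<close>. For fixed \<open>x\<close> it is a constant times a pairing with an L2 function
  (\<open>ball_avg_inner\<close>), so weak convergence gives pointwise convergence of the means.
  Integrating over shifts \<open>h\<close> in a fixed ball suits Fubini's theorem.\<close>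

definition ball_avg :: "real \<Rightarrow> ('a::euclidean_space \<Rightarrow> complex) \<Rightarrow> 'a \<Rightarrow> complex" where
  "ball_avg d \<phi> x = (1 / measure lborel (cball (0::'a) d)) *\<^sub>R (LINT h|lborel. indicator (cball 0 d) h *\<^sub>R \<phi> (x + h))"

lemma ball_avg_eq:
  fixes \<phi> :: "'a::euclidean_space \<Rightarrow> complex"
  assumes [measurable]: "\<phi> \<in> borel_measurable borel"
  shows "ball_avg d \<phi> x = (1 / measure lborel (cball (0::'a) d)) *\<^sub>R (LINT y|lebesgue. indicator (cball x d) y *\<^sub>R \<phi> y)"
proof -
  have m1: "(\<lambda>y. indicator (cball x d) y *\<^sub>R \<phi> y) \<in> borel_measurable borel"
    using assms by (intro borel_measurable_scaleR borel_measurable_indicator) auto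
  have m2: "(\<lambda>h. indicator (cball x d) (h + x) *\<^sub>R \<phi> (h + x)) \<in> borel_measurable lborel"
    using measurable_compose[OF _ m1, of "\<lambda>h. h + x" borel] by simp
  have "(LINT y|lebesgue. indicator (cball x d) y *\<^sub>R \<phi> y) = (LINT h|lebesgue. indicator (cball x d) (h + x) *\<^sub>R \<phi> (h + x))"
    by (rule integral_translation(1)[OF m1, symmetric])
  also have "\<dots> = (LINT h|lborel. indicator (cball x d) (h + x) *\<^sub>R \<phi> (h + x))" by (rule integral_completion[OF m2])
  also have "(\<lambda>h. indicator (cball x d) (h + x) *\<^sub>R \<phi> (h + x)) = (\<lambda>h. indicator (cball 0 d) h *\<^sub>R \<phi> (x + h))"
    by (auto simp: fun_eq_iff indicator_def dist_norm add.commute)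
  finally show ?thesis by (simp add: ball_avg_def)
qed

lemma measure_cball_eq:
  fixes x :: "'a::euclidean_space"
  shows "measure lborel (cball x d) = measure lborel (cball (0::'a) d)"
proof (cases "d \<ge> 0")
  case True then show ?thesis using content_cball[of d x] content_cball[of d "0::'a"] by simp
qed simp

lemma ball_avg_inner:
  fixes \<phi> :: "'a::euclidean_space \<Rightarrow> complex"
  assumes m: "\<phi> \<in> borel_measurable borel" and sq: "sq_int \<phi>"
  shows "sq_int (\<lambda>y. indicator (cball x d) y *\<^sub>R (b::complex))"
    "inner (ball_avg d \<phi> x) b = (1 / measure lborel (cball (0::'a) d)) * inner (abs_lsq \<phi>) (abs_lsq (\<lambda>y. indicator (cball x d) y *\<^sub>R b))"
    "norm (abs_lsq (\<lambda>y. indicator (cball x d) y *\<^sub>R b)) = sqrt (measure lborel (cball (0::'a) d)) * norm b"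
proof -
  have i: "integrable lebesgue (\<lambda>y. indicator (cball x d) y * r)" for r :: real
    using lmeasurable_cball[of x d] by (auto simp: fmeasurable_def)
  have eq: "(norm (indicator (cball x d) y *\<^sub>R b))\<^sup>2 = indicator (cball x d) y * (norm b)\<^sup>2" for y
    by (simp add: indicator_def)
  show s: "sq_int (\<lambda>y. indicator (cball x d) y *\<^sub>R b)"
    unfolding sq_int_def eq using i by (auto intro!: borel_measurable_scaleR borel_measurable_indicator)
  have ib: "integrable lebesgue (\<lambda>y. indicator (cball x d) y *\<^sub>R \<phi> y)"
    by (rule sq_int_integrable_on[OF sq lmeasurable_cball])
  have "inner (abs_lsq \<phi>) (abs_lsq (\<lambda>y. indicator (cball x d) y *\<^sub>R b)) = (LINT y|lebesgue. inner (indicator (cball x d) y *\<^sub>R \<phi> y) b)"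
    unfolding abs_lsq_arith(5)[OF sq s] by simp
  also have "\<dots> = inner (LINT y|lebesgue. indicator (cball x d) y *\<^sub>R \<phi> y) b"
    by (rule integral_inner_left) (use ib in auto)
  finally show "inner (ball_avg d \<phi> x) b = (1 / measure lborel (cball (0::'a) d)) * inner (abs_lsq \<phi>) (abs_lsq (\<lambda>y. indicator (cball x d) y *\<^sub>R b))"
    by (simp add: ball_avg_eq[OF m])
  have "(norm (abs_lsq (\<lambda>y. indicator (cball x d) y *\<^sub>R b)))\<^sup>2 = measure lborel (cball (0::'a) d) * (norm b)\<^sup>2"
    unfolding norm_abs_lsq[OF s] eq using i[of 1] by (simp add: measure_cball_eq[of x])
  then show "norm (abs_lsq (\<lambda>y. indicator (cball x d) y *\<^sub>R b)) = sqrt (measure lborel (cball (0::'a) d)) * norm b"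
    by (metis abs_norm_cancel real_sqrt_abs real_sqrt_mult)
qed

lemma ball_avg_norm_le:
  fixes \<phi> :: "'a::euclidean_space \<Rightarrow> complex" and d :: real
  assumes "\<phi> \<in> borel_measurable borel" "sq_int \<phi>"
  defines "\<beta> \<equiv> measure lborel (cball (0::'a) d)"
  shows "norm (ball_avg d \<phi> x) \<le> (1 / \<beta>) * (norm (abs_lsq \<phi>) * sqrt \<beta>)"
proof -
  define z where "z = ball_avg d \<phi> x"
  \<comment> \<open>Pairing with the phase of \<open>z\<close> recovers its modulus.\<close>
  define b where "b = sgn z"
  have b: "norm b \<le> 1" by (simp add: b_def norm_sgn)
  have "norm z = inner z b" by (cases "z = 0") (simp_all add: b_def sgn_div_norm power2_norm_eq_inner[symmetric] power2_eq_square)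
  also have "\<dots> = (1 / \<beta>) * inner (abs_lsq \<phi>) (abs_lsq (\<lambda>y. indicator (cball x d) y *\<^sub>R b))"
    unfolding z_def \<beta>_def by (rule ball_avg_inner(2)[OF assms(1,2)])
  also have "\<dots> \<le> (1 / \<beta>) * (norm (abs_lsq \<phi>) * norm (abs_lsq (\<lambda>y. indicator (cball x d) y *\<^sub>R b)))"
    by (intro mult_left_mono norm_cauchy_schwarz) (simp add: \<beta>_def)
  also have "\<dots> = (1 / \<beta>) * (norm (abs_lsq \<phi>) * (sqrt \<beta> * norm b))"
    unfolding \<beta>_def ball_avg_inner(3)[OF assms(1,2)] ..
  also have "\<dots> \<le> (1 / \<beta>) * (norm (abs_lsq \<phi>) * sqrt \<beta>)"
    using b by (intro mult_left_mono) (auto simp: \<beta>_def mult_left_le)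
  finally show ?thesis by (simp add: z_def)
qed

lemma ball_avg_borel:
  fixes \<phi> :: "'a::euclidean_space \<Rightarrow> complex"
  assumes "\<phi> \<in> borel_measurable borel"
  shows "ball_avg d \<phi> \<in> borel_measurable borel"
proof -
  have "(\<lambda>p. indicator (cball 0 d) (snd p) *\<^sub>R \<phi> (fst p + snd p)) \<in> borel_measurable (borel \<Otimes>\<^sub>M lborel)"
    by (rule borel_measurable_scaleR[OF measurable_compose[OF measurable_snd borel_measurable_indicator]
          measurable_compose[OF _ assms]]) auto
  then have "(\<lambda>x. LINT h|lborel. indicator (cball 0 d) h *\<^sub>R \<phi> (x + h)) \<in> borel_measurable borel"
    by (intro lborel.borel_measurable_lebesgue_integral) (simp add: split_beta')
  then show ?thesis unfolding ball_avg_def[abs_def] by measurable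
qed

text \<open>Cauchy-Schwarz against the indicator of \<open>B\<close>; for ball means it takes the
  place of Jensen's inequality.\<close>

lemma norm_integral_power2_le:
  fixes f :: "'a::euclidean_space \<Rightarrow> complex"
  assumes m: "f \<in> borel_measurable borel" and bd: "\<And>x. norm (f x) \<le> C" and B: "B \<in> sets borel" "B \<in> lmeasurable"
  shows "(norm (LINT x|lborel. indicator B x *\<^sub>R f x))\<^sup>2 \<le> measure lborel B * (LINT x|lborel. indicator B x * (norm (f x))\<^sup>2)"
proof -
  define g where "g x = indicator B x *\<^sub>R norm (f x)" for x
  define k where "k x = (indicator B x :: real)" for x
  have iB: "integrable lebesgue (\<lambda>x. indicator B x * r)" for r :: real
    using B(2) by (auto simp: fmeasurable_def)
  have gm: "g \<in> borel_measurable borel" "(\<lambda>x. indicator B x *\<^sub>R f x) \<in> borel_measurable borel"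
    unfolding g_def using m B(1) by measurable
  have ksq: "sq_int k" unfolding sq_int_def
  proof
    show "k \<in> borel_measurable lebesgue" unfolding k_def using B(2) by (intro borel_measurable_indicator) auto
    have "(\<lambda>x. (norm (k x))\<^sup>2) = (\<lambda>x. indicator B x * 1)" by (auto simp: k_def indicator_def)
    then show "integrable lebesgue (\<lambda>x. (norm (k x))\<^sup>2)" using iB[of 1] by simp
  qed
  have C: "C \<ge> 0" using bd norm_ge_zero order_trans by blast
  have gsq: "sq_int g"
    by (rule sq_int_bound[OF ksq, where c = C])
      (use gm bd C in \<open>auto simp: measurable_completion g_def k_def indicator_def\<close>)
  have "norm (LINT x|lborel. indicator B x *\<^sub>R f x) \<le> (LINT x|lborel. norm (indicator B x *\<^sub>R f x))"
    by (rule integral_norm_bound)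
  also have "\<dots> = (LINT x|lborel. g x)" by (simp add: g_def)
  also have "\<dots> = (LINT x|lebesgue. g x)" using gm by (simp add: integral_completion)
  also have "\<dots> = inner (abs_lsq k) (abs_lsq g)"
    unfolding abs_lsq_arith(5)[OF ksq gsq]
    by (rule Bochner_Integration.integral_cong) (auto simp: k_def g_def indicator_def)
  also have "\<dots> \<le> norm (abs_lsq k) * norm (abs_lsq g)" by (rule norm_cauchy_schwarz)
  finally have "(norm (LINT x|lborel. indicator B x *\<^sub>R f x))\<^sup>2 \<le> (norm (abs_lsq k) * norm (abs_lsq g))\<^sup>2"
    by (intro power_mono) auto
  also have "\<dots> = (LINT x|lebesgue. (norm (k x))\<^sup>2) * (LINT x|lebesgue. (norm (g x))\<^sup>2)"
    by (simp add: power_mult_distrib norm_abs_lsq ksq gsq)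
  also have "(LINT x|lebesgue. (norm (k x))\<^sup>2) = (LINT x|lebesgue. indicator B x)"
    by (rule Bochner_Integration.integral_cong) (auto simp: k_def indicator_def)
  also have "(LINT x|lebesgue. indicator B x) = measure lborel B" using B by simp
  also have "(LINT x|lebesgue. (norm (g x))\<^sup>2) = (LINT x|lborel. (norm (g x))\<^sup>2)"
    using gm by (intro integral_completion) measurable
  also have "\<dots> = (LINT x|lborel. indicator B x * (norm (f x))\<^sup>2)"
    by (rule Bochner_Integration.integral_cong) (auto simp: g_def indicator_def)
  finally show ?thesis .
qed

text \<open>The squared error at \<open>x\<close> is at most the mean over the shifts
  \<open>h\<close> of the squared increment of \<open>\<phi>\<close>. Exchanging the integrals
  leaves a mean of translation errors, each at most \<open>d\<close> times the norm of the
  gradient.\<close>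

lemma ball_avg_approx:
  fixes \<phi> :: "real ^ 'n \<Rightarrow> complex"
  assumes \<Omega>: "open \<Omega>" and \<phi>: "\<phi> \<in> test_functions \<Omega>" and d: "d > 0"
  shows "(\<integral>\<^sup>+x. ennreal ((norm (ball_avg d \<phi> x - \<phi> x))\<^sup>2) \<partial>lborel) \<le> ennreal ((d * norm (abs_lsq (grad \<phi>)))\<^sup>2)"
proof -
  obtain K where K: "compact K" "K \<subseteq> \<Omega>" "\<And>x. x \<notin> K \<Longrightarrow> \<phi> x = 0" using test_functionsE[OF \<phi>] by blast
  note c = continuous_compact_support[OF test_functions_continuous[OF \<phi>] K(1,3)]
  obtain C where C: "\<And>x. norm (\<phi> x) \<le> C" using c(1) by blast
  have [measurable]: "\<phi> \<in> borel_measurable borel" by (rule c(3))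
  define \<beta> where "\<beta> = measure lborel (cball (0 :: real ^ 'n) d)"
  have \<beta>: "\<beta> > 0" using d content_cball_pos by (simp add: \<beta>_def)
  have B: "cball (0 :: real ^ 'n) d \<in> sets borel" "cball (0 :: real ^ 'n) d \<in> lmeasurable" by auto
  define G where "G x h = (norm (\<phi> (x + h) - \<phi> x))\<^sup>2" for x h
  have G0: "G x h \<ge> 0" for x h by (simp add: G_def)
  have C2: "norm (\<phi> (x + h) - \<phi> x) \<le> 2 * C" for x h
    using norm_triangle_ineq4[of "\<phi> (x + h)" "\<phi> x"] C[of x] C[of "x + h"] by linarith
  have eB: "emeasure lborel (cball (0 :: real ^ 'n) d) = ennreal \<beta>"
    unfolding \<beta>_def by (rule emeasure_eq_ennreal_measure) (use emeasure_lborel_cball_finite in \<open>auto simp: less_top[symmetric]\<close>)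
  have pt: "ennreal ((norm (ball_avg d \<phi> x - \<phi> x))\<^sup>2)
      \<le> ennreal (1 / \<beta>) * (\<integral>\<^sup>+h. indicator (cball 0 d) h * ennreal (G x h) \<partial>lborel)" for x
  proof -
    have i1: "integrable lborel (\<lambda>h. indicator (cball 0 d) h *\<^sub>R \<phi> (x + h))"
      by (rule integrableI_bounded_set_indicator[where B = C]) (use C eB in auto)
    have i2: "integrable lborel (\<lambda>h. indicator (cball (0 :: real ^ 'n) d) h *\<^sub>R \<phi> x)"
      by (rule integrableI_bounded_set_indicator[where B = C]) (use C eB in auto)
    have gb: "\<bar>G x h\<bar> \<le> (2 * C)\<^sup>2" for h using power_mono[OF C2[of x h] norm_ge_zero, of 2] by (simp add: G_def)
    have i3: "integrable lborel (\<lambda>h. indicator (cball 0 d) h *\<^sub>R G x h)"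
      by (rule integrableI_bounded_set_indicator[where B = "(2 * C)\<^sup>2"]) (use gb eB in \<open>auto simp: G_def[abs_def]\<close>)
    have "(LINT h|lborel. indicator (cball (0 :: real ^ 'n) d) h *\<^sub>R \<phi> x) = \<beta> *\<^sub>R \<phi> x"
    proof -
      have "integrable lborel (indicator (cball (0 :: real ^ 'n) d) :: _ \<Rightarrow> real)"
        by (rule integrable_real_indicator) (use eB in auto)
      then show ?thesis by (subst integral_scaleR_left) (simp_all add: \<beta>_def)
    qed
    then have "ball_avg d \<phi> x - \<phi> x = (1 / \<beta>) *\<^sub>R ((LINT h|lborel. indicator (cball 0 d) h *\<^sub>R \<phi> (x + h))
        - (LINT h|lborel. indicator (cball (0 :: real ^ 'n) d) h *\<^sub>R \<phi> x))"
      using \<beta> by (simp add: ball_avg_def \<beta>_def[symmetric] scaleR_diff_right)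
    also have "\<dots> = (1 / \<beta>) *\<^sub>R (LINT h|lborel. indicator (cball 0 d) h *\<^sub>R (\<phi> (x + h) - \<phi> x))"
      using i1 i2 by (simp add: scaleR_diff_right)
    finally have "(norm (ball_avg d \<phi> x - \<phi> x))\<^sup>2
        = (1 / \<beta>)\<^sup>2 * (norm (LINT h|lborel. indicator (cball 0 d) h *\<^sub>R (\<phi> (x + h) - \<phi> x)))\<^sup>2"
      by (simp add: power_mult_distrib power_divide)
    also have "\<dots> \<le> (1 / \<beta>)\<^sup>2 * (\<beta> * (LINT h|lborel. indicator (cball 0 d) h * G x h))"
      unfolding \<beta>_def G_def
      by (intro mult_left_mono norm_integral_power2_le[where C = "2 * C"]) (use C2 in auto)
    also have "\<dots> = (1 / \<beta>) * (LINT h|lborel. indicator (cball 0 d) h * G x h)"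
      using \<beta> by (simp add: power2_eq_square)
    finally have "ennreal ((norm (ball_avg d \<phi> x - \<phi> x))\<^sup>2)
        \<le> ennreal ((1 / \<beta>) * (LINT h|lborel. indicator (cball 0 d) h * G x h))" by (rule ennreal_leI)
    also have "\<dots> = ennreal (1 / \<beta>) * ennreal (LINT h|lborel. indicator (cball 0 d) h * G x h)"
      using \<beta> G0 by (intro ennreal_mult Bochner_Integration.integral_nonneg) (auto simp: indicator_def)
    also have "ennreal (LINT h|lborel. indicator (cball 0 d) h * G x h) = (\<integral>\<^sup>+h. ennreal (indicator (cball 0 d) h * G x h) \<partial>lborel)"
      using i3 G0 by (intro nn_integral_eq_integral[symmetric]) (auto simp: indicator_def)
    also have "\<dots> = (\<integral>\<^sup>+h. indicator (cball 0 d) h * ennreal (G x h) \<partial>lborel)"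
      using G0 by (intro nn_integral_cong) (simp add: ennreal_mult ennreal_indicator)
    finally show ?thesis .
  qed
  have Gm[measurable]: "(\<lambda>(x, h). indicator (cball 0 d) h * ennreal (G x h)) \<in> borel_measurable (lborel \<Otimes>\<^sub>M lborel)"
  proof -
    have "(\<lambda>p. indicator (cball 0 d) (snd p) :: ennreal) \<in> borel_measurable (lborel \<Otimes>\<^sub>M lborel)"
      by (rule measurable_compose[OF measurable_snd borel_measurable_indicator]) auto
    moreover have "(\<lambda>p. \<phi> (fst p + snd p)) \<in> borel_measurable (lborel \<Otimes>\<^sub>M lborel)"
      by (rule measurable_compose[OF _ c(3)]) simp
    moreover have "(\<lambda>p. \<phi> (fst p)) \<in> borel_measurable (lborel \<Otimes>\<^sub>M lborel)"
      by (rule measurable_compose[OF measurable_fst]) (use c(3) in simp)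
    ultimately show ?thesis unfolding G_def split_beta' by measurable
  qed
  have trans: "(\<integral>\<^sup>+x. ennreal (G x h) \<partial>lborel) \<le> ennreal ((d * norm (abs_lsq (grad \<phi>)))\<^sup>2)" if h: "h \<in> cball 0 d" for h
  proof -
    note te = translation_estimate[OF \<Omega> \<phi>, of h]
    have "(\<integral>\<^sup>+x. ennreal (G x h) \<partial>lborel) = (\<integral>\<^sup>+x. ennreal (G x h) \<partial>lebesgue)" by (simp add: nn_integral_completion)
    also have "\<dots> = ennreal (LINT x|lebesgue. G x h)"
      unfolding G_def using sq_int_integrable[OF te(1)] by (intro nn_integral_eq_integral) auto
    also have "(LINT x|lebesgue. G x h) = (norm (abs_lsq (\<lambda>x. \<phi> (x + h) - \<phi> x)))\<^sup>2"
      unfolding G_def norm_abs_lsq[OF te(1)] ..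
    also have "ennreal \<dots> \<le> ennreal ((d * norm (abs_lsq (grad \<phi>)))\<^sup>2)"
      using te(2) h by (intro ennreal_leI power_mono order_trans[OF te(2)] mult_right_mono) auto
    finally show ?thesis .
  qed
  have "(\<integral>\<^sup>+x. ennreal ((norm (ball_avg d \<phi> x - \<phi> x))\<^sup>2) \<partial>lborel)
      \<le> (\<integral>\<^sup>+x. ennreal (1 / \<beta>) * (\<integral>\<^sup>+h. indicator (cball 0 d) h * ennreal (G x h) \<partial>lborel) \<partial>lborel)"
    by (intro nn_integral_mono pt)
  also have "\<dots> = ennreal (1 / \<beta>) * (\<integral>\<^sup>+x. (\<integral>\<^sup>+h. indicator (cball 0 d) h * ennreal (G x h) \<partial>lborel) \<partial>lborel)"
    by (rule nn_integral_cmult) (use Gm in measurable)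
  also have "(\<integral>\<^sup>+x. (\<integral>\<^sup>+h. indicator (cball 0 d) h * ennreal (G x h) \<partial>lborel) \<partial>lborel)
      = (\<integral>\<^sup>+h. (\<integral>\<^sup>+x. indicator (cball 0 d) h * ennreal (G x h) \<partial>lborel) \<partial>lborel)"
    by (rule lborel_pair.Fubini'[symmetric]) (rule Gm)
  also have "\<dots> \<le> (\<integral>\<^sup>+h. ennreal ((d * norm (abs_lsq (grad \<phi>)))\<^sup>2) * indicator (cball (0 :: real ^ 'n) d) h \<partial>lborel)"
  proof (rule nn_integral_mono)
    fix h :: "real ^ 'n"
    show "(\<integral>\<^sup>+x. indicator (cball 0 d) h * ennreal (G x h) \<partial>lborel)
        \<le> ennreal ((d * norm (abs_lsq (grad \<phi>)))\<^sup>2) * indicator (cball 0 d) h"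
      using trans[of h] by (cases "h \<in> cball 0 d") (simp_all add: indicator_def)
  qed
  also have "\<dots> = ennreal ((d * norm (abs_lsq (grad \<phi>)))\<^sup>2) * ennreal \<beta>"
    by (simp add: nn_integral_cmult_indicator eB)
  also have "ennreal (1 / \<beta>) * (ennreal ((d * norm (abs_lsq (grad \<phi>)))\<^sup>2) * ennreal \<beta>)
      = ennreal ((d * norm (abs_lsq (grad \<phi>)))\<^sup>2)"
    using \<beta> by (simp add: field_simps flip: ennreal_mult)
  finally show ?thesis by (simp add: mult_left_mono)
qed

text \<open>Compare \<open>\<phi> k\<close> with its ball means. The error is at most
  \<open>d * M\<close> for all \<open>k\<close>; for fixed \<open>d\<close> the means are uniformly
  bounded and tend to 0 pointwise by weak convergence, hence in L2 on \<open>\<Omega>\<close>, which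
  has finite measure.\<close>

lemma rellich_test:
  fixes \<phi> :: "nat \<Rightarrow> real ^ 'n \<Rightarrow> complex"
  assumes \<Omega>: "open \<Omega>" "\<Omega> \<in> lmeasurable" and \<phi>: "\<And>k. \<phi> k \<in> test_functions \<Omega>"
    and bd: "\<And>k. norm (abs_lsq (\<phi> k)) \<le> M" "\<And>k. norm (abs_lsq (grad (\<phi> k))) \<le> M"
    and weak: "weak_lim (\<lambda>k. abs_lsq (\<phi> k)) 0"
  shows "(\<lambda>k. abs_lsq (\<phi> k)) \<longlonglongrightarrow> 0"
proof -
  have M: "M \<ge> 0" using bd(1)[of 0] norm_ge_zero order_trans by blast
  have sq: "sq_int (\<phi> k)" for k using test_functions_L2(3)[OF \<Omega>(1) \<phi>] .
  have m[measurable]: "\<phi> k \<in> borel_measurable borel" for k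
    by (rule borel_measurable_continuous_onI[OF test_functions_continuous[OF \<phi>]])
  have Om: "\<Omega> \<in> sets lebesgue" using \<Omega>(2) by blast
  have jm[measurable]: "ball_avg d (\<phi> k) \<in> borel_measurable borel" for d k by (rule ball_avg_borel) measurable
  have J: "(\<lambda>k. LINT x|lebesgue. indicator \<Omega> x * (norm (ball_avg d (\<phi> k) x))\<^sup>2) \<longlonglongrightarrow> 0"
    and Ji: "\<And>k. integrable lebesgue (\<lambda>x. indicator \<Omega> x * (norm (ball_avg d (\<phi> k) x))\<^sup>2)" if d: "d > 0" for d
  proof -
    define \<beta> where "\<beta> = measure lborel (cball (0 :: real ^ 'n) d)"
    define C where "C = (1 / \<beta>) * (M * sqrt \<beta>)"
    have nb: "norm (ball_avg d (\<phi> k) x) \<le> C" for k x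
    proof -
      have "norm (ball_avg d (\<phi> k) x) \<le> (1 / \<beta>) * (norm (abs_lsq (\<phi> k)) * sqrt \<beta>)"
        unfolding \<beta>_def by (rule ball_avg_norm_le[OF m sq])
      also have "\<dots> \<le> C" unfolding C_def
        by (intro mult_left_mono mult_right_mono bd) (auto simp: \<beta>_def)
      finally show ?thesis .
    qed
    have mm: "(\<lambda>x. indicator \<Omega> x * (norm (ball_avg d (\<phi> k) x))\<^sup>2) \<in> borel_measurable lebesgue" for k
    proof -
      have "(\<lambda>x. (norm (ball_avg d (\<phi> k) x))\<^sup>2) \<in> borel_measurable lebesgue"
        by (rule measurable_completion) measurable
      then show ?thesis using Om by (intro borel_measurable_times borel_measurable_indicator)
    qed
    have wi: "integrable lebesgue (\<lambda>x. C\<^sup>2 * indicator \<Omega> x)" using \<Omega>(2) by (auto simp: fmeasurable_def)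
    have dom: "norm (indicator \<Omega> x * (norm (ball_avg d (\<phi> k) x))\<^sup>2) \<le> C\<^sup>2 * indicator \<Omega> x" for x k
      using power_mono[OF nb norm_ge_zero, of k x 2] by (auto simp: indicator_def)
    show "integrable lebesgue (\<lambda>x. indicator \<Omega> x * (norm (ball_avg d (\<phi> k) x))\<^sup>2)" for k
      by (rule Bochner_Integration.integrable_bound[OF wi mm]) (use dom in \<open>auto simp: abs_mult\<close>)
    have "(\<lambda>k. ball_avg d (\<phi> k) x) \<longlonglongrightarrow> 0" for x
    proof -
      have "(\<lambda>k. inner (ball_avg d (\<phi> k) x) b) \<longlonglongrightarrow> 0" for b
      proof -
        have "(\<lambda>k. (1 / measure lborel (cball (0 :: real ^ 'n) d)) * inner (abs_lsq (\<phi> k)) (abs_lsq (\<lambda>y. indicator (cball x d) y *\<^sub>R b)))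
          \<longlonglongrightarrow> (1 / measure lborel (cball (0 :: real ^ 'n) d)) * inner 0 (abs_lsq (\<lambda>y. indicator (cball x d) y *\<^sub>R b))"
          by (intro tendsto_intros weak_limD[OF weak])
        then show ?thesis by (simp add: ball_avg_inner(2)[OF m sq])
      qed
      from this[of 1] this[of \<i>] show ?thesis by (simp add: tendsto_complex_iff)
    qed
    then have "(\<lambda>k. LINT x|lebesgue. indicator \<Omega> x * (norm (ball_avg d (\<phi> k) x))\<^sup>2) \<longlonglongrightarrow> (LINT x|lebesgue. indicator \<Omega> x * (norm (0::complex))\<^sup>2)"
    proof (intro integral_dominated_convergence[OF _ mm wi] AE_I2 dom)
      show "(\<lambda>k. indicator \<Omega> x * (norm (ball_avg d (\<phi> k) x))\<^sup>2) \<longlonglongrightarrow> indicator \<Omega> x * (norm (0::complex))\<^sup>2"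
        if "\<And>x. (\<lambda>k. ball_avg d (\<phi> k) x) \<longlonglongrightarrow> 0" for x
        by (intro tendsto_mult tendsto_const tendsto_power tendsto_norm that)
    qed auto
    then show "(\<lambda>k. LINT x|lebesgue. indicator \<Omega> x * (norm (ball_avg d (\<phi> k) x))\<^sup>2) \<longlonglongrightarrow> 0" by simp
  qed
  have est: "(norm (abs_lsq (\<phi> k)))\<^sup>2 \<le> 2 * (d * M)\<^sup>2 + 2 * (LINT x|lebesgue. indicator \<Omega> x * (norm (ball_avg d (\<phi> k) x))\<^sup>2)"
    if d: "d > 0" for d k
  proof -
    define A where "A x = ball_avg d (\<phi> k) x - \<phi> k x" for x
    have le: "(\<integral>\<^sup>+x. ennreal ((norm (A x))\<^sup>2) \<partial>lborel) \<le> ennreal ((d * M)\<^sup>2)"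
    proof -
      have "(d * norm (abs_lsq (grad (\<phi> k))))\<^sup>2 \<le> (d * M)\<^sup>2"
        using d bd(2) by (intro power_mono mult_left_mono) auto
      then show ?thesis
        using ball_avg_approx[OF \<Omega>(1) \<phi> d, of k] unfolding A_def by (meson ennreal_leI order_trans)
    qed
    have Am: "(\<lambda>x. (norm (A x))\<^sup>2) \<in> borel_measurable borel" unfolding A_def by measurable
    have Ai: "integrable lborel (\<lambda>x. (norm (A x))\<^sup>2)"
      by (rule integrableI_bounded) (use Am le in \<open>auto simp: order_le_less_trans\<close>)
    have Ale: "(LINT x|lebesgue. (norm (A x))\<^sup>2) \<le> (d * M)\<^sup>2"
    proof -
      have "ennreal (LINT x|lborel. (norm (A x))\<^sup>2) \<le> ennreal ((d * M)\<^sup>2)"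
        using le nn_integral_eq_integral[OF Ai] by simp
      then show ?thesis using Am by (simp add: integral_completion)
    qed
    have Ai': "integrable lebesgue (\<lambda>x. (norm (A x))\<^sup>2)" using Ai Am by (simp add: integrable_completion)
    have z: "\<phi> k x = 0" if "x \<notin> \<Omega>" for x using \<phi>[of k] that by (auto simp: test_functions_def)
    have "(norm (\<phi> k x))\<^sup>2 \<le> 2 * (norm (A x))\<^sup>2 + 2 * (indicator \<Omega> x * (norm (ball_avg d (\<phi> k) x))\<^sup>2)" for x
    proof (cases "x \<in> \<Omega>")
      case True
      have "norm (\<phi> k x) \<le> norm (A x) + norm (ball_avg d (\<phi> k) x)"
        using norm_triangle_ineq4[of "ball_avg d (\<phi> k) x" "A x"] by (simp add: A_def)
      then have "(norm (\<phi> k x))\<^sup>2 \<le> (norm (A x) + norm (ball_avg d (\<phi> k) x))\<^sup>2" by (intro power_mono) auto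
      also have "\<dots> \<le> 2 * (norm (A x))\<^sup>2 + 2 * (norm (ball_avg d (\<phi> k) x))\<^sup>2"
        using sum_squares_bound[of "norm (A x)" "norm (ball_avg d (\<phi> k) x)"] by (simp add: power2_sum)
      finally show ?thesis using True by simp
    qed (simp add: z)
    then have "(LINT x|lebesgue. (norm (\<phi> k x))\<^sup>2)
        \<le> (LINT x|lebesgue. 2 * (norm (A x))\<^sup>2 + 2 * (indicator \<Omega> x * (norm (ball_avg d (\<phi> k) x))\<^sup>2))"
      using Ai' Ji[OF d, of k] sq_int_integrable[OF sq[of k]]
      by (intro integral_mono Bochner_Integration.integrable_add integrable_mult_right) auto
    also have "\<dots> = 2 * (LINT x|lebesgue. (norm (A x))\<^sup>2) + 2 * (LINT x|lebesgue. indicator \<Omega> x * (norm (ball_avg d (\<phi> k) x))\<^sup>2)"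
      using Ai' Ji[OF d, of k] by simp
    finally show ?thesis using Ale by (simp add: norm_abs_lsq[OF sq])
  qed
  have "(\<lambda>k. (norm (abs_lsq (\<phi> k)))\<^sup>2) \<longlonglongrightarrow> 0"
  proof (rule LIMSEQ_I)
    fix e :: real assume e: "e > 0"
    \<comment> \<open>Chosen so that \<open>2 * (d * M)\<^sup>2 \<le> e / 2\<close>; the summand 1
      avoids division by 0 when \<open>M = 0\<close>.\<close>
    define d where "d = sqrt (e / 4) / (M + 1)"
    have d: "d > 0" using e M by (simp add: d_def)
    have "d * M \<le> sqrt (e / 4)" using e M by (simp add: d_def field_simps)
    then have "(d * M)\<^sup>2 \<le> (sqrt (e / 4))\<^sup>2" using d M by (intro power_mono) auto
    then have dM: "2 * (d * M)\<^sup>2 \<le> e / 2" using e by simp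
    obtain N where N: "\<And>k. k \<ge> N \<Longrightarrow> norm ((LINT x|lebesgue. indicator \<Omega> x * (norm (ball_avg d (\<phi> k) x))\<^sup>2) - 0) < e / 4"
      using LIMSEQ_D[OF J[OF d], of "e / 4"] e by auto
    have "norm ((norm (abs_lsq (\<phi> k)))\<^sup>2 - 0) < e" if "k \<ge> N" for k
      using est[OF d, of k] N[OF that] dM by (simp add: abs_less_iff)
    then show "\<exists>no. \<forall>n\<ge>no. norm ((norm (abs_lsq (\<phi> n)))\<^sup>2 - 0) < e" by blast
  qed
  then have "(\<lambda>k. sqrt ((norm (abs_lsq (\<phi> k)))\<^sup>2)) \<longlonglongrightarrow> sqrt 0" by (rule tendsto_real_sqrt)
  then show ?thesis by (simp add: tendsto_norm_zero_iff)
qed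

text \<open>Test functions within \<open>1 / real (Suc k)\<close> of the given elements have the
  same weak limit and norms at most \<open>M + 1\<close>, so density reduces the claim to
  \<open>rellich_test\<close>.\<close>

lemma rellich:
  fixes s :: "nat \<Rightarrow> (real ^ 'n, complex) lsq \<times> (real ^ 'n, complex ^ 'n) lsq"
  assumes \<Omega>: "open \<Omega>" "\<Omega> \<in> lmeasurable" and s: "\<And>k. s k \<in> sobolev \<Omega>" "\<And>k. norm (s k) \<le> M"
    and weak: "weak_lim (\<lambda>k. fst (s k)) 0"
  shows "(\<lambda>k. fst (s k)) \<longlonglongrightarrow> 0"
proof -
  have "\<exists>f. f \<in> test_functions \<Omega> \<and> dist (graph \<Omega> f) (s k) < 1 / real (Suc k)" for k
    using s(1)[of k] unfolding sobolev_def closure_approachable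
    by (auto dest!: spec[of _ "1 / real (Suc k)"] simp del: of_nat_Suc)
  then obtain \<phi> where \<phi>: "\<And>k. \<phi> k \<in> test_functions \<Omega>" "\<And>k. dist (graph \<Omega> (\<phi> k)) (s k) < 1 / real (Suc k)"
    by metis
  have g: "graph \<Omega> (\<phi> k) = (abs_lsq (\<phi> k), abs_lsq (grad (\<phi> k)))" for k
    using test_H1(2)[OF \<Omega>(1) \<phi>(1)] test_functions_L2[OF \<Omega>(1) \<phi>(1)] by simp
  have nb: "norm (graph \<Omega> (\<phi> k)) \<le> M + 1" for k
  proof -
    have "norm (graph \<Omega> (\<phi> k)) \<le> norm (s k) + dist (graph \<Omega> (\<phi> k)) (s k)"
      using norm_triangle_sub[of "graph \<Omega> (\<phi> k)" "s k"] by (simp add: dist_norm)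
    also have "\<dots> \<le> M + 1" using s(2)[of k] \<phi>(2)[of k] by (smt (verit) divide_le_eq_1 of_nat_0_le_iff of_nat_Suc)
    finally show ?thesis .
  qed
  have d: "norm (abs_lsq (\<phi> k) - fst (s k)) \<le> 1 / real (Suc k)" for k
    using norm_fst_le[of "abs_lsq (\<phi> k) - fst (s k)" "abs_lsq (grad (\<phi> k)) - snd (s k)"] \<phi>(2)[of k] by (simp add: g dist_norm minus_prod_def del: of_nat_Suc)
  have diff: "(\<lambda>k. abs_lsq (\<phi> k) - fst (s k)) \<longlonglongrightarrow> 0"
  proof (rule Lim_null_comparison)
    show "\<forall>\<^sub>F k in sequentially. norm (abs_lsq (\<phi> k) - fst (s k)) \<le> 1 / real (Suc k)"
      by (intro always_eventually allI d)
    show "(\<lambda>k. 1 / real (Suc k)) \<longlonglongrightarrow> 0" by (rule LIMSEQ_Suc[OF lim_1_over_n])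
  qed
  have "weak_lim (\<lambda>k. abs_lsq (\<phi> k)) 0"
    unfolding weak_lim_def
  proof
    fix y
    have "(\<lambda>k. inner (abs_lsq (\<phi> k) - fst (s k)) y + inner (fst (s k)) y) \<longlonglongrightarrow> inner 0 y + inner 0 y"
      by (intro tendsto_intros diff weak_limD[OF weak])
    then show "(\<lambda>k. inner (abs_lsq (\<phi> k)) y) \<longlonglongrightarrow> inner 0 y" by (simp add: inner_diff_left)
  qed
  moreover have "norm (abs_lsq (\<phi> k)) \<le> M + 1" "norm (abs_lsq (grad (\<phi> k))) \<le> M + 1" for k
    using nb[of k] norm_fst_le[of "abs_lsq (\<phi> k)" "abs_lsq (grad (\<phi> k))"] norm_snd_le[of "abs_lsq (grad (\<phi> k))" "abs_lsq (\<phi> k)"] by (simp_all add: g)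
  ultimately have "(\<lambda>k. abs_lsq (\<phi> k)) \<longlonglongrightarrow> 0" by (intro rellich_test[OF \<Omega> \<phi>(1)])
  from tendsto_diff[OF this diff] show ?thesis by simp
qed

subsection \<open>Orthogonal transformations\<close>

lemma orthogonal_matrix_inverse:
  assumes "orthogonal_matrix M"
  shows "transpose M *v (M *v x) = x" "M *v (transpose M *v x) = x"
  using assms by (simp_all add: orthogonal_matrix_def matrix_vector_mul_assoc)

lemma nn_integral_lborel_affine:
  fixes f :: "'a::euclidean_space \<Rightarrow> ennreal"
  assumes f: "f \<in> borel_measurable borel"
  shows "(\<integral>\<^sup>+x. f (c + x) \<partial>lborel) = (\<integral>\<^sup>+x. f x \<partial>lborel)"
    "(\<integral>\<^sup>+x. f (c - x) \<partial>lborel) = (\<integral>\<^sup>+x. f x \<partial>lborel)"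
proof -
  have *: "(\<integral>\<^sup>+x. f (c + e *\<^sub>R x) \<partial>lborel) = (\<integral>\<^sup>+x. f x \<partial>lborel)" if "\<bar>e\<bar> = 1" for e
  proof -
    have "(\<lambda>x. c + e *\<^sub>R x) \<in> borel_measurable borel"
      by (intro borel_measurable_add borel_measurable_scaleR) auto
    then have "(\<integral>\<^sup>+x. f (c + e *\<^sub>R x) \<partial>lborel) = (\<integral>\<^sup>+x. f x \<partial>distr lborel borel (\<lambda>x. c + e *\<^sub>R x))"
      using f by (simp add: nn_integral_distr)
    also have "distr lborel borel (\<lambda>x. c + e *\<^sub>R x) = lborel"
      using lborel_affine[of e c] that by (auto simp: density_1)
    finally show ?thesis .
  qed
  show "(\<integral>\<^sup>+x. f (c + x) \<partial>lborel) = (\<integral>\<^sup>+x. f x \<partial>lborel)" using *[of 1] by simp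
  show "(\<integral>\<^sup>+x. f (c - x) \<partial>lborel) = (\<integral>\<^sup>+x. f x \<partial>lborel)" using *[of "-1"] by simp
qed

text \<open>The library version assumes a well-ordered index type. Here, as in the uniqueness of Haar
  measure, \<open>A\<close> is compared with a ball, which the isometry preserves.\<close>

lemma emeasure_linear_isometry:
  fixes T :: "'a::euclidean_space \<Rightarrow> 'a"
  assumes T: "linear T" "\<And>x. T (T' x) = x" "\<And>x. norm (T x) = norm x" and A: "A \<in> sets borel"
  shows "emeasure lborel (T -` A) = emeasure lborel A"
proof -
  define f :: "'a \<Rightarrow> ennreal" where "f = indicator A"
  define g :: "'a \<Rightarrow> ennreal" where "g = indicator (ball 0 1)"
  have fg: "f \<in> borel_measurable borel" "g \<in> borel_measurable borel" using A unfolding f_def g_def by (auto intro: borel_measurable_indicator)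
  have Tm: "T \<in> borel_measurable borel"
    by (intro borel_measurable_continuous_onI linear_continuous_on linear_conv_bounded_linear[THEN iffD1] T)
  have fT: "(\<lambda>x. f (T x)) \<in> borel_measurable borel" "(\<lambda>x. g (T x)) \<in> borel_measurable borel"
    using measurable_compose[OF Tm fg(1)] measurable_compose[OF Tm fg(2)] by auto
  have gT: "g (T x) = g x" for x using T(3)[of x] by (simp add: g_def indicator_def)
  have gi: "(\<integral>\<^sup>+x. g x \<partial>lborel) = emeasure lborel (ball (0::'a) 1)" by (simp add: g_def)
  have g_pos: "emeasure lborel (ball (0::'a) 1) \<noteq> 0" "emeasure lborel (ball (0::'a) 1) \<noteq> \<infinity>"
    using content_ball_pos[of 1 "0::'a"] emeasure_lborel_ball_finite[of "0::'a" 1]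
    by (auto simp: measure_def)
  have aT: "(\<lambda>p. T (fst p)) \<in> borel_measurable (lborel \<Otimes>\<^sub>M lborel)"
    by (rule measurable_compose[OF measurable_fst]) (use Tm in simp)
  have sn: "(\<lambda>p. snd p) \<in> borel_measurable (lborel \<Otimes>\<^sub>M (lborel :: 'a measure))" by simp
  have m1: "(\<lambda>p. f (T (fst p)) * g (T (fst p) + snd p)) \<in> borel_measurable (lborel \<Otimes>\<^sub>M lborel)"
    using measurable_compose[OF aT fg(1)] measurable_compose[OF borel_measurable_add[OF aT sn] fg(2)]
    by measurable
  have m2: "(\<lambda>p. f (T (fst p) - snd p) * g (T (fst p))) \<in> borel_measurable (lborel \<Otimes>\<^sub>M lborel)"
    using measurable_compose[OF borel_measurable_diff[OF aT sn] fg(1)] measurable_compose[OF aT fg(2)]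
    by measurable
  have sy: "(\<lambda>y. g (T x + y)) \<in> borel_measurable lborel" "(\<lambda>y. f (T x - y)) \<in> borel_measurable lborel" for x
    by (rule measurable_compose[OF _ fg(2)], simp, rule measurable_compose[OF _ fg(1)], simp)
  have "(\<integral>\<^sup>+x. f (T x) \<partial>lborel) * (\<integral>\<^sup>+y. g y \<partial>lborel) = (\<integral>\<^sup>+x. f (T x) * (\<integral>\<^sup>+y. g (T x + y) \<partial>lborel) \<partial>lborel)"
    using fT fg by (simp add: nn_integral_lborel_affine nn_integral_multc)
  also have "\<dots> = (\<integral>\<^sup>+x. \<integral>\<^sup>+y. f (T x) * g (T x + y) \<partial>lborel \<partial>lborel)"
    by (intro nn_integral_cong nn_integral_cmult[symmetric] sy)
  also have "\<dots> = (\<integral>\<^sup>+y. \<integral>\<^sup>+x. f (T x) * g (T x + y) \<partial>lborel \<partial>lborel)"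
    by (rule lborel_pair.Fubini'[symmetric]) (use m1 in \<open>simp add: split_beta'\<close>)
  \<comment> \<open>Translating \<open>x\<close> by \<open>- T' y\<close> turns \<open>T x\<close>
    into \<open>T x - y\<close>, which moves the shift from the ball factor to
    \<open>f\<close>.\<close>
  also have "\<dots> = (\<integral>\<^sup>+y. \<integral>\<^sup>+x. f (T x - y) * g (T x) \<partial>lborel \<partial>lborel)"
  proof (rule nn_integral_cong)
    fix y
    have "(\<lambda>x. f (T x) * g (T x + y)) \<in> borel_measurable borel"
      using fT(1) measurable_compose[OF borel_measurable_add[OF Tm borel_measurable_const] fg(2)] by measurable
    from nn_integral_lborel_affine(1)[OF this, of "- T' y", symmetric]
    show "(\<integral>\<^sup>+x. f (T x) * g (T x + y) \<partial>lborel) = (\<integral>\<^sup>+x. f (T x - y) * g (T x) \<partial>lborel)"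
      by (simp add: linear_add[OF T(1)] linear_neg[OF T(1)] linear_diff[OF T(1)] T(2))
  qed
  also have "\<dots> = (\<integral>\<^sup>+x. \<integral>\<^sup>+y. f (T x - y) * g (T x) \<partial>lborel \<partial>lborel)"
    by (rule lborel_pair.Fubini') (use m2 in \<open>simp add: split_beta'\<close>)
  also have "\<dots> = (\<integral>\<^sup>+x. (\<integral>\<^sup>+y. f (T x - y) \<partial>lborel) * g (T x) \<partial>lborel)"
    by (intro nn_integral_cong nn_integral_multc sy)
  also have "\<dots> = (\<integral>\<^sup>+y. f y \<partial>lborel) * (\<integral>\<^sup>+x. g x \<partial>lborel)"
    using fT fg by (simp add: nn_integral_lborel_affine nn_integral_cmult gT)
  finally have "(\<integral>\<^sup>+x. f (T x) \<partial>lborel) * emeasure lborel (ball (0::'a) 1)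
      = (\<integral>\<^sup>+y. f y \<partial>lborel) * emeasure lborel (ball (0::'a) 1)" by (simp only: gi)
  then have "(\<integral>\<^sup>+x. f (T x) \<partial>lborel) = (\<integral>\<^sup>+y. f y \<partial>lborel)"
    using g_pos by (simp add: mult.commute[of _ "emeasure lborel _"] ennreal_mult_cancel_left)
  moreover have "f (T x) = indicator (T -` A) x" for x by (simp add: f_def indicator_def)
  moreover have "T -` A \<in> sets borel" using measurable_sets[OF Tm A] by simp
  ultimately show ?thesis using A by (simp add: f_def)
qed

lemma distr_orthogonal:
  fixes M :: "real ^ 'n ^ 'n"
  assumes M: "orthogonal_matrix M"
  shows "(*v) M \<in> lebesgue \<rightarrow>\<^sub>M lebesgue" "distr lebesgue lebesgue ((*v) M) = lebesgue"
proof -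
  have T: "(*v) M \<in> borel_measurable borel"
    by (intro borel_measurable_continuous_onI linear_continuous_on matrix_vector_mul_bounded_linear)
  have ot: "orthogonal_transformation ((*v) M)" using M by (simp add: orthogonal_transformation_matrix)
  have em: "emeasure lborel ((*v) M -` A) = emeasure lborel A" if "A \<in> sets borel" for A
    using ot orthogonal_matrix_inverse(2)[OF M] that
    by (intro emeasure_linear_isometry[where T' = "(*v) (transpose M)"]) (simp_all add: orthogonal_transformation)
  have Tl: "(*v) M \<in> lebesgue \<rightarrow>\<^sub>M lborel" using T by (intro measurable_completion) simp
  have eq: "distr lebesgue lborel ((*v) M) = lborel"
  proof (rule measure_eqI)
    fix A assume A: "A \<in> sets (distr lebesgue lborel ((*v) M))"
    then have Ab: "A \<in> sets borel" by simp
    have "emeasure (distr lebesgue lborel ((*v) M)) A = emeasure lebesgue ((*v) M -` A)"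
      using Tl A by (simp add: emeasure_distr)
    also have "\<dots> = emeasure lborel ((*v) M -` A)" using measurable_sets[OF T Ab] by simp
    finally show "emeasure (distr lebesgue lborel ((*v) M)) A = emeasure lborel A" using em[OF Ab] by simp
  qed simp
  show "(*v) M \<in> lebesgue \<rightarrow>\<^sub>M lebesgue"
    by (rule completion.measurable_completion2[OF Tl]) (simp add: eq)
  have "completion (distr lebesgue lborel ((*v) M)) = distr lebesgue lebesgue ((*v) M)"
    by (rule completion.completion_distr_eq[OF Tl]) (simp add: eq)
  then show "distr lebesgue lebesgue ((*v) M) = lebesgue" by (simp add: eq)
qed

lemma AE_orthogonal:
  fixes M :: "real ^ 'n ^ 'n"
  assumes "orthogonal_matrix M" "AE x in lebesgue. P x"
  shows "AE x in lebesgue. P (M *v x)"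
  using AE_distrD[OF distr_orthogonal(1)[OF assms(1)], of P, unfolded distr_orthogonal(2)[OF assms(1)], OF assms(2)] .

lemma integral_orthogonal:
  fixes M :: "real ^ 'n ^ 'n" and f :: "real ^ 'n \<Rightarrow> 'b::euclidean_space"
  assumes M: "orthogonal_matrix M" and f: "f \<in> borel_measurable lebesgue"
  shows "(LINT x|lebesgue. f (M *v x)) = (LINT x|lebesgue. f x)"
    "integrable lebesgue (\<lambda>x. f (M *v x)) \<longleftrightarrow> integrable lebesgue f"
  using integral_distr[OF distr_orthogonal(1)[OF M] f] integrable_distr_eq[OF distr_orthogonal(1)[OF M] f]
  by (simp_all add: distr_orthogonal(2)[OF M])

text \<open>The preimage of \<open>\<Omega>\<close> contains \<open>\<Omega>\<close> up to a null
  set and has the same finite measure, so the two agree up to a null set.\<close>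

lemma AE_orthogonal_invariant:
  fixes M :: "real ^ 'n ^ 'n"
  assumes M: "orthogonal_matrix M" and \<Omega>: "\<Omega> \<in> lmeasurable" and inv: "AE x in lebesgue. x \<in> \<Omega> \<longrightarrow> M *v x \<in> \<Omega>"
  shows "AE x in lebesgue. M *v x \<in> \<Omega> \<longleftrightarrow> x \<in> \<Omega>"
proof -
  have m: "(indicator \<Omega> :: _ \<Rightarrow> real) \<in> borel_measurable lebesgue" using \<Omega> by (intro borel_measurable_indicator) auto
  have i: "integrable lebesgue (indicator \<Omega> :: _ \<Rightarrow> real)" using \<Omega> by (auto simp: fmeasurable_def)
  have i': "integrable lebesgue (\<lambda>x. indicator \<Omega> (M *v x) :: real)" using integral_orthogonal(2)[OF M m] i by simp
  have "(LINT x|lebesgue. indicator \<Omega> (M *v x) - indicator \<Omega> x :: real) = 0"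
    using i i' integral_orthogonal(1)[OF M m] by simp
  moreover have "AE x in lebesgue. 0 \<le> (indicator \<Omega> (M *v x) - indicator \<Omega> x :: real)"
    using inv by eventually_elim (auto simp: indicator_def)
  ultimately have "AE x in lebesgue. indicator \<Omega> (M *v x) - indicator \<Omega> x = (0 :: real)"
    using i i' by (subst (asm) integral_nonneg_eq_0_iff_AE) auto
  then show ?thesis by eventually_elim (auto simp: indicator_def split: if_splits)
qed

definition pull :: "real ^ 'n ^ 'n \<Rightarrow> (real ^ 'n, 'b::euclidean_space) lsq \<Rightarrow> (real ^ 'n, 'b) lsq" where
  "pull M X = abs_lsq (\<lambda>x. rep_lsq X (M *v x))"

lemma sq_int_orthogonal:
  fixes f :: "real ^ 'n \<Rightarrow> 'b::euclidean_space"
  assumes M: "orthogonal_matrix M" and f: "sq_int f" shows "sq_int (\<lambda>x. f (M *v x))"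
  unfolding sq_int_def
proof
  show "(\<lambda>x. f (M *v x)) \<in> borel_measurable lebesgue"
    by (rule measurable_compose[OF distr_orthogonal(1)[OF M] sq_int_measurable[OF f]])
  have "(\<lambda>x. (norm (f x))\<^sup>2) \<in> borel_measurable lebesgue" using sq_int_measurable[OF f] by measurable
  from integral_orthogonal(2)[OF M this] show "integrable lebesgue (\<lambda>x. (norm (f (M *v x)))\<^sup>2)"
    using sq_int_integrable[OF f] by simp
qed

lemma pull_abs:
  assumes M: "orthogonal_matrix M" and f: "sq_int f" shows "pull M (abs_lsq f) = abs_lsq (\<lambda>x. f (M *v x))"
  unfolding pull_def
  using AE_orthogonal[OF M rep_abs_lsq[OF f]]
  by (subst abs_lsq_eq_iff) (auto intro: sq_int_orthogonal M f)

lemma pull_inner: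
  assumes M: "orthogonal_matrix M" shows "inner (pull M X) (pull M Y) = inner X Y"
proof -
  obtain f g where fg: "sq_int f" "X = abs_lsq f" "sq_int g" "Y = abs_lsq g"
    using lsq_cases[of X] lsq_cases[of Y] by metis
  have m: "(\<lambda>x. inner (f x) (g x)) \<in> borel_measurable lebesgue"
    using sq_int_measurable[OF fg(1)] sq_int_measurable[OF fg(3)] by measurable
  show ?thesis using integral_orthogonal(1)[OF M m] fg
    by (simp add: pull_abs[OF M] abs_lsq_arith sq_int_orthogonal[OF M])
qed

lemma pull_linear:
  assumes M: "orthogonal_matrix M"
  shows "pull M (X + Y) = pull M X + pull M Y" "pull M (c *\<^sub>R X) = c *\<^sub>R pull M X"
proof -
  obtain f g where fg: "sq_int f" "X = abs_lsq f" "sq_int g" "Y = abs_lsq g"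
    using lsq_cases[of X] lsq_cases[of Y] by metis
  then show "pull M (X + Y) = pull M X + pull M Y" "pull M (c *\<^sub>R X) = c *\<^sub>R pull M X"
    by (simp_all add: pull_abs[OF M] abs_lsq_arith sq_int_orthogonal[OF M] sq_int_add sq_int_scaleR)
qed

text \<open>The chain rule for \<open>u \<circ> M\<close> turns the gradient \<open>p\<close> into the transpose of \<open>M\<close> applied to \<open>p \<circ> M\<close>.\<close>

definition rotate_vec :: "real ^ 'n ^ 'n \<Rightarrow> complex ^ 'n \<Rightarrow> complex ^ 'n" where
  "rotate_vec M p = (\<chi> i. \<Sum>j\<in>UNIV. M $ j $ i *\<^sub>R p $ j)"

lemma rotate_vec_linear: "linear (rotate_vec M)"
  by (rule linearI) (simp_all add: rotate_vec_def vec_eq_iff scaleR_add_right sum.distrib scaleR_sum_right mult.commute)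

lemma rotate_vec_inner:
  assumes "orthogonal_matrix M" shows "inner (rotate_vec M p) (rotate_vec M q) = inner p q"
proof -
  have one: "(\<Sum>i\<in>UNIV. M $ j $ i * M $ k $ i) = (if j = k then 1 else 0)" for j k
  proof -
    have "(M ** transpose M) $ j $ k = (mat 1 :: real ^ 'a ^ 'a) $ j $ k" using assms by (simp add: orthogonal_matrix_def)
    then show ?thesis by (simp add: matrix_matrix_mult_def transpose_def mat_def)
  qed
  have "inner (rotate_vec M p) (rotate_vec M q)
      = (\<Sum>i\<in>UNIV. \<Sum>j\<in>UNIV. \<Sum>k\<in>UNIV. (M $ j $ i * M $ k $ i) * inner (p $ k) (q $ j))"
    by (simp add: inner_vec_def rotate_vec_def inner_sum_left inner_sum_right sum_distrib_left mult.assoc)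
  also have "\<dots> = (\<Sum>j\<in>UNIV. \<Sum>i\<in>UNIV. \<Sum>k\<in>UNIV. (M $ j $ i * M $ k $ i) * inner (p $ k) (q $ j))"
    by (rule sum.swap)
  also have "\<dots> = (\<Sum>j\<in>UNIV. \<Sum>k\<in>UNIV. \<Sum>i\<in>UNIV. (M $ j $ i * M $ k $ i) * inner (p $ k) (q $ j))"
    by (intro sum.cong refl sum.swap)
  also have "\<dots> = (\<Sum>j\<in>UNIV. \<Sum>k\<in>UNIV. (if j = k then 1 else 0) * inner (p $ k) (q $ j))"
    by (simp only: sum_distrib_right[symmetric] one)
  also have "\<dots> = inner p q" by (simp add: inner_vec_def if_distrib[of "\<lambda>t. t * _"] cong: if_cong)
  finally show ?thesis .
qed

text \<open>The superposition operator of \<open>T\<close>. It serves the linear maps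
  \<open>rotate_vec\<close> and \<open>vec_cmult\<close> on gradients and the nonlinear
  \<open>reg_sign\<close> on functions; a bound \<open>norm (T z) \<le> K * norm z\<close> makes it
  well defined on classes.\<close>

definition lsq_map :: "('b::euclidean_space \<Rightarrow> 'c::euclidean_space) \<Rightarrow> ('a::euclidean_space, 'b) lsq \<Rightarrow> ('a, 'c) lsq" where
  "lsq_map T X = abs_lsq (\<lambda>x. T (rep_lsq X x))"

lemma sq_int_lipschitz:
  assumes f: "sq_int f" and T: "continuous_on UNIV T" "\<And>z. norm (T z) \<le> K * norm z"
  shows "sq_int (\<lambda>x. T (f x))"
  by (rule sq_int_bound[OF f, where c = K])
    (use T measurable_compose[OF sq_int_measurable[OF f] borel_measurable_continuous_onI[OF T(1)]] in auto)

lemma lsq_map_abs: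
  assumes f: "sq_int f" and T: "continuous_on UNIV T" "\<And>z. norm (T z) \<le> K * norm z"
  shows "lsq_map T (abs_lsq f) = abs_lsq (\<lambda>x. T (f x))"
proof -
  have "AE x in lebesgue. T (rep_lsq (abs_lsq f) x) = T (f x)" using rep_abs_lsq[OF f] by eventually_elim simp
  then show ?thesis unfolding lsq_map_def
    using sq_int_lipschitz[OF sq_int_rep[of "abs_lsq f"] T] sq_int_lipschitz[OF f T] by (simp add: abs_lsq_eq_iff)
qed

text \<open>The action of \<open>u \<mapsto> \<tau> u(M x)\<close> on pairs of function and
  gradient. It makes sense on the whole product space, whether or not \<open>\<Omega>\<close> is
  invariant, and is an isometry there.\<close>

definition sob_map :: "real ^ 'n ^ 'n \<Rightarrow> real \<Rightarrow> (real ^ 'n, complex) lsq \<times> (real ^ 'n, complex ^ 'n) lsq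
    \<Rightarrow> (real ^ 'n, complex) lsq \<times> (real ^ 'n, complex ^ 'n) lsq" where
  "sob_map M \<tau> s = (\<tau> *\<^sub>R pull M (fst s), \<tau> *\<^sub>R lsq_map (rotate_vec M) (pull M (snd s)))"

lemma rotate_vec_bounds:
  assumes "orthogonal_matrix M"
  shows "continuous_on UNIV (rotate_vec M)" "norm (rotate_vec M p) \<le> 1 * norm p"
  using linear_conv_bounded_linear[THEN iffD1, OF rotate_vec_linear[of M]] rotate_vec_inner[OF assms, of p p]
  by (auto intro: linear_continuous_on simp: norm_eq_sqrt_inner)

lemma lsq_map_rotate:
  assumes M: "orthogonal_matrix M"
  shows "inner (lsq_map (rotate_vec M) X) (lsq_map (rotate_vec M) Y) = inner X Y"
    "lsq_map (rotate_vec M) (X + Y) = lsq_map (rotate_vec M) X + lsq_map (rotate_vec M) Y"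
    "lsq_map (rotate_vec M) (c *\<^sub>R X) = c *\<^sub>R lsq_map (rotate_vec M) X"
proof -
  obtain f g where fg: "sq_int f" "X = abs_lsq f" "sq_int g" "Y = abs_lsq g"
    using lsq_cases[of X] lsq_cases[of Y] by metis
  note R = rotate_vec_bounds[OF M]
  note s = sq_int_lipschitz[OF fg(1) R] sq_int_lipschitz[OF fg(3) R]
  show "inner (lsq_map (rotate_vec M) X) (lsq_map (rotate_vec M) Y) = inner X Y"
    "lsq_map (rotate_vec M) (X + Y) = lsq_map (rotate_vec M) X + lsq_map (rotate_vec M) Y"
    "lsq_map (rotate_vec M) (c *\<^sub>R X) = c *\<^sub>R lsq_map (rotate_vec M) X"
    using fg s
    by (simp_all add: abs_lsq_arith lsq_map_abs[OF _ R] sq_int_add sq_int_scaleR rotate_vec_inner[OF M]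
        linear_add[OF rotate_vec_linear] linear_scale[OF rotate_vec_linear])
qed

lemma sob_map_inner:
  assumes "orthogonal_matrix M" "\<tau> = 1 \<or> \<tau> = -1" shows "inner (sob_map M \<tau> s) (sob_map M \<tau> t) = inner s t"
  using assms(2) by (auto simp: sob_map_def inner_prod_def pull_inner[OF assms(1)] lsq_map_rotate[OF assms(1)])

lemma sob_map_linear:
  assumes "orthogonal_matrix M"
  shows "linear (sob_map M \<tau>)"
  by (rule linearI) (simp_all add: sob_map_def pull_linear[OF assms] lsq_map_rotate[OF assms] scaleR_add_right)

lemma sob_map_bounded_linear:
  assumes "orthogonal_matrix M" "\<tau> = 1 \<or> \<tau> = -1" shows "bounded_linear (sob_map M \<tau>)"
proof (rule bounded_linear_intro[where K = 1])
  show "norm (sob_map M \<tau> x) \<le> norm x * 1" for x using sob_map_inner[OF assms, of x x] by (simp add: norm_eq_sqrt_inner)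
qed (use sob_map_linear[OF assms(1)] in \<open>auto simp: linear_add linear_scale\<close>)

lemma graph_test:
  assumes "open \<Omega>" "\<phi> \<in> test_functions \<Omega>" shows "graph \<Omega> \<phi> = (abs_lsq \<phi>, abs_lsq (grad \<phi>))"
  using test_H1(2)[OF assms] test_functions_L2[OF assms] by simp

lemma test_functions_orthogonal:
  fixes M :: "real ^ 'n ^ 'n"
  assumes M: "orthogonal_matrix M" and \<phi>: "\<phi> \<in> test_functions \<Omega>" and sub: "\<And>x. M *v x \<in> \<Omega> \<Longrightarrow> x \<in> \<Omega>'"
  shows "(\<lambda>x. \<phi> (M *v x)) \<in> test_functions \<Omega>'" "grad (\<lambda>x. \<phi> (M *v x)) x = rotate_vec M (grad \<phi> (M *v x))"
proof -
  obtain K where K: "compact K" "K \<subseteq> \<Omega>" "\<And>x. x \<notin> K \<Longrightarrow> \<phi> x = 0" using test_functionsE[OF \<phi>] by blast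
  have "compact ((*v) (transpose M) ` K)"
    by (intro compact_continuous_image linear_continuous_on matrix_vector_mul_bounded_linear K)
  moreover have "(*v) (transpose M) ` K \<subseteq> \<Omega>'" using K(2) sub orthogonal_matrix_inverse[OF M] by auto
  moreover have "\<phi> (M *v x) = 0" if "x \<notin> (*v) (transpose M) ` K" for x
    using that orthogonal_matrix_inverse(1)[OF M, of x] by (intro K(3)) (auto simp: image_iff)
  ultimately show "(\<lambda>x. \<phi> (M *v x)) \<in> test_functions \<Omega>'"
    using \<phi> unfolding test_functions_def by (auto intro: C_k_compose_matrix)
  show "grad (\<lambda>x. \<phi> (M *v x)) x = rotate_vec M (grad \<phi> (M *v x))"
    unfolding grad_def rotate_vec_def vec_eq_iff vec_lambda_beta
    by (intro allI partial_derivative_compose_matrix(1)[OF test_functions_differentiable[OF \<phi>]])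
qed

lemma sob_map_test:
  fixes M :: "real ^ 'n ^ 'n"
  assumes M: "orthogonal_matrix M" and \<Omega>: "open \<Omega>" and \<phi>: "\<phi> \<in> test_functions \<Omega>" and inv: "\<And>x. M *v x \<in> \<Omega> \<Longrightarrow> x \<in> \<Omega>"
  shows "sob_map M \<tau> (graph \<Omega> \<phi>) = \<tau> *\<^sub>R graph \<Omega> (\<lambda>x. \<phi> (M *v x))"
proof -
  have "grad (\<lambda>x. \<phi> (M *v x)) = (\<lambda>x. rotate_vec M (grad \<phi> (M *v x)))"
    by (rule ext) (rule test_functions_orthogonal(2)[OF M \<phi> inv])
  then show ?thesis using test_functions_orthogonal(1)[OF M \<phi> inv]
    by (simp add: sob_map_def graph_test[OF \<Omega>] \<phi> pull_abs[OF M] test_functions_L2[OF \<Omega> \<phi>] sq_int_orthogonal[OF M]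
        lsq_map_abs[OF _ rotate_vec_bounds[OF M]])
qed

lemma sob_map_sobolev:
  fixes M :: "real ^ 'n ^ 'n"
  assumes M: "orthogonal_matrix M" "\<tau> = 1 \<or> \<tau> = -1" and \<Omega>: "open \<Omega>" and inv: "\<And>x. M *v x \<in> \<Omega> \<Longrightarrow> x \<in> \<Omega>"
    and s: "s \<in> sobolev \<Omega>"
  shows "sob_map M \<tau> s \<in> sobolev \<Omega>"
proof -
  have "sob_map M \<tau> ` closure (graph \<Omega> ` test_functions \<Omega>) \<subseteq> sobolev \<Omega>"
  proof (rule image_closure_subset)
    show "continuous_on (closure (graph \<Omega> ` test_functions \<Omega>)) (sob_map M \<tau>)"
      by (rule linear_continuous_on[OF sob_map_bounded_linear[OF M]])
    show "sob_map M \<tau> ` graph \<Omega> ` test_functions \<Omega> \<subseteq> sobolev \<Omega>"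
    proof (rule subsetI)
      fix t assume "t \<in> sob_map M \<tau> ` graph \<Omega> ` test_functions \<Omega>"
      then obtain \<phi> where \<phi>: "\<phi> \<in> test_functions \<Omega>" and t: "t = sob_map M \<tau> (graph \<Omega> \<phi>)" by blast
      have "graph \<Omega> (\<lambda>x. \<phi> (M *v x)) \<in> sobolev \<Omega>"
        unfolding sobolev_def
        by (rule subsetD[OF closure_subset imageI[OF test_functions_orthogonal(1)[OF M(1) \<phi> inv]]])
      then have "\<tau> *\<^sub>R graph \<Omega> (\<lambda>x. \<phi> (M *v x)) \<in> sobolev \<Omega>" by (rule subspace_scale[OF subspace_sobolev[OF \<Omega>]])
      moreover have "sob_map M \<tau> (graph \<Omega> \<phi>) = \<tau> *\<^sub>R graph \<Omega> (\<lambda>x. \<phi> (M *v x))"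
        by (rule sob_map_test[OF M(1) \<Omega> \<phi> inv])
      ultimately show "t \<in> sobolev \<Omega>" by (simp add: t)
    qed
  qed (rule closed_sobolev)
  then show ?thesis using s unfolding sobolev_def by blast
qed

lemma sobolev_subset_UNIV:
  assumes \<Omega>: "open \<Omega>" shows "sobolev \<Omega> \<subseteq> sobolev UNIV"
  unfolding sobolev_def
proof (rule closure_mono, rule subsetI)
  fix s assume "s \<in> graph \<Omega> ` test_functions \<Omega>"
  then obtain \<phi> where \<phi>: "\<phi> \<in> test_functions \<Omega>" "s = graph \<Omega> \<phi>" by blast
  have t: "\<phi> \<in> test_functions UNIV" using \<phi>(1) by (auto simp: test_functions_def)
  have "s = graph UNIV \<phi>" using \<phi> graph_test[OF \<Omega> \<phi>(1)] graph_test[OF open_UNIV t] by simp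
  then show "s \<in> graph UNIV ` test_functions UNIV" using t by (rule image_eqI)
qed

text \<open>Weak gradients are unique up to null sets, so an identity in the Sobolev space may be
  checked on the first components alone.\<close>

lemma sobolev_snd_unique:
  assumes \<Omega>: "open \<Omega>" and s: "s \<in> sobolev \<Omega>" and t: "t \<in> sobolev \<Omega>" and eq: "fst s = fst t"
  shows "s = t"
proof -
  obtain u where u: "u \<in> H10 \<Omega>" "s = graph \<Omega> u" using sobolevE[OF \<Omega> s] .
  obtain v where v: "v \<in> H10 \<Omega>" "t = graph \<Omega> v" using sobolevE[OF \<Omega> t] .
  note U = H1D[OF \<Omega> H10_H1[OF u(1)]] and V = H1D[OF \<Omega> H10_H1[OF v(1)]]
  have "emb \<Omega> u = emb \<Omega> v" using eq u v by (simp add: graph_def)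
  then have "has_weak_gradient \<Omega> u (weak_gradient \<Omega> v)"
    using V(3) by (simp add: has_weak_gradient_iff_inner[OF \<Omega> U(1) V(2)] has_weak_gradient_iff_inner[OF \<Omega> V(1) V(2)])
  from weak_gradient_eq(3)[OF \<Omega> this V(2)] show ?thesis using eq u v by (simp add: graph_def)
qed

lemma H10_cong_AE:
  assumes \<Omega>: "open \<Omega>" and u: "u \<in> H10 \<Omega>" and ae: "AE x in lebesgue. x \<in> \<Omega> \<longrightarrow> u x = v x"
  shows "v \<in> H10 \<Omega>" "graph \<Omega> v = graph \<Omega> u"
proof -
  note U = H1D[OF \<Omega> H10_H1[OF u]]
  have v: "v \<in> L2 \<Omega>" "emb \<Omega> u = emb \<Omega> v" using L2_cong_AE[OF \<Omega> U(1) ae] by auto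
  then have "has_weak_gradient \<Omega> v (weak_gradient \<Omega> u)"
    using U(3) by (simp add: has_weak_gradient_iff_inner[OF \<Omega> U(1) U(2)] has_weak_gradient_iff_inner[OF \<Omega> v(1) U(2)])
  from H1_graphI[OF \<Omega> v(1) this U(2)] show g: "graph \<Omega> v = graph \<Omega> u" and "v \<in> H10 \<Omega>"
    using u v(2) by (simp_all add: H10_iff_sobolev[OF \<Omega>] graph_def)
qed

lemma emb_orthogonal:
  fixes M :: "real ^ 'n ^ 'n"
  assumes M: "orthogonal_matrix M" and \<Omega>: "open \<Omega>" and inv: "AE x in lebesgue. M *v x \<in> \<Omega> \<longleftrightarrow> x \<in> \<Omega>" and f: "f \<in> L2 \<Omega>"
  shows "(\<lambda>x. f (M *v x)) \<in> L2 \<Omega>" "emb \<Omega> (\<lambda>x. f (M *v x)) = pull M (emb \<Omega> f)"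
proof -
  have s: "sq_int (\<lambda>x. indicator \<Omega> (M *v x) *\<^sub>R f (M *v x))"
    using sq_int_orthogonal[OF M L2_sq_int[OF \<Omega> f]] .
  have ae: "AE x in lebesgue. indicator \<Omega> (M *v x) *\<^sub>R f (M *v x) = indicator \<Omega> x *\<^sub>R f (M *v x)"
    using inv by eventually_elim (auto simp: indicator_def)
  have s': "sq_int (\<lambda>x. indicator \<Omega> x *\<^sub>R f (M *v x))"
    by (rule sq_int_bound[OF s borel_measurable_AE[OF sq_int_measurable[OF s] ae], where c = 1])
      (use ae in \<open>eventually_elim, simp only: mult_1 order_refl\<close>)
  then show "(\<lambda>x. f (M *v x)) \<in> L2 \<Omega>" using L2_iff_sq_int[OF open_lebesgue[OF \<Omega>]] by blast
  show "emb \<Omega> (\<lambda>x. f (M *v x)) = pull M (emb \<Omega> f)"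
    unfolding emb_def pull_abs[OF M L2_sq_int[OF \<Omega> f]] using ae
    by (subst abs_lsq_eq_iff[OF s' s]) (auto elim: eventually_mono)
qed

text \<open>Both graphs lie in the Sobolev space of the whole space, where the first component determines
  the second; so no invariance of \<open>\<Omega>\<close> beyond null sets is needed.\<close>

lemma graph_orthogonal:
  fixes M :: "real ^ 'n ^ 'n"
  assumes M: "orthogonal_matrix M" "\<tau> = 1 \<or> \<tau> = -1" and \<Omega>: "open \<Omega>"
    and inv: "AE x in lebesgue. M *v x \<in> \<Omega> \<longleftrightarrow> x \<in> \<Omega>"
    and u: "u \<in> H10 \<Omega>" and \<sigma>u: "(\<lambda>x. \<tau> *\<^sub>R u (M *v x)) \<in> H10 \<Omega>"
  shows "graph \<Omega> (\<lambda>x. \<tau> *\<^sub>R u (M *v x)) = sob_map M \<tau> (graph \<Omega> u)"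
proof (rule sobolev_snd_unique[OF open_UNIV])
  show "graph \<Omega> (\<lambda>x. \<tau> *\<^sub>R u (M *v x)) \<in> sobolev UNIV"
    using \<sigma>u sobolev_subset_UNIV[OF \<Omega>] by (auto simp: H10_iff_sobolev[OF \<Omega>])
  have "graph \<Omega> u \<in> sobolev UNIV" using u sobolev_subset_UNIV[OF \<Omega>] by (auto simp: H10_iff_sobolev[OF \<Omega>])
  then show "sob_map M \<tau> (graph \<Omega> u) \<in> sobolev UNIV" by (intro sob_map_sobolev[OF M open_UNIV]) auto
  note e = emb_orthogonal[OF M(1) \<Omega> inv H1D(1)[OF \<Omega> H10_H1[OF u]]]
  show "fst (graph \<Omega> (\<lambda>x. \<tau> *\<^sub>R u (M *v x))) = fst (sob_map M \<tau> (graph \<Omega> u))"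
    by (simp add: graph_def sob_map_def emb_arith(3)[OF \<Omega> e(1) e(1)] e(2))
qed

text \<open>For the reflection \<open>\<Omega>\<close> is invariant at every point. Test functions
  then go to test functions, and composition acts on \<open>H10 \<Omega>\<close> without further
  assumption.\<close>

lemma H10_orthogonal:
  fixes M :: "real ^ 'n ^ 'n"
  assumes M: "orthogonal_matrix M" and \<Omega>: "open \<Omega>" and inv: "\<And>x. M *v x \<in> \<Omega> \<longleftrightarrow> x \<in> \<Omega>" and u: "u \<in> H10 \<Omega>"
  shows "(\<lambda>x. u (M *v x)) \<in> H10 \<Omega>"
proof -
  have "sob_map M 1 (graph \<Omega> u) \<in> sobolev \<Omega>"
    using u inv by (intro sob_map_sobolev[OF M _ \<Omega>]) (auto simp: H10_iff_sobolev[OF \<Omega>])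
  then obtain w where w: "w \<in> H10 \<Omega>" "sob_map M 1 (graph \<Omega> u) = graph \<Omega> w" using sobolevE[OF \<Omega>] by blast
  have e: "(\<lambda>x. u (M *v x)) \<in> L2 \<Omega>" "emb \<Omega> (\<lambda>x. u (M *v x)) = pull M (emb \<Omega> u)"
    using emb_orthogonal[OF M \<Omega> _ H1D(1)[OF \<Omega> H10_H1[OF u]]] inv by auto
  have "emb \<Omega> w = emb \<Omega> (\<lambda>x. u (M *v x))" using w(2) e(2) by (simp add: graph_def sob_map_def)
  then have "AE x in lebesgue. x \<in> \<Omega> \<longrightarrow> w x = u (M *v x)"
    using emb_eq_iff[OF \<Omega> H1D(1)[OF \<Omega> H10_H1[OF w(1)]] e(1)] by blast
  from H10_cong_AE(1)[OF \<Omega> w(1) this] show ?thesis .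
qed

subsection \<open>Multiplication operators\<close>

definition mulop :: "('a::euclidean_space \<Rightarrow> complex) \<Rightarrow> ('a, complex) lsq \<Rightarrow> ('a, complex) lsq" where
  "mulop h X = abs_lsq (\<lambda>x. h x * rep_lsq X x)"

lemma sq_int_mult:
  fixes f :: "'a::euclidean_space \<Rightarrow> complex"
  assumes h: "h \<in> borel_measurable lebesgue" "\<And>x. norm (h x) \<le> C" and f: "sq_int f"
  shows "sq_int (\<lambda>x. h x * f x)"
proof (rule sq_int_bound[OF f])
  show "(\<lambda>x. h x * f x) \<in> borel_measurable lebesgue" using h(1) sq_int_measurable[OF f] by measurable
  show "AE x in lebesgue. norm (h x * f x) \<le> C * norm (f x)"
    using h(2) by (intro AE_I2) (simp add: norm_mult mult_right_mono)
qed

lemma mulop_abs: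
  assumes h: "h \<in> borel_measurable lebesgue" "\<And>x. norm (h x) \<le> C" and f: "sq_int f"
  shows "mulop h (abs_lsq f) = abs_lsq (\<lambda>x. h x * f x)"
proof -
  have "AE x in lebesgue. h x * rep_lsq (abs_lsq f) x = h x * f x" using rep_abs_lsq[OF f] by eventually_elim simp
  then show ?thesis unfolding mulop_def
    using sq_int_mult[OF h sq_int_rep[of "abs_lsq f"]] sq_int_mult[OF h f] by (simp add: abs_lsq_eq_iff)
qed

lemma mulop_bounded_linear:
  assumes h: "h \<in> borel_measurable lebesgue" "\<And>x. norm (h x) \<le> C"
  shows "bounded_linear (mulop h)"
proof (rule bounded_linear_intro[where K = C])
  fix X Y :: "('a, complex) lsq" and r :: real
  obtain f g where fg: "sq_int f" "X = abs_lsq f" "sq_int g" "Y = abs_lsq g"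
    using lsq_cases[of X] lsq_cases[of Y] by metis
  note s = sq_int_mult[OF h fg(1)] sq_int_mult[OF h fg(3)]
  show "mulop h (X + Y) = mulop h X + mulop h Y" "mulop h (r *\<^sub>R X) = r *\<^sub>R mulop h X"
    using fg s by (simp_all add: abs_lsq_arith mulop_abs[OF h] sq_int_add sq_int_scaleR distrib_left)
  have "C \<ge> 0" using h(2) norm_ge_zero order_trans by blast
  then have "norm (mulop h X) \<le> C * norm X"
    unfolding fg(2) mulop_abs[OF h fg(1)] using h(2)
    by (intro norm_abs_lsq_mono s fg) (auto simp: norm_mult mult_right_mono)
  then show "norm (mulop h X) \<le> norm X * C" by (simp add: mult.commute)
qed

lemma mulop_pull:
  fixes h :: "real ^ 'n \<Rightarrow> complex"
  assumes M: "orthogonal_matrix M" and h: "h \<in> borel_measurable lebesgue" "\<And>x. norm (h x) \<le> C"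
    and inv: "AE x in lebesgue. h (M *v x) = h x"
  shows "mulop h (pull M X) = pull M (mulop h X)"
proof -
  obtain f where f: "sq_int f" "X = abs_lsq f" using lsq_cases[of X] .
  have 1: "mulop h (pull M X) = abs_lsq (\<lambda>x. h x * f (M *v x))"
    by (simp add: f pull_abs[OF M] mulop_abs[OF h] sq_int_orthogonal[OF M])
  have 2: "pull M (mulop h X) = abs_lsq (\<lambda>x. h (M *v x) * f (M *v x))"
    by (simp add: f pull_abs[OF M] mulop_abs[OF h] sq_int_mult[OF h])
  have s: "sq_int (\<lambda>x. h (M *v x) * f (M *v x))"
    using sq_int_orthogonal[OF M sq_int_mult[OF h f(1)]] .
  show ?thesis unfolding 1 2
    using inv by (subst abs_lsq_eq_iff[OF sq_int_mult[OF h sq_int_orthogonal[OF M f(1)]] s]) (auto elim: eventually_mono)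
qed

text \<open>The Riesz representative \<open>w\<close> of the functional
  \<open>v \<mapsto> inner (D v) y\<close> takes the place of the adjoint of \<open>D\<close>
  applied to \<open>y\<close>.\<close>

lemma weak_lim_bounded_linear:
  fixes D :: "'a::{real_inner,complete_space} \<Rightarrow> 'b::real_inner"
  assumes D: "bounded_linear D" and X: "weak_lim X x"
  shows "weak_lim (\<lambda>k. D (X k)) (D x)"
  unfolding weak_lim_def
proof
  fix y
  interpret D: bounded_linear D by fact
  obtain K where K: "\<And>x. norm (D x) \<le> norm x * K" using D.bounded by blast
  obtain w where w: "\<And>v. inner (D v) y = inner w v"
  proof (rule riesz_subspace[of UNIV "\<lambda>v. inner (D v) y" "K * norm y"])
    show "linear_functional_on UNIV (\<lambda>v. inner (D v) y)"
      by (simp add: linear_functional_on_def D.add D.scaleR inner_add_left)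
    show "\<bar>inner (D v) y\<bar> \<le> K * norm y * norm v" for v
      using Cauchy_Schwarz_ineq2[of "D v" y] mult_right_mono[OF K[of v] norm_ge_zero[of y]] by (simp add: mult_ac)
  qed auto
  show "(\<lambda>k. inner (D (X k)) y) \<longlonglongrightarrow> inner (D x) y"
    using weak_limD[OF X, of w] unfolding w by (simp only: inner_commute[of w])
qed

lemma weak_lim_unique_strong:
  assumes "weak_lim X x" "X \<longlonglongrightarrow> y" shows "x = y"
proof -
  have "(\<lambda>k. inner (X k) (x - y)) \<longlonglongrightarrow> inner y (x - y)" by (intro tendsto_intros assms(2))
  then have "inner x (x - y) = inner y (x - y)" using LIMSEQ_unique weak_limD[OF assms(1)] by blast
  then have "inner (x - y) (x - y) = 0" by (simp add: inner_diff_left)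
  then show ?thesis by simp
qed

lemma weak_lim_add_const: "weak_lim X x \<Longrightarrow> weak_lim (\<lambda>k. c + X k) (c + x)"
  unfolding weak_lim_def by (auto simp: inner_add_left intro!: tendsto_add)

text \<open>Coercivity is available only when \<open>v\<close> is paired with \<open>J v\<close>.
  The ordinary lemma is applied to the form \<open>B u (J v)\<close>; since \<open>J\<close> maps
  \<open>S\<close> onto itself, the solution satisfies the original equation for all
  \<open>v\<close>.\<close>

lemma lax_milgram_rotated:
  fixes S :: "'a::{real_inner,complete_space} set"
  assumes S: "closed S" "subspace S" and B: "bounded_bilinear B" and J: "bounded_linear J"
    and JS: "\<And>v. v \<in> S \<Longrightarrow> J v \<in> S" "\<And>v. v \<in> S \<Longrightarrow> \<exists>w\<in>S. J w = v"
    and \<kappa>: "\<kappa> > 0" "\<And>v. v \<in> S \<Longrightarrow> \<kappa> * (norm v)\<^sup>2 \<le> B v (J v)"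
    and lin: "linear_functional_on S f" and bd: "\<And>v. v \<in> S \<Longrightarrow> \<bar>f v\<bar> \<le> K * norm v"
  shows "\<exists>u\<in>S. \<forall>v\<in>S. B u v = f v"
proof -
  interpret J: bounded_linear J by fact
  obtain L where L: "\<And>x. norm (J x) \<le> norm x * L" using J.bounded by blast
  have "\<exists>u\<in>S. \<forall>v\<in>S. B u (J v) = f (J v)"
  proof (rule lax_milgram[where B = "\<lambda>u v. B u (J v)" and f = "\<lambda>v. f (J v)" and K = "\<bar>K\<bar> * L" and \<kappa> = \<kappa>])
    show "bounded_bilinear (\<lambda>u v. B u (J v))"
      using bounded_bilinear.comp[OF B bounded_linear_ident J] by simp
    show "linear_functional_on S (\<lambda>v. f (J v))"
      using lin JS(1) by (simp add: linear_functional_on_def J.add J.scaleR)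
    fix v assume v: "v \<in> S"
    have "\<bar>f (J v)\<bar> \<le> K * norm (J v)" using bd JS(1) v by blast
    also have "\<dots> \<le> \<bar>K\<bar> * norm (J v)" by (intro mult_right_mono) auto
    also have "\<dots> \<le> \<bar>K\<bar> * (norm v * L)" by (intro mult_left_mono L) auto
    finally show "\<bar>f (J v)\<bar> \<le> \<bar>K\<bar> * L * norm v" by (simp add: mult_ac)
  qed (use S \<kappa> in auto)
  then show ?thesis using JS(2) by metis
qed

subsection \<open>Complex multiples\<close>

definition vec_cmult :: "complex \<Rightarrow> complex ^ 'n \<Rightarrow> complex ^ 'n" where
  "vec_cmult c p = (\<chi> i. c * p $ i)"

lemma vec_cmult_bounded_linear: "bounded_linear (vec_cmult c)"
  using bounded_linear_vec_cmult[of c] by (simp add: vec_cmult_def[abs_def])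

lemma norm_vec_cmult: "norm (vec_cmult c p) = norm c * norm p"
  by (simp add: norm_vec_def L2_set_def vec_cmult_def norm_mult power_mult_distrib real_sqrt_mult flip: sum_distrib_left)

lemma inner_vec_cmult: "inner p (vec_cmult c p) = Re c * (norm p)\<^sup>2"
proof -
  have "inner z (c * z) = Re c * inner z z" for z :: complex
    by (simp add: inner_complex_def algebra_simps)
  then show ?thesis by (simp add: inner_vec_def vec_cmult_def power2_norm_eq_inner sum_distrib_left)
qed

definition cmul :: "complex \<Rightarrow> (real ^ 'n, complex) lsq \<times> (real ^ 'n, complex ^ 'n) lsq \<Rightarrow> (real ^ 'n, complex) lsq \<times> (real ^ 'n, complex ^ 'n) lsq" where
  "cmul c s = (mulop (\<lambda>_. c) (fst s), lsq_map (vec_cmult c) (snd s))"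

lemma vec_cmult_cont: "continuous_on UNIV (vec_cmult c)" "norm (vec_cmult c z) \<le> norm c * norm z"
  by (auto intro: linear_continuous_on vec_cmult_bounded_linear simp: norm_vec_cmult)

lemma mulop_const: "sq_int f \<Longrightarrow> mulop (\<lambda>_. c) (abs_lsq f) = abs_lsq (\<lambda>x. c * f x)"
  by (rule mulop_abs[where C = "norm c"]) auto

lemma sq_int_const_mult: "sq_int f \<Longrightarrow> sq_int (\<lambda>x. (c::complex) * f x)"
  by (rule sq_int_mult[where C = "norm c"]) auto

lemma lsq_map_bounded_linear:
  assumes T: "bounded_linear T" "\<And>z. norm (T z) \<le> K * norm z" "0 \<le> K"
  shows "bounded_linear (lsq_map T)"
proof (rule bounded_linear_intro[where K = K])
  interpret T: bounded_linear T by fact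
  note C = linear_continuous_on[OF T(1)] T(2)
  fix X Y :: "('c, 'a) lsq" and r :: real
  obtain f g where fg: "sq_int f" "X = abs_lsq f" "sq_int g" "Y = abs_lsq g"
    using lsq_cases[of X] lsq_cases[of Y] by metis
  note s = sq_int_lipschitz[OF fg(1) C] sq_int_lipschitz[OF fg(3) C]
  show "lsq_map T (X + Y) = lsq_map T X + lsq_map T Y" "lsq_map T (r *\<^sub>R X) = r *\<^sub>R lsq_map T X"
    using fg s by (simp_all add: abs_lsq_arith lsq_map_abs[OF _ C] sq_int_add sq_int_scaleR T.add T.scaleR)
  have "norm (lsq_map T X) \<le> K * norm X"
    unfolding fg(2) lsq_map_abs[OF fg(1) C] by (intro norm_abs_lsq_mono s fg T) (auto intro: T)
  then show "norm (lsq_map T X) \<le> norm X * K" by (simp add: mult.commute)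
qed

lemma cmul_bounded_linear: "bounded_linear (cmul c)"
proof -
  have 1: "bounded_linear (mulop (\<lambda>_. c))" by (rule mulop_bounded_linear[where C = "norm c"]) auto
  have 2: "bounded_linear (lsq_map (vec_cmult c))"
    by (rule lsq_map_bounded_linear[OF vec_cmult_bounded_linear vec_cmult_cont(2)]) simp
  show ?thesis unfolding cmul_def[abs_def]
    by (intro bounded_linear_Pair bounded_linear_compose[OF 1] bounded_linear_compose[OF 2]
        bounded_linear_fst bounded_linear_snd)
qed

lemma cmul_cmul: "cmul c (cmul d s) = cmul (c * d) s" and cmul_one: "cmul 1 s = s"
proof -
  obtain f g where fg: "sq_int f" "fst s = abs_lsq f" "sq_int g" "snd s = abs_lsq g"
    using lsq_cases[of "fst s"] lsq_cases[of "snd s"] by metis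
  have vv: "vec_cmult c (vec_cmult d p) = vec_cmult (c * d) p" "vec_cmult 1 p = p" for p :: "complex ^ 'a"
    by (simp_all add: vec_cmult_def vec_eq_iff)
  have sg: "sq_int (\<lambda>x. vec_cmult d (g x))" using sq_int_lipschitz[OF fg(3) vec_cmult_cont] .
  show "cmul c (cmul d s) = cmul (c * d) s"
    using fg sg by (simp add: cmul_def mulop_const sq_int_const_mult lsq_map_abs[OF _ vec_cmult_cont] vv mult.assoc)
  show "cmul 1 s = s"
    using fg by (simp add: cmul_def mulop_const lsq_map_abs[OF _ vec_cmult_cont] vv prod_eq_iff)
qed

lemma cmul_graph_test:
  assumes \<Omega>: "open \<Omega>" and \<phi>: "\<phi> \<in> test_functions \<Omega>"
  shows "cmul c (graph \<Omega> \<phi>) = graph \<Omega> (\<lambda>x. c * \<phi> x)"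
proof -
  have "grad (\<lambda>x. c * \<phi> x) = (\<lambda>x. vec_cmult c (grad \<phi> x))"
    using grad_cmult[OF \<phi>] by (auto simp: vec_cmult_def)
  then show ?thesis
    by (simp add: cmul_def graph_test[OF \<Omega>] \<phi> test_functions_cmult mulop_const lsq_map_abs[OF _ vec_cmult_cont]
        test_functions_L2[OF \<Omega> \<phi>])
qed

lemma cmul_sobolev:
  assumes \<Omega>: "open \<Omega>" and s: "s \<in> sobolev \<Omega>" shows "cmul c s \<in> sobolev \<Omega>"
proof -
  have "cmul c ` closure (graph \<Omega> ` test_functions \<Omega>) \<subseteq> sobolev \<Omega>"
  proof (rule image_closure_subset)
    show "continuous_on (closure (graph \<Omega> ` test_functions \<Omega>)) (cmul c)"
      by (rule linear_continuous_on[OF cmul_bounded_linear])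
    show "cmul c ` graph \<Omega> ` test_functions \<Omega> \<subseteq> sobolev \<Omega>"
    proof (rule subsetI)
      fix t assume "t \<in> cmul c ` graph \<Omega> ` test_functions \<Omega>"
      then obtain \<phi> where \<phi>: "\<phi> \<in> test_functions \<Omega>" and t: "t = cmul c (graph \<Omega> \<phi>)" by blast
      have "graph \<Omega> (\<lambda>x. c * \<phi> x) \<in> sobolev \<Omega>"
        unfolding sobolev_def by (rule subsetD[OF closure_subset imageI[OF test_functions_cmult[OF \<phi>]]])
      then show "t \<in> sobolev \<Omega>" by (simp add: t cmul_graph_test[OF \<Omega> \<phi>])
    qed
  qed (rule closed_sobolev)
  then show ?thesis using s unfolding sobolev_def by blast
qed

lemma sob_map_cmul:
  assumes M: "orthogonal_matrix M" shows "sob_map M \<tau> (cmul c s) = cmul c (sob_map M \<tau> s)"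
proof -
  obtain f g where fg: "sq_int f" "fst s = abs_lsq f" "sq_int g" "snd s = abs_lsq g"
    using lsq_cases[of "fst s"] lsq_cases[of "snd s"] by metis
  have rv: "rotate_vec M (vec_cmult c p) = vec_cmult c (rotate_vec M p)" for p
    by (simp add: rotate_vec_def vec_cmult_def vec_eq_iff sum_distrib_left)
  have sv: "vec_cmult c (\<tau> *\<^sub>R p) = \<tau> *\<^sub>R vec_cmult c p" for p :: "complex ^ 'a"
    by (simp add: vec_cmult_def vec_eq_iff)
  note R = rotate_vec_bounds[OF M]
  have s1: "sq_int (\<lambda>x. vec_cmult c (g x))" using sq_int_lipschitz[OF fg(3) vec_cmult_cont] .
  have s2: "sq_int (\<lambda>x. rotate_vec M (g (M *v x)))" using sq_int_lipschitz[OF sq_int_orthogonal[OF M fg(3)] R] .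
  show ?thesis
    using fg s1 s2
    by (simp add: cmul_def sob_map_def mulop_const sq_int_const_mult pull_abs[OF M] sq_int_orthogonal[OF M]
        lsq_map_abs[OF _ vec_cmult_cont] lsq_map_abs[OF _ R] abs_lsq_arith(4) sq_int_scaleR
        sq_int_lipschitz[OF _ R] sq_int_lipschitz[OF _ vec_cmult_cont] rv sv)
qed

subsection \<open>The regularized sign\<close>

definition reg_sign :: "real \<Rightarrow> complex \<Rightarrow> complex" where
  "reg_sign e z = z /\<^sub>R (norm z + e)"

lemma reg_sign_norm: assumes "e > 0" shows "norm (reg_sign e z) \<le> 1"
proof -
  have "norm z + e > 0" using assms by (simp add: add_nonneg_pos)
  then have "norm z / (norm z + e) \<le> 1" using assms by (simp only: pos_divide_le_eq) simp
  then show ?thesis using assms by (simp add: reg_sign_def divide_inverse mult.commute)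
qed

lemma reg_sign_lipschitz:
  assumes e: "e > 0" shows "norm (reg_sign e z - reg_sign e w) \<le> (2 / e) * norm (z - w)"
proof -
  define p q where "p = norm z + e" and "q = norm w + e"
  have pq: "p \<ge> e" "q \<ge> e" "p > 0" "q > 0" using e by (auto simp: p_def q_def add_nonneg_pos)
  \<comment> \<open>Numerator and denominator are changed separately. Each change contributes at
    most \<open>norm (z - w) / p\<close>, whence the factor 2.\<close>
  have "reg_sign e z - reg_sign e w = (1 / p) *\<^sub>R (z - w) + ((q - p) / p) *\<^sub>R reg_sign e w"
  proof -
    have "((q - p) / p) *\<^sub>R (1 / q) *\<^sub>R w = (1 / p - 1 / q) *\<^sub>R w"
      using pq by (simp add: diff_divide_distrib right_diff_distrib)
    then show ?thesis
      by (simp add: reg_sign_def p_def[symmetric] q_def[symmetric] scaleR_diff_right scaleR_diff_left inverse_eq_divide)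
  qed
  then have "norm (reg_sign e z - reg_sign e w) \<le> norm ((1 / p) *\<^sub>R (z - w)) + norm (((q - p) / p) *\<^sub>R reg_sign e w)"
    by (metis norm_triangle_ineq)
  also have "\<dots> \<le> (1 / p) * norm (z - w) + (1 / p) * norm (z - w)"
  proof (rule add_mono)
    have "\<bar>q - p\<bar> \<le> norm (z - w)" using norm_triangle_ineq3[of w z] by (simp add: p_def q_def norm_minus_commute)
    then have "\<bar>q - p\<bar> * norm (reg_sign e w) \<le> norm (z - w) * 1"
      using reg_sign_norm[OF e, of w] by (intro mult_mono) auto
    then have "\<bar>q - p\<bar> * norm (reg_sign e w) / p \<le> norm (z - w) / p" using pq by (intro divide_right_mono) auto
    then show "norm (((q - p) / p) *\<^sub>R reg_sign e w) \<le> (1 / p) * norm (z - w)" using pq by simp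
  qed (use pq in simp)
  also have "\<dots> = (2 / p) * norm (z - w)" by simp
  also have "\<dots> \<le> (2 / e) * norm (z - w)" using pq e by (intro mult_right_mono divide_left_mono) auto
  finally show ?thesis .
qed

lemma reg_sign_cont:
  assumes "e > 0" shows "continuous_on UNIV (reg_sign e)" "norm (reg_sign e z) \<le> (1 / e) * norm z"
proof -
  have "norm z + e \<noteq> 0" for z :: complex using assms norm_ge_zero[of z] by linarith
  then show "continuous_on UNIV (reg_sign e)" unfolding reg_sign_def[abs_def] by (intro continuous_intros) auto
  have "inverse (norm z + e) * norm z \<le> (1 / e) * norm z"
    using assms by (intro mult_right_mono) (auto simp: inverse_eq_divide intro!: divide_left_mono add_nonneg_pos mult_pos_pos)
  then show "norm (reg_sign e z) \<le> (1 / e) * norm z"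
    using assms by (simp add: reg_sign_def add_nonneg_pos less_imp_le)
qed

lemma reg_sign_tendsto:
  assumes "u \<longlonglongrightarrow> z" "z \<noteq> 0" "e \<longlonglongrightarrow> 0"
  shows "(\<lambda>k. reg_sign (e k) (u k)) \<longlonglongrightarrow> z / of_real (norm z)"
proof -
  have "(\<lambda>k. u k /\<^sub>R (norm (u k) + e k)) \<longlonglongrightarrow> z /\<^sub>R (norm z + 0)"
    using assms by (intro tendsto_intros) auto
  then show ?thesis by (simp add: reg_sign_def scaleR_conv_of_real divide_inverse mult.commute)
qed

subsection \<open>Existence\<close>

text \<open>\<open>F\<close> acts on functions, not on classes. Its bound by the H1 norm makes it
  equal on functions with the same graph, so it descends to \<open>sobolev \<Omega>\<close>,
  whichever representative \<open>SOME\<close> selects.\<close>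

lemma Hm1_graph:
  assumes \<Omega>: "open \<Omega>" and F: "F \<in> Hm1 \<Omega>"
  obtains Fs K where "\<And>v. v \<in> H10 \<Omega> \<Longrightarrow> Fs (graph \<Omega> v) = F v" "linear_functional_on (sobolev \<Omega>) Fs"
    "\<And>s. s \<in> sobolev \<Omega> \<Longrightarrow> \<bar>Fs s\<bar> \<le> K * norm s"
proof -
  obtain K where "\<forall>v\<in>H10 \<Omega>. \<bar>F v\<bar> \<le> K * H1_norm \<Omega> v" using F unfolding Hm1_def by blast
  then have K: "\<And>v. v \<in> H10 \<Omega> \<Longrightarrow> \<bar>F v\<bar> \<le> K * H1_norm \<Omega> v" by blast
  have Fa: "F (\<lambda>x. v x + w x) = F v + F w" if "v \<in> H10 \<Omega>" "w \<in> H10 \<Omega>" for v w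
    using F that by (simp add: Hm1_def)
  have Fc: "F (\<lambda>x. c *\<^sub>R v x) = c * F v" if "v \<in> H10 \<Omega>" for v c
    using F that by (simp add: Hm1_def)
  have eq: "F v = F w" if v: "v \<in> H10 \<Omega>" and w: "w \<in> H10 \<Omega>" and g: "graph \<Omega> v = graph \<Omega> w" for v w
  proof -
    have m: "(\<lambda>x. (-1) *\<^sub>R w x) \<in> H10 \<Omega>" by (rule H10_arith(3)[OF \<Omega> w w])
    have d: "(\<lambda>x. v x - w x) \<in> H10 \<Omega>" by (rule H10_arith(2)[OF \<Omega> v w])
    have "F (\<lambda>x. v x - w x) = F v - F w" using Fa[OF v m] Fc[OF w, of "-1"] by simp
    moreover have "H1_norm \<Omega> (\<lambda>x. v x - w x) = 0"
      using graph_arith(3)[OF \<Omega> H10_H1[OF v] H10_H1[OF w]] g by (simp add: H1_norm_eq[OF \<Omega> H10_H1[OF d]])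
    ultimately show ?thesis using K[OF d] by simp
  qed
  define Fs where "Fs s = F (SOME v. v \<in> H10 \<Omega> \<and> graph \<Omega> v = s)" for s
  have Fs: "Fs (graph \<Omega> v) = F v" if v: "v \<in> H10 \<Omega>" for v
  proof -
    have "(SOME w. w \<in> H10 \<Omega> \<and> graph \<Omega> w = graph \<Omega> v) \<in> H10 \<Omega> \<and>
        graph \<Omega> (SOME w. w \<in> H10 \<Omega> \<and> graph \<Omega> w = graph \<Omega> v) = graph \<Omega> v"
      by (rule someI[of _ v]) (use v in simp)
    then show ?thesis unfolding Fs_def using eq v by blast
  qed
  show ?thesis
  proof (rule that[of Fs K])
    show "linear_functional_on (sobolev \<Omega>) Fs"
      unfolding linear_functional_on_def
    proof (intro conjI ballI allI)
      fix s t assume s: "s \<in> sobolev \<Omega>" and t: "t \<in> sobolev \<Omega>"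
      obtain v where v: "v \<in> H10 \<Omega>" "s = graph \<Omega> v" using sobolevE[OF \<Omega> s] .
      obtain w where w: "w \<in> H10 \<Omega>" "t = graph \<Omega> w" using sobolevE[OF \<Omega> t] .
      show "Fs (s + t) = Fs s + Fs t"
        using Fs[OF H10_arith(1)[OF \<Omega> v(1) w(1)]] Fs[OF v(1)] Fs[OF w(1)] Fa[OF v(1) w(1)]
        by (simp add: v w graph_arith(1)[OF \<Omega> H10_H1[OF v(1)] H10_H1[OF w(1)]])
    next
      fix c s assume s: "s \<in> sobolev \<Omega>"
      obtain v where v: "v \<in> H10 \<Omega>" "s = graph \<Omega> v" using sobolevE[OF \<Omega> s] .
      show "Fs (c *\<^sub>R s) = c * Fs s"
        using Fs[OF H10_arith(3)[OF \<Omega> v(1) v(1)]] Fs[OF v(1)] Fc[OF v(1)]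
        by (simp add: v graph_arith(5)[OF \<Omega> H10_H1[OF v(1)] H10_H1[OF v(1)]])
    qed
    show "\<bar>Fs s\<bar> \<le> K * norm s" if s: "s \<in> sobolev \<Omega>" for s
    proof -
      obtain v where v: "v \<in> H10 \<Omega>" "s = graph \<Omega> v" using sobolevE[OF \<Omega> s] .
      show ?thesis using K[OF v(1)] Fs[OF v(1)] by (simp add: v H1_norm_eq[OF \<Omega> H10_H1[OF v(1)]])
    qed
  qed (rule Fs)
qed

text \<open>For real \<open>b\<close> the slit condition is the claim with \<open>c = 1\<close>.
  Otherwise the imaginary part of \<open>c\<close> is chosen so that \<open>Re (cnj c * b)\<close>
  becomes \<open>Re b + \<bar>Re b\<bar>\<close>. Keeping \<open>Re c = 1\<close> leaves the
  gradient term intact and the potential term nonnegative.\<close>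

lemma slit_plane_rotation:
  assumes P: "P > 0" and b: "b \<in> slit_plane P"
  obtains c where "Re c = 1" "- 1 < Re (cnj c * b) * P\<^sup>2"
proof (cases "Im b = 0")
  case True
  then have "Re b > - (1 / P\<^sup>2)" using b by (auto simp: slit_plane_def)
  then have "Re b * P\<^sup>2 > - (1 / P\<^sup>2) * P\<^sup>2" using P by (intro mult_strict_right_mono) auto
  then show ?thesis using that[of 1] P by simp
next
  case False
  define c where "c = Complex 1 (\<bar>Re b\<bar> / Im b)"
  have "Re (cnj c * b) = Re b + \<bar>Re b\<bar>" using False by (simp add: c_def)
  then have "Re (cnj c * b) * P\<^sup>2 \<ge> 0" by simp
  then show ?thesis using that[of c] by (simp add: c_def)
qed

text \<open>The equation \<open>\<tau> u(M x) = u x\<close> covers rotations (\<open>\<tau> = 1\<close>) and odd functions (\<open>M = - 1\<close>, \<open>\<tau> = - 1\<close>).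
  \<open>W\<close> is a version of \<open>V\<close> that satisfies its bounds everywhere.\<close>

locale dirichlet_data =
  fixes \<Omega> :: "(real ^ 'n) set" and P :: real and a b :: complex and W :: "real ^ 'n \<Rightarrow> real" and CW :: real
    and F :: "(real ^ 'n \<Rightarrow> complex) \<Rightarrow> real" and M :: "real ^ 'n ^ 'n" and \<tau> :: real
  assumes \<Omega>: "open \<Omega>" and fin: "\<Omega> \<in> lmeasurable"
    and P: "P > 0" and poincare: "\<And>s. s \<in> sobolev \<Omega> \<Longrightarrow> norm (fst s) \<le> P * norm (snd s)"
    and b: "b \<in> slit_plane P"
    and W: "W \<in> borel_measurable lebesgue" "\<And>x. 0 \<le> W x" "\<And>x. W x \<le> CW"
    and F: "F \<in> Hm1 \<Omega>"
    and M: "orthogonal_matrix M" and \<tau>: "\<tau> = 1 \<or> \<tau> = -1"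
    and inv: "AE x in lebesgue. M *v x \<in> \<Omega> \<longleftrightarrow> x \<in> \<Omega>"
    and sym: "\<And>v. v \<in> H10 \<Omega> \<Longrightarrow> (\<lambda>x. \<tau> *\<^sub>R v (M *v x)) \<in> H10 \<Omega>"
      "\<And>v. v \<in> H10 \<Omega> \<Longrightarrow> F (\<lambda>x. \<tau> *\<^sub>R v (M *v x)) = F v"
    and W_inv: "AE x in lebesgue. W (M *v x) = W x"
begin

section \<open>The energy form and the linear problem\<close>

definition h :: "real ^ 'n \<Rightarrow> complex" where "h x = b + of_real (W x)"

lemma h: "h \<in> borel_measurable lebesgue" "norm (h x) \<le> norm b + CW"
proof -
  show "h \<in> borel_measurable lebesgue" unfolding h_def[abs_def] using W(1) by measurable
  have "norm (h x) \<le> norm b + \<bar>W x\<bar>" unfolding h_def by (metis norm_of_real norm_triangle_ineq)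
  then show "norm (h x) \<le> norm b + CW" using W(2,3)[of x] by simp
qed

definition B where "B s t = inner (snd s) (snd t) + inner (mulop h (fst s)) (fst t)"
  for s t :: "(real ^ 'n, complex) lsq \<times> (real ^ 'n, complex ^ 'n) lsq"

lemma B: "bounded_bilinear B"
proof -
  have "bounded_linear (\<lambda>s :: (real ^ 'n, complex) lsq \<times> (real ^ 'n, complex ^ 'n) lsq. (mulop h (fst s), snd s))"
    by (intro bounded_linear_Pair bounded_linear_compose[OF mulop_bounded_linear[OF h] bounded_linear_fst] bounded_linear_snd)
  from bounded_bilinear.comp1[OF bounded_bilinear_inner this]
  have "bounded_bilinear (\<lambda>s t :: (real ^ 'n, complex) lsq \<times> (real ^ 'n, complex ^ 'n) lsq. inner (mulop h (fst s), snd s) t)" .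
  moreover have "B = (\<lambda>s t. inner (mulop h (fst s), snd s) t)"
    by (intro ext) (simp add: B_def inner_prod_def)
  ultimately show ?thesis by simp
qed

text \<open>Pointwise, \<open>inner (h z) (c z)\<close> is \<open>Re (cnj c * h)\<close> times the
  squared modulus of \<open>z\<close>. As gradient term and \<open>W\<close> have real coefficients,
  the imaginary part of \<open>c\<close> acts on \<open>b\<close> only.\<close>

lemma B_cmul:
  "B s (cmul c s) = Re c * (norm (snd s))\<^sup>2 + Re (cnj c * b) * (norm (fst s))\<^sup>2
    + Re c * (LINT x|lebesgue. W x * (norm (rep_lsq (fst s) x))\<^sup>2)"
proof -
  define f g where "f = rep_lsq (fst s)" and "g = rep_lsq (snd s)"
  have f: "sq_int f" "fst s = abs_lsq f" and g: "sq_int g" "snd s = abs_lsq g" by (simp_all add: f_def g_def)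
  have sg: "sq_int (\<lambda>x. vec_cmult c (g x))" using sq_int_lipschitz[OF g(1) vec_cmult_cont] .
  have "inner (snd s) (snd (cmul c s)) = (LINT x|lebesgue. Re c * (norm (g x))\<^sup>2)"
    by (simp add: g cmul_def lsq_map_abs[OF _ vec_cmult_cont] abs_lsq_arith sg inner_vec_cmult)
  then have 1: "inner (snd s) (snd (cmul c s)) = Re c * (norm (snd s))\<^sup>2"
    by (simp add: g norm_abs_lsq)
  have wi: "integrable lebesgue (\<lambda>x. W x * (norm (f x))\<^sup>2)"
  proof (rule Bochner_Integration.integrable_bound)
    show "integrable lebesgue (\<lambda>x. CW * (norm (f x))\<^sup>2)" using sq_int_integrable[OF f(1)] by simp
    show "(\<lambda>x. W x * (norm (f x))\<^sup>2) \<in> borel_measurable lebesgue" using W(1) sq_int_measurable[OF f(1)] by measurable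
    show "AE x in lebesgue. norm (W x * (norm (f x))\<^sup>2) \<le> norm (CW * (norm (f x))\<^sup>2)"
      using W(2,3) by (intro AE_I2) (simp add: abs_mult mult_right_mono order_trans[OF W(3) abs_ge_self])
  qed
  have "inner (h x * z) (c * z) = Re (cnj c * b) * (norm z)\<^sup>2 + Re c * (W x * (norm z)\<^sup>2)" for x z
    by (simp add: inner_complex_def h_def cmod_power2) (simp add: power2_eq_square algebra_simps)
  then have "inner (mulop h (fst s)) (fst (cmul c s))
      = (LINT x|lebesgue. Re (cnj c * b) * (norm (f x))\<^sup>2 + Re c * (W x * (norm (f x))\<^sup>2))"
    by (simp add: f cmul_def mulop_const mulop_abs[OF h] abs_lsq_arith sq_int_const_mult sq_int_mult[OF h])
  also have "\<dots> = Re (cnj c * b) * (LINT x|lebesgue. (norm (f x))\<^sup>2) + Re c * (LINT x|lebesgue. W x * (norm (f x))\<^sup>2)"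
    using wi sq_int_integrable[OF f(1)] by (simp del: minus_mult_right)
  finally have 2: "inner (mulop h (fst s)) (fst (cmul c s))
      = Re (cnj c * b) * (norm (fst s))\<^sup>2 + Re c * (LINT x|lebesgue. W x * (norm (f x))\<^sup>2)"
    by (simp add: f norm_abs_lsq)
  show ?thesis using 1 2 unfolding B_def f_def by simp
qed

lemma coercive:
  obtains c \<kappa> where "c \<noteq> 0" "\<kappa> > 0" "\<And>s. s \<in> sobolev \<Omega> \<Longrightarrow> \<kappa> * (norm s)\<^sup>2 \<le> B s (cmul c s)"
proof -
  obtain c where c: "Re c = 1" "- 1 < Re (cnj c * b) * P\<^sup>2" using slit_plane_rotation[OF P b] .
  define \<rho> where "\<rho> = Re (cnj c * b)"
  \<comment> \<open>For negative \<open>\<rho>\<close>, Poincare's inequality leaves at least the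
    fraction \<open>1 + \<rho> * P\<^sup>2\<close> of the gradient term; otherwise all of it
    remains. The divisor \<open>1 + P\<^sup>2\<close> in \<open>\<kappa>\<close> below passes from
    the gradient to the full norm.\<close>
  define m where "m = min 1 (1 + \<rho> * P\<^sup>2)"
  have m: "m > 0" "m \<le> 1" "m \<le> 1 + \<rho> * P\<^sup>2" using c(2) by (auto simp: m_def \<rho>_def)
  define \<kappa> where "\<kappa> = m / (1 + P\<^sup>2)"
  have P2: "1 + P\<^sup>2 > 0" using P by (simp add: add_pos_nonneg)
  have "\<kappa> * (norm s)\<^sup>2 \<le> B s (cmul c s)" if s: "s \<in> sobolev \<Omega>" for s
  proof -
    define p q where "p = (norm (snd s))\<^sup>2" and "q = (norm (fst s))\<^sup>2"
    have q: "0 \<le> q" "q \<le> P\<^sup>2 * p" "0 \<le> p"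
      using power_mono[OF poincare[OF s], of 2] by (simp_all add: p_def q_def power_mult_distrib)
    have ns: "(norm s)\<^sup>2 = q + p" by (cases s) (simp add: norm_Pair p_def q_def)
    have "\<kappa> * (norm s)\<^sup>2 \<le> \<kappa> * ((1 + P\<^sup>2) * p)"
      unfolding ns using q m P2 by (intro mult_left_mono) (auto simp: \<kappa>_def algebra_simps)
    also have "\<dots> = m * p" using P2 by (simp add: \<kappa>_def)
    also have "\<dots> \<le> p + \<rho> * q"
    proof (cases "\<rho> \<ge> 0")
      case True
      have "m * p \<le> 1 * p" using m q by (intro mult_right_mono) auto
      moreover have "0 \<le> \<rho> * q" using True q by simp
      ultimately show ?thesis by linarith
    next
      case False
      have "m * p \<le> (1 + \<rho> * P\<^sup>2) * p" using m q by (intro mult_right_mono) auto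
      also have "\<dots> = p + \<rho> * (P\<^sup>2 * p)" by (simp add: algebra_simps)
      also have "\<dots> \<le> p + \<rho> * q" using q(2) False by (simp add: mult_left_mono_neg)
      finally show ?thesis .
    qed
    also have "\<dots> \<le> B s (cmul c s)"
    proof -
      have "0 \<le> (LINT x|lebesgue. W x * (norm (rep_lsq (fst s) x))\<^sup>2)"
        using W(2) by (intro Bochner_Integration.integral_nonneg) simp
      then show ?thesis using c(1) by (simp add: B_cmul p_def q_def \<rho>_def)
    qed
    finally show ?thesis .
  qed
  moreover have "\<kappa> > 0" using m P2 by (simp add: \<kappa>_def)
  moreover have "c \<noteq> 0" using c(1) by auto
  ultimately show ?thesis using that by blast
qed

abbreviation \<sigma> where "\<sigma> \<equiv> sob_map M \<tau>"

definition S where "S = {s \<in> sobolev \<Omega>. \<sigma> s = s}"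

lemma \<sigma>_lin: "bounded_linear \<sigma>" by (rule sob_map_bounded_linear[OF M \<tau>])

lemma S: "closed S" "subspace S" "S \<subseteq> sobolev \<Omega>"
proof -
  interpret \<sigma>: bounded_linear \<sigma> by (rule \<sigma>_lin)
  show "closed S" unfolding S_def
  proof (rule closed_sequential_limits[THEN iffD2], intro allI impI, elim conjE)
    fix x l assume x: "\<forall>n. x n \<in> {s \<in> sobolev \<Omega>. \<sigma> s = s}" "x \<longlonglongrightarrow> l"
    have "l \<in> sobolev \<Omega>" using x(1) by (intro closed_sequentially[OF closed_sobolev _ x(2)]) auto
    moreover have "(\<lambda>n. \<sigma> (x n)) \<longlonglongrightarrow> \<sigma> l" by (rule \<sigma>.tendsto[OF x(2)])
    then have "x \<longlonglongrightarrow> \<sigma> l" using x(1) by simp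
    then have "\<sigma> l = l" using LIMSEQ_unique x(2) by blast
    ultimately show "l \<in> {s \<in> sobolev \<Omega>. \<sigma> s = s}" by simp
  qed
  show "subspace S" unfolding S_def subspace_def
    using subspace_sobolev[OF \<Omega>] by (auto simp: \<sigma>.zero \<sigma>.add \<sigma>.scaleR subspace_0 subspace_add subspace_scale)
  show "S \<subseteq> sobolev \<Omega>" by (auto simp: S_def)
qed

lemma \<sigma>_graph: "v \<in> H10 \<Omega> \<Longrightarrow> graph \<Omega> (\<lambda>x. \<tau> *\<^sub>R v (M *v x)) = \<sigma> (graph \<Omega> v)"
  by (rule graph_orthogonal[OF M \<tau> \<Omega> inv _ sym(1)])

lemma \<sigma>_sobolev: assumes "s \<in> sobolev \<Omega>" shows "\<sigma> s \<in> sobolev \<Omega>"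
proof -
  obtain v where v: "v \<in> H10 \<Omega>" "s = graph \<Omega> v" using sobolevE[OF \<Omega> assms] .
  then show ?thesis using \<sigma>_graph[OF v(1)] sym(1)[OF v(1)] by (metis H10_iff_sobolev[OF \<Omega>])
qed

lemma pull_\<tau>_inner: "inner (\<tau> *\<^sub>R pull M X) (\<tau> *\<^sub>R pull M Y) = inner X Y"
  using \<tau> by (auto simp: pull_inner[OF M])

lemma mulop_\<sigma>:
  assumes "k \<in> borel_measurable lebesgue" "\<And>x. norm (k x) \<le> C" "AE x in lebesgue. k (M *v x) = k x"
  shows "mulop k (\<tau> *\<^sub>R pull M X) = \<tau> *\<^sub>R pull M (mulop k X)"
proof -
  interpret bounded_linear "mulop k" by (rule mulop_bounded_linear[OF assms(1,2)])
  show ?thesis by (simp add: scaleR mulop_pull[OF M assms])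
qed

lemma B_\<sigma>: "B (\<sigma> s) (\<sigma> t) = B s t"
proof -
  have hi: "AE x in lebesgue. h (M *v x) = h x" using W_inv by eventually_elim (simp add: h_def)
  have "inner (snd (\<sigma> s)) (snd (\<sigma> t)) = inner (snd s) (snd t)"
    using \<tau> by (auto simp: sob_map_def pull_inner[OF M] lsq_map_rotate[OF M])
  then show ?thesis by (simp add: B_def sob_map_def mulop_\<sigma>[OF h hi] pull_\<tau>_inner del: inner_scaleR_left inner_scaleR_right)
qed

lemma cmul_S: "s \<in> S \<Longrightarrow> cmul c s \<in> S"
  by (simp add: S_def cmul_sobolev[OF \<Omega>] sob_map_cmul[OF M])

lemma solve:
  assumes "linear_functional_on S f" "\<And>v. v \<in> S \<Longrightarrow> \<bar>f v\<bar> \<le> K * norm v"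
  shows "\<exists>u\<in>S. \<forall>v\<in>S. B u v = f v"
proof -
  obtain c \<kappa> where c: "c \<noteq> 0" and \<kappa>: "\<kappa> > 0" "\<And>s. s \<in> sobolev \<Omega> \<Longrightarrow> \<kappa> * (norm s)\<^sup>2 \<le> B s (cmul c s)"
    using coercive by blast
  have surj: "\<exists>w\<in>S. cmul c w = v" if "v \<in> S" for v
    using c cmul_S[OF that, of "inverse c"] by (intro bexI[of _ "cmul (inverse c) v"]) (simp_all add: cmul_cmul cmul_one)
  show ?thesis
    by (rule lax_milgram_rotated[OF S(1,2) B cmul_bounded_linear cmul_S surj \<kappa>(1) \<kappa>(2) assms]) (use S(3) in auto)
qed

lemma solve_zero:
  assumes u: "u \<in> S" and z: "\<And>v. v \<in> S \<Longrightarrow> B u v = 0" shows "u = 0"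
proof -
  obtain c \<kappa> where \<kappa>: "\<kappa> > 0" "\<And>s. s \<in> sobolev \<Omega> \<Longrightarrow> \<kappa> * (norm s)\<^sup>2 \<le> B s (cmul c s)"
    using coercive by blast
  have "\<kappa> * (norm u)\<^sup>2 \<le> 0" using \<kappa>(2)[of u] z[OF cmul_S[OF u]] S(3) u by auto
  then show ?thesis using \<kappa>(1) by (simp add: mult_le_0_iff)
qed

lemma mulop_a: "bounded_linear (mulop (\<lambda>_. a))"
  by (rule mulop_bounded_linear[where C = "norm a"]) auto

text \<open>The linear part of the solution map of the overview, which splits as
  \<open>u\<^sub>F + T0 X\<close> with the contribution of \<open>F\<close> kept in
  \<open>u\<^sub>F\<close>. Uniqueness (\<open>solve_zero\<close>) makes \<open>T0\<close> linear,
  coercivity makes it bounded; so it respects weak limits.\<close>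

definition T0 where "T0 X = (SOME u. u \<in> S \<and> (\<forall>v\<in>S. B u v = - inner (mulop (\<lambda>_. a) X) (fst v)))"

lemma T0: "T0 X \<in> S" "\<And>v. v \<in> S \<Longrightarrow> B (T0 X) v = - inner (mulop (\<lambda>_. a) X) (fst v)"
proof -
  have "\<exists>u\<in>S. \<forall>v\<in>S. B u v = - inner (mulop (\<lambda>_. a) X) (fst v)"
  proof (rule solve)
    show "linear_functional_on S (\<lambda>v. - inner (mulop (\<lambda>_. a) X) (fst v))"
      by (simp add: linear_functional_on_def inner_add_right)
    show "\<bar>- inner (mulop (\<lambda>_. a) X) (fst v)\<bar> \<le> norm (mulop (\<lambda>_. a) X) * norm v" for v
      using Cauchy_Schwarz_ineq2[of "mulop (\<lambda>_. a) X" "fst v"] norm_fst_le[of "fst v" "snd v"]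
        mult_left_mono[OF norm_fst_le[of "fst v" "snd v"] norm_ge_zero[of "mulop (\<lambda>_. a) X"]]
      by simp
  qed
  then have "\<exists>u. u \<in> S \<and> (\<forall>v\<in>S. B u v = - inner (mulop (\<lambda>_. a) X) (fst v))" by blast
  from someI_ex[OF this] show "T0 X \<in> S" "\<And>v. v \<in> S \<Longrightarrow> B (T0 X) v = - inner (mulop (\<lambda>_. a) X) (fst v)"
    unfolding T0_def[symmetric] by auto
qed

lemma T0_bounded_linear: "bounded_linear T0"
proof -
  interpret B: bounded_bilinear B by (rule B)
  interpret A: bounded_linear "mulop (\<lambda>_. a) :: (real ^ 'n, complex) lsq \<Rightarrow> _" by (rule mulop_a)
  obtain c \<kappa> where \<kappa>: "\<kappa> > 0" "\<And>s. s \<in> sobolev \<Omega> \<Longrightarrow> \<kappa> * (norm s)\<^sup>2 \<le> B s (cmul c s)"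
    using coercive by blast
  obtain KA where KA: "\<And>X :: (real ^ 'n, complex) lsq. norm (mulop (\<lambda>_. a) X) \<le> norm X * KA" "KA \<ge> 0" using A.nonneg_bounded by blast
  interpret C: bounded_linear "cmul c :: (real ^ 'n, complex) lsq \<times> (real ^ 'n, complex ^ 'n) lsq \<Rightarrow> _" by (rule cmul_bounded_linear)
  obtain KC where KC: "\<And>s :: (real ^ 'n, complex) lsq \<times> (real ^ 'n, complex ^ 'n) lsq. norm (cmul c s) \<le> norm s * KC" "KC \<ge> 0" using C.nonneg_bounded by blast
  show ?thesis
  proof (rule bounded_linear_intro[where K = "KA * KC / \<kappa>"])
    fix X Y and r :: real
    have "T0 (X + Y) - (T0 X + T0 Y) = 0"
      by (rule solve_zero) (use T0 S(2) in \<open>auto simp: subspace_add subspace_diff B.diff_left B.add_left A.add inner_add_left\<close>)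
    then show "T0 (X + Y) = T0 X + T0 Y" by simp
    have "T0 (r *\<^sub>R X) - r *\<^sub>R T0 X = 0"
      by (rule solve_zero) (use T0 S(2) in \<open>auto simp: subspace_scale subspace_diff B.diff_left B.scaleR_left A.scaleR\<close>)
    then show "T0 (r *\<^sub>R X) = r *\<^sub>R T0 X" by simp
    let ?u = "T0 X"
    have "\<kappa> * (norm ?u)\<^sup>2 \<le> - inner (mulop (\<lambda>_. a) X) (fst (cmul c ?u))"
      using \<kappa>(2)[OF subsetD[OF S(3) T0(1)], of X] T0(2)[OF cmul_S[OF T0(1)], of X c X] by simp
    also have "\<dots> \<le> norm (mulop (\<lambda>_. a) X) * norm (fst (cmul c ?u))"
      using Cauchy_Schwarz_ineq2[of "mulop (\<lambda>_. a) X" "fst (cmul c ?u)"] by linarith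
    also have "\<dots> \<le> (norm X * KA) * (norm ?u * KC)"
      using norm_fst_le[of "fst (cmul c ?u)" "snd (cmul c ?u)"] KC(1)[of ?u] KA KC(2) by (intro mult_mono) auto
    finally have "(\<kappa> * norm ?u) * norm ?u \<le> (norm X * KA * KC) * norm ?u" by (simp add: power2_eq_square mult_ac)
    then have "norm ?u = 0 \<or> \<kappa> * norm ?u \<le> norm X * KA * KC" by (auto simp: mult_le_cancel_right)
    then show "norm (T0 X) \<le> norm X * (KA * KC / \<kappa>)"
    proof
      assume "norm ?u = 0"
      then show ?thesis using KA(2) KC(2) \<kappa>(1) by simp
    next
      assume "\<kappa> * norm ?u \<le> norm X * KA * KC"
      then show ?thesis using \<kappa>(1) by (simp add: field_simps)
    qed
  qed
qed

end

section \<open>Representatives, and the convex set of fields of modulus at most one\<close>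

lemma rep_pull_AE:
  assumes "orthogonal_matrix M" shows "AE x in lebesgue. rep_lsq (pull M X) x = rep_lsq X (M *v x)"
  unfolding pull_def by (rule rep_abs_lsq[OF sq_int_orthogonal[OF assms sq_int_rep]])

lemma lsq_eqI: "AE x in lebesgue. rep_lsq X x = rep_lsq Y x \<Longrightarrow> X = Y"
  using abs_lsq_eq_iff[of "rep_lsq X" "rep_lsq Y"] by simp

lemma rep_arith_AE:
  "AE x in lebesgue. rep_lsq (X + Y) x = rep_lsq X x + rep_lsq Y x"
  "AE x in lebesgue. rep_lsq (X - Y) x = rep_lsq X x - rep_lsq Y x"
  "AE x in lebesgue. rep_lsq (c *\<^sub>R X) x = c *\<^sub>R rep_lsq X x"
  "AE x in lebesgue. rep_lsq (0 :: ('a::euclidean_space, 'b::euclidean_space) lsq) x = 0"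
proof -
  show "AE x in lebesgue. rep_lsq (X + Y) x = rep_lsq X x + rep_lsq Y x"
    using rep_abs_lsq[OF sq_int_add[OF sq_int_rep[of X] sq_int_rep[of Y]]]
      abs_lsq_arith(1)[OF sq_int_rep[of X] sq_int_rep[of Y]] by simp
  show "AE x in lebesgue. rep_lsq (X - Y) x = rep_lsq X x - rep_lsq Y x"
    using rep_abs_lsq[OF sq_int_diff[OF sq_int_rep[of X] sq_int_rep[of Y]]]
      abs_lsq_arith(2)[OF sq_int_rep[of X] sq_int_rep[of Y]] by simp
  show "AE x in lebesgue. rep_lsq (c *\<^sub>R X) x = c *\<^sub>R rep_lsq X x"
    using rep_abs_lsq[OF sq_int_scaleR[OF sq_int_rep[of X], of c]] abs_lsq_arith(4)[OF sq_int_rep[of X], of c] by simp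
  show "AE x in lebesgue. rep_lsq (0 :: ('a, 'b) lsq) x = 0"
    using rep_abs_lsq[OF sq_int_zero] by (simp add: zero_lsq_def)
qed

lemma rep_lsq_map_AE:
  assumes "continuous_on UNIV T" "\<And>z. norm (T z) \<le> K * norm z"
  shows "AE x in lebesgue. rep_lsq (lsq_map T X) x = T (rep_lsq X x)"
  unfolding lsq_map_def by (rule rep_abs_lsq[OF sq_int_lipschitz[OF sq_int_rep assms]])

lemma norm_lsq_mono:
  assumes "AE x in lebesgue. norm (rep_lsq X x) \<le> c * norm (rep_lsq Y x)" "0 \<le> c" shows "norm X \<le> c * norm Y"
  using norm_abs_lsq_mono[OF sq_int_rep sq_int_rep assms] by simp

lemma lsq_map_lipschitz:
  assumes T: "continuous_on UNIV T" "\<And>z. norm (T z) \<le> K * norm z" and L: "\<And>z w. norm (T z - T w) \<le> L * norm (z - w)" "0 \<le> L"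
  shows "norm (lsq_map T X - lsq_map T Y) \<le> L * norm (X - Y)"
proof (rule norm_lsq_mono)
  show "AE x in lebesgue. norm (rep_lsq (lsq_map T X - lsq_map T Y) x) \<le> L * norm (rep_lsq (X - Y) x)"
    using rep_lsq_map_AE[OF T, of X] rep_lsq_map_AE[OF T, of Y] rep_arith_AE(2)[of "lsq_map T X" "lsq_map T Y"] rep_arith_AE(2)[of X Y]
    by eventually_elim (use L in simp)
qed fact

definition unit_fields :: "(real ^ 'n) set \<Rightarrow> (real ^ 'n, complex) lsq set" where
  "unit_fields \<Omega> = {X. AE x in lebesgue. norm (rep_lsq X x) \<le> indicator \<Omega> x}"

lemma zero_unit_fields: "0 \<in> unit_fields \<Omega>"
  unfolding unit_fields_def using rep_arith_AE(4) by (auto elim!: eventually_mono simp: indicator_def)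

lemma convex_unit_fields: "convex (unit_fields \<Omega>)"
proof (rule convexI)
  fix X Y :: "(real ^ 'a, complex) lsq" and u v :: real
  assume XY: "X \<in> unit_fields \<Omega>" "Y \<in> unit_fields \<Omega>" and uv: "0 \<le> u" "0 \<le> v" "u + v = 1"
  have X: "AE x in lebesgue. norm (rep_lsq X x) \<le> indicator \<Omega> x" and Y: "AE x in lebesgue. norm (rep_lsq Y x) \<le> indicator \<Omega> x"
    using XY by (auto simp: unit_fields_def)
  have "AE x in lebesgue. norm (rep_lsq (u *\<^sub>R X + v *\<^sub>R Y) x) \<le> indicator \<Omega> x"
    using X Y rep_arith_AE(1)[of "u *\<^sub>R X" "v *\<^sub>R Y"] rep_arith_AE(3)[of u X] rep_arith_AE(3)[of v Y]
  proof eventually_elim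
    case (elim x)
    have "norm (rep_lsq (u *\<^sub>R X + v *\<^sub>R Y) x) \<le> u * norm (rep_lsq X x) + v * norm (rep_lsq Y x)"
      using elim(3-5) uv norm_triangle_ineq[of "u *\<^sub>R rep_lsq X x" "v *\<^sub>R rep_lsq Y x"] by simp
    also have "\<dots> \<le> u * indicator \<Omega> x + v * indicator \<Omega> x"
      using elim uv by (intro add_mono mult_left_mono) auto
    also have "\<dots> = indicator \<Omega> x" using uv by (simp flip: distrib_right)
    finally show ?case .
  qed
  then show "u *\<^sub>R X + v *\<^sub>R Y \<in> unit_fields \<Omega>" by (simp add: unit_fields_def)
qed

text \<open>Strong closedness, from almost everywhere convergence of a subsequence. Together with
  convexity it yields the weak closedness that the limits require, through
  \<open>closed_convex_weak_lim\<close>.\<close>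

lemma closed_unit_fields: "closed (unit_fields \<Omega>)"
proof (rule closed_sequential_limits[THEN iffD2], intro allI impI, elim conjE)
  fix X :: "nat \<Rightarrow> (real ^ 'a, complex) lsq" and l assume X: "\<forall>n. X n \<in> unit_fields \<Omega>" "X \<longlonglongrightarrow> l"
  obtain r where r: "strict_mono r" "AE t in lebesgue. (\<lambda>k. rep_lsq (X (r k)) t) \<longlonglongrightarrow> rep_lsq l t"
    using lsq_tendsto_AE_subseq[OF X(2)] by blast
  have "AE x in lebesgue. \<forall>k. norm (rep_lsq (X (r k)) x) \<le> indicator \<Omega> x"
    using X(1) by (intro AE_all_countable[THEN iffD2] allI) (simp add: unit_fields_def)
  with r(2) have "AE x in lebesgue. norm (rep_lsq l x) \<le> indicator \<Omega> x"
  proof eventually_elim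
    case (elim x)
    then show ?case by (intro LIMSEQ_le_const2[OF tendsto_norm[OF elim(1)]]) auto
  qed
  then show "l \<in> unit_fields \<Omega>" by (simp add: unit_fields_def)
qed

lemma norm_unit_fields:
  assumes "\<Omega> \<in> lmeasurable" "X \<in> unit_fields \<Omega>"
  shows "norm X \<le> sqrt (measure lebesgue \<Omega>)"
proof -
  have i: "integrable lebesgue (indicator \<Omega> :: _ \<Rightarrow> real)" using assms(1) by (auto simp: fmeasurable_def)
  have "(norm X)\<^sup>2 = (LINT x|lebesgue. (norm (rep_lsq X x))\<^sup>2)" using norm_abs_lsq[OF sq_int_rep, of X] by simp
  also have "\<dots> \<le> (LINT x|lebesgue. indicator \<Omega> x)"
  proof (rule integral_mono_AE[OF sq_int_integrable[OF sq_int_rep] i])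
    have "AE x in lebesgue. norm (rep_lsq X x) \<le> indicator \<Omega> x" using assms(2) by (simp add: unit_fields_def)
    then show "AE x in lebesgue. (norm (rep_lsq X x))\<^sup>2 \<le> indicator \<Omega> x"
      by eventually_elim (auto simp: indicator_def power_le_one split: if_splits)
  qed
  also have "\<dots> = measure lebesgue \<Omega>" using assms(1) by auto
  finally show ?thesis by (rule real_le_rsqrt)
qed

lemma linear_functional_on_subset: "linear_functional_on A f \<Longrightarrow> C \<subseteq> A \<Longrightarrow> linear_functional_on C f"
  unfolding linear_functional_on_def by blast

section \<open>The fixed-point problem for the section\<close>

context dirichlet_data
begin

definition Kset where "Kset = {X \<in> unit_fields \<Omega>. \<tau> *\<^sub>R pull M X = X}"

lemma \<tau>pull_bounded_linear: "bounded_linear (\<lambda>X :: (real ^ 'n, complex) lsq. \<tau> *\<^sub>R pull M X)"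
proof (rule bounded_linear_intro[where K = 1])
  show "norm (\<tau> *\<^sub>R pull M X) \<le> norm X * 1" for X :: "(real ^ 'n, complex) lsq"
    using pull_\<tau>_inner[of X X] by (simp add: norm_eq_sqrt_inner del: inner_scaleR_left inner_scaleR_right)
qed (simp_all add: pull_linear[OF M] scaleR_add_right)

lemma Kset: "closed Kset" "convex Kset" "0 \<in> Kset" "\<And>X. X \<in> Kset \<Longrightarrow> norm X \<le> sqrt (measure lebesgue \<Omega>)"
proof -
  interpret t: bounded_linear "\<lambda>X :: (real ^ 'n, complex) lsq. \<tau> *\<^sub>R pull M X" by (rule \<tau>pull_bounded_linear)
  have eq: "Kset = unit_fields \<Omega> \<inter> {X. \<tau> *\<^sub>R pull M X = X}" by (auto simp: Kset_def)
  have "closed {X :: (real ^ 'n, complex) lsq. \<tau> *\<^sub>R pull M X = X}"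
    by (intro closed_Collect_eq linear_continuous_on \<tau>pull_bounded_linear continuous_intros)
  then show "closed Kset" unfolding eq by (intro closed_Int closed_unit_fields)
  have "subspace {X :: (real ^ 'n, complex) lsq. \<tau> *\<^sub>R pull M X = X}"
    unfolding subspace_def
  proof (intro conjI ballI allI CollectI)
    fix c and X Y :: "(real ^ 'n, complex) lsq"
    assume X: "X \<in> {X. \<tau> *\<^sub>R pull M X = X}"
    then show "\<tau> *\<^sub>R pull M (c *\<^sub>R X) = c *\<^sub>R X" using t.scaleR[of c X] by (simp only: mem_Collect_eq)
    assume "Y \<in> {X. \<tau> *\<^sub>R pull M X = X}"
    with X show "\<tau> *\<^sub>R pull M (X + Y) = X + Y" using t.add[of X Y] by (simp only: mem_Collect_eq)
  qed (rule t.zero)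
  then show "convex Kset" unfolding eq by (intro convex_Int convex_unit_fields subspace_imp_convex)
  show "0 \<in> Kset" using zero_unit_fields t.zero by (simp add: Kset_def)
  show "norm X \<le> sqrt (measure lebesgue \<Omega>)" if "X \<in> Kset" for X
    using that norm_unit_fields[OF fin] by (simp add: Kset_def)
qed

lemma particular:
  "\<exists>u\<^sub>F Fs K. u\<^sub>F \<in> S \<and> (\<forall>v\<in>S. B u\<^sub>F v = Fs v) \<and> (\<forall>v\<in>H10 \<Omega>. Fs (graph \<Omega> v) = F v) \<and>
    linear_functional_on (sobolev \<Omega>) Fs \<and> (\<forall>s\<in>sobolev \<Omega>. \<bar>Fs s\<bar> \<le> K * norm s)"
proof (rule Hm1_graph[OF \<Omega> F])
  fix Fs K assume Fs: "\<And>v. v \<in> H10 \<Omega> \<Longrightarrow> Fs (graph \<Omega> v) = F v" "linear_functional_on (sobolev \<Omega>) Fs"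
    "\<And>s. s \<in> sobolev \<Omega> \<Longrightarrow> \<bar>Fs s\<bar> \<le> K * norm s"
  have "\<exists>u\<in>S. \<forall>v\<in>S. B u v = Fs v"
    using S(3) Fs(3) by (intro solve[where K = K] linear_functional_on_subset[OF Fs(2)]) blast+
  then show ?thesis using Fs by blast
qed

text \<open>A functional on the Sobolev space that is invariant under the symmetry and vanishes on the
  symmetric functions is zero: its Riesz representative is fixed by the adjoint of an isometry.\<close>

lemma symmetric_criticality:
  assumes l: "linear_functional_on (sobolev \<Omega>) l" "\<And>v. v \<in> sobolev \<Omega> \<Longrightarrow> \<bar>l v\<bar> \<le> K * norm v"
    and inv: "\<And>v. v \<in> sobolev \<Omega> \<Longrightarrow> l (\<sigma> v) = l v" and zero: "\<And>v. v \<in> S \<Longrightarrow> l v = 0" and v: "v \<in> sobolev \<Omega>"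
  shows "l v = 0"
proof -
  obtain w where w: "w \<in> sobolev \<Omega>" "\<And>v. v \<in> sobolev \<Omega> \<Longrightarrow> l v = inner w v"
    using riesz_subspace[OF closed_sobolev subspace_sobolev[OF \<Omega>] l] by blast
  have "norm (\<sigma> w) \<le> norm w" using sob_map_inner[OF M \<tau>, of w w] by (simp add: norm_eq_sqrt_inner)
  moreover have "inner w (\<sigma> w) = inner w w"
    using w(2)[OF \<sigma>_sobolev[OF w(1)]] w(2)[OF w(1)] inv[OF w(1)] by simp
  ultimately have "\<sigma> w = w" by (rule contraction_adjoint_fixed)
  then have "w \<in> S" using w(1) by (simp add: S_def)
  then have "inner w w = 0" using zero[of w] w(2)[OF w(1)] by simp
  then show ?thesis using w(2)[OF v] by simp
qed

text \<open>\<open>reg_sign e\<close> commutes with the sign \<open>\<tau>\<close>, so the symmetry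
  is kept, and it fixes 0, so the field vanishes outside \<open>\<Omega>\<close>.\<close>

lemma lsq_map_reg_sign_K:
  assumes e: "e > 0" and u: "u \<in> S"
  shows "lsq_map (reg_sign e) (fst u) \<in> Kset"
proof -
  note R = reg_sign_cont[OF e]
  obtain v where v: "v \<in> H10 \<Omega>" "u = graph \<Omega> v" using sobolevE[OF \<Omega> subsetD[OF S(3) u]] .
  have "AE x in lebesgue. rep_lsq (fst u) x = indicator \<Omega> x *\<^sub>R v x"
    unfolding v(2) graph_def fst_conv emb_def by (rule rep_abs_lsq[OF L2_sq_int[OF \<Omega> H1D(1)[OF \<Omega> H10_H1[OF v(1)]]]])
  with rep_lsq_map_AE[OF R, of "fst u"]
  have "AE x in lebesgue. norm (rep_lsq (lsq_map (reg_sign e) (fst u)) x) \<le> indicator \<Omega> x"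
  proof eventually_elim
    case (elim x)
    then show ?case using reg_sign_norm[OF e, of "v x"] by (cases "x \<in> \<Omega>") (simp_all, simp add: reg_sign_def)
  qed
  moreover have "\<tau> *\<^sub>R pull M (lsq_map (reg_sign e) (fst u)) = lsq_map (reg_sign e) (fst u)"
  proof (rule lsq_eqI)
    have fu: "\<tau> *\<^sub>R pull M (fst u) = fst u" using u by (simp add: S_def sob_map_def prod_eq_iff)
    have odd: "reg_sign e (\<tau> *\<^sub>R z) = \<tau> *\<^sub>R reg_sign e z" for z using \<tau> by (auto simp: reg_sign_def)
    show "AE x in lebesgue. rep_lsq (\<tau> *\<^sub>R pull M (lsq_map (reg_sign e) (fst u))) x = rep_lsq (lsq_map (reg_sign e) (fst u)) x"
      using rep_arith_AE(3)[of \<tau> "pull M (lsq_map (reg_sign e) (fst u))"] rep_pull_AE[OF M, of "lsq_map (reg_sign e) (fst u)"]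
        AE_orthogonal[OF M rep_lsq_map_AE[OF R, of "fst u"]] rep_lsq_map_AE[OF R, of "fst u"]
        rep_arith_AE(3)[of \<tau> "pull M (fst u)", unfolded fu] rep_pull_AE[OF M, of "fst u"]
      by eventually_elim (simp add: odd)
  qed
  ultimately show ?thesis by (simp add: Kset_def unit_fields_def)
qed

text \<open>\<open>T0\<close> carries weak limits to weak limits and keeps the images bounded in the
  Sobolev space; \<open>rellich\<close> then makes the first components converge strongly.\<close>

lemma weak_strong:
  assumes X: "\<And>k. X k \<in> Kset" and w: "weak_lim X x"
  shows "(\<lambda>k. fst (T0 (X k))) \<longlonglongrightarrow> fst (T0 x)"
proof -
  interpret T0: bounded_linear T0 by (rule T0_bounded_linear)
  obtain K where K: "\<And>X. norm (T0 X) \<le> norm X * K" "K \<ge> 0" using T0.nonneg_bounded by blast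
  have x: "x \<in> Kset" using closed_convex_weak_lim[OF Kset(1,2) X w] .
  have "(\<lambda>k. fst (T0 (X k) - T0 x)) \<longlonglongrightarrow> 0"
  proof (rule rellich[OF \<Omega> fin])
    show "T0 (X k) - T0 x \<in> sobolev \<Omega>" for k
      using T0(1) S(3) subspace_diff[OF subspace_sobolev[OF \<Omega>]] by blast
    show "norm (T0 (X k) - T0 x) \<le> 2 * (sqrt (measure lebesgue \<Omega>) * K)" for k
    proof -
      have "norm (T0 Y) \<le> sqrt (measure lebesgue \<Omega>) * K" if "Y \<in> Kset" for Y
        using K(1)[of Y] mult_right_mono[OF Kset(4)[OF that] K(2)] by linarith
      from this[OF X] this[OF x] show ?thesis using norm_triangle_ineq4[of "T0 (X k)" "T0 x"] by (smt (verit))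
    qed
    have "weak_lim (\<lambda>k. fst (T0 (X k))) (fst (T0 x))"
      by (rule weak_lim_bounded_linear[OF bounded_linear_compose[OF bounded_linear_fst T0_bounded_linear] w])
    from weak_lim_add_const[OF this, of "- fst (T0 x)"]
    show "weak_lim (\<lambda>k. fst (T0 (X k) - T0 x)) 0" by simp
  qed
  then show ?thesis by (simp add: LIM_zero_iff)
qed

lemma approximate_solutions:
  assumes u\<^sub>F: "u\<^sub>F \<in> S" and e: "e > 0" and d: "d > 0"
  obtains X where "X \<in> Kset" "dist X (lsq_map (reg_sign e) (fst (u\<^sub>F + T0 X))) \<le> d"
proof -
  define f where "f X = lsq_map (reg_sign e) (fst (u\<^sub>F + T0 X))" for X
  interpret T0: bounded_linear T0 by (rule T0_bounded_linear)
  \<comment> \<open>\<open>f X\<close> depends on \<open>X\<close> only through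
    \<open>fst (T0 X)\<close>. Continuity of \<open>f\<close> and compactness of its range both
    reduce to convergence of that component.\<close>
  have lip: "norm (f X - f Y) \<le> (2 / e) * norm (fst (T0 X) - fst (T0 Y))" for X Y
    unfolding f_def using lsq_map_lipschitz[OF reg_sign_cont[OF e] reg_sign_lipschitz[OF e], of "fst (u\<^sub>F + T0 X)" "fst (u\<^sub>F + T0 Y)"] e by simp
  have fK: "f ` Kset \<subseteq> Kset"
    unfolding f_def using lsq_map_reg_sign_K[OF e] subspace_add[OF S(2) u\<^sub>F T0(1)] by blast
  have cf: "continuous_on Kset f"
  proof (rule continuous_on_sequentiallyI)
    fix X :: "nat \<Rightarrow> (real ^ 'n, complex) lsq" and x assume "X \<longlonglongrightarrow> x"
    then have "(\<lambda>n. (2 / e) * norm (fst (T0 (X n)) - fst (T0 x))) \<longlonglongrightarrow> (2 / e) * norm (fst (T0 x) - fst (T0 x))"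
      by (intro tendsto_intros T0.tendsto)
    then have "(\<lambda>n. f (X n) - f x) \<longlonglongrightarrow> 0" by (intro Lim_null_comparison[OF always_eventually[OF allI[OF lip]]]) simp
    then show "(\<lambda>n. f (X n)) \<longlonglongrightarrow> f x" by (simp add: LIM_zero_iff)
  qed
  have "compact (f ` Kset)"
    unfolding compact_def
  proof (intro allI impI)
    fix Y :: "nat \<Rightarrow> (real ^ 'n, complex) lsq" assume "\<forall>n. Y n \<in> f ` Kset"
    then have "\<forall>n. \<exists>X. X \<in> Kset \<and> Y n = f X" by blast
    from choice[OF this] obtain X where X: "\<forall>n. X n \<in> Kset \<and> Y n = f (X n)" by blast
    obtain r x where r: "strict_mono r" "weak_lim (X \<circ> r) x"
      using bounded_imp_weak_lim_subseq[of X "sqrt (measure lebesgue \<Omega>)"] X Kset(4) by blast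
    have x: "x \<in> Kset" by (rule closed_convex_weak_lim[OF Kset(1,2) _ r(2)]) (use X in simp)
    have "(\<lambda>k. fst (T0 ((X \<circ> r) k))) \<longlonglongrightarrow> fst (T0 x)" by (rule weak_strong[OF _ r(2)]) (use X in simp)
    then have "(\<lambda>n. (2 / e) * norm (fst (T0 ((X \<circ> r) n)) - fst (T0 x))) \<longlonglongrightarrow> (2 / e) * norm (fst (T0 x) - fst (T0 x))"
      by (intro tendsto_mult tendsto_const tendsto_norm tendsto_diff)
    then have "(\<lambda>n. f ((X \<circ> r) n) - f x) \<longlonglongrightarrow> 0" by (intro Lim_null_comparison[OF always_eventually[OF allI[OF lip]]]) simp
    then have "(\<lambda>n. f ((X \<circ> r) n)) \<longlonglongrightarrow> f x" by (simp add: LIM_zero_iff)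
    moreover have "Y \<circ> r = (\<lambda>n. f ((X \<circ> r) n))" using X by (simp add: fun_eq_iff)
    ultimately show "\<exists>l\<in>f ` Kset. \<exists>r. strict_mono r \<and> (Y \<circ> r) \<longlonglongrightarrow> l"
      using x r(1) by (intro bexI[of _ "f x"] exI[of _ r]) auto
  qed
  then obtain X where "X \<in> Kset" "dist X (f X) \<le> d"
    using schauder_approximate_fixpoint[OF Kset(2) _ fK cf _ d] Kset(3) by blast
  then show ?thesis using that by (simp add: f_def)
qed

text \<open>On \<open>E\<close> the fields converge pointwise and are dominated on a set of finite
  measure. Cut off to \<open>E\<close> they converge strongly in L2, and the strong limit must agree
  with the weak one.\<close>

lemma section_limit:
  assumes X: "\<And>k. X k \<in> unit_fields \<Omega>" and wX: "weak_lim X U" and ae: "AE x in lebesgue. x \<in> E \<longrightarrow> (\<lambda>k. rep_lsq (X k) x) \<longlonglongrightarrow> s x"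
    and E: "E \<in> sets lebesgue" "E \<subseteq> \<Omega>"
  shows "AE x in lebesgue. x \<in> E \<longrightarrow> rep_lsq U x = s x"
proof -
  define k where "k x = (indicator E x :: complex)" for x
  have k: "k \<in> borel_measurable lebesgue" "\<And>x. norm (k x) \<le> 1"
    unfolding k_def using E(1) by (auto simp: indicator_def)
  have Xle: "AE x in lebesgue. \<forall>n. norm (rep_lsq (X n) x) \<le> indicator \<Omega> x"
    using X by (intro AE_all_countable[THEN iffD2] allI) (simp add: unit_fields_def)
  \<comment> \<open>No measurability of \<open>s\<close> is assumed. The limit function of the
    cut-off fields is measurable by construction and equals \<open>s\<close> almost everywhere on
    \<open>E\<close>.\<close>
  define l where "l x = lim (\<lambda>n. k x * rep_lsq (X n) x)" for x
  have mX: "(\<lambda>x. k x * rep_lsq (X n) x) \<in> borel_measurable lebesgue" for n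
    using k(1) sq_int_measurable[OF sq_int_rep[of "X n"]] by measurable
  have ml: "l \<in> borel_measurable lebesgue" unfolding l_def using mX by measurable
  have tl: "AE x in lebesgue. (\<lambda>n. k x * rep_lsq (X n) x) \<longlonglongrightarrow> l x \<and> (x \<in> E \<longrightarrow> l x = s x)"
    using ae
  proof eventually_elim
    case (elim x)
    show ?case
    proof (cases "x \<in> E")
      case True
      then have "(\<lambda>n. k x * rep_lsq (X n) x) \<longlonglongrightarrow> s x" using elim by (simp add: k_def)
      then show ?thesis by (simp add: l_def limI)
    next
      case False
      then show ?thesis by (simp add: k_def l_def limI)
    qed
  qed
  have lb: "AE x in lebesgue. norm (l x) \<le> indicator \<Omega> x"
    using tl Xle
  proof eventually_elim
    case (elim x)
    have "norm (k x * rep_lsq (X n) x) \<le> indicator \<Omega> x" for n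
    proof -
      have "norm (k x * rep_lsq (X n) x) \<le> norm (rep_lsq (X n) x)" by (simp add: norm_mult k_def indicator_def)
      also have "\<dots> \<le> indicator \<Omega> x" using elim(2) by blast
      finally show ?thesis .
    qed
    then show ?case by (intro LIMSEQ_le_const2[OF tendsto_norm[OF conjunct1[OF elim(1)]]]) auto
  qed
  \<comment> \<open>The factor 4 is \<open>(1 + 1)\<^sup>2\<close>: the fields and their limit both
    have modulus at most 1.\<close>
  have wi: "integrable lebesgue (\<lambda>x. 4 * indicator \<Omega> x :: real)" using fin by (auto simp: fmeasurable_def)
  have ls: "sq_int l" unfolding sq_int_def
  proof (rule conjI, rule ml, rule Bochner_Integration.integrable_bound[OF wi])
    show "(\<lambda>x. (norm (l x))\<^sup>2) \<in> borel_measurable lebesgue" using ml by measurable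
    show "AE x in lebesgue. norm ((norm (l x))\<^sup>2) \<le> norm (4 * indicator \<Omega> x :: real)"
      using lb by eventually_elim (auto simp: indicator_def split: if_splits intro: order_trans[OF power_le_one])
  qed
  have sX: "sq_int (\<lambda>x. k x * rep_lsq (X n) x)" for n by (rule sq_int_mult[OF k sq_int_rep])
  have "(\<lambda>n. LINT x|lebesgue. (norm (k x * rep_lsq (X n) x - l x))\<^sup>2) \<longlonglongrightarrow> (LINT x|(lebesgue :: (real ^ 'n) measure). (0::real))"
  proof (rule integral_dominated_convergence[where w = "\<lambda>x. 4 * indicator \<Omega> x"])
    show "(\<lambda>x. (norm (k x * rep_lsq (X n) x - l x))\<^sup>2) \<in> borel_measurable lebesgue" for n
      using sq_int_measurable[OF sq_int_diff[OF sX ls]] by measurable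
    show "AE x in lebesgue. (\<lambda>n. (norm (k x * rep_lsq (X n) x - l x))\<^sup>2) \<longlonglongrightarrow> 0"
      using tl
    proof eventually_elim
      case (elim x)
      then have "(\<lambda>n. (norm (k x * rep_lsq (X n) x - l x))\<^sup>2) \<longlonglongrightarrow> (norm (l x - l x))\<^sup>2" by (intro tendsto_intros) auto
      then show ?case by simp
    qed
    show "AE x in lebesgue. norm ((norm (k x * rep_lsq (X n) x - l x))\<^sup>2) \<le> 4 * indicator \<Omega> x" for n
      using Xle lb
    proof eventually_elim
      case (elim x)
      have "norm (k x * rep_lsq (X n) x) \<le> indicator \<Omega> x"
      proof -
        have "norm (k x * rep_lsq (X n) x) \<le> norm (rep_lsq (X n) x)" by (simp add: norm_mult k_def indicator_def)
        also have "\<dots> \<le> indicator \<Omega> x" using elim(1) by blast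
        finally show ?thesis .
      qed
      then have "norm (k x * rep_lsq (X n) x - l x) \<le> 2 * indicator \<Omega> x"
        using norm_triangle_ineq4[of "k x * rep_lsq (X n) x" "l x"] elim(2) by linarith
      then have "(norm (k x * rep_lsq (X n) x - l x))\<^sup>2 \<le> (2 * indicator \<Omega> x)\<^sup>2" by (intro power_mono) auto
      then show ?case by (cases "x \<in> \<Omega>") auto
    qed
  qed (use wi in simp_all)
  then have "(\<lambda>n. (norm (mulop k (X n) - abs_lsq l))\<^sup>2) \<longlonglongrightarrow> 0"
    by (simp add: mulop_def abs_lsq_arith(2)[OF sX ls] norm_abs_lsq[OF sq_int_diff[OF sX ls]])
  then have "(\<lambda>n. sqrt ((norm (mulop k (X n) - abs_lsq l))\<^sup>2)) \<longlonglongrightarrow> sqrt 0" by (rule tendsto_real_sqrt)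
  then have "(\<lambda>n. mulop k (X n)) \<longlonglongrightarrow> abs_lsq l" by (simp add: tendsto_norm_zero_iff LIM_zero_iff)
  moreover have "weak_lim (\<lambda>n. mulop k (X n)) (mulop k U)"
    by (rule weak_lim_bounded_linear[OF mulop_bounded_linear[OF k] wX])
  ultimately have "mulop k U = abs_lsq l" using weak_lim_unique_strong by blast
  then have "AE x in lebesgue. k x * rep_lsq U x = l x"
    unfolding mulop_def using abs_lsq_eq_iff[OF sq_int_mult[OF k sq_int_rep] ls] by blast
  then show ?thesis using tl by eventually_elim (auto simp: k_def)
qed

end

section \<open>Between inner products and the weak formulation\<close>

lemma dualities:
  assumes \<Omega>: "open \<Omega>" and f: "f \<in> L2 \<Omega>" and v: "v \<in> L2 \<Omega>"
  shows "duality \<Omega> f v = inner (emb \<Omega> f) (emb \<Omega> v)" "integrable (lebesgue_on \<Omega>) (\<lambda>x. f x * cnj (v x))"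
    "duality \<Omega> f v = (LINT x|lebesgue_on \<Omega>. inner (f x) (v x))"
proof -
  have i: "integrable (lebesgue_on \<Omega>) (\<lambda>x. (norm (f x))\<^sup>2 + (norm (v x))\<^sup>2)" using f v by (simp add: L2_def)
  show int: "integrable (lebesgue_on \<Omega>) (\<lambda>x. f x * cnj (v x))"
  proof (rule Bochner_Integration.integrable_bound[OF i])
    have "f \<in> borel_measurable (lebesgue_on \<Omega>)" "v \<in> borel_measurable (lebesgue_on \<Omega>)" using f v by (auto simp: L2_def)
    moreover from this(2) have "(\<lambda>x. cnj (v x)) \<in> borel_measurable (lebesgue_on \<Omega>)"
      by (rule measurable_compose[OF _ borel_measurable_continuous_onI[OF continuous_on_cnj[OF continuous_on_id]]])
    ultimately show "(\<lambda>x. f x * cnj (v x)) \<in> borel_measurable (lebesgue_on \<Omega>)" by measurable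
    have "norm (f x) * norm (v x) \<le> (norm (f x))\<^sup>2 + (norm (v x))\<^sup>2" for x
      using sum_squares_bound[of "norm (f x)" "norm (v x)"] mult_nonneg_nonneg[OF norm_ge_zero[of "f x"] norm_ge_zero[of "v x"]]
      by linarith
    then show "AE x in lebesgue_on \<Omega>. norm (f x * cnj (v x)) \<le> norm ((norm (f x))\<^sup>2 + (norm (v x))\<^sup>2)"
      by (intro AE_I2) (simp add: norm_mult add_nonneg_nonneg)
  qed
  have "Re (LINT x|lebesgue_on \<Omega>. f x * cnj (v x)) = (LINT x|lebesgue_on \<Omega>. Re (f x * cnj (v x)))"
    by (rule integral_Re[OF int, symmetric])
  then show 1: "duality \<Omega> f v = (LINT x|lebesgue_on \<Omega>. inner (f x) (v x))"
    by (simp add: duality_def inner_complex_def)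
  show "duality \<Omega> f v = inner (emb \<Omega> f) (emb \<Omega> v)" unfolding 1 by (rule inner_emb(1)[OF \<Omega> f v, symmetric])
qed

lemma sum_dualities:
  assumes \<Omega>: "open \<Omega>" and p: "p \<in> L2 \<Omega>" and q: "q \<in> L2 \<Omega>"
  shows "(\<Sum>i\<in>UNIV. duality \<Omega> (\<lambda>x. p x $ i) (\<lambda>x. q x $ i)) = inner (emb \<Omega> p) (emb \<Omega> q)"
proof -
  have c: "(\<lambda>x. p x $ i) \<in> L2 \<Omega>" "(\<lambda>x. q x $ i) \<in> L2 \<Omega>" for i
    by (rule L2_bounded_linear[OF \<Omega> p bounded_linear_vec_nth], rule L2_bounded_linear[OF \<Omega> q bounded_linear_vec_nth])
  have "(\<Sum>i\<in>UNIV. duality \<Omega> (\<lambda>x. p x $ i) (\<lambda>x. q x $ i)) = (\<Sum>i\<in>UNIV. (LINT x|lebesgue_on \<Omega>. inner (p x $ i) (q x $ i)))"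
    by (simp only: dualities(3)[OF \<Omega> c])
  also have "\<dots> = (LINT x|lebesgue_on \<Omega>. (\<Sum>i\<in>UNIV. inner (p x $ i) (q x $ i)))"
    by (rule Bochner_Integration.integral_sum[symmetric]) (rule inner_emb(2)[OF \<Omega> c])
  also have "\<dots> = (LINT x|lebesgue_on \<Omega>. inner (p x) (q x))" by (simp add: inner_vec_def)
  finally show ?thesis by (simp only: inner_emb(1)[OF \<Omega> p q])
qed

lemma const_mult_L2: "open \<Omega> \<Longrightarrow> f \<in> L2 \<Omega> \<Longrightarrow> (\<lambda>x. (c::complex) * f x) \<in> L2 \<Omega>"
  by (rule L2_bounded_linear[OF _ _ bounded_linear_mult_right])

lemma mulop_const_emb: "open \<Omega> \<Longrightarrow> f \<in> L2 \<Omega> \<Longrightarrow> mulop (\<lambda>_. c) (emb \<Omega> f) = emb \<Omega> (\<lambda>x. c * f x)"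
  by (simp add: emb_def mulop_const[OF L2_sq_int] mult.commute mult_scaleR_right)

lemma unit_fields_emb:
  assumes \<Omega>: "open \<Omega>" and X: "X \<in> unit_fields \<Omega>" shows "rep_lsq X \<in> L2 \<Omega>" "emb \<Omega> (rep_lsq X) = X"
proof -
  have ae: "AE x in lebesgue. rep_lsq X x = indicator \<Omega> x *\<^sub>R rep_lsq X x"
    using X unfolding unit_fields_def mem_Collect_eq by eventually_elim (auto simp: indicator_def split: if_splits)
  have s: "sq_int (\<lambda>x. indicator \<Omega> x *\<^sub>R rep_lsq X x)"
    by (rule sq_int_bound[OF sq_int_rep borel_measurable_AE[OF sq_int_measurable[OF sq_int_rep] ae], where c = 1])
      (auto simp: indicator_def)
  then show "rep_lsq X \<in> L2 \<Omega>" using L2_iff_sq_int[OF open_lebesgue[OF \<Omega>]] by blast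
  have "abs_lsq (\<lambda>x. indicator \<Omega> x *\<^sub>R rep_lsq X x) = abs_lsq (rep_lsq X)"
    unfolding abs_lsq_eq_iff[OF s sq_int_rep] using ae by eventually_elim simp
  then show "emb \<Omega> (rep_lsq X) = X" by (simp add: emb_def)
qed

context dirichlet_data
begin

lemma existence_graph:
  obtains u U where "u \<in> H10 \<Omega>" "U \<in> Kset" "\<sigma> (graph \<Omega> u) = graph \<Omega> u"
    "\<And>v. v \<in> H10 \<Omega> \<Longrightarrow> B (graph \<Omega> u) (graph \<Omega> v) + inner (mulop (\<lambda>_. a) U) (emb \<Omega> v) = F v"
    "AE x in lebesgue. x \<in> \<Omega> \<and> rep_lsq (emb \<Omega> u) x \<noteq> 0 \<longrightarrow>
      rep_lsq U x = rep_lsq (emb \<Omega> u) x / of_real (norm (rep_lsq (emb \<Omega> u) x))"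
proof -
  obtain u\<^sub>F Fs K where "u\<^sub>F \<in> S" "\<forall>v\<in>S. B u\<^sub>F v = Fs v" "\<forall>v\<in>H10 \<Omega>. Fs (graph \<Omega> v) = F v"
    "linear_functional_on (sobolev \<Omega>) Fs" "\<forall>s\<in>sobolev \<Omega>. \<bar>Fs s\<bar> \<le> K * norm s" using particular by blast
  then have uF: "u\<^sub>F \<in> S" "\<And>v. v \<in> S \<Longrightarrow> B u\<^sub>F v = Fs v" and Fs: "\<And>v. v \<in> H10 \<Omega> \<Longrightarrow> Fs (graph \<Omega> v) = F v"
    "linear_functional_on (sobolev \<Omega>) Fs" "\<And>s. s \<in> sobolev \<Omega> \<Longrightarrow> \<bar>Fs s\<bar> \<le> K * norm s" by blast+
  \<comment> \<open>\<open>e k\<close> is both the regularisation of the sign and the tolerance of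
    the approximate fixed point, so both errors vanish in the limit.\<close>
  define e where "e k = 1 / real (Suc k)" for k
  have e: "e k > 0" for k by (simp add: e_def)
  have e0: "e \<longlonglongrightarrow> 0" unfolding e_def by (rule LIMSEQ_Suc[OF lim_1_over_n])
  define w where "w X = fst (u\<^sub>F + T0 X)" for X
  have "\<forall>k. \<exists>X. X \<in> Kset \<and> dist X (lsq_map (reg_sign (e k)) (w X)) \<le> e k"
    using approximate_solutions[OF uF(1) e e] unfolding w_def by blast
  from choice[OF this] obtain X where X: "\<forall>k. X k \<in> Kset \<and> dist (X k) (lsq_map (reg_sign (e k)) (w (X k))) \<le> e k" by blast
  have "norm (X k) \<le> sqrt (measure lebesgue \<Omega>)" for k using X Kset(4) by blast
  then obtain r U where r: "strict_mono r" "weak_lim (X \<circ> r) U"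
    using bounded_imp_weak_lim_subseq by blast
  have U: "U \<in> Kset" by (rule closed_convex_weak_lim[OF Kset(1,2) _ r(2)]) (use X in simp)
  have "(\<lambda>k. fst (T0 ((X \<circ> r) k))) \<longlonglongrightarrow> fst (T0 U)" by (rule weak_strong[OF _ r(2)]) (use X in simp)
  then have "(\<lambda>k. fst u\<^sub>F + fst (T0 ((X \<circ> r) k))) \<longlonglongrightarrow> fst u\<^sub>F + fst (T0 U)" by (rule tendsto_add[OF tendsto_const])
  then have wl: "(\<lambda>k. w (X (r k))) \<longlonglongrightarrow> w U" by (simp add: w_def)
  obtain r2 where r2: "strict_mono r2" "AE t in lebesgue. (\<lambda>k. rep_lsq (w (X (r (r2 k)))) t) \<longlonglongrightarrow> rep_lsq (w U) t"
    using lsq_tendsto_AE_subseq[OF wl] by blast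
  \<comment> \<open>The defect of the approximate fixed point. It tends to 0 in norm, so along a
    subsequence it does not disturb the pointwise limit of the signs.\<close>
  define D where "D k = X k - lsq_map (reg_sign (e k)) (w (X k))" for k
  have "D \<longlonglongrightarrow> 0"
    by (rule Lim_null_comparison[OF always_eventually e0]) (use X in \<open>simp add: D_def dist_norm\<close>)
  moreover have m2: "strict_mono (r \<circ> r2)" using r(1) r2(1) by (rule strict_mono_o)
  ultimately have "(\<lambda>k. D ((r \<circ> r2) k)) \<longlonglongrightarrow> 0" using LIMSEQ_subseq_LIMSEQ[of D 0 "r \<circ> r2"] by (simp add: o_def)
  then obtain r3 where r3: "strict_mono r3" "AE t in lebesgue. (\<lambda>k. rep_lsq (D ((r \<circ> r2) (r3 k))) t) \<longlonglongrightarrow> rep_lsq 0 t"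
    using lsq_tendsto_AE_subseq by blast
  \<comment> \<open>Nested subsequences: \<open>r\<close> for weak convergence of the fields,
    \<open>r2\<close> for pointwise convergence of the solutions, \<open>r3\<close> for that of the
    defects.\<close>
  define s where "s = r \<circ> r2 \<circ> r3"
  have s: "strict_mono s" unfolding s_def using m2 r3(1) by (rule strict_mono_o)
  have es: "(\<lambda>k. e (s k)) \<longlonglongrightarrow> 0" using LIMSEQ_subseq_LIMSEQ[OF e0 s] by (simp add: o_def)
  have XD: "AE t in lebesgue. \<forall>k. rep_lsq (X k) t = rep_lsq (D k) t + reg_sign (e k) (rep_lsq (w (X k)) t)"
  proof (intro AE_all_countable[THEN iffD2] allI)
    fix k
    show "AE t in lebesgue. rep_lsq (X k) t = rep_lsq (D k) t + reg_sign (e k) (rep_lsq (w (X k)) t)"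
      using rep_arith_AE(2)[of "X k" "lsq_map (reg_sign (e k)) (w (X k))"] rep_lsq_map_AE[OF reg_sign_cont[OF e[of k]], of "w (X k)"]
      by eventually_elim (simp add: D_def)
  qed
  have z0: "AE x in lebesgue. rep_lsq (0 :: (real ^ 'n, complex) lsq) x = 0" by (rule rep_arith_AE(4))
  define E where "E = {x \<in> \<Omega>. rep_lsq (w U) x \<noteq> 0}"
  have "AE x in lebesgue. x \<in> E \<longrightarrow> (\<lambda>k. rep_lsq (X (s k)) x) \<longlonglongrightarrow> rep_lsq (w U) x / of_real (norm (rep_lsq (w U) x))"
    using XD r2(2) r3(2) z0
  proof eventually_elim
    case (elim x)
    show ?case
    proof
      assume "x \<in> E"
      then have nz: "rep_lsq (w U) x \<noteq> 0" by (simp add: E_def)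
      have "(\<lambda>k. rep_lsq (w (X (s k))) x) \<longlonglongrightarrow> rep_lsq (w U) x"
        using LIMSEQ_subseq_LIMSEQ[OF elim(2) r3(1)] by (simp add: s_def o_def)
      from reg_sign_tendsto[OF this nz es]
      have "(\<lambda>k. rep_lsq (D (s k)) x + reg_sign (e (s k)) (rep_lsq (w (X (s k))) x)) \<longlonglongrightarrow> 0 + rep_lsq (w U) x / of_real (norm (rep_lsq (w U) x))"
        using elim(3,4) by (intro tendsto_add) (simp_all add: s_def)
      then show "(\<lambda>k. rep_lsq (X (s k)) x) \<longlonglongrightarrow> rep_lsq (w U) x / of_real (norm (rep_lsq (w U) x))"
        using elim(1) by simp
    qed
  qed
  then have sect: "AE x in lebesgue. x \<in> E \<longrightarrow> rep_lsq U x = rep_lsq (w U) x / of_real (norm (rep_lsq (w U) x))"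
  proof (rule section_limit[rotated 2])
    show "X (s k) \<in> unit_fields \<Omega>" for k using X by (auto simp: Kset_def)
    have "(\<lambda>k. X (s k)) = (X \<circ> r) \<circ> (r2 \<circ> r3)" by (simp add: s_def fun_eq_iff)
    then show "weak_lim (\<lambda>k. X (s k)) U"
      using weak_lim_subseq[OF r(2) strict_mono_o[OF r2(1) r3(1)]] by simp
    have ne: "{x \<in> space lebesgue. rep_lsq (w U) x \<noteq> 0} \<in> sets lebesgue"
      using sq_int_measurable[OF sq_int_rep[of "w U"]] by measurable
    have "E = \<Omega> \<inter> {x \<in> space lebesgue. rep_lsq (w U) x \<noteq> 0}" by (auto simp: E_def)
    then show "E \<in> sets lebesgue" using sets.Int[OF open_lebesgue[OF \<Omega>] ne] by simp
    show "E \<subseteq> \<Omega>" by (auto simp: E_def)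
  qed
  define sol where "sol = u\<^sub>F + T0 U"
  have solS: "sol \<in> S" unfolding sol_def using uF(1) T0(1) by (rule subspace_add[OF S(2)])
  interpret B: bounded_bilinear B by (rule B)
  \<comment> \<open>The residual on all of \<open>sobolev \<Omega>\<close>. It is invariant since
    \<open>\<sigma>\<close> fixes \<open>sol\<close> and preserves \<open>B\<close>,
    \<open>U\<close> is symmetric, and \<open>F\<close> is invariant; on \<open>S\<close> it
    vanishes by the choice of \<open>u\<^sub>F\<close> and \<open>T0\<close>.\<close>
  define l where "l v = B sol v + inner (mulop (\<lambda>_. a) U) (fst v) - Fs v" for v
  obtain KB where KB: "\<And>s t. norm (B s t) \<le> norm s * norm t * KB" using B.bounded by blast
  have l0: "l v = 0" if v: "v \<in> sobolev \<Omega>" for v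
  proof (rule symmetric_criticality[OF _ _ _ _ v])
    show "linear_functional_on (sobolev \<Omega>) l"
      using Fs(2) by (simp add: linear_functional_on_def l_def B.add_right B.scaleR_right inner_add_right algebra_simps)
    show "\<bar>l v\<bar> \<le> (norm sol * KB + norm (mulop (\<lambda>_. a) U) + K) * norm v" if "v \<in> sobolev \<Omega>" for v
    proof -
      have "\<bar>inner (mulop (\<lambda>_. a) U) (fst v)\<bar> \<le> norm (mulop (\<lambda>_. a) U) * norm v"
        using Cauchy_Schwarz_ineq2[of "mulop (\<lambda>_. a) U" "fst v"]
          mult_left_mono[OF norm_fst_le[of "fst v" "snd v"] norm_ge_zero[of "mulop (\<lambda>_. a) U"]] by simp
      then show ?thesis using KB[of sol v] Fs(3)[OF that] by (simp add: l_def algebra_simps)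
    qed
    show "l (\<sigma> v) = l v" if v: "v \<in> sobolev \<Omega>" for v
    proof -
      have "B sol (\<sigma> v) = B sol v" using B_\<sigma>[of sol v] solS by (simp add: S_def)
      moreover have "inner (mulop (\<lambda>_. a) U) (fst (\<sigma> v)) = inner (mulop (\<lambda>_. a) U) (fst v)"
      proof -
        have "mulop (\<lambda>_. a) U = \<tau> *\<^sub>R pull M (mulop (\<lambda>_. a) U)"
          using mulop_\<sigma>[of "\<lambda>_. a" "norm a" U] U by (simp add: Kset_def)
        then have "inner (mulop (\<lambda>_. a) U) (fst (\<sigma> v)) = inner (\<tau> *\<^sub>R pull M (mulop (\<lambda>_. a) U)) (\<tau> *\<^sub>R pull M (fst v))"
          by (simp only: sob_map_def fst_conv)
        then show ?thesis by (simp only: pull_\<tau>_inner)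
      qed
      moreover obtain g where g: "g \<in> H10 \<Omega>" "v = graph \<Omega> g" using sobolevE[OF \<Omega> v] .
      have "Fs (\<sigma> v) = Fs v" using Fs(1)[OF sym(1)[OF g(1)]] Fs(1)[OF g(1)] sym(2)[OF g(1)] by (simp add: g(2) \<sigma>_graph[OF g(1)])
      ultimately show ?thesis by (simp add: l_def)
    qed
    show "l v = 0" if "v \<in> S" for v
      using uF(2)[OF that] T0(2)[OF that, of U] by (simp add: l_def sol_def B.add_left)
  qed
  obtain u where u: "u \<in> H10 \<Omega>" "sol = graph \<Omega> u" using sobolevE[OF \<Omega> subsetD[OF S(3) solS]] .
  have wu: "w U = emb \<Omega> u" using u(2) by (simp add: w_def sol_def[symmetric] graph_def)
  show ?thesis
  proof (rule that[OF u(1) U])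
    show "\<sigma> (graph \<Omega> u) = graph \<Omega> u" using solS u(2) by (simp add: S_def)
    show "B (graph \<Omega> u) (graph \<Omega> v) + inner (mulop (\<lambda>_. a) U) (emb \<Omega> v) = F v" if v: "v \<in> H10 \<Omega>" for v
    proof -
      have "graph \<Omega> v \<in> sobolev \<Omega>" using v H10_iff_sobolev[OF \<Omega>] by blast
      from l0[OF this] show ?thesis using Fs(1)[OF v] by (simp add: l_def u(2)) (simp add: graph_def)
    qed
    show "AE x in lebesgue. x \<in> \<Omega> \<and> rep_lsq (emb \<Omega> u) x \<noteq> 0 \<longrightarrow>
      rep_lsq U x = rep_lsq (emb \<Omega> u) x / of_real (norm (rep_lsq (emb \<Omega> u) x))"
      using sect unfolding wu[symmetric] E_def by simp
  qed
qed

lemma existence: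
  assumes V: "V \<in> Linf \<Omega>" and VW: "AE x in lebesgue. x \<in> \<Omega> \<longrightarrow> V x = W x"
  shows "\<exists>u. global_weak_solution \<Omega> a b V F u \<and> (AE x in lebesgue. x \<in> \<Omega> \<longrightarrow> \<tau> *\<^sub>R u (M *v x) = u x)"
proof -
  obtain u X where u: "u \<in> H10 \<Omega>" and X: "X \<in> Kset" and \<sigma>u: "\<sigma> (graph \<Omega> u) = graph \<Omega> u"
    and eqn: "\<And>v. v \<in> H10 \<Omega> \<Longrightarrow> B (graph \<Omega> u) (graph \<Omega> v) + inner (mulop (\<lambda>_. a) X) (emb \<Omega> v) = F v"
    and sect: "AE x in lebesgue. x \<in> \<Omega> \<and> rep_lsq (emb \<Omega> u) x \<noteq> 0 \<longrightarrow>
      rep_lsq X x = rep_lsq (emb \<Omega> u) x / of_real (norm (rep_lsq (emb \<Omega> u) x))"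
    using existence_graph by blast
  note u2 = H1D[OF \<Omega> H10_H1[OF u]]
  have XU: "X \<in> unit_fields \<Omega>" using X by (simp add: Kset_def)
  note X2 = unit_fields_emb[OF \<Omega> XU]
  have ru: "AE x in lebesgue. rep_lsq (emb \<Omega> u) x = indicator \<Omega> x *\<^sub>R u x"
    unfolding emb_def by (rule rep_abs_lsq[OF L2_sq_int[OF \<Omega> u2(1)]])
  have le1: "AE x in lebesgue_on \<Omega>. norm (rep_lsq X x) \<le> 1"
    using XU unfolding unit_fields_def mem_Collect_eq AE_lebesgue_on[OF open_lebesgue[OF \<Omega>]]
    by eventually_elim (auto simp: indicator_def)
  have mX: "rep_lsq X \<in> borel_measurable (lebesgue_on \<Omega>)" using X2(1) by (simp add: L2_def)
  have hu: "(\<lambda>x. h x * u x) \<in> L2 \<Omega>" "emb \<Omega> (\<lambda>x. h x * u x) = mulop h (emb \<Omega> u)"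
  proof -
    have eq: "h x * (indicator \<Omega> x *\<^sub>R u x) = indicator \<Omega> x *\<^sub>R (h x * u x)" for x by simp
    have "sq_int (\<lambda>x. h x * (indicator \<Omega> x *\<^sub>R u x))" by (rule sq_int_mult[OF h L2_sq_int[OF \<Omega> u2(1)]])
    then show "(\<lambda>x. h x * u x) \<in> L2 \<Omega>" unfolding eq using L2_iff_sq_int[OF open_lebesgue[OF \<Omega>]] by blast
    show "emb \<Omega> (\<lambda>x. h x * u x) = mulop h (emb \<Omega> u)"
      unfolding emb_def mulop_abs[OF h L2_sq_int[OF \<Omega> u2(1)]] eq ..
  qed
  have bu: "(\<lambda>x. b * u x) \<in> L2 \<Omega>" by (rule const_mult_L2[OF \<Omega> u2(1)])
  have Vu: "(\<lambda>x. of_real (V x) * u x) \<in> L2 \<Omega>" "emb \<Omega> (\<lambda>x. of_real (V x) * u x) = emb \<Omega> (\<lambda>x. h x * u x) - emb \<Omega> (\<lambda>x. b * u x)"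
  proof -
    have ae: "AE x in lebesgue. x \<in> \<Omega> \<longrightarrow> h x * u x - b * u x = of_real (V x) * u x"
      using VW by eventually_elim (simp add: h_def distrib_right)
    show "(\<lambda>x. of_real (V x) * u x) \<in> L2 \<Omega>" "emb \<Omega> (\<lambda>x. of_real (V x) * u x) = emb \<Omega> (\<lambda>x. h x * u x) - emb \<Omega> (\<lambda>x. b * u x)"
      using L2_cong_AE[OF \<Omega> L2_lincomb(2)[OF \<Omega> hu(1) bu] ae] emb_arith(2)[OF \<Omega> hu(1) bu] by auto
  qed
  have aX: "(\<lambda>x. a * rep_lsq X x) \<in> L2 \<Omega>" "emb \<Omega> (\<lambda>x. a * rep_lsq X x) = mulop (\<lambda>_. a) X"
    using const_mult_L2[OF \<Omega> X2(1)] mulop_const_emb[OF \<Omega> X2(1), of a] X2(2) by auto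
  have "global_weak_solution \<Omega> a b V F u"
    unfolding global_weak_solution_def
  proof (intro conjI exI[of _ "rep_lsq X"] ballI)
    show "u \<in> H10 \<Omega> \<inter> L1 \<Omega>" using u L2_L1[OF \<Omega> fin u2(1)] by simp
    show "saturated_section \<Omega> u (rep_lsq X)"
      unfolding saturated_section_def
    proof (intro conjI)
      show "u \<in> L1loc \<Omega>" by (rule L2_L1loc[OF \<Omega> u2(1)])
      show "rep_lsq X \<in> Linf \<Omega>" using mX le1 by (auto simp: Linf_def)
      have "esssup (lebesgue_on \<Omega>) (\<lambda>x. ennreal (norm (rep_lsq X x))) \<le> 1"
        using mX le1 by (intro esssup_I) (auto elim: eventually_mono)
      then show "Linf_norm \<Omega> (rep_lsq X) \<le> 1"
        unfolding Linf_norm_def using enn2real_mono[of _ 1] by (simp add: enn2real_leI)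
      show "AE x in lebesgue_on \<Omega>. u x \<noteq> 0 \<longrightarrow> rep_lsq X x = u x / of_real (cmod (u x))"
        unfolding AE_lebesgue_on[OF open_lebesgue[OF \<Omega>]]
        using sect ru by eventually_elim auto
    qed
    fix v assume "v \<in> H10 \<Omega> \<inter> L1 \<Omega>"
    then have v: "v \<in> H10 \<Omega>" by simp
    note v2 = H1D[OF \<Omega> H10_H1[OF v]]
    show "(\<Sum>i\<in>UNIV. duality \<Omega> (\<lambda>x. weak_gradient \<Omega> u x $ i) (\<lambda>x. weak_gradient \<Omega> v x $ i))
        + duality \<Omega> (\<lambda>x. a * rep_lsq X x) v + duality \<Omega> (\<lambda>x. b * u x) v + duality \<Omega> (\<lambda>x. of_real (V x) * u x) v = F v"
      using eqn[OF v] hu(2)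
      by (simp add: sum_dualities[OF \<Omega> u2(2) v2(2)] dualities(1)[OF \<Omega> aX(1) v2(1)] dualities(1)[OF \<Omega> bu v2(1)]
          dualities(1)[OF \<Omega> Vu(1) v2(1)] aX(2) Vu(2) B_def graph_def inner_diff_left)
  qed
  moreover have "AE x in lebesgue. x \<in> \<Omega> \<longrightarrow> \<tau> *\<^sub>R u (M *v x) = u x"
  proof -
    note s = H1D(1)[OF \<Omega> H10_H1[OF sym(1)[OF u]]]
    have "emb \<Omega> (\<lambda>x. \<tau> *\<^sub>R u (M *v x)) = emb \<Omega> u"
      using \<sigma>_graph[OF u] \<sigma>u by (simp add: graph_def)
    then show ?thesis using emb_eq_iff[OF \<Omega> s u2(1)] by blast
  qed
  ultimately show ?thesis by blast
qed

end

subsection \<open>A priori bound\<close>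

lemma Hm1_bound:
  assumes \<Omega>: "open \<Omega>" and F: "F \<in> Hm1 \<Omega>" and v: "v \<in> H10 \<Omega>"
  shows "\<bar>F v\<bar> \<le> Hm1_norm \<Omega> F * H1_norm \<Omega> v" "0 \<le> Hm1_norm \<Omega> F"
proof -
  obtain K where K: "\<forall>v\<in>H10 \<Omega>. \<bar>F v\<bar> \<le> K * H1_norm \<Omega> v" using F unfolding Hm1_def by blast
  have Fc: "F (\<lambda>x. c *\<^sub>R v x) = c * F v" if "v \<in> H10 \<Omega>" for c v using F that unfolding Hm1_def by blast
  have Hn: "H1_norm \<Omega> v \<ge> 0" if "v \<in> H10 \<Omega>" for v by (simp add: H1_norm_eq[OF \<Omega> H10_H1[OF that]])
  \<comment> \<open>The supremum in \<open>Hm1_norm\<close> is taken in the reals, so it is an upper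
    bound only once boundedness is known; the constant \<open>K\<close> from \<open>Hm1\<close>
    provides it.\<close>
  have "bdd_above ((\<lambda>v. \<bar>F v\<bar>) ` {v \<in> H10 \<Omega>. H1_norm \<Omega> v \<le> 1})"
  proof (rule bdd_aboveI2[where M = "\<bar>K\<bar>"])
    fix w assume w: "w \<in> {v \<in> H10 \<Omega>. H1_norm \<Omega> v \<le> 1}"
    then have "\<bar>F w\<bar> \<le> K * H1_norm \<Omega> w" using K by blast
    also have "\<dots> \<le> \<bar>K\<bar> * 1" using w Hn[of w] by (intro mult_mono) auto
    finally show "\<bar>F w\<bar> \<le> \<bar>K\<bar>" by simp
  qed
  then have up: "\<bar>F w\<bar> \<le> Hm1_norm \<Omega> F" if "w \<in> H10 \<Omega>" "H1_norm \<Omega> w \<le> 1" for w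
    unfolding Hm1_norm_def using that by (intro cSUP_upper) auto
  have scale: "(\<lambda>x. r *\<^sub>R v x) \<in> H10 \<Omega>" "H1_norm \<Omega> (\<lambda>x. r *\<^sub>R v x) = \<bar>r\<bar> * H1_norm \<Omega> v" for r
  proof -
    show s: "(\<lambda>x. r *\<^sub>R v x) \<in> H10 \<Omega>" by (rule H10_arith(3)[OF \<Omega> v v])
    show "H1_norm \<Omega> (\<lambda>x. r *\<^sub>R v x) = \<bar>r\<bar> * H1_norm \<Omega> v"
      by (simp add: H1_norm_eq[OF \<Omega> H10_H1[OF v]] H1_norm_eq[OF \<Omega> H10_H1[OF s]] graph_arith(5)[OF \<Omega> H10_H1[OF v] H10_H1[OF v]])
  qed
  have "H1_norm \<Omega> (\<lambda>x. 0 *\<^sub>R v x) \<le> 1" using scale(2)[of 0] by simp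
  from up[OF scale(1)[of 0] this] show nn: "0 \<le> Hm1_norm \<Omega> F" using abs_ge_zero order_trans by blast
  show "\<bar>F v\<bar> \<le> Hm1_norm \<Omega> F * H1_norm \<Omega> v"
  proof (cases "H1_norm \<Omega> v = 0")
    case True
    then show ?thesis using K v by fastforce
  next
    case False
    then have p: "H1_norm \<Omega> v > 0" using Hn[OF v] by simp
    have "\<bar>F (\<lambda>x. (1 / H1_norm \<Omega> v) *\<^sub>R v x)\<bar> \<le> Hm1_norm \<Omega> F"
      using scale[of "1 / H1_norm \<Omega> v"] p by (intro up) auto
    then have "\<bar>F v\<bar> / H1_norm \<Omega> v \<le> Hm1_norm \<Omega> F" using p by (simp add: Fc[OF v] abs_mult)
    then show ?thesis using p by (simp add: pos_divide_le_eq)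
  qed
qed

lemma H10_cmult:
  fixes u :: "real ^ 'n \<Rightarrow> complex"
  assumes \<Omega>: "open \<Omega>" and u: "u \<in> H10 \<Omega>"
  shows "(\<lambda>x. c * u x) \<in> H10 \<Omega>" "graph \<Omega> (\<lambda>x. c * u x) = cmul c (graph \<Omega> u)"
    "H1_norm \<Omega> (\<lambda>x. c * u x) \<le> norm c * H1_norm \<Omega> u"
proof -
  note u2 = H1D[OF \<Omega> H10_H1[OF u]]
  have v: "(\<lambda>x. vec_cmult c (weak_gradient \<Omega> u x)) \<in> L2 \<Omega>" by (rule L2_bounded_linear[OF \<Omega> u2(2) vec_cmult_bounded_linear])
  have e: "emb \<Omega> (\<lambda>x. vec_cmult c (weak_gradient \<Omega> u x)) = lsq_map (vec_cmult c) (emb \<Omega> (weak_gradient \<Omega> u))"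
  proof -
    have "vec_cmult c (r *\<^sub>R p) = r *\<^sub>R vec_cmult c p" for r and p :: "complex ^ 'n"
      by (simp add: vec_cmult_def vec_eq_iff)
    then show ?thesis by (simp add: emb_def lsq_map_abs[OF L2_sq_int[OF \<Omega> u2(2)] vec_cmult_cont])
  qed
  have h1: "(\<lambda>x. c * u x) \<in> H1 \<Omega>" and g: "graph \<Omega> (\<lambda>x. c * u x) = cmul c (graph \<Omega> u)"
    using H1_lincomb[OF \<Omega> H10_H1[OF u] H10_H1[OF u], of c 0] e mulop_const_emb[OF \<Omega> u2(1), of c]
    by (simp_all add: cmul_def graph_def vec_cmult_def)
  then show "graph \<Omega> (\<lambda>x. c * u x) = cmul c (graph \<Omega> u)" by simp
  have "cmul c (graph \<Omega> u) \<in> sobolev \<Omega>" using u H10_iff_sobolev[OF \<Omega>] cmul_sobolev[OF \<Omega>] by blast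
  then show "(\<lambda>x. c * u x) \<in> H10 \<Omega>" using h1 g H10_iff_sobolev[OF \<Omega>, of "\<lambda>x. c * u x"] by simp
  have n1: "norm (emb \<Omega> (\<lambda>x. c * u x)) \<le> norm c * norm (emb \<Omega> u)"
    unfolding emb_def using L2_sq_int[OF \<Omega> const_mult_L2[OF \<Omega> u2(1)]] L2_sq_int[OF \<Omega> u2(1)]
    by (intro norm_abs_lsq_mono) (auto simp: norm_mult)
  have n2: "norm (emb \<Omega> (\<lambda>x. vec_cmult c (weak_gradient \<Omega> u x))) \<le> norm c * norm (emb \<Omega> (weak_gradient \<Omega> u))"
    unfolding emb_def using L2_sq_int[OF \<Omega> v] L2_sq_int[OF \<Omega> u2(2)]
    by (intro norm_abs_lsq_mono) (auto simp: norm_vec_cmult)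
  have "(norm (graph \<Omega> (\<lambda>x. c * u x)))\<^sup>2 = (norm (emb \<Omega> (\<lambda>x. c * u x)))\<^sup>2 + (norm (emb \<Omega> (\<lambda>x. vec_cmult c (weak_gradient \<Omega> u x))))\<^sup>2"
    unfolding g cmul_def by (simp add: norm_Pair graph_def mulop_const_emb[OF \<Omega> u2(1)] e)
  also have "\<dots> \<le> (norm c * norm (emb \<Omega> u))\<^sup>2 + (norm c * norm (emb \<Omega> (weak_gradient \<Omega> u)))\<^sup>2"
    using n1 n2 by (intro add_mono power_mono) auto
  also have "\<dots> = (norm c * norm (graph \<Omega> u))\<^sup>2"
    by (simp add: graph_def norm_Pair power_mult_distrib distrib_left)
  finally have "norm (graph \<Omega> (\<lambda>x. c * u x)) \<le> norm c * norm (graph \<Omega> u)" by (rule power2_le_imp_le) simp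
  then show "H1_norm \<Omega> (\<lambda>x. c * u x) \<le> norm c * H1_norm \<Omega> u"
    by (simp add: H1_norm_eq[OF \<Omega> H10_H1[OF u]] H1_norm_eq[OF \<Omega> h1])
qed

lemma integral_norm_le:
  fixes u :: "real ^ 'n \<Rightarrow> complex"
  assumes \<Omega>: "open \<Omega>" "\<Omega> \<in> lmeasurable" and u: "u \<in> L2 \<Omega>"
  shows "(LINT x|lebesgue_on \<Omega>. norm (u x)) \<le> sqrt (measure lebesgue \<Omega>) * norm (emb \<Omega> u)"
proof -
  note O = open_lebesgue[OF \<Omega>(1)]
  have i: "integrable lebesgue (indicator \<Omega> :: _ \<Rightarrow> real)" using \<Omega>(2) by (auto simp: fmeasurable_def)
  have 1: "(\<lambda>_. 1 :: real) \<in> L2 \<Omega>"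
    using i O by (simp add: L2_def integrable_restrict_space)
  have n: "(\<lambda>x. norm (u x)) \<in> L2 \<Omega>" using u by (auto simp: L2_def)
  have "(LINT x|lebesgue_on \<Omega>. norm (u x)) = inner (emb \<Omega> (\<lambda>_. 1 :: real)) (emb \<Omega> (\<lambda>x. norm (u x)))"
    by (simp add: inner_emb(1)[OF \<Omega>(1) 1 n])
  also have "\<dots> \<le> norm (emb \<Omega> (\<lambda>_. 1 :: real)) * norm (emb \<Omega> (\<lambda>x. norm (u x)))" by (rule norm_cauchy_schwarz)
  also have "norm (emb \<Omega> (\<lambda>_. 1 :: real)) = sqrt (measure lebesgue \<Omega>)"
    using L2_norm_eq[OF \<Omega>(1) 1] O by (simp add: L2_norm_def measure_restrict_space)
  also have "norm (emb \<Omega> (\<lambda>x. norm (u x))) = norm (emb \<Omega> u)"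
    using L2_norm_eq[OF \<Omega>(1) n] L2_norm_eq[OF \<Omega>(1) u] by (simp add: L2_norm_def)
  finally show ?thesis .
qed

text \<open>The equation is tested with \<open>c * u\<close>. In the term with \<open>a\<close>,
  \<open>U x\<close> multiplies \<open>cnj (u x)\<close> and is known wherever that factor is
  nonzero, so the product is \<open>norm (u x)\<close> for every saturated section.\<close>

lemma solution_energy:
  assumes \<Omega>: "open \<Omega>" "\<Omega> \<in> lmeasurable" and sol: "global_weak_solution \<Omega> a b V F u" and V: "V \<in> Linf \<Omega>"
  shows "F (\<lambda>x. c * u x) = Re c * (norm (emb \<Omega> (weak_gradient \<Omega> u)))\<^sup>2
      + Re (a * cnj c) * (LINT x|lebesgue_on \<Omega>. norm (u x)) + Re (b * cnj c) * (norm (emb \<Omega> u))\<^sup>2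
      + Re c * (LINT x|lebesgue_on \<Omega>. V x * (norm (u x))\<^sup>2)"
proof -
  obtain U where u: "u \<in> H10 \<Omega>" and sect: "saturated_section \<Omega> u U"
    and eqn: "\<And>v. v \<in> H10 \<Omega> \<inter> L1 \<Omega> \<Longrightarrow>
        (\<Sum>i\<in>UNIV. duality \<Omega> (\<lambda>x. weak_gradient \<Omega> u x $ i) (\<lambda>x. weak_gradient \<Omega> v x $ i))
        + duality \<Omega> (\<lambda>x. a * U x) v + duality \<Omega> (\<lambda>x. b * u x) v + duality \<Omega> (\<lambda>x. of_real (V x) * u x) v = F v"
    using sol unfolding global_weak_solution_def by blast
  note u2 = H1D[OF \<Omega>(1) H10_H1[OF u]]
  define w where "w x = c * u x" for x
  have w: "w \<in> H10 \<Omega>" and gw: "graph \<Omega> w = cmul c (graph \<Omega> u)" unfolding w_def using H10_cmult[OF \<Omega>(1) u] by auto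
  note w2 = H1D[OF \<Omega>(1) H10_H1[OF w]]
  have i1: "integrable (lebesgue_on \<Omega>) u" using L2_L1[OF \<Omega> u2(1)] by (simp add: L1_def)
  have i2: "integrable (lebesgue_on \<Omega>) (\<lambda>x. (norm (u x))\<^sup>2)" using u2(1) by (simp add: L2_def)
  have cplx: "complex_of_real ((norm z)\<^sup>2) = z * cnj z" for z by (rule complex_norm_square)
  have d1: "(\<Sum>i\<in>UNIV. duality \<Omega> (\<lambda>x. weak_gradient \<Omega> u x $ i) (\<lambda>x. weak_gradient \<Omega> w x $ i))
      = Re c * (norm (emb \<Omega> (weak_gradient \<Omega> u)))\<^sup>2"
  proof -
    have ew: "emb \<Omega> (weak_gradient \<Omega> w) = lsq_map (vec_cmult c) (emb \<Omega> (weak_gradient \<Omega> u))"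
      using gw by (simp add: graph_def cmul_def)
    obtain g where g: "sq_int g" "emb \<Omega> (weak_gradient \<Omega> u) = abs_lsq g" using lsq_cases .
    have "inner (abs_lsq g) (lsq_map (vec_cmult c) (abs_lsq g)) = (LINT x|lebesgue. Re c * (norm (g x))\<^sup>2)"
      by (simp add: lsq_map_abs[OF g(1) vec_cmult_cont] abs_lsq_arith(5)[OF g(1) sq_int_lipschitz[OF g(1) vec_cmult_cont]] inner_vec_cmult)
    then show ?thesis by (simp add: sum_dualities[OF \<Omega>(1) u2(2) w2(2)] ew g(2) norm_abs_lsq[OF g(1)])
  qed
  have mU: "U \<in> borel_measurable (lebesgue_on \<Omega>)" using sect by (auto simp: saturated_section_def Linf_def)
  have mu: "u \<in> borel_measurable (lebesgue_on \<Omega>)" using u2(1) by (simp add: L2_def)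
  have mcnj: "(\<lambda>x. cnj (u x)) \<in> borel_measurable (lebesgue_on \<Omega>)"
    by (rule measurable_compose[OF mu borel_measurable_continuous_onI[OF continuous_on_cnj[OF continuous_on_id]]])
  have d2: "duality \<Omega> (\<lambda>x. a * U x) w = Re (a * cnj c) * (LINT x|lebesgue_on \<Omega>. norm (u x))"
  proof -
    have "AE x in lebesgue_on \<Omega>. u x \<noteq> 0 \<longrightarrow> U x = u x / of_real (cmod (u x))" using sect by (simp add: saturated_section_def)
    then have "AE x in lebesgue_on \<Omega>. (a * U x) * cnj (w x) = (a * cnj c) * of_real (norm (u x))"
    proof eventually_elim
      case (elim x)
      show ?case
      proof (cases "u x = 0")
        case False
        then have "U x * cnj (u x) = of_real (norm (u x))"
          using elim cplx[of "u x"] by (simp add: power2_eq_square divide_eq_eq)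
        then show ?thesis by (simp add: w_def)
      qed (simp add: w_def)
    qed
    then have "(LINT x|lebesgue_on \<Omega>. (a * U x) * cnj (w x)) = (LINT x|lebesgue_on \<Omega>. (a * cnj c) * of_real (norm (u x)))"
      using mU mcnj mu by (intro integral_cong_AE) (auto simp: w_def)
    also have "\<dots> = (a * cnj c) * of_real (LINT x|lebesgue_on \<Omega>. norm (u x))" by simp
    finally show ?thesis by (simp add: duality_def)
  qed
  have d3: "duality \<Omega> (\<lambda>x. b * u x) w = Re (b * cnj c) * (norm (emb \<Omega> u))\<^sup>2"
  proof -
    have "(LINT x|lebesgue_on \<Omega>. (b * u x) * cnj (w x)) = (LINT x|lebesgue_on \<Omega>. (b * cnj c) * of_real ((norm (u x))\<^sup>2))"
      by (rule Bochner_Integration.integral_cong) (simp_all only: w_def cplx complex_cnj_mult mult_ac)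
    also have "\<dots> = (b * cnj c) * of_real (LINT x|lebesgue_on \<Omega>. (norm (u x))\<^sup>2)" by (simp del: of_real_power)
    also have "(LINT x|lebesgue_on \<Omega>. (norm (u x))\<^sup>2) = (norm (emb \<Omega> u))\<^sup>2"
      using L2_norm_eq[OF \<Omega>(1) u2(1)] by (simp add: L2_norm_def flip: L2_norm_eq[OF \<Omega>(1) u2(1)])
    finally show ?thesis by (simp add: duality_def del: of_real_power)
  qed
  have d4: "duality \<Omega> (\<lambda>x. of_real (V x) * u x) w = Re c * (LINT x|lebesgue_on \<Omega>. V x * (norm (u x))\<^sup>2)"
  proof -
    have "(LINT x|lebesgue_on \<Omega>. (of_real (V x) * u x) * cnj (w x)) = (LINT x|lebesgue_on \<Omega>. cnj c * of_real (V x * (norm (u x))\<^sup>2))"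
      by (rule Bochner_Integration.integral_cong) (simp_all only: w_def cplx complex_cnj_mult of_real_mult mult_ac)
    also have "\<dots> = cnj c * of_real (LINT x|lebesgue_on \<Omega>. V x * (norm (u x))\<^sup>2)" by (simp del: of_real_power of_real_mult)
    finally show ?thesis by (simp add: duality_def del: of_real_power of_real_mult)
  qed
  have "w \<in> H10 \<Omega> \<inter> L1 \<Omega>" using w L2_L1[OF \<Omega> w2(1)] by simp
  from eqn[OF this] show ?thesis unfolding d1 d2 d3 d4 w_def by simp
qed

text \<open>For \<open>P > 0\<close> the denominator vanishes exactly on the slit, so the factor is
  finite and continuous on the slit plane.\<close>

definition bound_factor :: "real \<Rightarrow> complex \<Rightarrow> real" where
  "bound_factor P b = (1 + \<bar>Im b\<bar> + max 0 (- Re b)) / (max 0 (1 - max 0 (- Re b) * P\<^sup>2) + \<bar>Im b\<bar>)"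

lemma bound_factor_pos:
  assumes "P > 0" "b \<in> slit_plane P"
  shows "max 0 (1 - max 0 (- Re b) * P\<^sup>2) + \<bar>Im b\<bar> > 0"
proof (cases "Im b = 0")
  case True
  then have "Re b > - (1 / P\<^sup>2)" using assms(2) by (auto simp: slit_plane_def)
  then have "Re b * P\<^sup>2 > - (1 / P\<^sup>2) * P\<^sup>2" using assms(1) by (intro mult_strict_right_mono) auto
  then show ?thesis using assms(1) by (auto simp: max_def)
qed (simp add: add_nonneg_pos)

text \<open>The real part of the energy identity bounds \<open>t - r s\<close>, the imaginary part \<open>\<bar>Im b\<bar> s\<close>; weighting the
  two with the terms of the denominator of \<open>bound_factor\<close> bounds \<open>t\<close>.\<close>

lemma energy_bound:
  assumes P: "P > 0" and b: "b \<in> slit_plane P" and t: "0 \<le> t" "0 \<le> s" "s \<le> P\<^sup>2 * t" and G: "0 \<le> G"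
    and 1: "t + Re b * s \<le> G" and 2: "\<bar>Im b\<bar> * s \<le> G"
  shows "t \<le> bound_factor P b * G"
proof -
  define r where "r = max 0 (- Re b)"
  define D where "D = max 0 (1 - r * P\<^sup>2)"
  have r: "r \<ge> 0" "- Re b \<le> r" by (auto simp: r_def)
  have "- Re b * s \<le> r * s" using r t by (intro mult_right_mono) auto
  then have ts: "t - r * s \<le> G" using 1 by simp
  have tD: "t * D \<le> G"
  proof (cases "1 - r * P\<^sup>2 \<ge> 0")
    case True
    have "r * s \<le> r * (P\<^sup>2 * t)" using r t by (intro mult_left_mono) auto
    then have "t * (1 - r * P\<^sup>2) \<le> t - r * s" by (simp add: algebra_simps)
    then show ?thesis using ts True by (simp add: D_def)
  qed (use G in \<open>simp add: D_def\<close>)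
  have "t * \<bar>Im b\<bar> \<le> (G + r * s) * \<bar>Im b\<bar>" using ts by (intro mult_right_mono) auto
  also have "\<dots> = G * \<bar>Im b\<bar> + r * (\<bar>Im b\<bar> * s)" by (simp add: algebra_simps)
  also have "\<dots> \<le> G * \<bar>Im b\<bar> + r * G" using 2 r by (intro add_left_mono mult_left_mono) auto
  finally have "t * (D + \<bar>Im b\<bar>) \<le> (1 + \<bar>Im b\<bar> + r) * G" using tD by (simp add: algebra_simps)
  moreover have "D + \<bar>Im b\<bar> > 0" using bound_factor_pos[OF P b] by (simp add: D_def r_def)
  ultimately show ?thesis by (simp add: bound_factor_def D_def[symmetric] r_def[symmetric] pos_le_divide_eq)
qed

lemma a_priori_bound:
  assumes \<Omega>: "open \<Omega>" "\<Omega> \<in> lmeasurable" and P: "P > 0" and b: "b \<in> slit_plane P"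
    and poincare: "\<And>w. w \<in> H10 \<Omega> \<Longrightarrow> L2_norm \<Omega> w \<le> P * L2_norm \<Omega> (weak_gradient \<Omega> w)"
    and V: "V \<in> Linf \<Omega>" "AE x in lebesgue_on \<Omega>. 0 \<le> V x" and F: "F \<in> Hm1 \<Omega>" and sol: "global_weak_solution \<Omega> a b V F u"
  shows "H1_norm \<Omega> u \<le> sqrt (1 + P\<^sup>2) * (bound_factor P b *
    (Hm1_norm \<Omega> F * sqrt (1 + P\<^sup>2) + norm a * (sqrt (measure lebesgue \<Omega>) * P)))"
proof -
  have u: "u \<in> H10 \<Omega>" using sol by (simp add: global_weak_solution_def)
  note u2 = H1D[OF \<Omega>(1) H10_H1[OF u]]
  define X where "X = norm (emb \<Omega> (weak_gradient \<Omega> u))"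
  define Y where "Y = norm (emb \<Omega> u)"
  define I where "I = (LINT x|lebesgue_on \<Omega>. norm (u x))"
  define J where "J = (LINT x|lebesgue_on \<Omega>. V x * (norm (u x))\<^sup>2)"
  define f where "f = Hm1_norm \<Omega> F"
  define m where "m = sqrt (measure lebesgue \<Omega>)"
  \<comment> \<open>The size of the data per unit of \<open>X\<close>: \<open>F\<close> is estimated
    through the full H1 norm, the term with \<open>a\<close> through the L1 norm of
    \<open>u\<close>, and both are reduced to \<open>X\<close> by Poincare's inequality.\<close>
  define g where "g = f * sqrt (1 + P\<^sup>2) + norm a * (m * P)"
  have XY: "0 \<le> X" "0 \<le> Y" "Y \<le> P * X"
    using poincare[OF u] by (simp_all add: X_def Y_def L2_norm_eq[OF \<Omega>(1)] u2)
  have f: "f \<ge> 0" unfolding f_def by (rule Hm1_bound(2)[OF \<Omega>(1) F u])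
  have m: "m \<ge> 0" by (simp add: m_def)
  have Hn: "H1_norm \<Omega> u = sqrt (Y\<^sup>2 + X\<^sup>2)"
    by (simp add: H1_norm_def L2_norm_eq[OF \<Omega>(1)] u2 X_def Y_def)
  have Y2: "Y\<^sup>2 \<le> P\<^sup>2 * X\<^sup>2" using power_mono[OF XY(3,2), of 2] by (simp add: power_mult_distrib)
  have HX: "H1_norm \<Omega> u \<le> sqrt (1 + P\<^sup>2) * X"
  proof -
    have "sqrt (Y\<^sup>2 + X\<^sup>2) \<le> sqrt ((1 + P\<^sup>2) * X\<^sup>2)" using Y2 by (simp add: algebra_simps)
    also have "\<dots> = sqrt (1 + P\<^sup>2) * X" using XY by (simp add: real_sqrt_mult)
    finally show ?thesis by (simp add: Hn)
  qed
  have I: "0 \<le> I" "I \<le> m * (P * X)"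
  proof -
    show "0 \<le> I" by (simp add: I_def)
    have "I \<le> m * Y" unfolding I_def m_def Y_def by (rule integral_norm_le[OF \<Omega> u2(1)])
    also have "\<dots> \<le> m * (P * X)" using XY m by (intro mult_left_mono) auto
    finally show "I \<le> m * (P * X)" .
  qed
  have J: "0 \<le> J" unfolding J_def
    using V(2) by (intro integral_nonneg_AE) (auto elim: eventually_mono)
  have Fb: "\<bar>F (\<lambda>x. c * u x)\<bar> \<le> f * (sqrt (1 + P\<^sup>2) * X)" if "norm c = 1" for c
  proof -
    have "\<bar>F (\<lambda>x. c * u x)\<bar> \<le> f * H1_norm \<Omega> (\<lambda>x. c * u x)"
      unfolding f_def by (rule Hm1_bound(1)[OF \<Omega>(1) F H10_cmult(1)[OF \<Omega>(1) u]])
    also have "\<dots> \<le> f * (sqrt (1 + P\<^sup>2) * X)"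
      using H10_cmult(3)[OF \<Omega>(1) u, of c] that HX f by (intro mult_left_mono) auto
    finally show ?thesis .
  qed
  have ab: "\<bar>Re (a * cnj c) * I\<bar> \<le> norm a * (m * (P * X))" if "norm c = 1" for c
  proof -
    have "\<bar>Re (a * cnj c)\<bar> \<le> norm a" using abs_Re_le_cmod[of "a * cnj c"] that by (simp add: norm_mult)
    then show ?thesis using I unfolding abs_mult by (intro mult_mono) auto
  qed
  note E = solution_energy[OF \<Omega> sol V(1), folded I_def J_def X_def Y_def]
  \<comment> \<open>The choice \<open>c = 1\<close> gives the real part of the energy identity; the
    nonnegative potential term \<open>J\<close> is dropped.\<close>
  have "X\<^sup>2 + Re b * Y\<^sup>2 \<le> g * X"
    using E[of 1] Fb[of 1] ab[of 1] J by (simp add: g_def algebra_simps)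
  moreover have "\<bar>Im b\<bar> * Y\<^sup>2 \<le> g * X"
  proof -
    \<comment> \<open>Since \<open>Re \<i> = 0\<close>, the choice \<open>c = \<i>\<close> removes
      the gradient and potential terms and isolates \<open>Im b\<close>.\<close>
    have "Im b * Y\<^sup>2 = F (\<lambda>x. \<i> * u x) - Re (a * cnj \<i>) * I" using E[of \<i>] by simp
    then have "\<bar>Im b * Y\<^sup>2\<bar> \<le> f * (sqrt (1 + P\<^sup>2) * X) + norm a * (m * (P * X))"
      using Fb[of \<i>] ab[of \<i>] by simp
    then show ?thesis by (simp add: g_def abs_mult algebra_simps)
  qed
  moreover have g: "0 \<le> g" using f m P by (simp add: g_def)
  ultimately have "X\<^sup>2 \<le> bound_factor P b * (g * X)"
    using Y2 XY by (intro energy_bound[OF P b, where s = "Y\<^sup>2"]) auto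
  then have "X * X \<le> (bound_factor P b * g) * X" by (simp add: power2_eq_square mult_ac)
  moreover have "0 \<le> bound_factor P b * g"
    using g bound_factor_pos[OF P b] by (simp add: bound_factor_def)
  ultimately have "X \<le> bound_factor P b * g" using XY(1) by (cases "X = 0") (auto simp: mult_le_cancel_right)
  then have "sqrt (1 + P\<^sup>2) * X \<le> sqrt (1 + P\<^sup>2) * (bound_factor P b * g)" by (intro mult_left_mono) auto
  then show ?thesis using HX by (simp add: g_def f_def m_def)
qed

subsection \<open>Symmetric solutions\<close>

lemma bounded_nonneg_version:
  fixes V :: "real ^ 'n \<Rightarrow> real"
  assumes \<Omega>: "\<Omega> \<in> sets lebesgue" and V: "V \<in> Linf \<Omega>" "AE x in lebesgue_on \<Omega>. 0 \<le> V x"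
  obtains W C where "W \<in> borel_measurable lebesgue" "\<And>x. 0 \<le> W x" "\<And>x. W x \<le> C"
    "AE x in lebesgue. x \<in> \<Omega> \<longrightarrow> V x = W x" "\<And>x. x \<notin> \<Omega> \<Longrightarrow> W x = 0"
proof -
  obtain c where c: "AE x in lebesgue_on \<Omega>. norm (V x) \<le> c" and m: "V \<in> borel_measurable (lebesgue_on \<Omega>)"
    using V(1) by (auto simp: Linf_def)
  \<comment> \<open>Clamping alters \<open>V\<close> on a null subset of \<open>\<Omega>\<close>
    only. The value 0 outside lets an invariance on \<open>\<Omega>\<close> extend to the whole
    space.\<close>
  define W where "W x = max 0 (min (max 0 c) (if x \<in> \<Omega> then V x else 0))" for x
  have "(\<lambda>x. if x \<in> \<Omega> then V x else 0) \<in> borel_measurable lebesgue" using borel_measurable_if[OF \<Omega>] m by blast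
  then have "W \<in> borel_measurable lebesgue" unfolding W_def[abs_def] by measurable
  moreover have "AE x in lebesgue. x \<in> \<Omega> \<longrightarrow> V x = W x"
    using c V(2) unfolding AE_lebesgue_on[OF \<Omega>] by eventually_elim (auto simp: W_def)
  ultimately show thesis by (intro that[of W "max 0 c"]) (auto simp: W_def)
qed

lemma symmetric_existence:
  fixes \<Omega> :: "(real ^ 'n) set" and M :: "real ^ 'n ^ 'n"
  assumes \<Omega>: "open \<Omega>" "\<Omega> \<in> lmeasurable" and P: "P > 0" and b: "b \<in> slit_plane P"
    and poincare: "\<And>w. w \<in> H10 \<Omega> \<Longrightarrow> L2_norm \<Omega> w \<le> P * L2_norm \<Omega> (weak_gradient \<Omega> w)"
    and V: "V \<in> Linf \<Omega>" "AE x in lebesgue_on \<Omega>. 0 \<le> V x" and F: "F \<in> Hm1 \<Omega>"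
    and M: "orthogonal_matrix M" and \<tau>: "\<tau> = 1 \<or> \<tau> = -1"
    and inv: "AE x in lebesgue_on \<Omega>. M *v x \<in> \<Omega>" and V_inv: "AE x in lebesgue_on \<Omega>. V (M *v x) = V x"
    and sym: "\<And>v. v \<in> H10 \<Omega> \<Longrightarrow> (\<lambda>x. \<tau> *\<^sub>R v (M *v x)) \<in> H10 \<Omega>"
      "\<And>v. v \<in> H10 \<Omega> \<Longrightarrow> F (\<lambda>x. \<tau> *\<^sub>R v (M *v x)) = F v"
  shows "\<exists>u. global_weak_solution \<Omega> a b V F u \<and> (AE x in lebesgue_on \<Omega>. \<tau> *\<^sub>R u (M *v x) = u x)"
proof -
  note O = open_lebesgue[OF \<Omega>(1)]
  obtain W C where W: "W \<in> borel_measurable lebesgue" "\<And>x. 0 \<le> W x" "\<And>x. W x \<le> C"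
    and VW: "AE x in lebesgue. x \<in> \<Omega> \<longrightarrow> V x = W x" and W0: "\<And>x. x \<notin> \<Omega> \<Longrightarrow> W x = 0"
    by (rule bounded_nonneg_version[OF O V]) (rule that)
  have inv': "AE x in lebesgue. M *v x \<in> \<Omega> \<longleftrightarrow> x \<in> \<Omega>"
    using AE_orthogonal_invariant[OF M \<Omega>(2)] inv unfolding AE_lebesgue_on[OF O] .
  have W_inv: "AE x in lebesgue. W (M *v x) = W x"
    using inv' AE_orthogonal[OF M VW] VW V_inv[unfolded AE_lebesgue_on[OF O]]
  proof eventually_elim
    case (elim x)
    then show ?case using W0[of x] W0[of "M *v x"] by (cases "x \<in> \<Omega>") auto
  qed
  have "norm (fst s) \<le> P * norm (snd s)" if s: "s \<in> sobolev \<Omega>" for s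
  proof -
    obtain u where u: "u \<in> H10 \<Omega>" "s = graph \<Omega> u" by (rule sobolevE[OF \<Omega>(1) s])
    then show ?thesis
      using poincare[OF u(1)] H1D[OF \<Omega>(1) H10_H1[OF u(1)]] by (simp add: graph_def L2_norm_eq[OF \<Omega>(1)])
  qed
  then interpret dirichlet_data \<Omega> P a b W C F M \<tau>
    using \<Omega> P b W F M \<tau> inv' sym W_inv by unfold_locales auto
  show ?thesis using existence[OF V(1) VW] by (simp add: AE_lebesgue_on[OF O])
qed

text \<open>An open null set is empty. This case stands apart because the Poincare constant is known
  to be positive only for positive measure; here all norms vanish and \<open>F\<close> is 0.\<close>

lemma solution_empty:
  assumes F: "F \<in> Hm1 {}"
  shows "global_weak_solution {} a b V F (\<lambda>_. 0)"
proof -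
  have n: "H1_norm {} v = 0" for v :: "real ^ 'n \<Rightarrow> complex" by (simp add: H1_norm_def L2_norm_def)
  have h: "(\<lambda>_. 0) \<in> H10 ({} :: (real ^ 'n) set)" by (rule test_subset_H10[OF open_empty test_functions_zero])
  have "F v = 0" if "v \<in> H10 {}" for v
    using Hm1_bound(1)[OF open_empty F that] by (simp add: n)
  moreover have "saturated_section {} (\<lambda>_ :: real ^ 'n. 0) (\<lambda>_. 0)"
    by (auto simp: saturated_section_def L1loc_def Linf_def Linf_norm_def intro!: exI[of _ 0] enn2real_leI esssup_I)
  ultimately show ?thesis
    using h unfolding global_weak_solution_def
    by (auto simp: L1_def duality_def intro!: exI[of _ "\<lambda>_. 0"])
qed

text \<open>The slit moves with \<open>m\<close> through \<open>P m\<close>. On the stated set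
  \<open>bound_factor_pos\<close> keeps the denominator nonzero, and the rest is composed of
  continuous functions.\<close>

lemma continuous_energy_constant:
  fixes P :: "real \<Rightarrow> real"
  assumes P: "\<And>m. 0 < m \<Longrightarrow> 0 < P m" "continuous_on {0<..} P"
  shows "continuous_on {(f, v, m, \<alpha>, b). 0 \<le> f \<and> 0 \<le> v \<and> 0 < m \<and> 0 \<le> \<alpha> \<and> b \<in> slit_plane (P m)}
    (\<lambda>(f :: real, v :: real, m, \<alpha> :: real, b). sqrt (1 + (P m)\<^sup>2) * (bound_factor (P m) b *
      (f * sqrt (1 + (P m)\<^sup>2) + \<alpha> * (sqrt m * P m))))" (is "continuous_on ?S _")
proof -
  define S where "S = {x :: real \<times> real \<times> real \<times> real \<times> complex.
    0 < fst (snd (snd x)) \<and> snd (snd (snd (snd x))) \<in> slit_plane (P (fst (snd (snd x))))}"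
  have c: "continuous_on S (\<lambda>x. P (fst (snd (snd x))))"
    by (rule continuous_on_compose2[OF P(2)]) (auto intro!: continuous_intros simp: S_def)
  have "max 0 (1 - max 0 (- Re (snd (snd (snd (snd x))))) * (P (fst (snd (snd x))))\<^sup>2) + \<bar>Im (snd (snd (snd (snd x))))\<bar> \<noteq> 0"
    if "x \<in> S" for x
    using bound_factor_pos[OF P(1)[of "fst (snd (snd x))"], of "snd (snd (snd (snd x)))"] that by (simp add: S_def)
  then have "continuous_on S (\<lambda>(f :: real, v :: real, m, \<alpha> :: real, b). sqrt (1 + (P m)\<^sup>2) * (bound_factor (P m) b *
      (f * sqrt (1 + (P m)\<^sup>2) + \<alpha> * (sqrt m * P m))))"
    unfolding split_beta bound_factor_def by (intro continuous_intros c ballI)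
  then show ?thesis by (rule continuous_on_subset) (auto simp: S_def)
qed

text \<open>\<open>C\<close> is chosen before the domain and the data, from the Poincare constant as
  a function of the measure; the dimension is fixed by the type. It receives \<open>b\<close> rather
  than \<open>cmod b\<close>, because the estimate degenerates as \<open>b\<close> approaches the
  slit, which the modulus does not detect.\<close>

theorem theorem3p2:
  fixes C\<^sub>P :: "real \<Rightarrow> real"
  assumes "\<And>m. 0 < m \<Longrightarrow> 0 < C\<^sub>P m"
    and "continuous_on {0<..} C\<^sub>P"
    and "\<And>(\<Omega> :: (real ^ 'n) set) w. open \<Omega> \<Longrightarrow> \<Omega> \<in> lmeasurable \<Longrightarrow> w \<in> H10 \<Omega> \<Longrightarrow>
      L2_norm \<Omega> w \<le> C\<^sub>P (measure lebesgue \<Omega>) * L2_norm \<Omega> (weak_gradient \<Omega> w)"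
  shows "\<exists>C :: real \<times> real \<times> real \<times> real \<times> complex \<Rightarrow> real.
    (\<forall>p. 0 < C p) \<and>
    continuous_on
      {(f, v, m, \<alpha>, b). 0 \<le> f \<and> 0 \<le> v \<and> 0 < m \<and> 0 \<le> \<alpha> \<and> b \<in> slit_plane (C\<^sub>P m)} C \<and>
    (\<forall>(\<Omega> :: (real ^ 'n) set) (a :: complex) (b :: complex) (V :: real ^ 'n \<Rightarrow> real)
        (F :: (real ^ 'n \<Rightarrow> complex) \<Rightarrow> real).
      open \<Omega> \<and> \<Omega> \<in> lmeasurable \<and> b \<in> slit_plane (C\<^sub>P (measure lebesgue \<Omega>)) \<and>
      V \<in> Linf \<Omega> \<and> (AE x in lebesgue_on \<Omega>. 0 \<le> V x) \<and> F \<in> Hm1 \<Omega> \<longrightarrow>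
        (\<exists>u. global_weak_solution \<Omega> a b V F u) \<and>
        (\<forall>R :: real ^ 'n ^ 'n.
          rotation_matrix R \<and> (AE x in lebesgue_on \<Omega>. R *v x \<in> \<Omega>) \<and> dual_invariant \<Omega> R F \<and>
          (AE x in lebesgue_on \<Omega>. V (R *v x) = V x) \<longrightarrow>
            (\<exists>u. global_weak_solution \<Omega> a b V F u \<and>
              (AE x in lebesgue_on \<Omega>. u (R *v x) = u x))) \<and>
        (CARD('n) = 1 \<and> uminus ` \<Omega> = \<Omega> \<and> dual_odd \<Omega> F \<and>
          (AE x in lebesgue_on \<Omega>. V (- x) = - V x) \<longrightarrow>
            (\<exists>u. global_weak_solution \<Omega> a b V F u \<and>
              (AE x in lebesgue_on \<Omega>. u (- x) = - u x))) \<and>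
        (\<forall>u. global_weak_solution \<Omega> a b V F u \<longrightarrow>
          H1_norm \<Omega> u \<le> C (Hm1_norm \<Omega> F, Linf_norm \<Omega> V, measure lebesgue \<Omega>, cmod a, b)))"
proof -
  \<comment> \<open>The constant will be \<open>1 + \<bar>K p\<bar>\<close>, which is positive for
    every tuple \<open>p\<close>, also where the formula for \<open>K\<close> carries no
    meaning.\<close>
  define K :: "real \<times> real \<times> real \<times> real \<times> complex \<Rightarrow> real" where
    "K = (\<lambda>(f, v, m, \<alpha>, b). sqrt (1 + (C\<^sub>P m)\<^sup>2) * (bound_factor (C\<^sub>P m) b *
      (f * sqrt (1 + (C\<^sub>P m)\<^sup>2) + \<alpha> * (sqrt m * C\<^sub>P m))))"
  have main: "(\<exists>u. global_weak_solution \<Omega> a b V F u) \<and>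
        (\<forall>R :: real ^ 'n ^ 'n.
          rotation_matrix R \<and> (AE x in lebesgue_on \<Omega>. R *v x \<in> \<Omega>) \<and> dual_invariant \<Omega> R F \<and>
          (AE x in lebesgue_on \<Omega>. V (R *v x) = V x) \<longrightarrow>
            (\<exists>u. global_weak_solution \<Omega> a b V F u \<and>
              (AE x in lebesgue_on \<Omega>. u (R *v x) = u x))) \<and>
        (CARD('n) = 1 \<and> uminus ` \<Omega> = \<Omega> \<and> dual_odd \<Omega> F \<and>
          (AE x in lebesgue_on \<Omega>. V (- x) = - V x) \<longrightarrow>
            (\<exists>u. global_weak_solution \<Omega> a b V F u \<and>
              (AE x in lebesgue_on \<Omega>. u (- x) = - u x))) \<and>
        (\<forall>u. global_weak_solution \<Omega> a b V F u \<longrightarrow>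
          H1_norm \<Omega> u \<le> 1 + \<bar>K (Hm1_norm \<Omega> F, Linf_norm \<Omega> V, measure lebesgue \<Omega>, cmod a, b)\<bar>)"
    if \<Omega>: "open \<Omega>" "\<Omega> \<in> lmeasurable" and b: "b \<in> slit_plane (C\<^sub>P (measure lebesgue \<Omega>))"
      and V: "V \<in> Linf \<Omega>" "AE x in lebesgue_on \<Omega>. 0 \<le> V x" and F: "F \<in> Hm1 \<Omega>"
    for \<Omega> :: "(real ^ 'n) set" and a b V F
  proof (cases "measure lebesgue \<Omega> = 0")
    case True
    then have e: "\<Omega> = {}" using open_not_negligible[OF \<Omega>(1)] negligible_iff_measure \<Omega>(2) by blast
    have AE: "AE x in lebesgue_on {}. P x" for P :: "real ^ 'n \<Rightarrow> bool" by (simp add: AE_lebesgue_on)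
    have n: "H1_norm {} v = 0" for v :: "real ^ 'n \<Rightarrow> complex" by (simp add: H1_norm_def L2_norm_def)
    show ?thesis using solution_empty[OF F[unfolded e], of a b V] AE unfolding e n by force
  next
    case False
    define P where "P = C\<^sub>P (measure lebesgue \<Omega>)"
    have P: "P > 0" unfolding P_def using False by (intro assms(1)) (simp add: zero_less_measure_iff)
    have b': "b \<in> slit_plane P" using b by (simp add: P_def)
    have poincare: "L2_norm \<Omega> w \<le> P * L2_norm \<Omega> (weak_gradient \<Omega> w)" if "w \<in> H10 \<Omega>" for w
      unfolding P_def by (rule assms(3)[OF \<Omega> that])
    note O = open_lebesgue[OF \<Omega>(1)]
    have ex: "\<exists>u. global_weak_solution \<Omega> a b V F u \<and> (AE x in lebesgue_on \<Omega>. \<tau> *\<^sub>R u (M *v x) = u x)"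
      if "orthogonal_matrix M" "\<tau> = 1 \<or> \<tau> = -1" "AE x in lebesgue_on \<Omega>. M *v x \<in> \<Omega>"
        "AE x in lebesgue_on \<Omega>. V (M *v x) = V x"
        "\<And>v. v \<in> H10 \<Omega> \<Longrightarrow> (\<lambda>x. \<tau> *\<^sub>R v (M *v x)) \<in> H10 \<Omega>"
        "\<And>v. v \<in> H10 \<Omega> \<Longrightarrow> F (\<lambda>x. \<tau> *\<^sub>R v (M *v x)) = F v" for M \<tau>
      using \<Omega> P b' poincare V F that by (rule symmetric_existence)
    \<comment> \<open>Plain existence is the case of the trivial symmetry.\<close>
    have 1: "\<exists>u. global_weak_solution \<Omega> a b V F u"
      using ex[of "mat 1" 1] by (auto simp: orthogonal_matrix_id AE_lebesgue_on[OF O])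
    have 2: "\<exists>u. global_weak_solution \<Omega> a b V F u \<and> (AE x in lebesgue_on \<Omega>. u (R *v x) = u x)"
      if R: "rotation_matrix R" and RO: "AE x in lebesgue_on \<Omega>. R *v x \<in> \<Omega>" and RF: "dual_invariant \<Omega> R F"
        and RV: "AE x in lebesgue_on \<Omega>. V (R *v x) = V x" for R
    proof -
      have oR: "orthogonal_matrix R" using R by (simp add: rotation_matrix_def)
      \<comment> \<open>By duality the invariance of \<open>F\<close> concerns composition with the
        transpose. A solution symmetric under \<open>transpose R\<close> is constructed, and
        composing with \<open>R\<close> gives the required identity.\<close>
      then have oT: "orthogonal_matrix (transpose R)" by (simp add: orthogonal_matrix_transpose)
      have inv: "AE x in lebesgue. R *v x \<in> \<Omega> \<longleftrightarrow> x \<in> \<Omega>"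
        using AE_orthogonal_invariant[OF oR \<Omega>(2)] RO unfolding AE_lebesgue_on[OF O] .
      have invT: "AE x in lebesgue. transpose R *v x \<in> \<Omega> \<longleftrightarrow> x \<in> \<Omega>"
        using AE_orthogonal[OF oT inv] by eventually_elim (simp add: orthogonal_matrix_inverse[OF oR] del: transpose_matrix_vector)
      have VT: "AE x in lebesgue_on \<Omega>. V (transpose R *v x) = V x"
        using AE_orthogonal[OF oT RV[unfolded AE_lebesgue_on[OF O]]] invT unfolding AE_lebesgue_on[OF O]
        by eventually_elim (simp add: orthogonal_matrix_inverse[OF oR] del: transpose_matrix_vector)
      have "AE x in lebesgue_on \<Omega>. transpose R *v x \<in> \<Omega>"
        using invT unfolding AE_lebesgue_on[OF O] by eventually_elim simp
      from ex[of "transpose R" 1, unfolded scaleR_one, OF oT _ this VT] obtain u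
        where u: "global_weak_solution \<Omega> a b V F u" "AE x in lebesgue_on \<Omega>. u (transpose R *v x) = u x"
        using RF unfolding dual_invariant_def by blast
      have "AE x in lebesgue_on \<Omega>. u (R *v x) = u x"
        using AE_orthogonal[OF oR u(2)[unfolded AE_lebesgue_on[OF O]]] inv unfolding AE_lebesgue_on[OF O]
        by eventually_elim (simp add: orthogonal_matrix_inverse[OF oR] del: transpose_matrix_vector)
      then show ?thesis using u(1) by blast
    qed
    have 3: "\<exists>u. global_weak_solution \<Omega> a b V F u \<and> (AE x in lebesgue_on \<Omega>. u (- x) = - u x)"
      if \<Omega>_sym: "uminus ` \<Omega> = \<Omega>" and odd: "dual_odd \<Omega> F" and V_odd: "AE x in lebesgue_on \<Omega>. V (- x) = - V x"
    proof -
      define M :: "real ^ 'n ^ 'n" where "M = - mat 1"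
      have Mx: "M *v x = - x" for x by (simp add: M_def matrix_vector_mult_def vec_eq_iff mat_def if_distrib[of uminus] if_distrib[of "\<lambda>c. c * _"] cong: if_cong)
      have oM: "orthogonal_matrix M"
      proof -
        have "transpose M = M" by (auto simp: M_def transpose_def mat_def vec_eq_iff)
        moreover have "M ** M = mat 1" by (simp add: matrix_eq matrix_vector_mul_assoc[symmetric] Mx)
        ultimately show ?thesis by (simp add: orthogonal_matrix)
      qed
      have mem: "- x \<in> \<Omega> \<longleftrightarrow> x \<in> \<Omega>" for x using \<Omega>_sym by (metis image_eqI minus_minus)
      \<comment> \<open>\<open>V\<close> is nonnegative at both \<open>x\<close> and
        \<open>- x\<close> and changes sign between them, so it vanishes almost everywhere; an odd
        \<open>V\<close> is therefore even as well, as the general result requires.\<close>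
      have VM: "AE x in lebesgue_on \<Omega>. V (M *v x) = V x"
        using V_odd V(2) AE_orthogonal[OF oM V(2)[unfolded AE_lebesgue_on[OF O]]] unfolding AE_lebesgue_on[OF O] Mx
        by eventually_elim (auto simp: mem)
      have H: "(\<lambda>x. v (- x)) \<in> H10 \<Omega>" if "v \<in> H10 \<Omega>" for v
        using H10_orthogonal[OF oM \<Omega>(1) _ that] by (simp add: Mx mem)
      have h: "(\<lambda>x. (- 1) *\<^sub>R v (M *v x)) \<in> H10 \<Omega>" if "v \<in> H10 \<Omega>" for v
        unfolding Mx by (rule H10_arith(3)[OF \<Omega>(1) H[OF that] H[OF that]])
      \<comment> \<open>The functional applied to the odd reflection of \<open>v\<close> picks up
        two signs, one from the factor \<open>- 1\<close> and one from \<open>dual_odd\<close>,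
        which cancel.\<close>
      have f: "F (\<lambda>x. (- 1) *\<^sub>R v (M *v x)) = F v" if "v \<in> H10 \<Omega>" for v
      proof -
        have "\<forall>c. \<forall>v\<in>H10 \<Omega>. F (\<lambda>x. c *\<^sub>R v x) = c * F v" using F by (simp add: Hm1_def)
        then have "F (\<lambda>x. (- 1) *\<^sub>R v (- x)) = (- 1) * F (\<lambda>x. v (- x))"
          by (rule allE[where x = "- 1"]) (erule bspec[OF _ H[OF that]])
        then show ?thesis using odd that by (simp add: Mx dual_odd_def)
      qed
      have "AE x in lebesgue_on \<Omega>. M *v x \<in> \<Omega>" by (simp add: AE_lebesgue_on[OF O] Mx mem)
      then obtain u
        where u: "global_weak_solution \<Omega> a b V F u" "AE x in lebesgue_on \<Omega>. (- 1) *\<^sub>R u (M *v x) = u x"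
        using ex[OF oM disjI2[OF refl] _ VM] h f by blast
      have "AE x in lebesgue_on \<Omega>. u (- x) = - u x"
        using u(2) unfolding Mx by eventually_elim (simp add: minus_equation_iff)
      then show ?thesis using u(1) by blast
    qed
    have 4: "H1_norm \<Omega> u \<le> 1 + \<bar>K (Hm1_norm \<Omega> F, Linf_norm \<Omega> V, measure lebesgue \<Omega>, cmod a, b)\<bar>"
      if "global_weak_solution \<Omega> a b V F u" for u
      using a_priori_bound[OF \<Omega> P b' _ V F that] poincare by (simp add: K_def P_def)
    show ?thesis using 1 2 3 4 by blast
  qed
  have "continuous_on {(f, v, m, \<alpha>, b). 0 \<le> f \<and> 0 \<le> v \<and> 0 < m \<and> 0 \<le> \<alpha> \<and> b \<in> slit_plane (C\<^sub>P m)} K"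
    unfolding K_def using assms(1,2) by (rule continuous_energy_constant)
  then have "continuous_on {(f, v, m, \<alpha>, b). 0 \<le> f \<and> 0 \<le> v \<and> 0 < m \<and> 0 \<le> \<alpha> \<and> b \<in> slit_plane (C\<^sub>P m)} (\<lambda>p. 1 + \<bar>K p\<bar>)"
    by (intro continuous_intros)
  moreover have "\<forall>p. 0 < 1 + \<bar>K p\<bar>" by (simp add: add_pos_nonneg)
  ultimately show ?thesis
    by (intro exI[of _ "\<lambda>p. 1 + \<bar>K p\<bar>"])
      (erule conjI, erule conjI, (rule allI)+, rule impI, elim conjE, rule main)
qed

end
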